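(* Let $G$ be a connected, simply connected, nilpotent Lie group with Lie algebra $\mathfrak g$, and let $\pi\colon G\to\mathcal B(\mathcal H)$ be a unitary irreducible representation, associated with the coadjoint orbit $\mathcal O\subseteq\mathfrak g^*$, which is square integrable modulo the center of $G$. Then: (1) For every $f,h\in\mathcal H$ and $X\in\mathfrak g$ we have $\mathcal W(\pi(\exp_GX)f,\pi(\exp_GX)h)(\xi)=\mathcal W(f,h)(\xi\circ e^{\mathrm{ad}_{\mathfrak g}X})$ for a.e. $\xi\in\mathcal O$. (2) For every symbol $a\in\mathcal S'(\mathcal O)$ and arbitrary $g\in G$ we have $\mathrm{Op}^\pi(a\circ\mathrm{Ad}_G^*(g^{-1})|_{\mathcal O})=\pi(g)\,\mathrm{Op}^\pi(a)\,\pi(g)^{-1}$.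
   Context: **Setting.** $n=\dim\mathfrak g$; $\exp_G\colon\mathfrak g\to G$ is a diffeomorphism; $\langle\cdot,\cdot\rangle\colon\mathfrak g^*\times\mathfrak g\to\mathbb R$ is the duality pairing; $\mathrm{Ad}_G^*(g)\xi=\xi\circ\mathrm{Ad}_G(g^{-1})$. $\mathcal O\subseteq\mathfrak g^*$ is the coadjoint orbit associated with $\pi$ by Kirillov's theorem; $\xi_0\in\mathcal O$ and $\mathfrak g_{\xi_0}=\{X\in\mathfrak g\mid \langle\xi_0,[X,\mathfrak g]\rangle=0\}$. Fix ideals $\{0\}=\mathfrak g_0\subset\mathfrak g_1\subset\cdots\subset\mathfrak g_n=\mathfrak g$ with $\dim(\mathfrak g_j/\mathfrak g_{j-1})=1$, $[\mathfrak g,\mathfrak g_j]\subseteq\mathfrak g_{j-1}$, and a Jordan-Hölder basis $X_j\in\mathfrak g_j\setminus\mathfrak g_{j-1}$. The jump indices are $e=\{j\mid\mathfrak g_j\not\subseteq\mathfrak g_{j-1}+\mathfrak g_{\xi_0}\}$ (independent of $\xi_0\in\mathcal O$) and the predual of $\mathcal O$ is $\mathfrak g_e=\mathrm{span}\{X_j\mid j\in e\}$. Restriction $\xi\mapsto\xi|_{\mathfrak g_e}$ identifies $\mathcal O$ with $\mathfrak g_e^*$, giving the Schwartz space $\mathcal S(\mathcal O)$ and tempered distributions $\mathcal S'(\mathcal O)$. $\mathcal O$ carries its canonical Liouville measure (normalized as in Kirillov's character formula $\mathrm{Tr}\int_{\mathfrak g}\varphi(X)\pi(\exp_GX)\,dX=\int_{\mathcal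 O}\int_{\mathfrak g}\varphi(X)e^{i\langle\xi,X\rangle}dX\,d\xi$), and $\mathfrak g_e$ carries the Lebesgue measure for which $\widehat a(X)=\int_{\mathcal O}e^{-i\langle\xi,X\rangle}a(\xi)\,d\xi$ extends to a unitary operator $L^2(\mathcal O)\to L^2(\mathfrak g_e)$. **Square integrability.** With $Z$ the center of $G$, $\pi$ is square integrable modulo the center if there is $\phi_0\in\mathcal H\setminus\{0\}$ such that $gZ\mapsto|(\pi(g)\phi_0\mid\phi_0)|$ is in $L^2(G/Z)$. **Vectors.** $\mathcal H_\infty$ is the Fréchet space of smooth vectors of $\pi$; $\mathcal H_{-\infty}$ is the space of continuous antilinear functionals on $\mathcal H_\infty$, with pairing $(\cdot\mid\cdot)$ extending the scalar product of $\mathcal H$; $\pi(g)$ acts on both by restriction/extension. **Cross-Wigner distribution.** For $f,\phi\in\mathcal H$, $(\mathcal A_\phi f)(X)=(f\mid\pi(\exp_GX)\phi)$, $X\in\mathfrak g_e$ (this is in $L^2(\mathfrak g_e)$), and $\mathcal W(f,\phi)\in L^2(\mathcal O)$ is defined by $\widehat{\mathcal W(f,\phi)}=\mathcal A_\phi f$. **Weyl-Pedersen calculus.** For $a\in\mathcal S(\mathcal O)$, $\mathrm{Op}^\pi(a)=\int_{\mathfrak g_e}\widehat a(X)\pi(\exp_GX)\,dX$. The map $\mathrm{Op}^\pi$ is an isomorphism of $\mathcal S(\mathcal O)$ onto the space $\mathcal B(\mathcal H)_\infty$ of smooth operators (the smooth vectors of the representation $(g_1,g_2)\mapsto(T\mapsto\pi(g_1)T\pi(g_2)^{-1})$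 of $G\times G$ on the Hilbert-Schmidt operators). It extends to an isomorphism $\mathcal S'(\mathcal O)\to\mathcal B(\mathcal H)_\infty^*$ by $\mathrm{Tr}(\mathrm{Op}^\pi(a)\mathrm{Op}^\pi(b))=\langle a,b\rangle$ for $b\in\mathcal S(\mathcal O)$. A functional $T\in\mathcal B(\mathcal H)_\infty^*$ is identified with the operator $\mathcal H_\infty\to\mathcal H_{-\infty}$ given by $(T\phi\mid f)=T((\cdot\mid f)\phi)$. For $a\in\mathcal S'(\mathcal O)$, the composition $a\circ\mathrm{Ad}_G^*(g^{-1})|_{\mathcal O}$ is defined by duality: $\langle a\circ\mathrm{Ad}_G^*(g^{-1})|_{\mathcal O},b\rangle=\langle a,b\circ\mathrm{Ad}_G^*(g)|_{\mathcal O}\rangle$. *)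

theory Defs
  imports "HOL-Analysis.Analysis" "HOL-Algebra.Coset"
begin

section \<open>Complex Hilbert spaces\<close>

text \<open>The scalar product is linear in its first and antilinear in its second argument.\<close>

class chilbert_space = real_inner + complete_space +
  fixes scaleC :: "complex \<Rightarrow> 'a \<Rightarrow> 'a" (infixr \<open>*C\<close> 75)
    and cinner :: "'a \<Rightarrow> 'a \<Rightarrow> complex"
  assumes scaleC_add_right: "c *C (x + y) = c *C x + c *C y"
    and scaleC_add_left: "(c + d) *C x = c *C x + d *C x"
    and scaleC_scaleC: "c *C (d *C x) = (c * d) *C x"
    and scaleR_scaleC: "r *\<^sub>R x = complex_of_real r *C x"
    and cinner_commute: "cinner x y = cnj (cinner y x)"
    and cinner_add_left: "cinner (x + y) z = cinner x z + cinner y z"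
    and cinner_scaleC_left: "cinner (c *C x) y = c * cinner x y"
    and inner_eq_Re_cinner: "inner x y = Re (cinner x y)"

definition clinear_op :: "('h::chilbert_space \<Rightarrow> 'h) \<Rightarrow> bool" where
  "clinear_op T \<longleftrightarrow> (\<forall>x y. T (x + y) = T x + T y) \<and> (\<forall>c x. T (c *C x) = c *C T x)"

definition onb :: "'h::chilbert_space set \<Rightarrow> bool" where
  "onb B \<longleftrightarrow> (\<forall>e\<in>B. \<forall>f\<in>B. cinner e f = (if e = f then 1 else 0)) \<and>
     (\<forall>v. (\<forall>e\<in>B. cinner v e = 0) \<longrightarrow> v = 0)"

definition has_trace :: "('h::chilbert_space \<Rightarrow> 'h) \<Rightarrow> complex \<Rightarrow> bool" where
  "has_trace T t \<longleftrightarrow> (\<forall>B. onb B \<longrightarrow> ((\<lambda>e. cinner (T e) e) has_sum t) B)"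

definition hilbert_schmidt :: "('h::chilbert_space \<Rightarrow> 'h) \<Rightarrow> bool" where
  "hilbert_schmidt T \<longleftrightarrow> clinear_op T \<and> bounded_linear T \<and>
     (\<exists>B. onb B \<and> (\<lambda>e. (norm (T e))\<^sup>2) summable_on B)"

definition hs_norm :: "('h::chilbert_space \<Rightarrow> 'h) \<Rightarrow> real" where
  "hs_norm T = sqrt (\<Sum>\<^sub>\<infinity>e\<in>(SOME B. onb B). (norm (T e))\<^sup>2)"


section \<open>Smooth maps, manifolds and Lie groups\<close>

primrec Ck_on :: "nat \<Rightarrow> 'a::real_normed_vector set \<Rightarrow> ('a \<Rightarrow> 'b::real_normed_vector) \<Rightarrow> bool" where
  "Ck_on 0 U f \<longleftrightarrow> continuous_on U f"
| "Ck_on (Suc k) U f \<longleftrightarrow>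
     (\<exists>f'. (\<forall>x\<in>U. (f has_derivative f' x) (at x)) \<and> (\<forall>v. Ck_on k U (\<lambda>x. f' x v)))"

definition smooth_on :: "'a::real_normed_vector set \<Rightarrow> ('a \<Rightarrow> 'b::real_normed_vector) \<Rightarrow> bool" where
  "smooth_on U f \<longleftrightarrow> (\<forall>k. Ck_on k U f)"

text \<open>Maps with values in the Hilbert space of Hilbert-Schmidt operators, which is not a type here;
  \<open>D v\<close> is the derivative in the direction \<open>v\<close>, taken in the Hilbert-Schmidt norm.\<close>

definition hs_continuous_on ::
  "'a::real_normed_vector set \<Rightarrow> ('a \<Rightarrow> 'h::chilbert_space \<Rightarrow> 'h) \<Rightarrow> bool" where
  "hs_continuous_on U F \<longleftrightarrow> (\<forall>x\<in>U. hilbert_schmidt (F x) \<and>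
     ((\<lambda>y. hs_norm (\<lambda>u. F y u - F x u)) \<longlongrightarrow> 0) (at x within U))"

primrec hs_Ck_on ::
  "nat \<Rightarrow> 'a::real_normed_vector set \<Rightarrow> ('a \<Rightarrow> 'h::chilbert_space \<Rightarrow> 'h) \<Rightarrow> bool" where
  "hs_Ck_on 0 U F \<longleftrightarrow> hs_continuous_on U F"
| "hs_Ck_on (Suc k) U F \<longleftrightarrow> hs_continuous_on U F \<and>
     (\<exists>D. \<forall>v. hs_Ck_on k U (D v) \<and>
        (\<forall>x\<in>U. ((\<lambda>s::real. hs_norm (\<lambda>u. (F (x + s *\<^sub>R v) u - F x u) /\<^sub>R s - D v x u)) \<longlongrightarrow> 0)
                  (at 0)))"

type_synonym ('m, 'e) chart = "'m set \<times> ('m \<Rightarrow> 'e)"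

definition smooth_atlas :: "('m::topological_space, 'e::real_normed_vector) chart set \<Rightarrow> bool" where
  "smooth_atlas A \<longleftrightarrow>
     (\<forall>(U, \<phi>)\<in>A. open U \<and> open (\<phi> ` U) \<and> inj_on \<phi> U \<and>
                  homeomorphism U (\<phi> ` U) \<phi> (inv_into U \<phi>)) \<and>
     (\<Union>(U, \<phi>)\<in>A. U) = UNIV \<and>
     (\<forall>(U, \<phi>)\<in>A. \<forall>(V, \<psi>)\<in>A. smooth_on (\<phi> ` (U \<inter> V)) (\<lambda>x. \<psi> (inv_into U \<phi> x)))"

definition prod_atlas ::
  "('m, 'e) chart set \<Rightarrow> ('n, 'f) chart set \<Rightarrow> ('m \<times> 'n, 'e \<times> 'f) chart set" where
  "prod_atlas A B = {(U \<times> V, map_prod \<phi> \<psi>) | U \<phi> V \<psi>. (U, \<phi>) \<in> A \<and> (V, \<psi>) \<in> B}"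

definition vec_atlas :: "('e, 'e) chart set" where
  "vec_atlas = {(UNIV, \<lambda>x. x)}"

definition smooth_map ::
  "('m::topological_space, 'e::real_normed_vector) chart set \<Rightarrow>
   ('n::topological_space, 'f::real_normed_vector) chart set \<Rightarrow> ('m \<Rightarrow> 'n) \<Rightarrow> bool" where
  "smooth_map A B f \<longleftrightarrow> continuous_on UNIV f \<and>
     (\<forall>(U, \<phi>)\<in>A. \<forall>(V, \<psi>)\<in>B. smooth_on (\<phi> ` (U \<inter> f -` V)) (\<lambda>x. \<psi> (f (inv_into U \<phi> x))))"

text \<open>All data that are fixed throughout.  The type \<open>'g\<close> carries the group, \<open>'a\<close> is its Lie algebra
  (whose inner product plays no role) and \<open>'h\<close> the Hilbert space of the representation; the dual of
  the Lie algebra is the type of bounded linear functionals on \<open>'a\<close>.  The measures \<open>liou\<close> on the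
  coadjoint orbit and \<open>leb\<close> on its predual are pinned down by \<open>liouville_normalized\<close> and
  \<open>lebesgue_normalized\<close> below.\<close>

record (overloaded) ('g, 'a::real_normed_vector, 'h) kirillov_data =
  grp :: "'g monoid"
  atlas :: "('g, 'a) chart set"
  bracket :: "'a \<Rightarrow> 'a \<Rightarrow> 'a"
  lexp :: "'a \<Rightarrow> 'g"
  rep :: "'g \<Rightarrow> 'h \<Rightarrow> 'h"
  base :: "'a \<Rightarrow>\<^sub>L real"
  flag :: "nat \<Rightarrow> 'a set"
  jh :: "nat \<Rightarrow> 'a"
  liou :: "('a \<Rightarrow>\<^sub>L real) measure"
  leb :: "'a measure"

type_synonym ('g, 'a, 'h) kdata = "('g, 'a, 'h) kirillov_data"

definition lie_group ::
  "('g::{t2_space, second_countable_topology}, 'a::euclidean_space, 'h) kdata \<Rightarrow> bool" where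
  "lie_group D \<longleftrightarrow> group (grp D) \<and> carrier (grp D) = UNIV \<and> smooth_atlas (atlas D) \<and>
     smooth_map (prod_atlas (atlas D) (atlas D)) (atlas D) (\<lambda>(x, y). x \<otimes>\<^bsub>grp D\<^esub> y) \<and>
     smooth_map (atlas D) (atlas D) (\<lambda>x. inv\<^bsub>grp D\<^esub> x)"

definition llog :: "('g, 'a::euclidean_space, 'h) kdata \<Rightarrow> 'g \<Rightarrow> 'a" where
  "llog D = inv_into UNIV (lexp D)"

definition exp_diffeomorphism ::
  "('g::topological_space, 'a::euclidean_space, 'h) kdata \<Rightarrow> bool" where
  "exp_diffeomorphism D \<longleftrightarrow> bij (lexp D) \<and>
     smooth_map vec_atlas (atlas D) (lexp D) \<and> smooth_map (atlas D) vec_atlas (llog D)"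

text \<open>The differential at the identity of the conjugation by \<open>g\<close>.\<close>

definition Ad :: "('g, 'a::euclidean_space, 'h) kdata \<Rightarrow> 'g \<Rightarrow> 'a \<Rightarrow> 'a" where
  "Ad D g Y = vector_derivative
     (\<lambda>t. llog D (g \<otimes>\<^bsub>grp D\<^esub> lexp D (t *\<^sub>R Y) \<otimes>\<^bsub>grp D\<^esub> inv\<^bsub>grp D\<^esub> g)) (at 0)"

text \<open>\<open>'a\<close> with \<open>bracket\<close> is the Lie algebra and \<open>lexp\<close> the exponential map of the group: the tangent
  space at the identity is identified with \<open>'a\<close> by the differential of \<open>lexp\<close> at \<open>0\<close>, and the bracket
  is the differential at the identity of the adjoint representation.\<close>

definition lie_algebra_of :: "('g, 'a::euclidean_space, 'h) kdata \<Rightarrow> bool" where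
  "lie_algebra_of D \<longleftrightarrow> bilinear (bracket D) \<and>
     (\<forall>X. bracket D X X = 0) \<and>
     (\<forall>X Y Z. bracket D X (bracket D Y Z) + bracket D Y (bracket D Z X)
                + bracket D Z (bracket D X Y) = 0) \<and>
     (\<forall>X s t. lexp D ((s + t) *\<^sub>R X) = lexp D (s *\<^sub>R X) \<otimes>\<^bsub>grp D\<^esub> lexp D (t *\<^sub>R X)) \<and>
     (\<forall>X Y. ((\<lambda>t. Ad D (lexp D (t *\<^sub>R X)) Y) has_vector_derivative bracket D X Y) (at 0))"

primrec lower_central :: "('g, 'a::euclidean_space, 'h) kdata \<Rightarrow> nat \<Rightarrow> 'a set" where
  "lower_central D 0 = UNIV"
| "lower_central D (Suc k) = span {bracket D X Y | X Y. Y \<in> lower_central D k}"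

definition nilpotent :: "('g, 'a::euclidean_space, 'h) kdata \<Rightarrow> bool" where
  "nilpotent D \<longleftrightarrow> (\<exists>k. lower_central D k = {0})"

definition exp_ad :: "('g, 'a::euclidean_space, 'h) kdata \<Rightarrow> 'a \<Rightarrow> 'a \<Rightarrow> 'a" where
  "exp_ad D X Y = (\<Sum>k. (1 / fact k) *\<^sub>R ((bracket D X ^^ k) Y))"

definition CoAd ::
  "('g, 'a::euclidean_space, 'h) kdata \<Rightarrow> 'g \<Rightarrow> ('a \<Rightarrow>\<^sub>L real) \<Rightarrow> ('a \<Rightarrow>\<^sub>L real)" where
  "CoAd D g \<xi> = Blinfun (\<lambda>Y. \<xi> (Ad D (inv\<^bsub>grp D\<^esub> g) Y))"

definition center :: "('g, 'a::euclidean_space, 'h) kdata \<Rightarrow> 'g set" where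
  "center D = {z. \<forall>g. z \<otimes>\<^bsub>grp D\<^esub> g = g \<otimes>\<^bsub>grp D\<^esub> z}"


section \<open>Invariant measures on coset spaces\<close>

definition left_cosets :: "'g monoid \<Rightarrow> 'g set \<Rightarrow> 'g set set" where
  "left_cosets G H = (\<lambda>x. x <#\<^bsub>G\<^esub> H) ` UNIV"

text \<open>A nonzero left invariant Borel measure, finite on compact sets, on the space of left cosets with
  its quotient topology.  If \<open>H\<close> is normal, this is a Haar measure of the quotient group.\<close>

definition invariant_measure ::
  "'g::topological_space monoid \<Rightarrow> 'g set \<Rightarrow> 'g set measure \<Rightarrow> bool" where
  "invariant_measure G H \<nu> \<longleftrightarrow>
     space \<nu> = left_cosets G H \<and>
     sets \<nu> = sets (sigma (left_cosets G H) {\<U>. \<U> \<subseteq> left_cosets G H \<and> open (\<Union>\<U>)}) \<and>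
     (\<forall>g. \<forall>\<A>\<in>sets \<nu>. emeasure \<nu> ((\<lambda>C. g <#\<^bsub>G\<^esub> C) ` \<A>) = emeasure \<nu> \<A>) \<and>
     (\<forall>K. compact K \<longrightarrow> emeasure \<nu> ((\<lambda>x. x <#\<^bsub>G\<^esub> H) ` K) < \<infinity>) \<and>
     emeasure \<nu> (space \<nu>) \<noteq> 0"

text \<open>For functions on the group that are constant on left cosets.\<close>

definition on_coset :: "('g \<Rightarrow> 'b) \<Rightarrow> 'g set \<Rightarrow> 'b" where
  "on_coset F C = F (SOME x. x \<in> C)"


section \<open>Unitary representations\<close>

definition unitary_rep ::
  "('g::topological_space, 'a::euclidean_space, 'h::chilbert_space) kdata \<Rightarrow> bool" where
  "unitary_rep D \<longleftrightarrow>
     (\<forall>g. bij (rep D g) \<and> clinear_op (rep D g) \<and>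
          (\<forall>u v. cinner (rep D g u) (rep D g v) = cinner u v)) \<and>
     rep D \<one>\<^bsub>grp D\<^esub> = id \<and>
     (\<forall>g h. rep D (g \<otimes>\<^bsub>grp D\<^esub> h) = rep D g \<circ> rep D h) \<and>
     (\<forall>v. continuous_on UNIV (\<lambda>g. rep D g v))"

definition irreducible_rep ::
  "('g, 'a::euclidean_space, 'h::chilbert_space) kdata \<Rightarrow> bool" where
  "irreducible_rep D \<longleftrightarrow> (\<exists>v::'h. v \<noteq> 0) \<and>
     (\<forall>V. closed V \<and> 0 \<in> V \<and> (\<forall>u\<in>V. \<forall>v\<in>V. u + v \<in> V) \<and> (\<forall>c. \<forall>v\<in>V. c *C v \<in> V) \<and>
          (\<forall>g. \<forall>v\<in>V. rep D g v \<in> V) \<longrightarrow> V = {0} \<or> V = UNIV)"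

definition square_integrable_mod_center ::
  "('g::topological_space, 'a::euclidean_space, 'h::chilbert_space) kdata \<Rightarrow> bool" where
  "square_integrable_mod_center D \<longleftrightarrow>
     (\<exists>\<nu> \<phi>. invariant_measure (grp D) (center D) \<nu> \<and> \<phi> \<noteq> 0 \<and>
        integrable \<nu> (on_coset (\<lambda>g. (cmod (cinner (rep D g \<phi>) \<phi>))\<^sup>2)))"

definition smooth_vectors ::
  "('g::topological_space, 'a::euclidean_space, 'h::chilbert_space) kdata \<Rightarrow> 'h set" where
  "smooth_vectors D = {v. smooth_map (atlas D) vec_atlas (\<lambda>g. rep D g v)}"

text \<open>The extension to antilinear functionals on the smooth vectors, \<open>\<Lambda> f\<close> standing for the pairing of
  \<open>\<Lambda>\<close> and \<open>f\<close>.\<close>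

definition rep_ext ::
  "('g, 'a::euclidean_space, 'h::chilbert_space) kdata \<Rightarrow> 'g \<Rightarrow> ('h \<Rightarrow> complex) \<Rightarrow> 'h \<Rightarrow> complex" where
  "rep_ext D g \<Lambda> f = \<Lambda> (rep D (inv\<^bsub>grp D\<^esub> g) f)"

definition smooth_operators ::
  "('g::topological_space, 'a::euclidean_space, 'h::chilbert_space) kdata \<Rightarrow> ('h \<Rightarrow> 'h) set" where
  "smooth_operators D = {T. \<forall>(U, \<phi>)\<in>atlas D. \<forall>(V, \<psi>)\<in>atlas D. \<forall>k.
     hs_Ck_on k (\<phi> ` U \<times> \<psi> ` V)
       (\<lambda>(x, y) u. rep D (inv_into U \<phi> x) (T (rep D (inv\<^bsub>grp D\<^esub> (inv_into V \<psi> y)) u)))}"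


section \<open>Coadjoint orbits and Kirillov's correspondence\<close>

definition orbit :: "('g, 'a::euclidean_space, 'h) kdata \<Rightarrow> ('a \<Rightarrow>\<^sub>L real) set" where
  "orbit D = range (\<lambda>g. CoAd D g (base D))"

definition isotropic ::
  "('g, 'a::euclidean_space, 'h) kdata \<Rightarrow> ('a \<Rightarrow>\<^sub>L real) \<Rightarrow> 'a set \<Rightarrow> bool" where
  "isotropic D \<xi> V \<longleftrightarrow> subspace V \<and> (\<forall>X\<in>V. \<forall>Y\<in>V. \<xi> (bracket D X Y) = 0)"

definition polarization ::
  "('g, 'a::euclidean_space, 'h) kdata \<Rightarrow> ('a \<Rightarrow>\<^sub>L real) \<Rightarrow> 'a set \<Rightarrow> bool" where
  "polarization D \<xi> V \<longleftrightarrow> isotropic D \<xi> V \<and> (\<forall>X\<in>V. \<forall>Y\<in>V. bracket D X Y \<in> V) \<and>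
     (\<forall>W. isotropic D \<xi> W \<and> V \<subseteq> W \<longrightarrow> W = V)"

text \<open>Functions, before passing to classes modulo null sets, in the space of the representation induced
  from the character \<open>lexp D Y \<mapsto> cis (\<xi> Y)\<close> of \<open>lexp D ` V\<close>; the group acts by left translations.\<close>

definition induced_space ::
  "('g::topological_space, 'a::euclidean_space, 'h) kdata \<Rightarrow> ('a \<Rightarrow>\<^sub>L real) \<Rightarrow> 'a set \<Rightarrow>
   'g set measure \<Rightarrow> ('g \<Rightarrow> complex) set" where
  "induced_space D \<xi> V \<nu> = {F \<in> borel_measurable borel.
     (\<forall>x. \<forall>Y\<in>V. F (x \<otimes>\<^bsub>grp D\<^esub> lexp D Y) = cis (- \<xi> Y) * F x) \<and>
     integrable \<nu> (on_coset (\<lambda>x. (cmod (F x))\<^sup>2))}"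

definition equivalent_to_induced ::
  "('g::topological_space, 'a::euclidean_space, 'h::chilbert_space) kdata \<Rightarrow> ('a \<Rightarrow>\<^sub>L real) \<Rightarrow>
   'a set \<Rightarrow> bool" where
  "equivalent_to_induced D \<xi> V \<longleftrightarrow>
     (\<exists>\<nu> J. invariant_measure (grp D) (lexp D ` V) \<nu> \<and>
        (\<forall>u. J u \<in> induced_space D \<xi> V \<nu>) \<and>
        (\<forall>u v. AE C in \<nu>. \<forall>x\<in>C. J (u + v) x = J u x + J v x) \<and>
        (\<forall>c u. AE C in \<nu>. \<forall>x\<in>C. J (c *C u) x = c * J u x) \<and>
        (\<forall>u::'h. (LINT C|\<nu>. on_coset (\<lambda>x. (cmod (J u x))\<^sup>2) C) = (norm u)\<^sup>2) \<and>
        (\<forall>F\<in>induced_space D \<xi> V \<nu>. \<exists>u. AE C in \<nu>. \<forall>x\<in>C. J u x = F x) \<and>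
        (\<forall>g u. AE C in \<nu>. \<forall>x\<in>C. J (rep D g u) x = J u (inv\<^bsub>grp D\<^esub> g \<otimes>\<^bsub>grp D\<^esub> x)))"

definition associated_with_orbit ::
  "('g::topological_space, 'a::euclidean_space, 'h::chilbert_space) kdata \<Rightarrow> bool" where
  "associated_with_orbit D \<longleftrightarrow>
     (\<exists>\<xi>\<in>orbit D. \<exists>V. polarization D \<xi> V \<and> equivalent_to_induced D \<xi> V)"

definition stab :: "('g, 'a::euclidean_space, 'h) kdata \<Rightarrow> 'a set" where
  "stab D = {X. \<forall>Y. base D (bracket D X Y) = 0}"

definition jordan_hoelder :: "('g, 'a::euclidean_space, 'h) kdata \<Rightarrow> bool" where
  "jordan_hoelder D \<longleftrightarrow> flag D 0 = {0} \<and> flag D DIM('a) = UNIV \<and>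
     (\<forall>j\<le>DIM('a). subspace (flag D j)) \<and>
     (\<forall>j\<in>{1..DIM('a)}. flag D (j - 1) \<subseteq> flag D j \<and> dim (flag D j) = Suc (dim (flag D (j - 1))) \<and>
        (\<forall>X. \<forall>Y\<in>flag D j. bracket D X Y \<in> flag D (j - 1)) \<and>
        jh D j \<in> flag D j - flag D (j - 1))"

definition jump :: "('g, 'a::euclidean_space, 'h) kdata \<Rightarrow> nat set" where
  "jump D = {j\<in>{1..DIM('a)}. \<not> flag D j \<subseteq> {X + Y | X Y. X \<in> flag D (j - 1) \<and> Y \<in> stab D}}"

definition predual :: "('g, 'a::euclidean_space, 'h) kdata \<Rightarrow> 'a set" where
  "predual D = span (jh D ` jump D)"

text \<open>The dual of \<open>predual D\<close> is identified with real families indexed by \<open>jump D\<close> through the basis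
  \<open>jh D j\<close>, \<open>j \<in> jump D\<close>; \<open>sec\<close> is the inverse of the restriction map on the orbit in these
  coordinates.\<close>

definition coords ::
  "('g, 'a::euclidean_space, 'h) kdata \<Rightarrow> ('a \<Rightarrow>\<^sub>L real) \<Rightarrow> nat \<Rightarrow> real" where
  "coords D \<xi> = (\<lambda>j\<in>jump D. \<xi> (jh D j))"

definition sec :: "('g, 'a::euclidean_space, 'h) kdata \<Rightarrow> (nat \<Rightarrow> real) \<Rightarrow> ('a \<Rightarrow>\<^sub>L real)" where
  "sec D = the_inv_into (orbit D) (coords D)"


section \<open>Schwartz functions and tempered distributions\<close>

text \<open>Functions of real variables indexed by a finite set \<open>I\<close> are functions on \<open>extensional I\<close>.\<close>

definition partial :: "nat \<Rightarrow> ((nat \<Rightarrow> real) \<Rightarrow> complex) \<Rightarrow> (nat \<Rightarrow> real) \<Rightarrow> complex" where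
  "partial j F t = vector_derivative (\<lambda>s. F (t(j := s))) (at (t j))"

definition partials :: "nat list \<Rightarrow> ((nat \<Rightarrow> real) \<Rightarrow> complex) \<Rightarrow> (nat \<Rightarrow> real) \<Rightarrow> complex" where
  "partials js F = foldr partial js F"

definition schwartz :: "nat set \<Rightarrow> ((nat \<Rightarrow> real) \<Rightarrow> complex) \<Rightarrow> bool" where
  "schwartz I F \<longleftrightarrow> (\<forall>js\<in>lists I.
     continuous_on (extensional I) (partials js F) \<and>
     (\<forall>j\<in>I. \<forall>t\<in>extensional I. (\<lambda>s. partials js F (t(j := s))) differentiable (at (t j))) \<and>
     (\<forall>k::nat. \<exists>C. \<forall>t\<in>extensional I. (1 + (\<Sum>i\<in>I. \<bar>t i\<bar>)) ^ k * cmod (partials js F t) \<le> C))"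

definition schwartz_seminorm ::
  "nat set \<Rightarrow> nat list \<Rightarrow> nat \<Rightarrow> ((nat \<Rightarrow> real) \<Rightarrow> complex) \<Rightarrow> real" where
  "schwartz_seminorm I js k F =
     (SUP t\<in>extensional I. (1 + (\<Sum>i\<in>I. \<bar>t i\<bar>)) ^ k * cmod (partials js F t))"

definition schwartz_algebra ::
  "('g, 'a::euclidean_space, 'h) kdata \<Rightarrow> ('a \<Rightarrow> complex) set" where
  "schwartz_algebra D =
     {\<phi>. schwartz {1..DIM('a)} (\<lambda>t. \<phi> (\<Sum>j\<in>{1..DIM('a)}. t j *\<^sub>R jh D j))}"

text \<open>Functions on the orbit are represented by functions on the whole dual that vanish off it.\<close>

definition schwartz_orbit ::
  "('g, 'a::euclidean_space, 'h) kdata \<Rightarrow> (('a \<Rightarrow>\<^sub>L real) \<Rightarrow> complex) set" where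
  "schwartz_orbit D =
     {b. (\<forall>\<xi>. \<xi> \<notin> orbit D \<longrightarrow> b \<xi> = 0) \<and> schwartz (jump D) (\<lambda>t. b (sec D t))}"

definition tempered ::
  "('g, 'a::euclidean_space, 'h) kdata \<Rightarrow> ((('a \<Rightarrow>\<^sub>L real) \<Rightarrow> complex) \<Rightarrow> complex) set" where
  "tempered D = {a.
     (\<forall>b\<in>schwartz_orbit D. \<forall>c\<in>schwartz_orbit D. a (\<lambda>\<xi>. b \<xi> + c \<xi>) = a b + a c) \<and>
     (\<forall>z. \<forall>b\<in>schwartz_orbit D. a (\<lambda>\<xi>. z * b \<xi>) = z * a b) \<and>
     (\<exists>Q C. finite Q \<and> Q \<subseteq> lists (jump D) \<times> UNIV \<and>
        (\<forall>b\<in>schwartz_orbit D. cmod (a b) \<le>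
           C * (\<Sum>(js, k)\<in>Q. schwartz_seminorm (jump D) js k (\<lambda>t. b (sec D t)))))}"

text \<open>The composition of a tempered distribution with \<open>CoAd D g\<close>.\<close>

definition dist_comp_CoAd ::
  "('g, 'a::euclidean_space, 'h) kdata \<Rightarrow> ((('a \<Rightarrow>\<^sub>L real) \<Rightarrow> complex) \<Rightarrow> complex) \<Rightarrow> 'g \<Rightarrow>
   (('a \<Rightarrow>\<^sub>L real) \<Rightarrow> complex) \<Rightarrow> complex" where
  "dist_comp_CoAd D a g b = a (\<lambda>\<xi>. b (CoAd D (inv\<^bsub>grp D\<^esub> g) \<xi>))"


section \<open>Liouville measure, Fourier transform and normalizations\<close>

definition det_on :: "nat set \<Rightarrow> (nat \<Rightarrow> nat \<Rightarrow> real) \<Rightarrow> real" where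
  "det_on I A = (\<Sum>p | p permutes I. of_int (sign p) * (\<Prod>i\<in>I. A i (p i)))"

text \<open>The tangent space of the orbit at \<open>\<xi>\<close> consists of the functionals \<open>\<lambda>Y. - \<xi> (bracket D X Y)\<close>.
  The coordinate vector field of \<open>coords\<close> with index \<open>i\<close> is obtained at \<open>\<xi>\<close> for
  \<open>X = coord_field D \<xi> i\<close>, which is unique up to the stabilizer of \<open>\<xi>\<close>.\<close>

definition coord_field ::
  "('g, 'a::euclidean_space, 'h) kdata \<Rightarrow> ('a \<Rightarrow>\<^sub>L real) \<Rightarrow> nat \<Rightarrow> 'a" where
  "coord_field D \<xi> i =
     (SOME X. \<forall>j\<in>jump D. - \<xi> (bracket D X (jh D j)) = (if i = j then 1 else 0))"

text \<open>If \<open>\<omega>\<close> is the Kirillov-Kostant-Souriau form and the orbit has dimension \<open>2 * d\<close>, then the volume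
  \<open>\<omega> ^ d / fact d\<close> has in coordinates the density \<open>sqrt (det (\<omega> \<partial>\<^sub>i \<partial>\<^sub>j))\<close>.\<close>

definition liouville_density ::
  "('g, 'a::euclidean_space, 'h) kdata \<Rightarrow> ('a \<Rightarrow>\<^sub>L real) \<Rightarrow> real" where
  "liouville_density D \<xi> =
     sqrt (det_on (jump D) (\<lambda>i j. \<xi> (bracket D (coord_field D \<xi> i) (coord_field D \<xi> j))))"

definition liouville ::
  "('g, 'a::euclidean_space, 'h) kdata \<Rightarrow> ('a \<Rightarrow>\<^sub>L real) measure" where
  "liouville D = distr
     (density (\<Pi>\<^sub>M j\<in>jump D. lborel) (\<lambda>t. ennreal (liouville_density D (sec D t))))
     (restrict_space borel (orbit D)) (sec D)"

text \<open>The operator \<open>\<integral> c(X) \<pi>(exp X) dN(X)\<close>, as a weak integral.\<close>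

definition op_integral ::
  "('g, 'a::euclidean_space, 'h::chilbert_space) kdata \<Rightarrow> 'a measure \<Rightarrow> ('a \<Rightarrow> complex) \<Rightarrow>
   'h \<Rightarrow> 'h" where
  "op_integral D N c u =
     (THE w. \<forall>v. cinner w v = (LINT X|N. c X * cinner (rep D (lexp D X) u) v))"

definition character_formula ::
  "('g, 'a::euclidean_space, 'h::chilbert_space) kdata \<Rightarrow> ('a \<Rightarrow>\<^sub>L real) measure \<Rightarrow> bool" where
  "character_formula D \<mu> \<longleftrightarrow> (\<forall>\<phi>\<in>schwartz_algebra D.
     has_trace (op_integral D lborel \<phi>) (LINT \<xi>|\<mu>. (LINT X|lborel. \<phi> X * cis (\<xi> X))))"

definition liouville_normalized ::
  "('g, 'a::euclidean_space, 'h::chilbert_space) kdata \<Rightarrow> bool" where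
  "liouville_normalized D \<longleftrightarrow>
     (\<exists>c>0. liou D = scale_measure (ennreal c) (liouville D)) \<and> character_formula D (liou D)"

definition fourier ::
  "('g, 'a::euclidean_space, 'h) kdata \<Rightarrow> (('a \<Rightarrow>\<^sub>L real) \<Rightarrow> complex) \<Rightarrow> 'a \<Rightarrow> complex" where
  "fourier D a X = (LINT \<xi>|liou D. cis (- blinfun_apply \<xi> X) * a \<xi>)"

definition L2 :: "'x measure \<Rightarrow> ('x \<Rightarrow> complex) set" where
  "L2 N = {w \<in> borel_measurable N. integrable N (\<lambda>x. (cmod (w x))\<^sup>2)}"

text \<open>\<open>v\<close> is the image of \<open>w\<close> under the extension by continuity of \<open>fourier D\<close> from the Schwartz space
  to square integrable functions.\<close>

definition fourier_L2 ::
  "('g, 'a::euclidean_space, 'h) kdata \<Rightarrow> (('a \<Rightarrow>\<^sub>L real) \<Rightarrow> complex) \<Rightarrow> ('a \<Rightarrow> complex) \<Rightarrow> bool" where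
  "fourier_L2 D w v \<longleftrightarrow> w \<in> L2 (liou D) \<and> v \<in> L2 (leb D) \<and>
     (\<exists>a. (\<forall>n. a n \<in> schwartz_orbit D) \<and>
        (\<lambda>n. \<integral>\<^sup>+\<xi>. ennreal ((cmod (a n \<xi> - w \<xi>))\<^sup>2) \<partial>liou D) \<longlonglongrightarrow> 0 \<and>
        (\<lambda>n. \<integral>\<^sup>+X. ennreal ((cmod (fourier D (a n) X - v X))\<^sup>2) \<partial>leb D) \<longlonglongrightarrow> 0)"

definition fourier_unitary :: "('g, 'a::euclidean_space, 'h) kdata \<Rightarrow> bool" where
  "fourier_unitary D \<longleftrightarrow>
     (\<forall>a\<in>schwartz_orbit D. a \<in> L2 (liou D) \<and> fourier D a \<in> L2 (leb D) \<and>
        (LINT X|leb D. (cmod (fourier D a X))\<^sup>2) = (LINT \<xi>|liou D. (cmod (a \<xi>))\<^sup>2)) \<and>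
     (\<forall>w\<in>L2 (liou D). \<exists>v. fourier_L2 D w v) \<and>
     (\<forall>v\<in>L2 (leb D). \<exists>w. fourier_L2 D w v)"

definition lebesgue_normalized :: "('g, 'a::euclidean_space, 'h) kdata \<Rightarrow> bool" where
  "lebesgue_normalized D \<longleftrightarrow>
     (\<exists>c>0. leb D = scale_measure (ennreal c)
        (distr (\<Pi>\<^sub>M j\<in>jump D. lborel) (restrict_space borel (predual D))
           (\<lambda>t. \<Sum>j\<in>jump D. t j *\<^sub>R jh D j))) \<and>
     fourier_unitary D"


section \<open>Cross-Wigner distributions and the Weyl-Pedersen calculus\<close>

definition ambiguity ::
  "('g, 'a::euclidean_space, 'h::chilbert_space) kdata \<Rightarrow> 'h \<Rightarrow> 'h \<Rightarrow> 'a \<Rightarrow> complex" where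
  "ambiguity D \<phi> f X = cinner f (rep D (lexp D X) \<phi>)"

text \<open>A representative of the class in \<open>L2 (liou D)\<close>; the value \<open>0\<close> is never used, since ambiguity
  functions of square integrable representations are square integrable on the predual.\<close>

definition cross_wigner ::
  "('g, 'a::euclidean_space, 'h::chilbert_space) kdata \<Rightarrow> 'h \<Rightarrow> 'h \<Rightarrow> ('a \<Rightarrow>\<^sub>L real) \<Rightarrow> complex" where
  "cross_wigner D f \<phi> =
     (if \<exists>w. fourier_L2 D w (ambiguity D \<phi> f)
      then (SOME w. fourier_L2 D w (ambiguity D \<phi> f)) else (\<lambda>_. 0))"

definition Op ::
  "('g, 'a::euclidean_space, 'h::chilbert_space) kdata \<Rightarrow> (('a \<Rightarrow>\<^sub>L real) \<Rightarrow> complex) \<Rightarrow>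
   'h \<Rightarrow> 'h" where
  "Op D a = op_integral D (leb D) (fourier D a)"

text \<open>The functional \<open>Op D b \<mapsto> a b\<close>, \<open>b \<in> schwartz_orbit D\<close>, on \<open>smooth_operators D\<close>.  By Pedersen's
  theorem \<open>Op D\<close> is a bijection from \<open>schwartz_orbit D\<close> onto \<open>smooth_operators D\<close>, so the value \<open>0\<close>
  only extends the functional to all operators.\<close>

definition Op_dist ::
  "('g::topological_space, 'a::euclidean_space, 'h::chilbert_space) kdata \<Rightarrow>
   ((('a \<Rightarrow>\<^sub>L real) \<Rightarrow> complex) \<Rightarrow> complex) \<Rightarrow> ('h \<Rightarrow> 'h) \<Rightarrow> complex" where
  "Op_dist D a S =
     (if S \<in> smooth_operators D \<and> (\<exists>!b. b \<in> schwartz_orbit D \<and> Op D b = S)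
      then a (THE b. b \<in> schwartz_orbit D \<and> Op D b = S) else 0)"

text \<open>The operator from smooth vectors to antilinear functionals on smooth vectors identified with a
  functional on smooth operators: \<open>as_operator T \<phi> f\<close> is the value at \<open>f\<close> of the image of \<open>\<phi>\<close>.\<close>

definition as_operator :: "(('h::chilbert_space \<Rightarrow> 'h) \<Rightarrow> complex) \<Rightarrow> 'h \<Rightarrow> 'h \<Rightarrow> complex" where
  "as_operator T \<phi> f = T (\<lambda>u. cinner u f *C \<phi>)"

end

theory Submission
 imports Defs
begin

text \<open>Square integrability forces the orbit to be flat. Otherwise the first non-central flag index \<open>j\<close>
 that is not a jump index gives, by pushing functionals to a base point along the jump directions, a
 coadjoint invariant \<open>\<xi>(X\<^sub>j) + p(\<xi>)\<close> whose polynomial part \<open>p\<close> involves only lower terms of the flag.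
 Its symmetrised operator commutes with \<open>\<pi>\<close>, hence is a real scalar by Schur's lemma and so is
 symmetric for every sesquilinear form. Integrating products of matrix coefficients over \<open>G/Z\<close> with
 weight \<open>arctan\<close> of the \<open>X\<^sub>j\<close>-coordinate gives a form, finite by square integrability, for
 which the lower terms are symmetric while the defect of \<open>X\<^sub>j\<close> is strictly definite: a contradiction.
 Hence \<open>\<gg>\<close> is the direct sum of the predual and the centre, and both adjoint actions are
 unitriangular and affine in the coordinates. They preserve the Lebesgue and Liouville measures, so
 the Fourier transform is covariant and both parts follow; the second part also needs that rank-one
 operators of smooth vectors are smooth operators.\<close>

\<comment> \<open>The obstacle is to derive flatness from a single square integrable coefficient.
  The integral of that square over \<open>G/Z\<close> is a closed invariant form, so Schur's lemma
  makes it a multiple of the scalar product; all coefficients then become square integrable and any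
  bounded weight may be inserted. \<open>arctan\<close> is bounded and has a strictly positive
  derivative: left translation by \<open>exp(t X)\<close> shifts the argument of the weight by a
  multiple of \<open>t\<close>, and differentiating at \<open>t = 0\<close> leaves the positive
  weight \<open>1/(1 + s^2)\<close>. The smallest offending index is taken because below it every
  non-jump basis vector is central modulo lower terms, so the pushes reach the base point on all of
  \<open>hh (j - 1)\<close>. Polynomials are written as sums of powers of linear forms since the
  symmetrised operator of \<open>Y^k\<close> is then the k-th power of the operator of
  \<open>Y\<close>; the price is to show that linear relations among powers carry over to the
  operators. Schur's lemma goes through closed forms because the operators are unbounded and live on
  vectors of class \<open>C^k\<close>.\<close>
type_notation blinfun ("(_ =>L /_)" [22, 21] 21)

notation scaleR (infixr "*R" 75) and tendsto (infixr "--->" 55)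
  and LIMSEQ ("((_)/ ----> (_))" [60, 60] 60)

section \<open>Complex Hilbert spaces\<close>

instance chilbert_space \<subseteq> banach ..

lemma scaleC_one [simp]: "1 *C (x::'h::chilbert_space) = x" using scaleR_scaleC[of 1 x] by simp

lemma scaleC_zero_left [simp]: "0 *C (x::'h::chilbert_space) = 0" using scaleR_scaleC[of 0 x] by simp

lemma scaleC_minus_one: "(-1) *C (x::'h::chilbert_space) = - x" using scaleR_scaleC[of "-1" x] by simp

lemma scaleC_zero_right [simp]: "c *C (0::'h::chilbert_space) = 0" using scaleC_add_right[of c 0 "0::'h"] by simp

lemma scaleC_minus_right: "c *C (- x::'h::chilbert_space) = - (c *C x)"
 using scaleC_add_right[of c x "- x"] by (simp add: eq_neg_iff_add_eq_0 add.commute)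

lemma scaleC_diff_right: "c *C (x - y::'h::chilbert_space) = c *C x - c *C y"
 using scaleC_add_right[of c x "- y"] by (simp add: scaleC_minus_right)

lemma scaleC_minus_left: "(- c) *C (x::'h::chilbert_space) = - (c *C x)"
 using scaleC_add_left[of c "- c" x] by (simp add: eq_neg_iff_add_eq_0 add.commute)

lemma scaleC_diff_left: "(c - d) *C (x::'h::chilbert_space) = c *C x - d *C x"
 using scaleC_add_left[of c "- d" x] by (simp add: scaleC_minus_left)

lemma scaleR_scaleC_commute: "r *R c *C (x::'h::chilbert_space) = c *C r *R x"
 by (simp add: scaleR_scaleC scaleC_scaleC mult.commute)

lemma cinner_add_right: "cinner (z::'h::chilbert_space) (x + y) = cinner z x + cinner z y"
 by (metis cinner_commute cinner_add_left complex_cnj_add)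

lemma cinner_scaleC_right: "cinner (x::'h::chilbert_space) (c *C y) = cnj c * cinner x y"
 by (metis cinner_commute cinner_scaleC_left complex_cnj_mult)

lemma cinner_scaleR_left: "cinner (r *R x::'h::chilbert_space) y = of_real r * cinner x y"
 by (simp add: scaleR_scaleC cinner_scaleC_left)

lemma cinner_scaleR_right: "cinner (x::'h::chilbert_space) (r *R y) = of_real r * cinner x y"
 by (simp add: scaleR_scaleC cinner_scaleC_right)

lemma cinner_self: "cinner (x::'h::chilbert_space) x = of_real ((norm x)^2)"
proof -
 have "cinner x x = cnj (cinner x x)" by (rule cinner_commute)
 then have "Im (cinner x x) = 0" by (metis cnj.simps(2) equal_neg_zero)
 then show ?thesis by (simp add: complex_eq_iff inner_eq_Re_cinner[symmetric] power2_norm_eq_inner)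
qed

lemma norm_scaleC: "norm (c *C (x::'h::chilbert_space)) = cmod c * norm x"
proof -
 have "cinner (c *C x) (c *C x) = of_real ((cmod c)^2) * of_real ((norm x)^2)"
  unfolding cinner_scaleC_left cinner_scaleC_right complex_norm_square[of c] unfolding cinner_self by (simp add: mult.assoc)
 then have "(norm (c *C x))^2 = (cmod c * norm x)^2"
  unfolding cinner_self of_real_mult[symmetric] of_real_eq_iff by (simp add: power_mult_distrib)
 then show ?thesis by (simp add: power2_eq_iff_nonneg)
qed

text \<open>Multiplying \<open>x\<close> by the phase \<open>c\<close> makes the scalar product real
  and nonnegative, which reduces the claim to the real Cauchy-Schwarz inequality for
  \<open>inner\<close>.\<close>

lemma cmod_cinner_le: "cmod (cinner (x::'h::chilbert_space) y) <= norm x * norm y"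
proof (cases "cinner x y = 0")
 case False
 define c where "c = cnj (cinner x y) / of_real (cmod (cinner x y))"
 have c: "cmod c = 1" using False by (simp add: c_def norm_divide)
 have "c * cinner x y = of_real (cmod (cinner x y))" using False
  by (simp add: c_def field_simps complex_norm_square power2_eq_square del: of_real_mult)
    (metis complex_norm_square mult.commute of_real_mult power2_eq_square)
 then have "cmod (cinner x y) = inner (c *C x) y" by (simp add: inner_eq_Re_cinner cinner_scaleC_left)
 also have "... <= norm (c *C x) * norm y" by (rule norm_cauchy_schwarz)
 finally show ?thesis by (simp add: norm_scaleC c)
qed simp

lemma bounded_bilinear_cinner: "bounded_bilinear (cinner :: 'h::chilbert_space => 'h => complex)"
proof
 show "EX K. ALL a b::'h. norm (cinner a b) <= norm a * norm b * K" using cmod_cinner_le by (intro exI[of _ 1]) auto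
qed (simp_all add: cinner_add_left cinner_add_right cinner_scaleR_left cinner_scaleR_right
   scaleR_conv_of_real)

interpretation cinner: bounded_bilinear "cinner :: 'h::chilbert_space => 'h => complex" by (rule bounded_bilinear_cinner)

lemmas continuous_on_cinner [continuous_intros] = cinner.continuous_on
lemmas tendsto_cinner [tendsto_intros] = cinner.tendsto
lemmas cinner_simps = cinner_add_left cinner_add_right cinner.diff_left cinner.diff_right
 cinner_scaleC_left cinner_scaleC_right cinner.zero_left cinner.zero_right
 cinner.minus_left cinner.minus_right

lemma bounded_linear_scaleC: "bounded_linear ((*C) c :: 'h::chilbert_space => 'h)" by (rule bounded_linear_intro[of _ "cmod c"])
  (simp_all add: scaleC_add_right scaleR_scaleC_commute norm_scaleC mult.commute)

lemma bounded_bilinear_scaleC: "bounded_bilinear ((*C) :: complex => 'h::chilbert_space => 'h)"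
proof
 show "EX K. ALL a. ALL b::'h. norm (a *C b) <= norm a * norm b * K" by (intro exI[of _ 1]) (auto simp: norm_scaleC)
qed (simp_all add: scaleC_add_left scaleC_add_right scaleR_scaleC scaleC_scaleC mult.commute
   scaleR_conv_of_real)

lemma cinner_eqI: "(!!v. cinner w v = cinner w' v) ==> w = (w'::'h::chilbert_space)"
 by (metis cinner.diff_left cinner_self eq_iff_diff_eq_0 norm_eq_zero of_real_eq_0_iff
   power_eq_0_iff)

lemma inner_scaleC_i: "inner (\<i> *C x) (\<i> *C y) = inner x (y::'h::chilbert_space)"
 by (simp add: inner_eq_Re_cinner cinner_scaleC_right cinner_scaleC_left)

section \<open>Quadratic functionals and Riesz representation\<close>

lemma quadratic_nonneg:
 fixes a b c :: real
 assumes nn: "!!t. 0 <= a + 2 * t * b + t^2 * c" and c: "0 <= c"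
 shows "b^2 <= a * c"
proof (cases "c = 0")
 case True
 then show ?thesis using nn[of "- (a + 1) / (2 * b)"] by (cases "b = 0") (auto simp: field_simps)
next
 case False
 then have "0 <= (a - b^2 / c) * c" using nn[of "- b / c"] c by (simp add: power2_eq_square field_simps)
 then show ?thesis using False by (simp add: left_diff_distrib)
qed

text \<open>Direct method: a minimising sequence of \<open>w \<mapsto> |w|\<^sup>2 + q(w, w) - 2 f(w)\<close> is Cauchy by the
 parallelogram law.\<close>

lemma complete_form_riesz:
 fixes q :: "'h::{real_inner,complete_space} => 'h => real" and f :: "'h => real"
 assumes E: "subspace E" and q_sym: "!!u v. u \<in> E ==> v \<in> E ==> q u v = q v u"
  and q_add: "!!u v w. u \<in> E ==> v \<in> E ==> w \<in> E ==> q (u + v) w = q u w + q v w"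
  and q_scale: "!!r u v. u \<in> E ==> v \<in> E ==> q (r *R u) v = r * q u v" and q_nonneg: "!!u. u \<in> E ==> 0 <= q u u"
  and q_complete: "!!s. (!!n. s n \<in> E) ==> Cauchy s ==>
    (!!e. 0 < e ==> EX N. \<forall>m\<ge>N. \<forall>n\<ge>N. q (s m - s n) (s m - s n) < e) ==>
    \<exists>w\<in>E. s ----> w & (%n. q (s n - w) (s n - w)) ----> 0"
  and f_add: "!!u v. u \<in> E ==> v \<in> E ==> f (u + v) = f u + f v" and f_scale: "!!r u. u \<in> E ==> f (r *R u) = r * f u"
  and f_bound: "!!u. u \<in> E ==> \<bar>f u\<bar> <= M * norm u"
 shows "\<exists>w\<in>E. \<forall>v\<in>E. inner w v + q w v = f v"
proof -
 define B where "B u v = inner u v + q u v" for u v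
 define N where "N u = B u u" for u
 define F where "F u = N u - 2 * f u" for u
 have E0: "0 \<in> E" and Eadd: "!!u v. u \<in> E ==> v \<in> E ==> u + v \<in> E"
  and Esc: "!!r u. u \<in> E ==> r *R u \<in> E" and Ediff: "!!u v. u \<in> E ==> v \<in> E ==> u - v \<in> E"
  using E by (auto simp: subspace_0 subspace_add subspace_scale subspace_diff)
 have B_sym: "B u v = B v u" if "u \<in> E" "v \<in> E" for u v using that by (simp add: B_def q_sym inner_commute)
 have B_add: "B (u + v) w = B u w + B v w" if "u \<in> E" "v \<in> E" "w \<in> E" for u v w
  using that by (simp add: B_def q_add inner_add_left)
 have B_sc: "B (r *R u) w = r * B u w" if "u \<in> E" "w \<in> E" for r u w using that by (simp add: B_def q_scale algebra_simps)
 have B_add2: "B w (u + v) = B w u + B w v" if "u \<in> E" "v \<in> E" "w \<in> E" for u v w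
  using that by (metis B_add B_sym Eadd)
 have B_sc2: "B w (r *R u) = r * B w u" if "u \<in> E" "w \<in> E" for r u w using that by (metis B_sc B_sym Esc)
 have NE: "(norm u)^2 <= N u" "q u u <= N u" "0 <= N u" if "u \<in> E" for u
  using q_nonneg[OF that] by (auto simp: N_def B_def power2_norm_eq_inner)
 have N_lin: "N (u + t *R v) = N u + 2 * t * B u v + t^2 * N v" if "u \<in> E" "v \<in> E" for u v t
  using that by (simp add: N_def B_add B_add2 B_sc B_sc2 Eadd Esc B_sym power2_eq_square algebra_simps)
 have F_lin: "F (u + t *R v) = F u + 2 * t * (B u v - f v) + t^2 * N v" if "u \<in> E" "v \<in> E" for u v t
  using that by (simp add: F_def N_lin f_add f_scale Esc algebra_simps)
 have F_low: "- M\<^sup>2 <= F u" if "u \<in> E" for u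
 proof -
  have "- M\<^sup>2 <= (norm u)^2 - 2 * (M * norm u)"
   using zero_le_power2[of "norm u - M"] by (simp add: power2_eq_square algebra_simps)
  also have "... <= F u" using NE(1)[OF that] f_bound[OF that] by (simp add: F_def)
  finally show ?thesis .
 qed
 define m where "m = Inf (F ` E)"
 have bdd: "bdd_below (F ` E)" using F_low by (intro bdd_belowI[of _ "- M\<^sup>2"]) auto
 have m_le: "m <= F u" if "u \<in> E" for u unfolding m_def using bdd that by (intro cInf_lower) auto
 have "\<exists>u\<in>E. F u < m + inverse (real (Suc n))" for n
 proof -
  have "Inf (F ` E) < m + inverse (real (Suc n))" by (simp add: m_def)
  then show ?thesis using cInf_lessD[of "F ` E" "m + inverse (real (Suc n))"] E0 by auto
 qed
 then obtain s where s: "!!n. s n \<in> E" "!!n. F (s n) < m + inverse (real (Suc n))" by metis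
 have par: "N (u - v) <= 2 * (F u - m) + 2 * (F v - m)" if "u \<in> E" "v \<in> E" for u v
 proof -
  have e: "(1/2) *R (u - v) \<in> E" "u - v \<in> E" using that by (auto intro: Ediff Esc)
  have u: "u = v + 1 *R (u - v)" and mid: "v + (1/2) *R (u - v) \<in> E" using that e by (auto intro: Eadd)
  have "F u = F v + 2 * (B v (u - v) - f (u - v)) + N (u - v)" using F_lin[of v "u - v" 1] that e u by simp
  moreover have "F (v + (1/2) *R (u - v)) = F v + (B v (u - v) - f (u - v)) + N (u - v) / 4"
   using F_lin[of v "u - v" "1/2"] that e by (simp add: power2_eq_square)
  moreover note m_le[OF mid]
  ultimately show ?thesis by argo
 qed
 have small: "EX K. \<forall>a\<ge>K. \<forall>b\<ge>K. N (s a - s b) < e" if "0 < e" for e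
 proof -
  obtain K where K: "inverse (real (Suc K)) < e / 4" using reals_Archimedean[of "e/4"] \<open>0 < e\<close> by auto
  have "N (s a - s b) < e" if "K <= a" "K <= b" for a b
  proof -
   have "inverse (real (Suc a)) <= inverse (real (Suc K))"
    "inverse (real (Suc b)) <= inverse (real (Suc K))" using that by (auto intro!: le_imp_inverse_le)
   then show ?thesis using par[OF s(1)[of a] s(1)[of b]] s(2)[of a] s(2)[of b] K by argo
  qed
  then show ?thesis by blast
 qed
 have "Cauchy s"
 proof (rule metric_CauchyI)
  fix e :: real assume "0 < e"
  then obtain K where K: "\<forall>a\<ge>K. \<forall>b\<ge>K. N (s a - s b) < e^2" using small[of "e^2"] by auto
  have "dist (s a) (s b) < e" if "K <= a" "K <= b" for a b
  proof -
   have "(norm (s a - s b))^2 < e^2" using K that NE(1)[OF Ediff[OF s(1) s(1)], of a b] by (meson order_le_less_trans)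
   then show ?thesis using \<open>0 < e\<close> by (simp add: dist_norm power_less_imp_less_base)
  qed
  then show "EX M. \<forall>m\<ge>M. \<forall>n\<ge>M. dist (s m) (s n) < e" by blast
 qed
 moreover have "EX K. \<forall>a\<ge>K. \<forall>b\<ge>K. q (s a - s b) (s a - s b) < e" if "0 < e" for e
  using small[OF that] NE(2)[OF Ediff[OF s(1) s(1)]] by (meson order_le_less_trans)
 ultimately obtain w where w: "w \<in> E" "s ----> w" "(%n. q (s n - w) (s n - w)) ----> 0" using q_complete[of s] s(1) by blast
 have N_lim: "(%n. N (s n - w)) ----> 0"
 proof -
  have "(%n. (norm (s n - w))\<^sup>2 + q (s n - w) (s n - w)) ----> (norm (w - w))\<^sup>2 + 0" by (intro tendsto_intros w)
  then show ?thesis by (simp add: N_def B_def power2_norm_eq_inner)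
 qed
 have CS: "(B u v)^2 <= N u * N v" if "u \<in> E" "v \<in> E" for u v
 proof (rule quadratic_nonneg[OF _ NE(3)[OF that(2)]])
  show "0 <= N u + 2 * t * B u v + t^2 * N v" for t using NE(3)[OF Eadd[OF that(1) Esc[OF that(2)]]] by (simp add: N_lin that)
 qed
 have "B w v = f v" if v: "v \<in> E" for v
 proof -
  have B_lim: "(%n. B (s n) v) ----> B w v"
  proof -
   have "(%n. (B (s n - w) v)\<^sup>2) ----> 0"
   proof (rule tendsto_sandwich[OF _ _ tendsto_const])
    show "\<forall>\<^sub>F n in sequentially. (B (s n - w) v)\<^sup>2 <= N (s n - w) * N v"
     using CS s(1) w(1) v by (auto intro!: always_eventually Ediff)
    show "(%n. N (s n - w) * N v) ----> 0" using tendsto_mult_left_zero[OF N_lim] .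
   qed auto
   then have "(%n. B (s n - w) v) ----> 0" by simp
   moreover have "B (s n - w) v = B (s n) v - B w v" for n using B_add[of "s n - w" w v] s(1) w(1) v by (simp add: Ediff)
   ultimately show ?thesis by (simp add: LIM_zero_cancel)
  qed
  \<comment> \<open>\<open>s n\<close> minimises only up to \<open>1/(n+1)\<close>, so the
    first-order inequality holds with that error and becomes exact in the limit. Being valid for all
    \<open>t\<close>, it forces the linear coefficient to vanish.\<close>
  have var: "0 <= 2 * t * (B w v - f v) + t^2 * N v" for t
  proof -
   have "m - F (s n) <= 2 * t * (B (s n) v - f v) + t^2 * N v" for n
    using F_lin[OF s(1)[of n] v, of t] m_le[OF Eadd[OF s(1)[of n] Esc[OF v]], of t] by simp
   then have "- inverse (real (Suc n)) <= 2 * t * (B (s n) v - f v) + t^2 * N v" for n using s(2)[of n] by (smt (verit))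
   moreover have "(%n. - inverse (real (Suc n))) ----> - 0" by (intro tendsto_minus LIMSEQ_inverse_real_of_nat)
   moreover have "(%n. 2 * t * (B (s n) v - f v) + t^2 * N v) ----> 2 * t * (B w v - f v) + t^2 * N v"
    by (intro tendsto_intros B_lim)
   ultimately show ?thesis using LIMSEQ_le[of "%n. - inverse (real (Suc n))" "- 0"] by auto
  qed
  show ?thesis using quadratic_nonneg[of 0 "B w v - f v" "N v"] var NE(3)[OF v] by simp
 qed
 then show ?thesis using w(1) by (auto simp: B_def)
qed

text \<open>The real Riesz theorem (the case \<open>q = 0\<close>) represents \<open>Re f\<close>;
  antilinearity recovers \<open>Im f\<close> by testing with \<open>i v\<close>.\<close>

lemma riesz_antilinear:
 fixes f :: "'h::chilbert_space => complex"
 assumes add: "!!u v. f (u + v) = f u + f v" and scale: "!!c u. f (c *C u) = cnj c * f u"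
  and bound: "!!u. cmod (f u) <= M * norm u"
 shows "EX w. ALL v. cinner w v = f v"
proof -
 have "\<exists>w\<in>UNIV. \<forall>v\<in>UNIV. inner w v + (%_ _. 0) w v = Re (f v)"
 proof (rule complete_form_riesz[where M = M])
  show "\<bar>Re (f u)\<bar> <= M * norm u" for u using abs_Re_le_cmod[of "f u"] bound[of u] by linarith
  show "\<exists>w\<in>UNIV. s ----> w & (%n. 0::real) ----> 0" if "Cauchy s" for s :: "nat => 'h"
   using that by (auto simp: Cauchy_convergent_iff convergent_def)
 qed (auto simp: add scaleR_scaleC scale)
 then obtain w where w: "!!v. Re (cinner w v) = Re (f v)" by (auto simp: inner_eq_Re_cinner)
 have "Im (cinner w v) = Im (f v)" for v using w[of "\<i> *C v"] by (simp add: cinner_scaleC_right scale)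
 then show ?thesis using w by (auto simp: complex_eq_iff)
qed

section \<open>Schur's lemma\<close>

interpretation blinfun_compose: bounded_bilinear "(o\<^sub>L)" by (rule bounded_bilinear_blinfun_compose)

text \<open>If \<open>R = 1 - B\<^sup>2\<close> then the iteration \<open>Y \<mapsto> (R + Y^2) / 2\<close> converges to \<open>1 - \<bar>B\<bar>\<close>; it is dominated
 by the same iteration for \<open>R = 1\<close> in the real numbers.\<close>

primrec sqrt_iter :: "('h::real_normed_vector =>L 'h) => nat => ('h =>L 'h)" where
 "sqrt_iter R 0 = 0"
| "sqrt_iter R (Suc n) = (1/2) *R (R + (sqrt_iter R n o\<^sub>L sqrt_iter R n))"

primrec sqrt_iter_real :: "nat => real" where
 "sqrt_iter_real 0 = 0"
| "sqrt_iter_real (Suc n) = (1 + (sqrt_iter_real n)^2) / 2"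

lemma sqrt_iter_real_bounds: "0 <= sqrt_iter_real n" "sqrt_iter_real n <= 1"
proof -
 have "0 <= sqrt_iter_real n & sqrt_iter_real n <= 1" by (induction n) (auto simp: power_le_one)
 then show "0 <= sqrt_iter_real n" "sqrt_iter_real n <= 1" by auto
qed

lemma sqrt_iter_real_Suc: "sqrt_iter_real n <= sqrt_iter_real (Suc n)"
 using zero_le_power2[of "sqrt_iter_real n - 1"] by (simp add: power2_eq_square algebra_simps)

text \<open>All iterates are polynomials in \<open>R\<close> and commute, so the difference of two
  squares factors as \<open>(v + u)(v - u)\<close>. Hence every increment is dominated by the
  increment of the scalar iteration.\<close>

lemma sqrt_iter_bounds:
 assumes "norm R <= 1"
 shows "norm (sqrt_iter R n) <= sqrt_iter_real n"
  and "norm (sqrt_iter R (Suc n) - sqrt_iter R n) <= sqrt_iter_real (Suc n) - sqrt_iter_real n"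
proof -
 have comm: "sqrt_iter R n o\<^sub>L R = R o\<^sub>L sqrt_iter R n" for n
 proof (induction n)
  case (Suc n)
  then have "sqrt_iter R n (R u) = R (sqrt_iter R n u)" for u by (metis blinfun_apply_blinfun_compose)
  then show ?case by (auto intro!: blinfun_eqI simp: blinfun.bilinear_simps)
 qed simp
 have comm2: "sqrt_iter R (Suc n) o\<^sub>L sqrt_iter R n = sqrt_iter R n o\<^sub>L sqrt_iter R (Suc n)" for n
 proof -
  have "sqrt_iter R n (R u) = R (sqrt_iter R n u)" for u using comm[of n] by (metis blinfun_apply_blinfun_compose)
  then show ?thesis by (auto intro!: blinfun_eqI simp: blinfun.bilinear_simps)
 qed
 have bd: "norm (sqrt_iter R n) <= sqrt_iter_real n" for n
 proof (induction n)
  case (Suc n)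
  have "norm (R + (sqrt_iter R n o\<^sub>L sqrt_iter R n)) <= 1 + norm (sqrt_iter R n) * norm (sqrt_iter R n)"
   using norm_triangle_ineq[of R "sqrt_iter R n o\<^sub>L sqrt_iter R n"] assms
    norm_blinfun_compose[of "sqrt_iter R n" "sqrt_iter R n"] by linarith
  also have "... <= 1 + (sqrt_iter_real n)^2" unfolding power2_eq_square
   by (intro add_left_mono mult_mono Suc) (auto simp: sqrt_iter_real_bounds)
  finally show ?case by simp
 qed simp
 show "norm (sqrt_iter R n) <= sqrt_iter_real n" by (rule bd)
 show "norm (sqrt_iter R (Suc n) - sqrt_iter R n) <= sqrt_iter_real (Suc n) - sqrt_iter_real n"
 proof (induction n)
  case 0
  then show ?case using assms by simp
 next
  case (Suc n)
  define u v where "u = sqrt_iter R n" and "v = sqrt_iter R (Suc n)"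
  define a b where "a = sqrt_iter_real n" and "b = sqrt_iter_real (Suc n)"
  have c: "v o\<^sub>L u = u o\<^sub>L v" using comm2[of n] by (simp add: u_def v_def)
  have "sqrt_iter R (Suc (Suc n)) - sqrt_iter R (Suc n) = (1/2) *R (R + (v o\<^sub>L v)) - (1/2) *R (R + (u o\<^sub>L u))"
   by (simp add: u_def v_def)
  also have "... = (1/2) *R ((v + u) o\<^sub>L (v - u))"
   by (simp add: blinfun_compose.add_left blinfun_compose.diff_right c algebra_simps)
  finally have "norm (sqrt_iter R (Suc (Suc n)) - sqrt_iter R (Suc n)) = (1/2) * norm ((v + u) o\<^sub>L (v - u))" by simp
  also have "norm ((v + u) o\<^sub>L (v - u)) <= norm (v + u) * norm (v - u)" by (rule norm_blinfun_compose)
  also have "... <= (b + a) * (b - a)"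
  proof (intro mult_mono)
   show "norm (v + u) <= b + a" unfolding u_def v_def a_def b_def by (intro norm_triangle_le add_mono bd)
   show "norm (v - u) <= b - a" using Suc.IH by (simp add: u_def v_def a_def b_def)
  qed (auto simp: a_def b_def sqrt_iter_real_bounds)
  also have "(1/2) * ((b + a) * (b - a)) = sqrt_iter_real (Suc (Suc n)) - sqrt_iter_real (Suc n)"
   by (simp add: a_def b_def power2_eq_square field_simps)
  finally show ?case by simp
 qed
qed

text \<open>The operator \<open>T\<close> is the absolute value of \<open>B\<close>. Commutation
  with a bounded \<open>V\<close> that commutes with \<open>B\<close> holds for each iterate and
  passes to the limit; this is what makes Schur's lemma applicable to \<open>T\<close>.\<close>

lemma blinfun_abs_exists:
 fixes B :: "'h::{real_inner,banach} =>L 'h"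
 assumes sym: "!!x y. inner (B x) y = inner x (B y)"
 shows "EX T::'h =>L 'h. T o\<^sub>L T = B o\<^sub>L B & (ALL u. 0 <= inner (T u) u) &
  (ALL V. bounded_linear V --> (ALL u. V (B u) = B (V u)) --> (ALL u. V (T u) = T (V u)))" proof -
 \<comment> \<open>Dividing by \<open>M\<close> turns \<open>B\<close> into a contraction, so that
   \<open>R\<close> below has norm at most 1.\<close>
 define M where "M = norm B + 1"
 have M: "0 < M" "norm B <= M" using norm_ge_zero[of B] unfolding M_def by linarith+
 define R where "R = id_blinfun - (1 / M^2) *R (B o\<^sub>L B)"
 have R_app: "R u = u - (1 / M^2) *R B (B u)" for u by (simp add: R_def blinfun.bilinear_simps)
 have Bn: "norm (B u) <= M * norm u" for u by (rule order_trans[OF norm_blinfun mult_right_mono[OF M(2) norm_ge_zero]])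
 have "norm R <= 1"
 proof (rule norm_blinfun_bound)
  fix u :: 'h
  have *: "(norm (u - k *R v))^2 = (norm u)^2 - 2 * k * inner u v + (k * norm v)^2" for k and v :: 'h
   unfolding power_mult_distrib power2_norm_eq_inner
   by (simp add: inner_diff_left inner_diff_right inner_commute power2_eq_square)
  define k where "k = 1 / M^2"
  have k: "0 <= k" "k * M^2 = 1" using M by (auto simp: k_def)
  have "(norm (R u))^2 = (norm u)^2 - 2 * k * (norm (B u))^2 + (k * norm (B (B u)))^2"
   using *[of k "B (B u)"] by (simp add: R_app k_def sym[symmetric] power2_norm_eq_inner)
  moreover have "(k * norm (B (B u)))^2 <= (k * (M * norm (B u)))^2" by (intro power_mono mult_left_mono Bn) (auto simp: k)
  moreover have "(k * (M * norm (B u)))^2 = k * (k * M^2) * (norm (B u))^2" by (simp add: power2_eq_square)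
  moreover have "0 <= k * (norm (B u))^2" using k by simp
  ultimately have "(norm (R u))^2 <= (norm u)^2" unfolding k(2) by simp
  then show "norm (R u) <= 1 * norm u" by (simp add: power2_le_iff_abs_le)
 qed simp
 note bd = sqrt_iter_bounds[OF this]
 have "incseq sqrt_iter_real" by (rule incseq_SucI) (rule sqrt_iter_real_Suc)
 moreover have "bdd_above (range sqrt_iter_real)" using sqrt_iter_real_bounds(2) by (auto intro!: bdd_aboveI[of _ 1])
 ultimately have "convergent sqrt_iter_real" using LIMSEQ_incseq_SUP[of sqrt_iter_real] convergentI by blast
 then have cauchy: "Cauchy sqrt_iter_real" by (rule convergent_Cauchy)
 have dist: "norm (sqrt_iter R (n + k) - sqrt_iter R n) <= sqrt_iter_real (n + k) - sqrt_iter_real n" for n k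
 proof (induction k)
  case (Suc k)
  have "norm (sqrt_iter R (n + Suc k) - sqrt_iter R n)
    <= norm (sqrt_iter R (Suc (n + k)) - sqrt_iter R (n + k)) + norm (sqrt_iter R (n + k) - sqrt_iter R n)"
   by (rule order_trans[OF _ norm_triangle_ineq]) simp
  then show ?case using Suc bd(2)[of "n + k"] by (simp del: sqrt_iter.simps sqrt_iter_real.simps)
 qed simp
 have "Cauchy (sqrt_iter R)"
 proof (rule CauchyI')
  fix e :: real assume "0 < e"
  then obtain K where K: "!!m n. m >= K ==> n >= K ==> norm (sqrt_iter_real m - sqrt_iter_real n) < e"
   using CauchyD[OF cauchy] by blast
  have "norm (sqrt_iter R m - sqrt_iter R n) < e" if "m >= K" "m < n" for m n
   using dist[of m "n - m"] K[of n m] that by (simp add: norm_minus_commute)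
  then show "EX M. \<forall>m\<ge>M. \<forall>n>m. dist (sqrt_iter R m) (sqrt_iter R n) < e" unfolding dist_norm by blast
 qed
 then have "convergent (sqrt_iter R)" by (rule Cauchy_convergent)
 then obtain Y where Y: "sqrt_iter R ----> Y" unfolding convergent_def by blast
 \<comment> \<open>The fixed point equation says \<open>(1 - Y)^2 = 1 - R\<close>, which is
   \<open>B^2 / M^2\<close>.\<close>
 have Y_eq: "Y = (1/2) *R (R + (Y o\<^sub>L Y))"
 proof (rule LIMSEQ_unique)
  show "(%n. sqrt_iter R (Suc n)) ----> Y" using Y by (rule LIMSEQ_Suc)
  show "(%n. sqrt_iter R (Suc n)) ----> (1/2) *R (R + (Y o\<^sub>L Y))" unfolding sqrt_iter.simps
   by (rule tendsto_scaleR[OF tendsto_const tendsto_add[OF tendsto_const blinfun_compose.tendsto[OF Y Y]]])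
 qed
 have "norm Y <= 1" by (rule LIMSEQ_le_const2[OF tendsto_norm[OF Y]]) (use bd(1) sqrt_iter_real_bounds(2) order_trans in blast)
 define T where "T = M *R (id_blinfun - Y)"
 have T_app: "T u = M *R (u - Y u)" for u by (simp add: T_def blinfun.bilinear_simps)
 have YY: "Y (Y u) = 2 *R Y u - R u" for u
 proof -
  have "Y u = (1/2) *R (R u + Y (Y u))" using arg_cong[OF Y_eq, of "%A. A u"] unfolding blinfun.scaleR_left blinfun.add_left
   by (simp only: blinfun_apply_blinfun_compose)
  then have "2 *R Y u = 2 *R ((1/2) *R (R u + Y (Y u)))" by (rule arg_cong)
  also have "... = R u + Y (Y u)" by (simp only: scaleR_scaleR) simp
  finally show ?thesis by (simp only: add_diff_cancel_left')
 qed
 have TT: "T o\<^sub>L T = B o\<^sub>L B"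
 proof (rule blinfun_eqI)
  fix u
  have "T (T u) = (M * M) *R (u - Y u - (Y u - Y (Y u)))"
   unfolding T_app blinfun.scaleR_right blinfun.diff_right scaleR_right_diff_distrib scaleR_scaleR ..
  also have "u - Y u - (Y u - Y (Y u)) = u - R u" unfolding YY scaleR_2 by (simp only: diff_diff_eq2) simp
  also have "(M * M) *R (u - R u) = B (B u)" using M by (simp add: R_app power2_eq_square)
  finally show "(T o\<^sub>L T) u = (B o\<^sub>L B) u" by simp
 qed
 have Tpos: "0 <= inner (T u) u" for u
 proof -
  have "inner (Y u) u <= norm (Y u) * norm u" by (rule norm_cauchy_schwarz)
  also have "... <= (norm Y * norm u) * norm u" by (intro mult_right_mono norm_blinfun) auto
  also have "... <= (1 * norm u) * norm u" by (intro mult_right_mono \<open>norm Y <= 1\<close>) auto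
  also have "... = inner u u" by (simp add: power2_norm_eq_inner[symmetric] power2_eq_square)
  finally show ?thesis using M by (simp add: T_app inner_diff_left)
 qed
 have Tcomm: "V (T u) = T (V u)" if V: "bounded_linear V" "!!u. V (B u) = B (V u)" for V u
 proof -
  interpret V: bounded_linear V by (rule V)
  have VR: "V (R u) = R (V u)" for u by (simp add: R_app V.diff V.scaleR V(2))
  have Vn: "V (sqrt_iter R n u) = sqrt_iter R n (V u)" for n u
   by (induction n arbitrary: u) (simp_all add: blinfun.bilinear_simps V.zero V.add V.scaleR VR)
  have "V (Y u) = Y (V u)"
  proof (rule LIMSEQ_unique)
   show "(%n. V (sqrt_iter R n u)) ----> V (Y u)" by (rule V.tendsto[OF blinfun.tendsto[OF Y tendsto_const]])
   show "(%n. V (sqrt_iter R n u)) ----> Y (V u)" unfolding Vn by (rule blinfun.tendsto[OF Y tendsto_const])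
  qed
  then show ?thesis by (simp add: T_app V.diff V.scaleR)
 qed
 show ?thesis by (intro exI[of _ T] conjI allI impI TT Tpos Tcomm) simp_all
qed

section \<open>Schur's lemma for bounded operators and closed forms\<close>

locale irreducible_family =
 fixes U :: "'i => 'h::chilbert_space => 'h"
 assumes U_linear: "clinear_op (U g)" and U_isometry: "cinner (U g u) (U g v) = cinner u v"
  and U_inverse: "EX g'. ALL u. U g' (U g u) = u & U g (U g' u) = u" and nontrivial: "EX v::'h. v ~= 0"
  and irreducible: "closed V ==> 0 \<in> V ==> (!!u v. u \<in> V ==> v \<in> V ==> u + v \<in> V) ==>
   (!!c v. v \<in> V ==> c *C v \<in> V) ==> (!!g v. v \<in> V ==> U g v \<in> V) ==> V = {0} \<or> V = UNIV" begin

lemma U_add: "U g (u + v) = U g u + U g v" and U_scaleC: "U g (c *C v) = c *C U g v"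
 using U_linear[of g] by (auto simp: clinear_op_def)

lemma U_scaleR: "U g (r *R v) = r *R U g v" by (simp add: scaleR_scaleC U_scaleC)

lemma U_diff: "U g (u - v) = U g u - U g v" using U_add[of g "u - v" v] by simp

lemma norm_U: "norm (U g v) = norm v" using U_isometry[of g v v] unfolding cinner_self of_real_eq_iff by simp

lemma bounded_linear_U: "bounded_linear (U g)" by (rule bounded_linear_intro[of _ 1]) (simp_all add: U_add U_scaleR norm_U)

lemma inner_U: "inner (U g u) (U g v) = inner u v" by (simp add: inner_eq_Re_cinner U_isometry)

lemma kernel_trivial:
 assumes T: "bounded_linear T" and C: "!!c u. T (c *C u) = c *C T u" and comm: "!!g u. U g (T u) = T (U g u)"
 shows "(ALL u. T u = 0 --> u = 0) \<or> (ALL u. T u = 0)"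
proof -
 interpret T: bounded_linear T by (rule T)
 have "{u. T u = 0} = {0} \<or> {u. T u = 0} = UNIV"
 proof (rule irreducible)
  show "closed {u. T u = 0}" by (intro closed_Collect_eq T.continuous_on continuous_on_id continuous_on_const)
  show "U g v \<in> {u. T u = 0}" if "v \<in> {u. T u = 0}" for g v
   using that comm[of g v, symmetric] U_scaleR[of g 0 0] by simp
 qed (auto simp: T.zero T.add C)
 then show ?thesis by blast
qed

text \<open>For \<open>B = S - c\<close> with absolute value \<open>T\<close>, the kernel of
  \<open>T + B\<close> is closed and invariant. If it is trivial then \<open>B = T\<close> is
  nonnegative, if it is everything then \<open>B = -T\<close> is nonpositive. So the quadratic form
  of \<open>S\<close> compares with every real multiple of the identity form, and the infimum of the
  upper bounds is the scalar.\<close>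

lemma commuting_symmetric_scalar:
 assumes S: "bounded_linear S" and C: "!!c u. S (c *C u) = c *C S u"
  and sym: "!!x y. inner (S x) y = inner x (S y)" and comm: "!!g u. U g (S u) = S (U g u)"
 shows "EX l. ALL u. S u = l *R u"
proof -
 interpret S: bounded_linear S by (rule S)
 have dich: "(ALL u. inner (S u) u <= c * inner u u) \<or> (ALL u. c * inner u u <= inner (S u) u)" for c
 proof -
  define B where "B = Blinfun S - c *R id_blinfun"
  have B: "B u = S u - c *R u" for u by (simp add: B_def blinfun.bilinear_simps bounded_linear_Blinfun_apply S)
  have "inner (B x) y = inner x (B y)" for x y by (simp add: B inner_diff_left inner_diff_right sym)
  then obtain T where T: "T o\<^sub>L T = B o\<^sub>L B" "!!u. 0 <= inner (T u) u"
   "!!V u. bounded_linear V ==> (!!u. V (B u) = B (V u)) ==> V (T u) = T (V u)" using blinfun_abs_exists[of B] by metis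
  have TU: "U g (T u) = T (U g u)" for g u by (rule T(3)[OF bounded_linear_U]) (simp add: B U_diff U_scaleR comm)
  have TC: "k *C T u = T (k *C u)" for k u
   by (rule T(3)[OF bounded_linear_scaleC]) (simp add: B C scaleC_diff_right scaleR_scaleC_commute)
  have TB: "B (T u) = T (B u)" for u by (rule T(3)[OF blinfun.bounded_linear_right]) simp
  have "(ALL u. (T + B) u = 0 --> u = 0) \<or> (ALL u. (T + B) u = 0)"
  proof (rule kernel_trivial)
   show "(T + B) (k *C u) = k *C (T + B) u" for k u
    by (simp add: blinfun.bilinear_simps TC[symmetric] scaleC_add_right B C scaleC_diff_right
      scaleR_scaleC_commute)
   show "U g ((T + B) u) = (T + B) (U g u)" for g u by (simp add: blinfun.bilinear_simps U_add TU B U_diff U_scaleR comm)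
  qed (rule blinfun.bounded_linear_right)
  then show ?thesis
  proof
   \<comment> \<open>\<open>T\<close> and \<open>B\<close> commute, so
     \<open>(T + B)(T - B) = T^2 - B^2 = 0\<close>.\<close>
   assume inj: "ALL u. (T + B) u = 0 --> u = 0"
   have "(T + B) ((T - B) u) = 0" for u using arg_cong[OF T(1), of "%A. A u"] by (simp add: blinfun.bilinear_simps TB)
   then have "(T - B) u = 0" for u using inj by blast
   then have "T u = B u" for u by (simp add: blinfun.diff_left)
   then have "c * inner u u <= inner (S u) u" for u using T(2)[of u] by (simp add: B inner_diff_left)
   then show ?thesis by blast
  next
   assume "ALL u. (T + B) u = 0"
   then have "T u + (S u - c *R u) = 0" for u by (simp add: blinfun.add_left B)
   then have "inner (T u + (S u - c *R u)) u = 0" for u by simp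
   then have "inner (T u) u + (inner (S u) u - c * inner u u) = 0" for u
    unfolding inner_add_left inner_diff_left inner_scaleR_left .
   then have "inner (S u) u <= c * inner u u" for u using T(2)[of u] by (smt (verit))
   then show ?thesis by blast
  qed
 qed
 define A where "A = {c. ALL u. inner (S u) u <= c * inner u u}"
 obtain K where K: "!!u. norm (S u) <= norm u * K" using S.bounded by blast
 have up: "\<bar>inner (S u) u\<bar> <= K * inner u u" for u
 proof -
  have "\<bar>inner (S u) u\<bar> <= norm (S u) * norm u" by (rule Cauchy_Schwarz_ineq2)
  also have "... <= (norm u * K) * norm u" by (intro mult_right_mono K) auto
  finally show ?thesis by (simp add: power2_norm_eq_inner[symmetric] power2_eq_square ac_simps)
 qed
 have KA: "K \<in> A" unfolding A_def using up by (auto intro: order_trans[OF abs_ge_self])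
 obtain v :: 'h where "v ~= 0" using nontrivial by blast
 then have v: "0 < inner v v" by simp
 have "bdd_below A"
 proof (rule bdd_belowI)
  fix c assume "c \<in> A"
  then have "inner (S v) v <= c * inner v v" by (simp add: A_def)
  then have "- (K * inner v v) <= c * inner v v" using up[of v] by linarith
  then show "- K <= c" using v by (metis minus_mult_left mult_le_cancel_right_pos)
 qed
 define l where "l = Inf A"
 have le: "inner (S u) u <= l * inner u u" for u
 proof (cases "u = 0")
  case False
  then have pos: "0 < inner u u" by simp
  have "inner (S u) u / inner u u <= l" unfolding l_def using KA pos by (intro cInf_greatest) (auto simp: A_def field_simps)
  then show ?thesis using pos by (simp add: field_simps)
 qed (simp add: S.zero)
 have ge: "l * inner u u <= inner (S u) u" for u
 proof (rule ccontr)
  assume *: "\<not> l * inner u u <= inner (S u) u"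
  then have pos: "0 < inner u u" by (auto simp: S.zero)
  have "inner (S u) u / inner u u < l" using * pos by (simp add: field_simps)
  then obtain c where c: "inner (S u) u / inner u u < c" "c < l" using dense by blast
  then have "\<not> c * inner u u <= inner (S u) u" using pos by (simp add: field_simps)
  then have "c \<in> A" using dich[of c] by (auto simp: A_def)
  then have "l <= c" unfolding l_def by (rule cInf_lower) (rule \<open>bdd_below A\<close>)
  then show False using c by simp
 qed
 define D where "D u = S u - l *R u" for u
 have D0: "inner (D u) u = 0" for u using le[of u] ge[of u] by (simp add: D_def inner_diff_left)
 have "D u = 0" for u
 proof -
  have Dadd: "D (x + y) = D x + D y" for x y by (simp add: D_def S.add algebra_simps)
  have Dsym: "inner (D x) y = inner x (D y)" for x y by (simp add: D_def inner_diff_left inner_diff_right sym)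
  \<comment> \<open>Polarising the vanishing quadratic form of \<open>D\<close> at \<open>u\<close>
    and \<open>D u\<close> isolates the squared norm of \<open>D u\<close>.\<close>
  have "inner (D (u + D u)) (u + D u) = inner (D u) u + 2 * inner (D u) (D u) + inner (D (D u)) (D u)"
   by (simp add: Dadd inner_add_left inner_add_right Dsym inner_commute)
  then have "inner (D u) (D u) = 0" using D0 by simp
  then show ?thesis by simp
 qed
 then show ?thesis unfolding D_def by (intro exI[of _ l]) simp
qed

text \<open>If \<open>A\<close> is the operator of the closed form \<open>q\<close>, then
  \<open>S = (1 + A)^(-1)\<close> is bounded, symmetric and commutes with the family, hence is a
  scalar \<open>l\<close>. As \<open>l\<close> is nonzero, the domain is the whole space and
  \<open>q\<close> is \<open>1/l - 1\<close> times the inner product.\<close>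

lemma closed_form_scalar:
 fixes q :: "'h => 'h => real"
 assumes E: "subspace E" and Ei: "!!u. u \<in> E ==> \<i> *C u \<in> E" and EU: "!!g u. u \<in> E ==> U g u \<in> E"
  and Enz: "e \<in> E" "e ~= 0" and q_sym: "!!u v. u \<in> E ==> v \<in> E ==> q u v = q v u"
  and q_add: "!!u v w. u \<in> E ==> v \<in> E ==> w \<in> E ==> q (u + v) w = q u w + q v w"
  and q_scale: "!!r u v. u \<in> E ==> v \<in> E ==> q (r *R u) v = r * q u v" and q_nonneg: "!!u. u \<in> E ==> 0 <= q u u"
  and q_i: "!!u v. u \<in> E ==> v \<in> E ==> q (\<i> *C u) (\<i> *C v) = q u v"
  and q_U: "!!g u v. u \<in> E ==> v \<in> E ==> q (U g u) (U g v) = q u v"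
  and q_complete: "!!s. (!!n. s n \<in> E) ==> Cauchy s ==>
    (!!e. 0 < e ==> EX N. \<forall>m\<ge>N. \<forall>n\<ge>N. q (s m - s n) (s m - s n) < e) ==>
    \<exists>w\<in>E. s ----> w & (%n. q (s n - w) (s n - w)) ----> 0"
 shows "E = UNIV & (EX c. ALL u v. q u v = c * inner u v)"
proof -
 have Eadd: "!!u v. u \<in> E ==> v \<in> E ==> u + v \<in> E" and Esc: "!!r u. u \<in> E ==> r *R u \<in> E"
  and Ediff: "!!u v. u \<in> E ==> v \<in> E ==> u - v \<in> E"
  using E by (auto simp: subspace_add subspace_scale subspace_diff)
 have EC: "c *C u \<in> E" if "u \<in> E" for c u
 proof -
  have "c *C u = Re c *R u + Im c *R (\<i> *C u)"
   by (simp add: scaleR_scaleC scaleC_scaleC scaleC_add_left[symmetric] complex_eq mult.commute)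
     (metis complex_eq mult.commute)
  then show ?thesis using that by (simp add: Eadd Esc Ei)
 qed
 have "\<exists>w\<in>E. \<forall>v\<in>E. inner w v + q w v = inner y v" for y
  by (rule complete_form_riesz[OF E q_sym q_add q_scale q_nonneg q_complete, where M = "norm y"])
   (auto simp: inner_add_right Cauchy_Schwarz_ineq2)
 then obtain S where S: "!!y. S y \<in> E" "!!y v. v \<in> E ==> inner (S y) v + q (S y) v = inner y v" by metis
 have S_unique: "S y = w" if "w \<in> E" "!!v. v \<in> E ==> inner w v + q w v = inner y v" for y w
 proof -
  have d: "S y - w \<in> E" using S(1) that(1) by (rule Ediff)
  have "q (S y - w) (S y - w) = q (S y) (S y - w) - q w (S y - w)" using q_add[of "S y - w" w "S y - w"] d that(1) by simp
  then have "inner (S y - w) (S y - w) + q (S y - w) (S y - w) = 0"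
   using S(2)[OF d, of y] that(2)[OF d] by (simp add: inner_diff_left)
  then have "inner (S y - w) (S y - w) = 0" using q_nonneg[OF d] inner_ge_zero[of "S y - w"] by linarith
  then show ?thesis by simp
 qed
 have Sadd: "S (x + y) = S x + S y" for x y
 proof (rule S_unique)
  show "inner (S x + S y) v + q (S x + S y) v = inner (x + y) v" if "v \<in> E" for v
   using S(2)[OF that, of x] S(2)[OF that, of y] q_add[OF S(1) S(1) that, of x y] by (simp add: inner_add_left)
 qed (simp add: S(1) Eadd)
 have Ssc: "S (r *R x) = r *R S x" for r x
 proof (rule S_unique)
  show "inner (r *R S x) v + q (r *R S x) v = inner (r *R x) v" if "v \<in> E" for v
   using S(2)[OF that, of x] q_scale[OF S(1) that, of r x] by (simp add: distrib_left[symmetric])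
 qed (simp add: S(1) Esc)
 have norm_S: "norm (S x) <= norm x" for x
 proof -
  have "(norm (S x))^2 <= inner x (S x)"
   using S(2)[OF S(1), of x x] q_nonneg[OF S(1)[of x]] unfolding power2_norm_eq_inner by linarith
  also have "... <= norm x * norm (S x)" by (rule norm_cauchy_schwarz)
  finally have "norm (S x) * norm (S x) <= norm x * norm (S x)" by (simp add: power2_eq_square)
  then show ?thesis by (cases "norm (S x) = 0") (auto simp: mult_le_cancel_right)
 qed
 \<comment> \<open>A map preserving both forms carries the variational problem for \<open>x\<close>
   to the one for \<open>V x\<close>, and solutions are unique; \<open>V'\<close> pulls test vectors
   back.\<close>
 have S_comm: "S (V x) = V (S x)" if "!!u. u \<in> E ==> V u \<in> E" "!!u. u \<in> E ==> V' u \<in> E" "!!u. V (V' u) = u"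
   "!!u v. inner (V u) (V v) = inner u v" "!!u v. u \<in> E ==> v \<in> E ==> q (V u) (V v) = q u v" for V V' x
 proof (rule S_unique)
  show "inner (V (S x)) v + q (V (S x)) v = inner (V x) v" if "v \<in> E" for v
   using S(2)[of "V' v" x] \<open>!!u. V (V' u) = u\<close>[of v] that \<open>!!u. u \<in> E ==> V' u \<in> E\<close>[OF that]
    \<open>!!u v. inner (V u) (V v) = inner u v\<close>[of _ "V' v"]
    \<open>!!u v. u \<in> E ==> v \<in> E ==> q (V u) (V v) = q u v\<close>[OF S(1)[of x], of "V' v"] by simp
 qed (simp add: S(1) that)
 have S_i: "S (\<i> *C x) = \<i> *C S x" for x
  by (rule S_comm[where V' = "%u. (- \<i>) *C u"]) (auto intro: EC simp: scaleC_scaleC q_i inner_scaleC_i)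
 have S_C: "S (c *C x) = c *C S x" for c x
 proof -
  have "c *C u = Re c *R u + Im c *R (\<i> *C u)" for u :: 'h
   by (simp add: scaleR_scaleC scaleC_scaleC scaleC_add_left[symmetric]) (metis complex_eq mult.commute)
  then show ?thesis by (simp add: Sadd Ssc S_i)
 qed
 have S_U: "S (U g x) = U g (S x)" for g x
 proof -
  obtain g' where g': "!!u. U g (U g' u) = u" using U_inverse by blast
  show ?thesis by (rule S_comm[where V' = "U g'"]) (auto intro: EU simp: g' inner_U q_U)
 qed
 have "EX l. ALL u. S u = l *R u"
 proof (rule commuting_symmetric_scalar)
  show "bounded_linear S" by (rule bounded_linear_intro[of _ 1]) (simp_all add: Sadd Ssc norm_S)
  show "inner (S x) y = inner x (S y)" for x y using S(2)[OF S(1), of x y] S(2)[OF S(1), of y x] q_sym[OF S(1) S(1), of x y]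
   by (simp add: inner_commute)
 qed (auto simp: S_C S_U)
 then obtain l where l: "!!u. S u = l *R u" by blast
 have "l ~= 0"
 proof
  assume "l = 0"
  have "inner e e = 0"
  proof -
   have "S e = 0" using l \<open>l = 0\<close> by simp
   then show ?thesis using S(2)[OF Enz(1), of e] q_scale[OF Enz(1) Enz(1), of 0] by simp
  qed
  then show False using Enz by simp
 qed
 have "u \<in> E" for u using Esc[OF S(1)[of u], of "inverse l"] l[of u] \<open>l ~= 0\<close> by simp
 then have EU': "E = UNIV" by blast
 have quv: "q u v = (1 / l - 1) * inner u v" for u v
 proof -
  have "l * inner u v + l * q u v = inner u v" using S(2)[of v u] EU' l[of u] q_scale[of u v l] by simp
  then show ?thesis using \<open>l ~= 0\<close> by (simp add: field_simps)
 qed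
 show ?thesis by (intro conjI EU' exI[of _ "1 / l - 1"] allI quv)
qed

end

section \<open>Calculus of smooth maps\<close>

lemma Ck_on_subset: "Ck_on k U f ==> V <= U ==> Ck_on k V f"
 by (induction k arbitrary: f) (auto intro: continuous_on_subset simp: subset_iff, meson)

lemma Ck_on_Suc_ex:
 "Ck_on (Suc k) U f ==> EX f'. (\<forall>x\<in>U. (f has_derivative f' x) (at x)) & (ALL v. Ck_on k U (%x. f' x v))" by simp

lemma Ck_on_SucI:
 assumes "!!x. x \<in> U ==> (f has_derivative f' x) (at x)" "!!v. Ck_on k U (%x. f' x v)"
 shows "Ck_on (Suc k) U f" using assms by auto

declare Ck_on.simps(2) [simp del]

lemma Ck_on_cong:
 assumes "open U" "!!x. x \<in> U ==> f x = g x"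
 shows "Ck_on k U f \<longleftrightarrow> Ck_on k U g"
proof -
 have "Ck_on k U g" if ck: "Ck_on k U f" and "!!x. x \<in> U ==> f x = g x" for f g
 proof (cases k)
  case 0
  then show ?thesis using ck \<open>!!x. x \<in> U ==> f x = g x\<close> continuous_on_cong[of U U f g] by simp
 next
  case (Suc j)
  obtain f' where f': "!!x. x \<in> U ==> (f has_derivative f' x) (at x)" "!!v. Ck_on j U (%x. f' x v)"
   using Ck_on_Suc_ex[OF ck[unfolded Suc]] by auto
  have "(g has_derivative f' x) (at x)" if "x \<in> U" for x
   using f'(1)[OF that] \<open>open U\<close> that by (rule has_derivative_transform_within_open) (rule \<open>!!x. x \<in> U ==> f x = g x\<close>)
  then show ?thesis unfolding Suc using f'(2) by (rule Ck_on_SucI)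
 qed
 from this[of f g] this[of g f] show ?thesis using assms(2) by auto
qed

text \<open>\<open>Ck_on\<close> only asserts that some family of derivatives is good. Uniqueness of
  derivatives at interior points transfers this to any given one.\<close>

lemma Ck_on_SucD:
 assumes "open U" "Ck_on (Suc k) U f" "!!x. x \<in> U ==> (f has_derivative f' x) (at x)"
 shows "Ck_on k U (%x. f' x v)"
proof -
 obtain g where g: "!!x. x \<in> U ==> (f has_derivative g x) (at x)" "!!v. Ck_on k U (%x. g x v)"
  using Ck_on_Suc_ex[OF assms(2)] by auto
 have "g x = f' x" if "x \<in> U" for x using g(1)[OF that] assms(3)[OF that] by (rule has_derivative_unique)
 then show ?thesis using g(2)[of v] Ck_on_cong[OF assms(1), of "%x. g x v" "%x. f' x v"] by simp
qed

lemma Ck_on_imp_continuous_on: "Ck_on k U f ==> continuous_on U f"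
 by (cases k) (auto intro!: continuous_at_imp_continuous_on dest!: Ck_on_Suc_ex intro: has_derivative_continuous)

lemma Ck_on_mono: "Ck_on k U f ==> j <= k ==> Ck_on j U f"
proof (induction k arbitrary: j f)
 case (Suc k)
 show ?case
 proof (cases j)
  case 0
  then show ?thesis using Ck_on_imp_continuous_on[OF Suc.prems(1)] by simp
 next
  case j: (Suc i)
  obtain f' where f': "!!x. x \<in> U ==> (f has_derivative f' x) (at x)" "!!v. Ck_on k U (%x. f' x v)"
   using Ck_on_Suc_ex[OF Suc.prems(1)] by auto
  have "i <= k" using Suc.prems(2) j by simp
  show ?thesis unfolding j by (rule Ck_on_SucI[OF f'(1)]) (auto intro: Suc.IH[OF f'(2) \<open>i <= k\<close>])
 qed
qed auto

lemma Ck_on_differentiable: "Ck_on (Suc k) U f ==> x \<in> U ==> f differentiable (at x)"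
 unfolding differentiable_def by (auto dest!: Ck_on_Suc_ex)

text \<open>The derivatives found on the neighbourhoods all agree with
  \<open>frechet_derivative\<close>, which therefore glues them together.\<close>

lemma Ck_on_local:
 assumes "!!x. x \<in> U ==> EX V. open V & x \<in> V & Ck_on k V f"
 shows "Ck_on k U f"
proof -
 obtain V where V: "!!x. x \<in> U ==> open (V x) & x \<in> V x & Ck_on k (V x) f" using assms by metis
 \<comment> \<open>The induction runs over this open union with the neighbourhoods held fixed,
   because \<open>U\<close> need not be open.\<close>
 define W where "W = (\<Union>x\<in>U. V x)"
 have "Ck_on k W f" if "!!x. x \<in> U ==> Ck_on k (V x) f" for f using that
 proof (induction k arbitrary: f)
  case 0
  then show ?case unfolding W_def by (auto intro!: continuous_on_open_UN simp: V)
 next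
  case (Suc k)
  have d: "(f has_derivative frechet_derivative f (at x)) (at x)" if "x \<in> W" for x
  proof -
   obtain y where "y \<in> U" "x \<in> V y" using \<open>x \<in> W\<close> by (auto simp: W_def)
   then show ?thesis using Ck_on_differentiable[OF Suc.prems] frechet_derivative_works by blast
  qed
  show ?case
  proof (rule Ck_on_SucI[OF d])
   show "Ck_on k W (%x. frechet_derivative f (at x) v)" for v
   proof (rule Suc.IH)
    show "Ck_on k (V x) (%x. frechet_derivative f (at x) v)" if "x \<in> U" for x
     by (rule Ck_on_SucD[OF _ Suc.prems[OF that]]) (use V[OF that] d that in \<open>auto simp: W_def\<close>)
   qed
  qed
 qed
 then have "Ck_on k W f" using V by blast
 then show ?thesis by (rule Ck_on_subset) (use V in \<open>auto simp: W_def\<close>)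
qed

lemma Ck_on_const [simp]: "Ck_on k U (%x. c)"
proof (induction k arbitrary: c)
 case (Suc k)
 then show ?case by (intro Ck_on_SucI[where f' = "%_ _. 0"]) auto
qed auto

lemma Ck_on_add: "Ck_on k U f ==> Ck_on k U g ==> Ck_on k U (%x. f x + g x)"
proof (induction k arbitrary: f g)
 case (Suc k)
 obtain f' where "!!x. x \<in> U ==> (f has_derivative f' x) (at x)" "!!v. Ck_on k U (%x. f' x v)"
  using Ck_on_Suc_ex[OF Suc.prems(1)] by auto
 moreover obtain g' where "!!x. x \<in> U ==> (g has_derivative g' x) (at x)" "!!v. Ck_on k U (%x. g' x v)"
  using Ck_on_Suc_ex[OF Suc.prems(2)] by auto
 ultimately show ?case using Suc.IH by (intro Ck_on_SucI[where f' = "%x v. f' x v + g' x v"]) (auto intro: has_derivative_add)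
qed (auto intro: continuous_on_add)

lemma Ck_on_bounded_linear:
 assumes "bounded_linear h"
 shows "Ck_on k U f ==> Ck_on k U (%x. h (f x))"
proof (induction k arbitrary: f)
 case 0
 then show ?case using assms bounded_linear.continuous_on by auto
next
 case (Suc k)
 obtain f' where "!!x. x \<in> U ==> (f has_derivative f' x) (at x)" "!!v. Ck_on k U (%x. f' x v)"
  using Ck_on_Suc_ex[OF Suc.prems] by auto
 then show ?case using Suc.IH
  by (intro Ck_on_SucI[where f' = "%x v. h (f' x v)"]) (auto intro: bounded_linear.has_derivative[OF assms])
qed

lemma Ck_on_id: "Ck_on k U (%x. x)"
proof (cases k)
 case (Suc j)
 show ?thesis unfolding Suc by (rule Ck_on_SucI[where f' = "%x v. v"]) auto
qed auto

lemma Ck_on_linear: "bounded_linear h ==> Ck_on k U h" by (rule Ck_on_bounded_linear[OF _ Ck_on_id])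

lemma Ck_on_sum: "finite I ==> (!!i. i \<in> I ==> Ck_on k U (f i)) ==> Ck_on k U (%x. \<Sum>i\<in>I. f i x)"
 by (induction I rule: finite_induct) (auto intro: Ck_on_add)

lemma Ck_on_bounded_bilinear:
 assumes "bounded_bilinear h"
 shows "Ck_on k U f ==> Ck_on k U g ==> Ck_on k U (%x. h (f x) (g x))"
proof (induction k arbitrary: f g)
 case 0
 then show ?case using bounded_bilinear.continuous_on[OF assms] by auto
next
 case (Suc k)
 obtain f' where d: "!!x. x \<in> U ==> (f has_derivative f' x) (at x)" "!!v. Ck_on k U (%x. f' x v)"
  using Ck_on_Suc_ex[OF Suc.prems(1)] by auto
 obtain g' where d': "!!x. x \<in> U ==> (g has_derivative g' x) (at x)" "!!v. Ck_on k U (%x. g' x v)"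
  using Ck_on_Suc_ex[OF Suc.prems(2)] by auto
 have "Ck_on k U f" "Ck_on k U g" using Suc.prems Ck_on_mono[of "Suc k" U _ k] by auto
 then show ?case using Suc.IH d d' by (intro Ck_on_SucI[where f' = "%x v. h (f x) (g' x v) + h (f' x v) (g x)"])
   (auto intro: bounded_bilinear.FDERIV[OF assms] Ck_on_add)
qed

lemmas Ck_on_scaleR = Ck_on_bounded_bilinear[OF bounded_bilinear_scaleR]

lemma Ck_on_Pair:
 assumes "Ck_on k U f" "Ck_on k U g"
 shows "Ck_on k U (%x. (f x, g x))"
proof -
 have "bounded_linear (%x. (x, 0))" "bounded_linear (%x. (0, x))"
  by (auto intro!: bounded_linear_Pair bounded_linear_ident bounded_linear_zero)
 from Ck_on_add[OF Ck_on_bounded_linear[OF this(1) assms(1)] Ck_on_bounded_linear[OF this(2) assms(2)]]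
 show ?thesis by simp
qed

text \<open>The chain rule evaluates \<open>g'\<close> in a direction that moves with
  \<open>x\<close>, whereas \<open>Ck_on\<close> controls fixed directions. Expanding the direction
  in a basis of the Euclidean intermediate space reduces to those.\<close>

lemma Ck_on_compose:
 fixes g :: "'b::euclidean_space => 'c::real_normed_vector"
 shows "Ck_on k V g ==> Ck_on k U f ==> (!!x. x \<in> U ==> f x \<in> V) ==> Ck_on k U (%x. g (f x))"
proof (induction k arbitrary: g)
 case 0
 then show ?case by (auto intro: continuous_on_compose2)
next
 case (Suc k)
 obtain g' where g': "!!x. x \<in> V ==> (g has_derivative g' x) (at x)" "!!v. Ck_on k V (%x. g' x v)"
  using Ck_on_Suc_ex[OF Suc.prems(1)] by auto
 obtain f' where f': "!!x. x \<in> U ==> (f has_derivative f' x) (at x)" "!!v. Ck_on k U (%x. f' x v)"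
  using Ck_on_Suc_ex[OF Suc.prems(2)] by auto
 have fk: "Ck_on k U f" using Suc.prems(2) Ck_on_mono[of "Suc k" U _ k] by auto
 show ?case
 proof (rule Ck_on_SucI)
  fix x assume x: "x \<in> U"
  have "((%x. g (f x)) has_derivative (%v. g' (f x) (f' x v))) (at x)"
   using f'(1)[OF x] g'(1)[OF Suc.prems(3)[OF x]] by (rule has_derivative_compose)
  also have "(%v. g' (f x) (f' x v)) = (%v. \<Sum>b\<in>Basis. (f' x v \<bullet> b) *R g' (f x) b)"
  proof
   fix v
   have lin: "linear (g' (f x))" using g'(1)[OF Suc.prems(3)[OF x]] has_derivative_linear by blast
   have "g' (f x) (f' x v) = g' (f x) (\<Sum>b\<in>Basis. (f' x v \<bullet> b) *R b)" by (simp add: euclidean_representation)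
   then show "g' (f x) (f' x v) = (\<Sum>b\<in>Basis. (f' x v \<bullet> b) *R g' (f x) b)"
    by (simp add: linear_sum[OF lin] linear_scale[OF lin])
  qed
  finally show "((%x. g (f x)) has_derivative (%v. \<Sum>b\<in>Basis. (f' x v \<bullet> b) *R g' (f x) b)) (at x)" .
 next
  fix v
  show "Ck_on k U (%x. \<Sum>b\<in>Basis. (f' x v \<bullet> b) *R g' (f x) b)"
   by (intro Ck_on_sum Ck_on_scaleR Ck_on_bounded_linear[OF bounded_linear_inner_left] f'
     Suc.IH g' fk Suc.prems(3)) auto
 qed
qed

section \<open>Charts and smooth maps of manifolds\<close>

text \<open>The part of \<^const>\<open>smooth_atlas\<close> that does not concern transition maps.\<close>

definition charts_ok :: "('m::topological_space, 'e::real_normed_vector) chart set => bool" where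
 "charts_ok A \<longleftrightarrow> (\<forall>(U, phi)\<in>A. open U & open (phi ` U) & inj_on phi U &
   homeomorphism U (phi ` U) phi (inv_into U phi)) & (\<Union>(U, phi)\<in>A. U) = UNIV"

lemma smooth_atlas_charts_ok: "smooth_atlas A ==> charts_ok A" by (simp add: smooth_atlas_def charts_ok_def)

lemma charts_okD:
 assumes "charts_ok A" "(U, phi) \<in> A"
 shows "open U" "open (phi ` U)" "inj_on phi U" "homeomorphism U (phi ` U) phi (inv_into U phi)"
 using assms unfolding charts_ok_def by auto

lemma charts_ok_cover: "charts_ok A ==> EX U phi. (U, phi) \<in> A & x \<in> U"
proof -
 assume "charts_ok A"
 then have "x \<in> (\<Union>(U, phi)\<in>A. U)" by (simp add: charts_ok_def)
 then show ?thesis by auto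
qed

lemma chart_open_image:
 assumes "charts_ok A" "(U, phi) \<in> A" "open T" "T <= U"
 shows "open (phi ` T)"
proof -
 have "openin (top_of_set (phi ` U)) (phi ` T)" using homeomorphism_imp_open_map[OF charts_okD(4)[OF assms(1,2)]] assms(3,4)
  by (simp add: openin_open_eq charts_okD[OF assms(1,2)])
 then show ?thesis using charts_okD(2)[OF assms(1,2)] openin_open_trans by blast
qed

lemma charts_ok_vec: "charts_ok vec_atlas"
proof -
 have "homeomorphism UNIV UNIV (%x::'a. x) (inv_into UNIV (%x. x))" by (auto simp: homeomorphism_def inv_into_def)
 then show ?thesis by (auto simp: charts_ok_def vec_atlas_def)
qed

lemma inv_into_map_prod:
 assumes "inj_on phi U" "inj_on psi V" "x \<in> phi ` U" "y \<in> psi ` V"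
 shows "inv_into (U \<times> V) (map_prod phi psi) (x, y) = (inv_into U phi x, inv_into V psi y)"
 using assms by (intro inv_into_f_eq map_prod_inj_on) (auto simp: f_inv_into_f inv_into_into)

lemma charts_ok_prod:
 assumes "charts_ok A" "charts_ok B"
 shows "charts_ok (prod_atlas A B)" unfolding charts_ok_def
proof (intro conjI ballI, goal_cases)
 case (1 c)
 then show ?case
 proof (cases c, clarify)
 fix W theta assume "(W, theta) \<in> prod_atlas A B"
 then obtain U phi V psi where W: "W = U \<times> V" "theta = map_prod phi psi" "(U, phi) \<in> A" "(V, psi) \<in> B"
  by (auto simp: prod_atlas_def)
 note a = charts_okD[OF assms(1) W(3)] and b = charts_okD[OF assms(2) W(4)]
 have im: "theta ` W = phi ` U \<times> psi ` V" by (auto simp: W)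
 have inj: "inj_on theta W" unfolding W by (intro map_prod_inj_on a b)
 have "continuous_on W theta" unfolding W map_prod_def case_prod_beta by (intro continuous_on_Pair
    continuous_on_compose2[OF homeomorphism_cont1[OF a(4)] continuous_on_fst[OF continuous_on_id]]
    continuous_on_compose2[OF homeomorphism_cont1[OF b(4)] continuous_on_snd[OF continuous_on_id]]) auto
 moreover have "continuous_on (theta ` W) (inv_into W theta)"
 proof -
  have "continuous_on (phi ` U \<times> psi ` V) (%p. (inv_into U phi (fst p), inv_into V psi (snd p)))"
   by (intro continuous_on_Pair
     continuous_on_compose2[OF homeomorphism_cont2[OF a(4)] continuous_on_fst[OF continuous_on_id]]
     continuous_on_compose2[OF homeomorphism_cont2[OF b(4)] continuous_on_snd[OF continuous_on_id]]) auto
  moreover have "inv_into W theta p = (inv_into U phi (fst p), inv_into V psi (snd p))" if "p \<in> phi ` U \<times> psi ` V" for p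
   using inv_into_map_prod[OF a(3) b(3), of "fst p" "snd p"] that by (auto simp: W)
  ultimately show ?thesis unfolding im using continuous_on_cong by (metis (no_types, lifting))
 qed
 moreover have "inv_into W theta ` theta ` W = W" using inj by (auto simp: image_image inv_into_f_f)
 ultimately have "homeomorphism W (theta ` W) theta (inv_into W theta)"
  unfolding homeomorphism_def using inj by (auto simp: f_inv_into_f)
 moreover have "open W" "open (theta ` W)" unfolding im unfolding W by (intro open_Times a b)+
 ultimately show "open W & open (theta ` W) & inj_on theta W & homeomorphism W (theta ` W) theta (inv_into W theta)"
  using inj by blast
 qed
next
 case 2
 show ?case
 proof (rule UNIV_eq_I[symmetric])
  fix p :: "'a \<times> 'c"
  obtain U phi V psi where "(U, phi) \<in> A" "fst p \<in> U" "(V, psi) \<in> B" "snd p \<in> V"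
   using charts_ok_cover[OF assms(1)] charts_ok_cover[OF assms(2)] by metis
  then have "(U \<times> V, map_prod phi psi) \<in> prod_atlas A B" "p \<in> U \<times> V"
   by (auto simp: prod_atlas_def mem_Times_iff)
  then show "p \<in> (\<Union>(U, phi)\<in>prod_atlas A B. U)" by blast
 qed
qed

lemma smooth_mapD:
 assumes "smooth_map A B f" "(U, phi) \<in> A" "(V, psi) \<in> B"
 shows "Ck_on k (phi ` (U \<inter> f -` V)) (%x. psi (f (inv_into U phi x)))"
 using assms unfolding smooth_map_def smooth_on_def by blast

lemma smooth_map_continuous: "smooth_map A B f ==> continuous_on UNIV f" by (simp add: smooth_map_def)

text \<open>The image of one chart domain need not lie in a single chart of the middle manifold, so
  such a chart is inserted around each point and regularity is checked locally.\<close>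

lemma smooth_map_compose:
 fixes B :: "('n::topological_space, 'f::euclidean_space) chart set"
 assumes A: "charts_ok A" and B: "charts_ok B" and C: "charts_ok C" and f: "smooth_map A B f" and g: "smooth_map B C g"
 shows "smooth_map A C (%x. g (f x))" unfolding smooth_map_def
proof (intro conjI ballI, goal_cases)
 case 1
 show ?case by (rule continuous_on_compose2[OF smooth_map_continuous[OF g] smooth_map_continuous[OF f]]) simp
next
 case (2 c)
 obtain U phi where c: "c = (U, phi)" by (cases c)
 have "smooth_on (phi ` (U \<inter> (%x. g (f x)) -` W)) (%x. theta (g (f (inv_into U phi x))))"
  if W: "(W, theta) \<in> C" for W theta unfolding smooth_on_def
 proof (intro allI Ck_on_local)
  fix k x assume "x \<in> phi ` (U \<inter> (%x. g (f x)) -` W)"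
  then obtain u where u: "x = phi u" "u \<in> U" "g (f u) \<in> W" by auto
  obtain V psi where V: "(V, psi) \<in> B" "f u \<in> V" using charts_ok_cover[OF B] by blast
  have Ua: "(U, phi) \<in> A" using 2 c by simp
  define T where "T = U \<inter> f -` V \<inter> (%x. g (f x)) -` W"
  have oT: "open T" unfolding T_def
   by (intro open_Int charts_okD(1)[OF A Ua] open_vimage charts_okD(1)[OF B V(1)] charts_okD(1)[OF C W]
     smooth_map_continuous[OF f] continuous_on_compose2[OF smooth_map_continuous[OF g] smooth_map_continuous[OF f]]) simp
  have o: "open (phi ` T)" by (rule chart_open_image[OF A Ua oT]) (auto simp: T_def)
  have inj: "inj_on phi U" "inj_on psi V" using charts_okD(3)[OF A Ua] charts_okD(3)[OF B V(1)] by auto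
  have "Ck_on k (phi ` T) (%x. theta (g (inv_into V psi (psi (f (inv_into U phi x))))))"
  proof (rule Ck_on_compose[OF smooth_mapD[OF g V(1) W] Ck_on_subset[OF smooth_mapD[OF f Ua V(1)]]])
   show "phi ` T <= phi ` (U \<inter> f -` V)" by (auto simp: T_def)
   show "psi (f (inv_into U phi x)) \<in> psi ` (V \<inter> g -` W)" if "x \<in> phi ` T" for x
    using that inj by (auto simp: T_def inv_into_f_f)
  qed
  then have "Ck_on k (phi ` T) (%x. theta (g (f (inv_into U phi x))))"
   by (subst (asm) Ck_on_cong[OF o, of _ "%x. theta (g (f (inv_into U phi x)))"])
    (use inj in \<open>auto simp: T_def inv_into_f_f\<close>)
  then show "EX V. open V & x \<in> V & Ck_on k V (%x. theta (g (f (inv_into U phi x))))"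
   using o u V by (intro exI[of _ "phi ` T"]) (auto simp: T_def)
 qed
 then show ?case unfolding c by auto
qed

lemma smooth_map_Pair:
 assumes A: "charts_ok A" and B: "charts_ok B" and C: "charts_ok C" and f: "smooth_map A B f" and g: "smooth_map A C g"
 shows "smooth_map A (prod_atlas B C) (%x. (f x, g x))" unfolding smooth_map_def
proof (intro conjI ballI, goal_cases)
 case 1
 show ?case by (intro continuous_on_Pair smooth_map_continuous[OF f] smooth_map_continuous[OF g])
next
 case (2 c)
 obtain U phi where c: "c = (U, phi)" by (cases c)
 have Ua: "(U, phi) \<in> A" using 2 c by simp
 have "smooth_on (phi ` (U \<inter> (%x. (f x, g x)) -` (V \<times> W))) (%x. map_prod psi theta (f (inv_into U phi x), g (inv_into U phi x)))"
  if "(V, psi) \<in> B" "(W, theta) \<in> C" for V psi W theta unfolding smooth_on_def map_prod_simp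
  by (intro allI Ck_on_Pair Ck_on_subset[OF smooth_mapD[OF f Ua that(1)]] Ck_on_subset[OF smooth_mapD[OF g Ua that(2)]]) auto
 then show ?case unfolding c prod_atlas_def by auto
qed

lemma smooth_map_id: "smooth_atlas A ==> smooth_map A A (%x. x)"
 unfolding smooth_map_def smooth_atlas_def by (auto simp: continuous_on_id)

lemma smooth_map_const: "smooth_map A B (%x. c)" unfolding smooth_map_def smooth_on_def by (auto simp: continuous_on_const)

lemma smooth_map_vec_iff: "smooth_map vec_atlas vec_atlas f \<longleftrightarrow> smooth_on UNIV f"
proof -
 have "continuous_on UNIV f" if "smooth_on UNIV f" using that Ck_on_imp_continuous_on unfolding smooth_on_def by blast
 then show ?thesis by (auto simp: smooth_map_def vec_atlas_def)
qed

section \<open>The exponential map of a nilpotent Lie group\<close>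

lemma subspace_annihilator_exists:
 fixes S :: "'a::euclidean_space set"
 assumes "subspace S" "v \<notin> S"
 shows "EX w. (\<forall>y\<in>S. inner w y = 0) & inner w v ~= 0"
proof -
 obtain y z where yz: "y \<in> span S" "!!w. w \<in> span S ==> orthogonal z w" "v = y + z"
  using orthogonal_subspace_decomp_exists[of S v] by blast
 have "y \<in> S" using yz(1) span_minimal[OF subset_refl assms(1)] by blast
 then have "z ~= 0" using yz(3) assms(2) by auto
 moreover have "inner z v = inner z z" using yz by (simp add: inner_add_right orthogonal_def)
 moreover have "\<forall>y\<in>S. inner z y = 0" using yz(2) span_superset by (auto simp: orthogonal_def)
 ultimately show ?thesis by (intro exI[of _ z]) auto
qed

text \<open>Reduces membership of a vector in a subspace to scalar identities, so that a curve can
  be shown constant modulo the subspace by derivatives of real functions.\<close>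

lemma subspaceI_annihilator:
 fixes S :: "'a::euclidean_space set"
 assumes "subspace S" "!!w. (!!y. y \<in> S ==> inner w y = 0) ==> inner w v = 0"
 shows "v \<in> S" using subspace_annihilator_exists[OF assms(1), of v] assms(2) by blast

lemma has_vector_derivative_scaleR_id: "((%t. t *R Y) has_vector_derivative Y) (at t within S)"
 by (auto intro!: derivative_eq_intros)

text \<open>Descending induction on the exponent: once \<open>A^(i+1) W\<close> vanishes along the
  curve, \<open>A^i W\<close> has derivative zero and equals its initial value 0.\<close>

lemma nilpotent_ode_zero:
 fixes W :: "real => 'a::real_normed_vector"
 assumes A: "bounded_linear A" and W: "!!t. (W has_vector_derivative A (W t)) (at t)"
  and nil: "!!x. (A ^^ k) x = 0" and W0: "W 0 = 0"
 shows "W t = 0"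
proof -
 interpret A: bounded_linear A by (rule A)
 have pw0: "(A ^^ j) 0 = 0" for j by (induction j) (simp_all add: A.zero)
 have "j <= k ==> (A ^^ (k - j)) (W t) = 0" for j t
 proof (induction j arbitrary: t)
  case 0
  then show ?case by (simp add: nil)
 next
  case (Suc j)
  have d: "((%t. (A ^^ i) (W t)) has_vector_derivative (A ^^ Suc i) (W t)) (at t)" for i t
  proof (induction i)
   case 0
   then show ?case using W by simp
  next
   case (Suc i)
   then show ?case using A.has_vector_derivative[of "%t. (A ^^ i) (W t)"] by simp
  qed
  have "Suc (k - Suc j) = k - j" using Suc.prems by simp
  then have "((%t. (A ^^ (k - Suc j)) (W t)) has_vector_derivative 0) (at t)" for t
   using d[of "k - Suc j" t] Suc.IH[of t] Suc.prems by simp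
  then obtain c where c: "!!t. (A ^^ (k - Suc j)) (W t) = c"
   using has_vector_derivative_zero_constant[of UNIV "%t. (A ^^ (k - Suc j)) (W t)"] by auto
  from c[of 0] c[of t] show ?case using W0 pw0 by simp
 qed
 from this[of k t] show ?thesis by simp
qed

section \<open>The group in exponential coordinates\<close>

locale nilpotent_lie_group =
 fixes D :: "('g::{t2_space, second_countable_topology}, 'a::euclidean_space, 'h::chilbert_space) kdata"
 assumes lie: "lie_group D" and alg: "lie_algebra_of D" and nil: "nilpotent D" and expd: "exp_diffeomorphism D"
begin

abbreviation gmul :: "'g => 'g => 'g" (infixl "\<cdot>" 70) where "x \<cdot> y \<equiv> x \<otimes>\<^bsub>grp D\<^esub> y"
abbreviation ginv :: "'g => 'g" where "ginv x \<equiv> inv\<^bsub>grp D\<^esub> x"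
abbreviation gone :: 'g where "gone \<equiv> \<one>\<^bsub>grp D\<^esub>"
abbreviation br :: "'a => 'a => 'a" where "br \<equiv> bracket D"

sublocale G: group "grp D" using lie by (simp add: lie_group_def)

lemma in_carrier [simp]: "x \<in> carrier (grp D)" using lie by (simp add: lie_group_def)

lemma ginv_mult: "ginv (x \<cdot> y) = ginv y \<cdot> ginv x" by (simp add: G.inv_mult_group)

lemma assoc: "x \<cdot> y \<cdot> z = x \<cdot> (y \<cdot> z)" by (simp add: G.m_assoc)

lemma cancel_simps [simp]: "x \<cdot> (ginv x \<cdot> y) = y" "ginv x \<cdot> (x \<cdot> y) = y" by (simp_all flip: assoc)

lemma lexp_llog [simp]: "lexp D (llog D g) = g" and llog_lexp [simp]: "llog D (lexp D X) = X"
 using expd by (auto simp: exp_diffeomorphism_def llog_def bij_def surj_f_inv_f)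

lemma lexp_inj: "lexp D X = lexp D Y \<longleftrightarrow> X = Y" by (metis llog_lexp)

lemma lexp_add_scale: "lexp D ((s + t) *R X) = lexp D (s *R X) \<cdot> lexp D (t *R X)"
 using alg by (simp add: lie_algebra_of_def)

lemma lexp_zero [simp]: "lexp D 0 = gone"
proof -
 have "lexp D 0 \<cdot> lexp D 0 = lexp D 0 \<cdot> gone" using lexp_add_scale[of 0 0 0] by simp
 then show ?thesis by simp
qed

lemma llog_one [simp]: "llog D gone = 0" by (metis lexp_zero llog_lexp)

lemma lexp_minus: "lexp D (- X) = ginv (lexp D X)"
proof -
 have "lexp D (- X) \<cdot> lexp D X = gone" using lexp_add_scale[of "-1" 1 X] by simp
 then show ?thesis by (simp add: G.inv_equality)
qed

lemma lexp_double: "lexp D (2 *R X) = lexp D X \<cdot> lexp D X" using lexp_add_scale[of 1 1 X] by simp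

text \<open>The Baker-Campbell-Hausdorff product, taken from the group law and not from the
  series.\<close>

definition bch :: "'a => 'a => 'a" where
 "bch X Y = llog D (lexp D X \<cdot> lexp D Y)"

lemma lexp_bch: "lexp D (bch X Y) = lexp D X \<cdot> lexp D Y" by (simp add: bch_def)

lemma bch_zero [simp]: "bch X 0 = X" "bch 0 X = X" by (simp_all add: bch_def)

lemma bch_assoc: "bch (bch X Y) Z = bch X (bch Y Z)" by (simp add: bch_def assoc)

lemma bch_minus [simp]: "bch X (- X) = 0" "bch (- X) X = 0" "bch X (bch (- X) Y) = Y" "bch (- X) (bch X Y) = Y"
 by (simp_all add: bch_def lexp_minus)

lemma smooth_bch: "Ck_on k UNIV (%p. bch (fst p) (snd p))"
proof -
 have atl: "smooth_atlas (atlas D)" using lie by (simp add: lie_group_def)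
 note ok = smooth_atlas_charts_ok[OF atl]
 have ex: "smooth_map vec_atlas (atlas D) (lexp D)" "smooth_map (atlas D) vec_atlas (llog D)"
  using expd by (auto simp: exp_diffeomorphism_def)
 have pr: "smooth_map vec_atlas vec_atlas (fst :: 'a \<times> 'a => 'a)" "smooth_map vec_atlas vec_atlas (snd :: 'a \<times> 'a => 'a)"
  by (auto simp: smooth_map_vec_iff smooth_on_def intro: Ck_on_linear bounded_linear_fst bounded_linear_snd)
 have pair: "smooth_map vec_atlas (prod_atlas (atlas D) (atlas D)) (%p. (lexp D (fst p), lexp D (snd p)))"
  by (intro smooth_map_Pair charts_ok_vec ok smooth_map_compose[OF charts_ok_vec charts_ok_vec ok _ ex(1)] pr)
 have mult: "smooth_map (prod_atlas (atlas D) (atlas D)) (atlas D) (%(x, y). x \<cdot> y)" using lie by (simp add: lie_group_def)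
 have "smooth_map vec_atlas (atlas D) (%p. (%(x, y). x \<cdot> y) (lexp D (fst p), lexp D (snd p)))"
  by (rule smooth_map_compose[OF charts_ok_vec charts_ok_prod[OF ok ok] ok pair mult])
 then have "smooth_map vec_atlas vec_atlas (%p. llog D ((%(x, y). x \<cdot> y) (lexp D (fst p), lexp D (snd p))))"
  by (rule smooth_map_compose[OF charts_ok_vec ok charts_ok_vec _ ex(2)])
 then show ?thesis unfolding smooth_map_vec_iff smooth_on_def by (simp add: bch_def)
qed

definition dbch :: "'a \<times> 'a => 'a \<times> 'a => 'a" where
 "dbch p = frechet_derivative (%p. bch (fst p) (snd p)) (at p)"

lemma dbch: "((%p. bch (fst p) (snd p)) has_derivative dbch p) (at p)" using Ck_on_differentiable[OF smooth_bch[of "Suc 0"], of p]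
 by (simp add: dbch_def frechet_derivative_works)

lemma Ck_dbch: "Ck_on k UNIV (%p. dbch p v)" by (rule Ck_on_SucD[OF open_UNIV smooth_bch dbch])

lemma linear_dbch: "linear (dbch p)" using dbch has_derivative_linear by blast

definition dbch2 :: "'a => 'a => 'a => 'a" where
 "dbch2 X Y V = dbch (X, Y) (0, V)"

lemma has_derivative_bch:
 assumes "(f has_derivative f') (at x within S)" "(g has_derivative g') (at x within S)"
 shows "((%x. bch (f x) (g x)) has_derivative (%v. dbch (f x, g x) (f' v, g' v))) (at x within S)"
 using has_derivative_compose[OF has_derivative_Pair[OF assms] dbch] by simp

lemma has_vector_derivative_bch:
 assumes "(f has_vector_derivative f') (at x within S)" "(g has_vector_derivative g') (at x within S)"
 shows "((%x. bch (f x) (g x)) has_vector_derivative dbch (f x, g x) (f', g')) (at x within S)"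
 using has_derivative_bch[OF assms[unfolded has_vector_derivative_def]]
  linear_scale[OF linear_dbch, of _ _ "(f', g')"] by (simp add: has_vector_derivative_def)

lemma has_vector_derivative_bch2:
 assumes "(g has_vector_derivative g') (at x within S)"
 shows "((%x. bch X (g x)) has_vector_derivative dbch2 X (g x) g') (at x within S)"
 using has_vector_derivative_bch[OF has_vector_derivative_const assms, of X] by (simp add: dbch2_def)

lemma linear_dbch2: "linear (dbch2 X Y)"
proof (rule linearI)
 show "dbch2 X Y (U + V) = dbch2 X Y U + dbch2 X Y V" for U V
  using linear_add[OF linear_dbch, of "(X, Y)" "(0, U)" "(0, V)"] by (simp add: dbch2_def)
 show "dbch2 X Y (r *R U) = r *R dbch2 X Y U" for r U
  using linear_scale[OF linear_dbch, of "(X, Y)" r "(0, U)"] by (simp add: dbch2_def)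
qed

lemma dbch_zero: "dbch (0, 0) (U, V) = U + V"
proof -
 have "((%t. bch (t *R U) 0) has_vector_derivative dbch (0 *R U, 0) (1 *R U, 0)) (at 0)"
  by (rule has_vector_derivative_bch[where f = "%t. t *R U" and x = 0]) (auto intro!: derivative_eq_intros)
 moreover have "((%t. t *R U) has_vector_derivative U) (at 0)" by (auto intro!: derivative_eq_intros)
 ultimately have 1: "dbch (0, 0) (U, 0) = U" using vector_derivative_unique_at by fastforce
 have "((%t. bch 0 (t *R V)) has_vector_derivative dbch (0, 0 *R V) (0, 1 *R V)) (at 0)"
  by (rule has_vector_derivative_bch[where g = "%t. t *R V" and x = 0]) (auto intro!: derivative_eq_intros)
 moreover have "((%t. t *R V) has_vector_derivative V) (at 0)" by (auto intro!: derivative_eq_intros)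
 ultimately have 2: "dbch (0, 0) (0, V) = V" using vector_derivative_unique_at by fastforce
 show ?thesis using linear_add[OF linear_dbch, of "(0, 0)" "(U, 0)" "(0, V)"] 1 2 by simp
qed

text \<open>Doubling alone suffices: it gives \<open>c t = 2^n c(t / 2^n)\<close>, and the right
  side tends to \<open>t v\<close> by differentiability at 0.\<close>

lemma one_parameter_subgroup:
 assumes c: "!!t. lexp D (c (2 * t)) = lexp D (c t) \<cdot> lexp D (c t)" and d: "(c has_vector_derivative v) (at 0)"
 shows "c t = t *R v"
proof -
 have dbl: "c (2 * t) = 2 *R c t" for t using c[of t] by (simp flip: lexp_double add: lexp_inj)
 have "c 0 = 2 *R c 0" using dbl[of 0] by simp
 then have c0: "c 0 = 0" by (simp add: scaleR_2)
 have pow: "c t = 2 ^ n *R c (t / 2 ^ n)" for n t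
 proof (induction n)
  case (Suc n)
  have "c (t / 2 ^ n) = 2 *R c (t / 2 ^ Suc n)" using dbl[of "t / 2 ^ Suc n"] by (simp add: field_simps)
  then show ?case using Suc by (simp add: mult.commute)
 qed simp
 show ?thesis
 proof (cases "t = 0")
  case False
  have "((%h. (1 / h) *R c h) ---> v) (at 0)"
  proof -
   have "((%h. norm (c h - h *R v) / norm h) ---> 0) (at 0)"
    using d c0 by (simp add: has_vector_derivative_def has_derivative_at)
   moreover have "\<forall>\<^sub>F h in at 0. norm (c h - h *R v) / norm h = norm ((1 / h) *R c h - v)"
   proof (rule eventually_mono[OF eventually_neq_at_within[of 0]])
    fix h :: real assume "h ~= 0"
    then have "(1 / h) *R c h - v = (1 / h) *R (c h - h *R v)" by (simp add: scaleR_right_diff_distrib)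
    then show "norm (c h - h *R v) / norm h = norm ((1 / h) *R c h - v)" by simp
   qed
   ultimately have "((%h. norm ((1 / h) *R c h - v)) ---> 0) (at 0)" by (rule Lim_transform_eventually)
   then show ?thesis by (simp add: tendsto_norm_zero_iff LIM_zero_iff)
  qed
  moreover have "filterlim (%n. t / 2 ^ n) (at 0) sequentially"
   using False by (auto simp: filterlim_at LIMSEQ_divide_realpow_zero)
  ultimately have "(%n. (1 / (t / 2 ^ n)) *R c (t / 2 ^ n)) ----> v" by (rule filterlim_compose)
  moreover have "(1 / (t / 2 ^ n)) *R c (t / 2 ^ n) = (1 / t) *R c t" for n unfolding pow[of t n] by simp
  ultimately have "(1 / t) *R c t = v" by (simp add: LIMSEQ_const_iff)
  then show ?thesis using False by auto
 qed (simp add: c0)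
qed

text \<open>The conjugates of \<open>exp(t Y)\<close> satisfy the doubling relation, so their
  logarithm is linear in \<open>t\<close>; its value at 1 is the derivative by which
  \<open>Ad\<close> is defined.\<close>

lemma lexp_Ad: "lexp D (Ad D g Y) = g \<cdot> lexp D Y \<cdot> ginv g"
proof -
 define X where "X = llog D g"
 define c where "c t = llog D (g \<cdot> lexp D (t *R Y) \<cdot> ginv g)" for t :: real
 have c_bch: "c t = bch (bch X (t *R Y)) (- X)" for t by (simp add: c_def X_def bch_def lexp_minus)
 have "EX v. (c has_vector_derivative v) (at 0)" unfolding c_bch
  by (rule exI, rule has_vector_derivative_bch[OF has_vector_derivative_bch2[OF has_vector_derivative_scaleR_id] has_vector_derivative_const])
 then obtain v where v: "(c has_vector_derivative v) (at 0)" by blast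
 have "c t = t *R v" for t
 proof (rule one_parameter_subgroup[OF _ v])
  show "lexp D (c (2 * t)) = lexp D (c t) \<cdot> lexp D (c t)" for t using lexp_double[of "t *R Y"] by (simp add: c_def assoc)
 qed
 moreover have "Ad D g Y = v" unfolding Ad_def using v vector_derivative_at by (simp add: c_def[abs_def])
 ultimately have "Ad D g Y = c 1" by simp
 then show ?thesis by (simp add: c_def)
qed

lemma Ad_eqI: "lexp D Z = g \<cdot> lexp D Y \<cdot> ginv g ==> Ad D g Y = Z" by (metis lexp_Ad lexp_inj)

lemma Ad_mult: "Ad D (g \<cdot> h) Y = Ad D g (Ad D h Y)" by (rule Ad_eqI) (simp add: lexp_Ad assoc ginv_mult)

lemma Ad_one [simp]: "Ad D gone Y = Y" by (rule Ad_eqI) simp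

lemma Ad_inv [simp]: "Ad D (ginv g) (Ad D g Y) = Y" "Ad D g (Ad D (ginv g) Y) = Y" by (simp_all flip: Ad_mult)

lemma Ad_scaleR: "Ad D g (r *R Y) = r *R Ad D g Y"
proof -
 define c where "c t = Ad D g (t *R Y)" for t :: real
 have "EX v. (c has_vector_derivative v) (at 0)"
 proof -
  have "c t = bch (bch (llog D g) (t *R Y)) (- llog D g)" for t unfolding c_def by (rule Ad_eqI) (simp add: lexp_bch lexp_minus)
  then have ceq: "c = (%t. bch (bch (llog D g) (t *R Y)) (- llog D g))" by blast
  show ?thesis unfolding ceq
   by (rule exI, rule has_vector_derivative_bch[OF has_vector_derivative_bch2[OF has_vector_derivative_scaleR_id] has_vector_derivative_const])
 qed
 then obtain v where v: "(c has_vector_derivative v) (at 0)" by blast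
 have "c t = t *R v" for t
 proof (rule one_parameter_subgroup[OF _ v])
  show "lexp D (c (2 * t)) = lexp D (c t) \<cdot> lexp D (c t)" for t
   using lexp_double[of "t *R Y"] by (simp add: c_def lexp_Ad assoc)
 qed
 from this[of r] this[of 1] show ?thesis by (simp add: c_def)
qed

text \<open>\<open>Ad\<close> is homogeneous and, as a composition of \<open>bch\<close>,
  differentiable at 0. Such a map coincides with its derivative at 0.\<close>

lemma linear_Ad: "linear (Ad D g)"
proof -
 define F where "F Y = bch (bch (llog D g) Y) (- llog D g)" for Y
 have F: "F = Ad D g" by (rule ext, rule sym, rule Ad_eqI) (simp add: F_def lexp_bch lexp_minus)
 have "EX F'. (F has_derivative F') (at 0)" unfolding F_def
  by (rule exI, rule has_derivative_bch[OF has_derivative_bch[OF has_derivative_const has_derivative_ident] has_derivative_const])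
 then obtain F' where F': "(F has_derivative F') (at 0)" by blast
 have "F Y = F' Y" for Y
 proof -
  have "((%t. F (t *R Y)) has_vector_derivative F' Y) (at 0)"
  proof -
   have "(F has_derivative F') (at (0 *R Y))" using F' by simp
   from has_derivative_compose[OF has_vector_derivative_scaleR_id[unfolded has_vector_derivative_def] this]
   show ?thesis by (simp add: has_vector_derivative_def linear_scale[OF has_derivative_linear[OF F']])
  qed
  moreover have "(%t. F (t *R Y)) = (%t. t *R F Y)" by (simp add: F Ad_scaleR)
  moreover have "((%t. t *R F Y) has_vector_derivative F Y) (at 0)" by (auto intro!: derivative_eq_intros)
  ultimately show ?thesis by (simp add: vector_derivative_unique_at)
 qed
 then have "F = F'" by blast
 then show ?thesis using F' F has_derivative_linear by blast
qed

lemma Ad_minus: "Ad D g (- X) = - Ad D g X" and Ad_diff: "Ad D g (X - Y) = Ad D g X - Ad D g Y" and Ad_zero [simp]: "Ad D g 0 = 0"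
 by (simp_all add: linear_neg[OF linear_Ad] linear_diff[OF linear_Ad] linear_0[OF linear_Ad])

section \<open>The bracket and the adjoint action\<close>

lemma bilinear_br: "bilinear br" using alg by (simp add: lie_algebra_of_def)

lemmas br_simps = bilinear_ladd[OF bilinear_br] bilinear_radd[OF bilinear_br]
 bilinear_lmul[OF bilinear_br] bilinear_rmul[OF bilinear_br] bilinear_lneg[OF bilinear_br]
 bilinear_rneg[OF bilinear_br] bilinear_lzero[OF bilinear_br] bilinear_rzero[OF bilinear_br]
 bilinear_lsub[OF bilinear_br] bilinear_rsub[OF bilinear_br]

lemma br_self [simp]: "br X X = 0" using alg by (simp add: lie_algebra_of_def)

lemma br_antisym: "br X Y = - br Y X"
proof -
 have "br (X + Y) (X + Y) = br X Y + br Y X" by (simp add: br_simps del: br_self) simp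
 then show ?thesis by (simp add: eq_neg_iff_add_eq_0)
qed

lemma linear_br: "linear (br X)" using bilinear_br by (simp add: bilinear_def)

lemma bounded_linear_br: "bounded_linear (br X)" by (rule linear_conv_bounded_linear[THEN iffD1, OF linear_br])

lemma Ad_deriv_zero: "((%t. Ad D (lexp D (t *R X)) Y) has_vector_derivative br X Y) (at 0)"
 using alg by (simp add: lie_algebra_of_def)

lemma Ad_deriv: "((%t. Ad D (lexp D (t *R X)) Y) has_vector_derivative br X (Ad D (lexp D (t *R X)) Y)) (at t)"
proof -
 have "((%s. Ad D (lexp D (s *R X)) (Ad D (lexp D (t *R X)) Y)) has_vector_derivative br X (Ad D (lexp D (t *R X)) Y)) (at (t - t))"
  using Ad_deriv_zero by simp
 moreover have "Ad D (lexp D (s *R X)) (Ad D (lexp D (t *R X)) Y) = Ad D (lexp D ((s + t) *R X)) Y" for s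
  by (simp add: lexp_add_scale Ad_mult)
 ultimately have "((%s. Ad D (lexp D ((s + t) *R X)) Y) has_vector_derivative br X (Ad D (lexp D (t *R X)) Y)) (at (t - t))"
  by simp
 then have "(((%s. Ad D (lexp D ((s + t) *R X)) Y) \<circ> (%r. r - t)) has_vector_derivative 1 *R br X (Ad D (lexp D (t *R X)) Y)) (at t)"
  by (intro vector_diff_chain_at) (auto intro!: derivative_eq_intros)
 then show ?thesis by (simp add: o_def)
qed

lemma br_pow_nilpotent: "EX k. ALL X Y. (br X ^^ k) Y = 0"
proof -
 obtain k where k: "lower_central D k = {0}" using nil by (auto simp: nilpotent_def)
 have "(br X ^^ j) Y \<in> lower_central D j" for X Y j by (induction j) (auto intro: span_base)
 from this[of k] k show ?thesis by auto
qed

lemma br_pow_zero [simp]: "(br X ^^ j) 0 = 0" by (induction j) (simp_all add: br_simps)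

text \<open>With \<open>t X\<close> in place of \<open>X\<close>, both sides solve
  \<open>W' = [X, W]\<close> with initial value \<open>Y\<close>, and
  \<open>nilpotent_ode_zero\<close> applies to the difference.\<close>

lemma Ad_lexp_sum:
 assumes k: "!!Y. (br X ^^ k) Y = 0"
 shows "Ad D (lexp D X) Y = (\<Sum>i<k. (1 / fact i) *R (br X ^^ i) Y)"
proof -
 define P where "P t = (\<Sum>i<k. (t ^ i / fact i) *R (br X ^^ i) Y)" for t :: real
 have P': "(P has_vector_derivative br X (P t)) (at t)" for t
 proof (cases k)
  case 0
  then have "P = (%_. 0)" by (auto simp: P_def)
  then show ?thesis by (simp add: br_simps)
 next
  case (Suc j)
  have top: "(br X ^^ Suc j) Y = 0" using k Suc by blast
  have "P = (%t. Y + (\<Sum>i<j. (t ^ Suc i / fact (Suc i)) *R (br X ^^ Suc i) Y))"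
   unfolding P_def Suc sum.lessThan_Suc_shift by (auto simp del: funpow.simps fact_Suc power_Suc simp: funpow_0)
  moreover have "((%t. Y + (\<Sum>i<j. (t ^ Suc i / fact (Suc i)) *R (br X ^^ Suc i) Y))
    has_vector_derivative 0 + (\<Sum>i<j. (t ^ i / fact i) *R (br X ^^ Suc i) Y)) (at t)"
  proof (intro has_vector_derivative_add has_vector_derivative_const has_vector_derivative_sum)
   fix i
   have "((%t. t ^ Suc i / fact (Suc i)) has_real_derivative t ^ i / fact i) (at t)" by (rule derivative_eq_intros | simp)+
   from has_vector_derivative_scaleR[OF this has_vector_derivative_const[of "(br X ^^ Suc i) Y"]]
   show "((%t. (t ^ Suc i / fact (Suc i)) *R (br X ^^ Suc i) Y) has_vector_derivative (t ^ i / fact i) *R (br X ^^ Suc i) Y) (at t)"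
    by simp
  qed
  moreover have "br X (P t) = (\<Sum>i<j. (t ^ i / fact i) *R (br X ^^ Suc i) Y)"
   using top unfolding P_def Suc by (simp add: linear_sum[OF linear_br] br_simps)
  ultimately show ?thesis by simp
 qed
 define W where "W t = Ad D (lexp D (t *R X)) Y - P t" for t
 have "W 1 = 0"
 proof (rule nilpotent_ode_zero[OF bounded_linear_br])
  show "(W has_vector_derivative br X (W t)) (at t)" for t
   unfolding W_def[abs_def] using has_vector_derivative_diff[OF Ad_deriv P'] by (simp add: br_simps)
  show "(br X ^^ k) x = 0" for x by (rule k)
  have "P 0 = Y \<or> k = 0" by (cases k) (auto simp: P_def sum.lessThan_Suc_shift simp del: sum.lessThan_Suc)
  moreover have "k = 0 ==> Y = 0" using k[of Y] by simp
  ultimately show "W 0 = 0" by (auto simp: W_def P_def)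
 qed
 then show ?thesis by (simp add: W_def P_def)
qed

lemma Ad_lexp_exp_ad: "Ad D (lexp D X) Y = exp_ad D X Y"
proof -
 obtain k where k: "!!X Y. (br X ^^ k) Y = 0" using br_pow_nilpotent by blast
 have "(br X ^^ i) Y = 0" if "i \<notin> {..<k}" for i
 proof -
  have "(br X ^^ i) Y = (br X ^^ ((i - k) + k)) Y" using that by simp
  also have "... = (br X ^^ (i - k)) ((br X ^^ k) Y)" by (simp only: funpow_add o_apply)
  finally have "(br X ^^ i) Y = (br X ^^ (i - k)) ((br X ^^ k) Y)" .
  then show ?thesis by (simp add: k)
 qed
 then have "exp_ad D X Y = (\<Sum>i<k. (1 / fact i) *R (br X ^^ i) Y)" unfolding exp_ad_def by (intro suminf_finite) auto
 then show ?thesis using Ad_lexp_sum[OF k] by simp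
qed

text \<open>Differentiate \<open>Ad g (Ad (exp tX) Y) = Ad (exp(t Ad g X)) (Ad g Y)\<close> at
  \<open>t = 0\<close>.\<close>

lemma Ad_br: "Ad D g (br X Y) = br (Ad D g X) (Ad D g Y)"
proof -
 have "((%t. Ad D g (Ad D (lexp D (t *R X)) Y)) has_vector_derivative Ad D g (br X Y)) (at 0)"
  by (rule bounded_linear.has_vector_derivative[OF linear_conv_bounded_linear[THEN iffD1, OF linear_Ad] Ad_deriv_zero])
 moreover have "Ad D g (Ad D (lexp D (t *R X)) Y) = Ad D (lexp D (t *R Ad D g X)) (Ad D g Y)" for t
 proof -
  have "lexp D (t *R Ad D g X) = g \<cdot> lexp D (t *R X) \<cdot> ginv g" using lexp_Ad[of g "t *R X"] by (simp add: Ad_scaleR)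
  then show ?thesis by (simp flip: Ad_mult add: assoc)
 qed
 ultimately show ?thesis using vector_derivative_unique_at[OF _ Ad_deriv_zero[of "Ad D g X" "Ad D g Y"]] by auto
qed

section \<open>The centre of the Lie algebra and of the group\<close>

definition zc :: "'a set" where "zc = {Z. ALL X. br X Z = 0}"

lemma subspace_zc: "subspace zc" by (auto simp: zc_def subspace_def br_simps)

lemma Ad_zc: "Z \<in> zc ==> Ad D g Z = Z"
proof -
 assume Z: "Z \<in> zc"
 obtain k where k: "!!X Y. (br X ^^ k) Y = 0" using br_pow_nilpotent by blast
 have "Ad D (lexp D (llog D g)) Z = (\<Sum>i<k. (1 / fact i) *R (br (llog D g) ^^ i) Z)" by (rule Ad_lexp_sum[OF k])
 also have "... = Z"
 proof (cases k)
  case 0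
  then show ?thesis using k[of Z Z] by simp
 next
  case (Suc j)
  have "(br (llog D g) ^^ Suc i) Z = 0" for i using Z by (simp add: funpow_Suc_right zc_def del: funpow.simps)
  then show ?thesis unfolding Suc sum.lessThan_Suc_shift by simp
 qed
 finally show ?thesis by simp
qed

lemma center_iff: "g \<in> center D \<longleftrightarrow> llog D g \<in> zc"
proof
 assume g: "g \<in> center D"
 have "br X (llog D g) = 0" for X
 proof -
  have "Ad D (lexp D (t *R X)) (llog D g) = llog D g" for t
   by (rule Ad_eqI) (use g in \<open>simp add: center_def assoc\<close>)
  then show ?thesis using vector_derivative_unique_at[OF Ad_deriv_zero[of X "llog D g"] ] has_vector_derivative_const by simp
 qed
 then show "llog D g \<in> zc" by (simp add: zc_def)
next
 assume Z: "llog D g \<in> zc"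
 have "g \<cdot> h = h \<cdot> g" for h
 proof -
  have "h \<cdot> g \<cdot> ginv h = g" using lexp_Ad[of h "llog D g"] Ad_zc[OF Z, of h] by simp
  then have "h \<cdot> g \<cdot> ginv h \<cdot> h = g \<cdot> h" by simp
  then show ?thesis by (simp add: assoc)
 qed
 then show "g \<in> center D" by (simp add: center_def)
qed

text \<open>Because \<open>Z\<close> is central, \<open>t\<close> goes to
  \<open>bch (t Y) (t Z)\<close> satisfies the doubling relation, and its derivative at 0 is
  \<open>Y + Z\<close>.\<close>

lemma bch_zc: "Z \<in> zc ==> bch Y Z = Y + Z"
proof -
 assume Z: "Z \<in> zc"
 define c where "c t = bch (t *R Y) (t *R Z)" for t
 have comm: "lexp D (t *R Z) \<cdot> h = h \<cdot> lexp D (t *R Z)" for t h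
 proof -
  have "lexp D (t *R Z) \<in> center D" unfolding center_iff using subspace_scale[OF subspace_zc Z] by simp
  then show ?thesis by (simp add: center_def)
 qed
 have "c 1 = 1 *R (Y + Z)"
 proof (rule one_parameter_subgroup)
  fix t
  have "lexp D (c (2 * t)) = lexp D (2 *R (t *R Y)) \<cdot> lexp D (2 *R (t *R Z))" by (simp add: c_def lexp_bch)
  also have "... = lexp D (t *R Y) \<cdot> ((lexp D (t *R Y) \<cdot> lexp D (t *R Z)) \<cdot> lexp D (t *R Z))"
   unfolding lexp_double by (simp only: assoc)
  also have "... = lexp D (t *R Y) \<cdot> ((lexp D (t *R Z) \<cdot> lexp D (t *R Y)) \<cdot> lexp D (t *R Z))"
   by (simp only: comm[of t "lexp D (t *R Y)"])
  also have "... = lexp D (c t) \<cdot> lexp D (c t)" unfolding c_def lexp_bch by (simp only: assoc)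
  finally show "lexp D (c (2 * t)) = lexp D (c t) \<cdot> lexp D (c t)" .
 next
  have "(c has_vector_derivative dbch (0 *R Y, 0 *R Z) (Y, Z)) (at 0)"
   unfolding c_def[abs_def] by (rule has_vector_derivative_bch) (auto intro!: derivative_eq_intros)
  then show "(c has_vector_derivative Y + Z) (at 0)" by (simp add: dbch_zero)
 qed
 then show ?thesis by (simp add: c_def)
qed

lemma lexp_add_zc: "Z \<in> zc ==> lexp D (Y + Z) = lexp D Y \<cdot> lexp D Z" using lexp_bch[of Y Z] bch_zc[of Z Y] by simp

text \<open>Two neighbouring terms of a central series of ideals: modulo \<open>h'\<close> the
  elements of \<open>h\<close> are central. It is used for the flag and for the flag enlarged by the
  centre.\<close>

definition central_step :: "'a set => 'a set => bool" where
 "central_step h h' \<longleftrightarrow> subspace h & subspace h' & h' <= h & (ALL X. \<forall>Y\<in>h. br X Y \<in> h')"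

lemma central_step_Ad:
 assumes "central_step h h'" "V \<in> h"
 shows "Ad D g V - V \<in> h'" and "Ad D g V \<in> h"
proof -
 note h = assms(1)[unfolded central_step_def]
 obtain k where k: "!!X Y. (br X ^^ k) Y = 0" using br_pow_nilpotent by blast
 have pow: "(br X ^^ i) V \<in> h" for X i by (induction i) (use assms in \<open>auto simp: central_step_def\<close>)
 have "Ad D (lexp D (llog D g)) V = (\<Sum>i<k. (1 / fact i) *R (br (llog D g) ^^ i) V)" by (rule Ad_lexp_sum[OF k])
 moreover have "(\<Sum>i<k. (1 / fact i) *R (br (llog D g) ^^ i) V) - V \<in> h'"
 proof (cases k)
  case 0
  then show ?thesis using k[of V V] h by (simp add: subspace_0)
 next
  case (Suc j)
  show ?thesis unfolding Suc sum.lessThan_Suc_shift using h pow by (auto intro!: subspace_sum subspace_scale)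
 qed
 ultimately show "Ad D g V - V \<in> h'" by simp
 then have "(Ad D g V - V) + V \<in> h" using h assms(2) by (blast intro: subspace_add)
 then show "Ad D g V \<in> h" by simp
qed

lemma continuous_dbch2:
 assumes "continuous_on S f" "continuous_on S g"
 shows "continuous_on S (%x. dbch2 (f x) (g x) V)"
proof -
 have "continuous_on UNIV (%p. dbch p (0, V))" by (rule Ck_on_imp_continuous_on[OF Ck_dbch[of 0]])
 from continuous_on_compose2[OF this continuous_on_Pair[OF assms]] show ?thesis by (simp add: dbch2_def)
qed

text \<open>The logarithmic derivative of the exponential map at \<open>X\<close>, computed from the flow property of
 \<open>\<Phi>(t) = d/ds log(exp(-tX) exp(t(X + sV)))\<close>.\<close>

lemma dbch2_minus_step:
 assumes h: "central_step h h'" and V: "V \<in> h"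
 shows "dbch2 (- X) X V - V \<in> h'"
proof -
 define \<Phi> where "\<Phi> t = t *R dbch2 (- (t *R X)) (t *R X) V" for t :: real
 have line: "((%s. t *R (X + s *R V)) has_vector_derivative t *R V) (at 0)" for t :: real by (auto intro!: derivative_eq_intros)
 have d: "((%s. bch (- (t *R X)) (t *R (X + s *R V))) has_vector_derivative \<Phi> t) (at 0)" for t
  using has_vector_derivative_bch2[OF line[of t], of "- (t *R X)"] by (simp add: \<Phi>_def linear_scale[OF linear_dbch2])
 \<comment> \<open>\<open>exp(-(r+t)X) exp((r+t)(X+sV))\<close> is the conjugate by
   \<open>exp(-tX)\<close> of the factor for \<open>r\<close>, times the factor for
   \<open>t\<close>. The resulting cocycle identity gives the derivative
   \<open>Ad (exp(-tX)) V\<close> at every \<open>t\<close>, which equals \<open>V\<close> modulo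
   \<open>h'\<close>.\<close>
 have flow: "\<Phi> (r + t) = Ad D (lexp D (- (t *R X))) (\<Phi> r) + \<Phi> t" for r t
 proof -
  define a where "a r s = bch (- (r *R X)) (r *R (X + s *R V))" for r s
  define A where "A = Ad D (lexp D (- (t *R X)))"
  have a0: "a r 0 = 0" for r by (simp add: a_def)
  have da: "(a r has_vector_derivative \<Phi> r) (at 0)" for r using d[of r] by (simp add: a_def[abs_def])
  have eq: "a (r + t) s = bch (A (a r s)) (a t s)" for s
  proof -
   have e1: "lexp D (- ((r + t) *R X)) = lexp D (- (t *R X)) \<cdot> lexp D (- (r *R X))"
    using lexp_add_scale[of "- t" "- r" X] by (simp add: algebra_simps)
   have e2: "lexp D ((r + t) *R (X + s *R V)) = lexp D (r *R (X + s *R V)) \<cdot> lexp D (t *R (X + s *R V))"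
    by (rule lexp_add_scale)
   have "lexp D (a (r + t) s) = lexp D (bch (A (a r s)) (a t s))"
    unfolding a_def lexp_bch A_def lexp_Ad e1 e2 by (simp add: assoc flip: lexp_minus) (simp add: lexp_minus assoc)
   then show ?thesis by (simp add: lexp_inj)
  qed
  have "((%s. bch (A (a r s)) (a t s)) has_vector_derivative dbch (A (a r 0), a t 0) (A (\<Phi> r), \<Phi> t)) (at 0)"
   by (intro has_vector_derivative_bch da bounded_linear.has_vector_derivative[OF _ da])
    (simp add: A_def linear_conv_bounded_linear[symmetric] linear_Ad)
  then have "((%s. a (r + t) s) has_vector_derivative A (\<Phi> r) + \<Phi> t) (at 0)" by (simp add: eq a0 A_def dbch_zero)
  then show ?thesis using vector_derivative_unique_at[OF da[of "r + t"]] by (simp add: A_def)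
 qed
 have \<Phi>0: "(\<Phi> has_vector_derivative V) (at 0)"
 proof -
  have "continuous_on UNIV (%t::real. dbch2 (- (t *R X)) (t *R X) V)" by (intro continuous_dbch2 continuous_intros)
  then have "((%t::real. dbch2 (- (t *R X)) (t *R X) V) ---> dbch2 (- (0 *R X)) (0 *R X) V) (at 0)"
   unfolding continuous_on_def by (drule_tac bspec[of _ _ 0]) simp_all
  moreover have "dbch2 0 0 V = V" using dbch_zero[of 0 V] by (simp add: dbch2_def)
  ultimately have "((%t::real. dbch2 (- (t *R X)) (t *R X) V - V) ---> 0) (at 0)" by (simp add: LIM_zero_iff)
  then have "((%t::real. norm (dbch2 (- (t *R X)) (t *R X) V - V)) ---> 0) (at 0)" by (rule tendsto_norm_zero)
  moreover have "\<forall>\<^sub>F t in at 0. norm (dbch2 (- (t *R X)) (t *R X) V - V) = norm (\<Phi> t - t *R V) / norm t"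
   by (rule eventually_mono[OF eventually_neq_at_within[of 0]]) (simp add: \<Phi>_def scaleR_right_diff_distrib[symmetric])
  ultimately have "((%t. norm (\<Phi> t - t *R V) / norm t) ---> 0) (at 0)" by (rule Lim_transform_eventually)
  then show ?thesis unfolding has_vector_derivative_def has_derivative_at by (simp add: \<Phi>_def bounded_linear_scaleR_left)
 qed
 have d\<Phi>: "(\<Phi> has_vector_derivative Ad D (lexp D (- (t *R X))) V) (at t)" for t
 proof -
  have "((%r. Ad D (lexp D (- (t *R X))) (\<Phi> r) + \<Phi> t) has_vector_derivative Ad D (lexp D (- (t *R X))) V + 0) (at 0)"
   by (intro has_vector_derivative_add has_vector_derivative_const
     bounded_linear.has_vector_derivative[OF _ \<Phi>0])
    (simp add: linear_conv_bounded_linear[symmetric] linear_Ad)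
  then have "((%r. \<Phi> (r + t)) has_vector_derivative Ad D (lexp D (- (t *R X))) V) (at (t - t))" by (simp add: flow)
  then have "(((%r. \<Phi> (r + t)) \<circ> (%r. r - t)) has_vector_derivative 1 *R Ad D (lexp D (- (t *R X))) V) (at t)"
   by (intro vector_diff_chain_at) (auto intro!: derivative_eq_intros)
  then show ?thesis by (simp add: o_def)
 qed
 have "\<Phi> 1 - V \<in> h'"
 proof (rule subspaceI_annihilator)
  show "subspace h'" using h by (simp add: central_step_def)
  fix w assume w: "!!y. y \<in> h' ==> inner w y = 0"
  have "((%t. inner w (\<Phi> t - t *R V)) has_vector_derivative 0) (at t within UNIV)" for t
  proof -
   have "((%t. inner w (\<Phi> t - t *R V)) has_vector_derivative inner w (Ad D (lexp D (- (t *R X))) V - V)) (at t)"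
    by (intro bounded_linear.has_vector_derivative[OF bounded_linear_inner_right]
      has_vector_derivative_diff d\<Phi> has_vector_derivative_scaleR_id)
   then show ?thesis using w[OF central_step_Ad(1)[OF h V]] by simp
  qed
  then obtain c where c: "!!t. inner w (\<Phi> t - t *R V) = c"
   using has_vector_derivative_zero_constant[of UNIV "%t. inner w (\<Phi> t - t *R V)"] by auto
  from c[of 0] c[of 1] show "inner w (\<Phi> 1 - V) = 0" by (simp add: \<Phi>_def)
 qed
 then show ?thesis by (simp add: \<Phi>_def)
qed

lemma dbch2_inverse: "dbch2 X 0 (dbch2 (- X) X V) = V"
proof -
 have "((%s. X + s *R V) has_vector_derivative V) (at 0)" by (auto intro!: derivative_eq_intros)
 then have "((%s. bch X (bch (- X) (X + s *R V))) has_vector_derivative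
   dbch2 X (bch (- X) (X + 0 *R V)) (dbch2 (- X) (X + 0 *R V) V)) (at 0)" by (intro has_vector_derivative_bch2)
 moreover have "((%s. X + s *R V) has_vector_derivative V) (at 0)" by (auto intro!: derivative_eq_intros)
 ultimately show ?thesis using vector_derivative_unique_at by (simp, blast)
qed

text \<open>\<open>dbch2 X 0\<close> is a left inverse of \<open>dbch2 (- X) X\<close>. The latter
  maps \<open>h\<close> injectively into itself, hence onto by dimension, and moves vectors only
  within \<open>h'\<close>; so the same holds for the inverse.\<close>

lemma dbch2_zero_step:
 assumes h: "central_step h h'" and U: "U \<in> h"
 shows "dbch2 X 0 U - U \<in> h'"
proof -
 have sub: "subspace h" "subspace h'" "h' <= h" using h by (auto simp: central_step_def)
 define F where "F = dbch2 (- X) X"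
 have FV: "F V - V \<in> h'" if "V \<in> h" for V unfolding F_def by (rule dbch2_minus_step[OF h that])
 have Fh: "F ` h <= h"
 proof
  fix y assume "y \<in> F ` h"
  then obtain V where V: "V \<in> h" "y = F V" by auto
  have "(F V - V) + V \<in> h" using FV[OF V(1)] sub V(1) by (blast intro: subspace_add)
  then show "y \<in> h" by (simp add: V)
 qed
 have inj: "inj_on F (span h)" by (rule inj_on_inverseI[of _ "dbch2 X 0"]) (simp add: F_def dbch2_inverse)
 have "dim (F ` h) = dim h" by (rule dim_image_eq[OF _ inj]) (simp add: F_def linear_dbch2)
 moreover have "subspace (F ` h)" using sub by (intro linear_subspace_image) (simp_all add: F_def linear_dbch2)
 ultimately have "F ` h = h" using subspace_dim_equal[OF _ sub(1) Fh] by simp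
 then obtain V where V: "V \<in> h" "U = F V" using U by auto
 then have "dbch2 X 0 U = V" by (simp add: F_def dbch2_inverse)
 moreover have "- (F V - V) \<in> h'" by (rule subspace_neg[OF sub(2) FV[OF V(1)]])
 ultimately show ?thesis by (simp add: V(2))
qed

text \<open>Differentiating \<open>bch Y (bch X (s U)) = bch (bch Y X) (s U)\<close> expresses the
  derivative of a left translation at \<open>X\<close> through derivatives at 0.\<close>

lemma dbch2_step:
 assumes h: "central_step h h'" and V: "V \<in> h"
 shows "dbch2 Y X V - V \<in> h'"
proof -
 have sub: "subspace h" "subspace h'" "h' <= h" using h by (auto simp: central_step_def)
 define U where "U = dbch2 (- X) X V"
 have U: "U - V \<in> h'" unfolding U_def by (rule dbch2_minus_step[OF h V])
 then have "(U - V) + V \<in> h" using sub V by (blast intro: subspace_add)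
 then have Uh: "U \<in> h" by simp
 have line: "((%s. s *R U) has_vector_derivative U) (at 0)" by (rule has_vector_derivative_scaleR_id)
 have "((%s. bch Y (bch X (s *R U))) has_vector_derivative dbch2 Y (bch X (0 *R U)) (dbch2 X (0 *R U) U)) (at 0)"
  by (intro has_vector_derivative_bch2 line)
 moreover have "((%s. bch (bch Y X) (s *R U)) has_vector_derivative dbch2 (bch Y X) (0 *R U) U) (at 0)"
  by (intro has_vector_derivative_bch2 line)
 ultimately have "dbch2 Y X (dbch2 X 0 U) = dbch2 (bch Y X) 0 U"
  unfolding bch_assoc using vector_derivative_unique_at by (simp, blast)
 then have "dbch2 Y X V = dbch2 (bch Y X) 0 U" by (simp add: U_def dbch2_inverse)
 moreover have "(dbch2 (bch Y X) 0 U - U) + (U - V) \<in> h'" by (rule subspace_add[OF sub(2) dbch2_zero_step[OF h Uh] U])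
 ultimately show ?thesis by simp
qed

text \<open>Integrate \<open>dbch2_step\<close> along the segment from \<open>X\<close> to
  \<open>X + V\<close>. Consequently left translations are unitriangular in Jordan-Hoelder
  coordinates.\<close>

lemma bch_right_step:
 assumes h: "central_step h h'" and V: "V \<in> h"
 shows "bch Y (X + V) - bch Y X - V \<in> h'"
proof (rule subspaceI_annihilator)
 show "subspace h'" using h by (simp add: central_step_def)
 fix w assume w: "!!y. y \<in> h' ==> inner w y = 0"
 have "((%t. inner w (bch Y (X + t *R V) - t *R V)) has_vector_derivative 0) (at t within UNIV)" for t
 proof -
  have "((%s. X + s *R V) has_vector_derivative V) (at t)" by (auto intro!: derivative_eq_intros)
  then have "((%t. inner w (bch Y (X + t *R V) - t *R V)) has_vector_derivative inner w (dbch2 Y (X + t *R V) V - V)) (at t)"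
   by (intro bounded_linear.has_vector_derivative[OF bounded_linear_inner_right]
     has_vector_derivative_diff has_vector_derivative_bch2 has_vector_derivative_scaleR_id)
  then show ?thesis using w[OF dbch2_step[OF h V]] by simp
 qed
 then obtain c where c: "!!t. inner w (bch Y (X + t *R V) - t *R V) = c"
  using has_vector_derivative_zero_constant[of UNIV "%t. inner w (bch Y (X + t *R V) - t *R V)"] by auto
 from c[of 0] c[of 1] show "inner w (bch Y (X + V) - bch Y X - V) = 0" by (simp add: inner_diff_right)
qed

text \<open>Rewrite \<open>exp U exp Y\<close> as \<open>exp Y exp (Ad (exp(-Y)) U)\<close>; the
  conjugated vector differs from \<open>U\<close> by an element of \<open>h'\<close>.\<close>

lemma bch_left_step:
 assumes h: "central_step h h'" and U: "U \<in> h"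
 shows "bch U Y - Y - U \<in> h'"
proof -
 have sub: "subspace h" "subspace h'" "h' <= h" using h by (auto simp: central_step_def)
 define V where "V = Ad D (lexp D (- Y)) U"
 have V: "V - U \<in> h'" "V \<in> h" unfolding V_def by (rule central_step_Ad[OF h U])+
 have "lexp D V = ginv (lexp D Y) \<cdot> lexp D U \<cdot> lexp D Y" unfolding V_def lexp_Ad lexp_minus by simp
 then have "lexp D Y \<cdot> lexp D V = lexp D U \<cdot> lexp D Y" by (simp only: assoc cancel_simps)
 then have eq: "bch U Y = bch Y (0 + V)" unfolding bch_def by (simp only: add_0)
 have "bch Y (0 + V) - bch Y 0 - V \<in> h'" by (rule bch_right_step[OF h V(2)])
 then have "bch U Y - Y - V \<in> h'" by (simp add: eq)
 from subspace_add[OF sub(2) this V(1)] show ?thesis by simp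
qed

end

section \<open>Triangular substitutions and Haar measure\<close>

abbreviation lborel_on :: "'i set => ('i => real) measure" where
 "lborel_on I == \<Pi>\<^sub>M i\<in>I. lborel"

text \<open>Fubini with the coordinate of largest rank innermost: for fixed other coordinates it is
  merely translated. The rank is integer-valued so that the indices can be taken in either order,
  \<open>int\<close> for functionals and its negative for vectors.\<close>

lemma nn_integral_PiM_triangular:
 fixes r :: "nat => int"
 assumes "finite I" "inj_on r I" and "!!t i. t \<in> extensional I ==> i \<in> I ==> theta t i = t i + q i t"
  and "!!t. t \<in> extensional I ==> theta t \<in> extensional I"
  and "!!i. i \<in> I ==> q i \<in> borel_measurable (lborel_on I)"
  and "!!i t t'. i \<in> I ==> t \<in> extensional I ==> t' \<in> extensional I ==>
   (!!l. l \<in> I ==> r l < r i ==> t l = t' l) ==> q i t = q i t'"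
  and "f \<in> borel_measurable (lborel_on I)"
 shows "theta \<in> measurable (lborel_on I) (lborel_on I) &
  (\<integral>\<^sup>+t. f (theta t) \<partial>(lborel_on I)) = (\<integral>\<^sup>+t. f t \<partial>(lborel_on I))"
 using assms
proof (induction I arbitrary: theta q f rule: finite_ranking_induct[where f = r])
 case (empty theta q f)
 have eq: "theta t = t" if "t \<in> space (lborel_on {})" for t
 proof -
  have t: "t \<in> extensional {}" using that by (simp add: space_PiM PiE_def)
  from empty.prems(3)[OF t] t show ?thesis by simp
 qed
 have 1: "(\<integral>\<^sup>+t. f (theta t) \<partial>(lborel_on {})) = (\<integral>\<^sup>+t. f t \<partial>(lborel_on {}))"
  by (rule nn_integral_cong) (simp only: eq)
 have 2: "theta \<in> measurable (lborel_on {}) (lborel_on {})"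
  by (subst measurable_cong[OF eq]) simp_all
 show ?case by (rule conjI[OF 2 1])
next
 case (insert j J theta q f)
 show ?case
 proof (cases "j \<in> J")
  case True
  then have eq: "insert j J = J" by blast
  show ?thesis using insert.prems unfolding eq by (rule insert.IH)
 next
  case j: False
  interpret product_sigma_finite "%_::nat. lborel :: real measure" by standard
  define I where "I = insert j J"
  let ?MJ = "lborel_on J" and ?MI = "lborel_on I"
  note pr = insert.prems[folded I_def]
  have sp: "space ?MI = extensional I" "space ?MJ = extensional J" for t by (auto simp: space_PiM PiE_def)
  have theta_meas: "theta \<in> measurable ?MI ?MI"
  proof -
   have "(%t i. theta t i) \<in> measurable ?MI ?MI"
   proof (rule measurable_PiM_single')
    show "(%t. theta t i) \<in> measurable ?MI lborel" if "i \<in> I" for i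
    proof -
     have "(%t. t i + q i t) \<in> borel_measurable ?MI"
      using that pr(4)[OF that] by (intro borel_measurable_add) (auto intro: measurable_component_singleton[where M = "%_. lborel", simplified])
     then show ?thesis using pr(2)[OF _ that] by (subst measurable_cong[of _ _ "%t. t i + q i t"]) (auto simp: sp)
    qed
    show "(%t i. theta t i) \<in> space ?MI \<rightarrow> (\<Pi>\<^sub>E i\<in>I. space lborel)"
     using pr(3) by (auto simp: sp PiE_def)
   qed
   then show ?thesis by simp
  qed
  have jI: "j \<in> I" and JI: "!!i. i \<in> J ==> i \<in> I" and IJ: "!!i. i \<in> I ==> i = j \<or> i \<in> J"
   by (auto simp: I_def)
  define u where "u x y = x(j := y)" for x :: "nat => real" and y
  have u_j: "u x y j = y" and u_i: "i \<in> J ==> u x y i = x i" for x y i using j by (auto simp: u_def)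
  have u_ext: "u x y \<in> extensional I" if "x \<in> extensional J" for x y
   using that by (simp add: extensional_def I_def u_def)
  \<comment> \<open>The entry 0 at \<open>j\<close> is a placeholder, since no \<open>q i\<close>
    depends on the coordinate of largest rank.\<close>
  define thetaJ where "thetaJ x = restrict (theta (u x 0)) J" for x
  define qJ where "qJ i x = q i (u x 0)" for i x
  have e_meas: "(%x. u x 0) \<in> measurable ?MJ ?MI"
  proof -
   have "(%x i. u x 0 i) \<in> measurable ?MJ ?MI"
   proof (rule measurable_PiM_single')
    show "(%x. u x 0 i) \<in> measurable ?MJ lborel" if "i \<in> I" for i using IJ[OF that]
    proof
     assume "i \<in> J"
     then show ?thesis using measurable_component_singleton[of i J "%_. lborel :: real measure"] by (simp add: u_i)
    qed (simp add: u_j)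
    show "(%x i. u x 0 i) \<in> space ?MJ \<rightarrow> (\<Pi>\<^sub>E i\<in>I. space lborel)"
     using u_ext by (auto simp: sp PiE_def)
   qed
   then show ?thesis by simp
  qed
  have rj: "r i < r j" if "i \<in> J" for i
   using insert.hyps(2)[OF that] pr(1) that j by (auto simp: I_def inj_on_def order_less_le)
  have qu: "q i (u x y) = q i (u x 0)" if "i \<in> I" "x \<in> extensional J" for i x y
  proof (rule pr(5)[OF that(1) u_ext[OF that(2)] u_ext[OF that(2)]])
   fix l assume l: "l \<in> I" "r l < r i"
   have "l ~= j" using IJ[OF that(1)] l(2) rj[of i] by auto
   then show "u x y l = u x 0 l" using IJ[OF l(1)] by (simp add: u_i)
  qed
  \<comment> \<open>Separating off the coordinate \<open>j\<close>, the map is \<open>thetaJ\<close>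
    on the others together with a translation of \<open>y\<close> by an amount depending on
    \<open>x\<close> alone.\<close>
  have split: "theta (u x y) = u (thetaJ x) (y + q j (u x 0))" if x: "x \<in> extensional J" for x y
  proof
   fix i
   consider "i = j" | "i \<in> J" | "i \<notin> I" using IJ by blast
   then show "theta (u x y) i = u (thetaJ x) (y + q j (u x 0)) i"
   proof cases
    case 1
    have "theta (u x y) j = u x y j + q j (u x y)" by (rule pr(2)[OF u_ext[OF x] jI])
    then show ?thesis unfolding 1 u_j qu[OF jI x, of y] .
   next
    case 2
    have a: "theta (u x z) i = x i + q i (u x z)" for z using pr(2)[OF u_ext[OF x] JI[OF 2], of z] u_i[OF 2] by simp
    have "u (thetaJ x) (y + q j (u x 0)) i = theta (u x 0) i" using 2 by (simp add: u_i thetaJ_def)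
    then show ?thesis using a[of y] a[of 0] qu[OF JI[OF 2] x, of y] by simp
   next
    case 3
    have "thetaJ x \<in> extensional J" by (simp add: thetaJ_def)
    then show ?thesis using pr(3)[OF u_ext[OF x]] u_ext[of "thetaJ x"] 3 by (simp add: extensional_def)
   qed
  qed
  have IH: "thetaJ \<in> measurable ?MJ ?MJ & (\<integral>\<^sup>+x. g (thetaJ x) \<partial>?MJ) = (\<integral>\<^sup>+x. g x \<partial>?MJ)"
   if g: "g \<in> borel_measurable ?MJ" for g
  proof (rule insert.IH[of thetaJ qJ])
   show "inj_on r J" using pr(1) by (auto simp: I_def)
   show "thetaJ t i = t i + qJ i t" if "t \<in> extensional J" "i \<in> J" for t i
    using pr(2)[OF u_ext[OF that(1)] JI[OF that(2)]] that by (simp add: thetaJ_def qJ_def u_i)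
   show "qJ i \<in> borel_measurable ?MJ" if "i \<in> J" for i
    unfolding qJ_def[abs_def] by (rule measurable_compose[OF e_meas pr(4)[OF JI[OF that]]])
   show "qJ i t = qJ i t'" if h: "i \<in> J" "t \<in> extensional J" "t' \<in> extensional J"
    "!!l. l \<in> J ==> r l < r i ==> t l = t' l" for i t t' unfolding qJ_def
   proof (rule pr(5)[OF JI[OF h(1)] u_ext[OF h(2)] u_ext[OF h(3)]])
    fix l assume "l \<in> I" "r l < r i"
    then show "u t 0 l = u t' 0 l" using IJ[of l] h(4)[of l] by (auto simp: u_j u_i)
   qed
   show "thetaJ t \<in> extensional J" if "t \<in> extensional J" for t by (simp add: thetaJ_def)
  qed (rule g)
  have upd: "(%(x, y). u x y) \<in> measurable (?MJ \<Otimes>\<^sub>M lborel) ?MI"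
   unfolding u_def using measurable_add_dim[of j J "%_. lborel :: real measure"] by (simp only: I_def)
  define h where "h x = (\<integral>\<^sup>+y. f (u x y) \<partial>lborel)" for x
  have f_upd: "(%(x, y). f (u x y)) \<in> borel_measurable (?MJ \<Otimes>\<^sub>M lborel)"
   using measurable_compose[OF upd pr(6)] by (simp add: case_prod_unfold)
  have h_meas: "h \<in> borel_measurable ?MJ" unfolding h_def[abs_def] using f_upd by (rule lborel.borel_measurable_nn_integral)
  have "(\<integral>\<^sup>+t. f (theta t) \<partial>?MI) = (\<integral>\<^sup>+x. (\<integral>\<^sup>+y. f (theta (u x y)) \<partial>lborel) \<partial>?MJ)"
   unfolding I_def u_def using insert.hyps(1) j measurable_compose[OF theta_meas pr(6)]
   by (intro product_nn_integral_insert) (auto simp: I_def)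
  also have "... = (\<integral>\<^sup>+x. h (thetaJ x) \<partial>?MJ)"
  proof (rule nn_integral_cong)
   fix x assume x: "x \<in> space ?MJ"
   have sJ: "thetaJ x \<in> space ?MJ" by (simp add: thetaJ_def sp)
   have m: "(%y. f (u (thetaJ x) y)) \<in> borel_measurable borel" using measurable_Pair2[OF f_upd sJ] by simp
   have "(\<integral>\<^sup>+y. f (theta (u x y)) \<partial>lborel) = (\<integral>\<^sup>+y. f (u (thetaJ x) (q j (u x 0) + 1 * y)) \<partial>lborel)"
    using x by (simp add: split sp add.commute)
   also have "... = h (thetaJ x)" unfolding h_def using nn_integral_real_affine[OF m, of 1 "q j (u x 0)"] by simp
   finally show "(\<integral>\<^sup>+y. f (theta (u x y)) \<partial>lborel) = h (thetaJ x)" .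
  qed
  also have "... = (\<integral>\<^sup>+x. h x \<partial>?MJ)" using IH[OF h_meas] by simp
  also have "... = (\<integral>\<^sup>+t. f t \<partial>?MI)" unfolding I_def h_def u_def using insert.hyps(1) j pr(6)
   by (intro product_nn_integral_insert[symmetric]) (auto simp: I_def)
  finally show ?thesis using theta_meas by (simp add: I_def)
 qed
qed

lemma distr_PiM_triangular:
 fixes r :: "nat => int"
 assumes "finite I" "inj_on r I" and "!!t i. t \<in> extensional I ==> i \<in> I ==> theta t i = t i + q i t"
  and "!!t. t \<in> extensional I ==> theta t \<in> extensional I"
  and "!!i. i \<in> I ==> q i \<in> borel_measurable (lborel_on I)"
  and "!!i t t'. i \<in> I ==> t \<in> extensional I ==> t' \<in> extensional I ==>
   (!!l. l \<in> I ==> r l < r i ==> t l = t' l) ==> q i t = q i t'"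
 shows "theta \<in> measurable (lborel_on I) (lborel_on I)"
  and "distr (lborel_on I) (lborel_on I) theta = (lborel_on I)"
proof -
 let ?M = "lborel_on I"
 have *: "theta \<in> measurable ?M ?M & (\<integral>\<^sup>+t. f (theta t) \<partial>?M) = (\<integral>\<^sup>+t. f t \<partial>?M)"
  if "f \<in> borel_measurable ?M" for f by (rule nn_integral_PiM_triangular[where r = r and q = q]) (fact assms that)+
 show m: "theta \<in> measurable ?M ?M" by (rule *[THEN conjunct1, of "%_. 0"]) simp
 show "distr ?M ?M theta = ?M"
 proof (rule measure_eqI)
  fix A assume "A \<in> sets (distr ?M ?M theta)"
  then have A: "A \<in> sets ?M" by simp
  have "emeasure (distr ?M ?M theta) A = (\<integral>\<^sup>+t. indicator A t \<partial>distr ?M ?M theta)" using A by simp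
  also have "... = (\<integral>\<^sup>+t. indicator A (theta t) \<partial>?M)" using A m by (intro nn_integral_distr) auto
  also have "... = (\<integral>\<^sup>+t. indicator A t \<partial>?M)" using A by (intro *[THEN conjunct2]) auto
  also have "... = emeasure ?M A" using A by simp
  finally show "emeasure (distr ?M ?M theta) A = emeasure ?M A" .
 qed simp
qed

declare One_nat_def [simp del]

section \<open>Jordan-Hoelder coordinates and Haar measure\<close>

locale jh_lie_group = nilpotent_lie_group D
 for D :: "('g::{t2_space, second_countable_topology}, 'a::euclidean_space, 'h::chilbert_space) kdata" +
 assumes jh: "jordan_hoelder D"
begin

lemma flag_zero: "flag D 0 = {0}" and flag_top: "flag D DIM('a) = UNIV" and subspace_flag: "j <= DIM('a) ==> subspace (flag D j)"
 using jh by (auto simp: jordan_hoelder_def)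

lemma flag_step: "j \<in> {1..DIM('a)} ==> central_step (flag D j) (flag D (j - 1))"
 using jh by (auto simp: jordan_hoelder_def central_step_def)

lemma jh_in: "j \<in> {1..DIM('a)} ==> jh D j \<in> flag D j" and jh_notin: "j \<in> {1..DIM('a)} ==> jh D j \<notin> flag D (j - 1)"
 using jh by (auto simp: jordan_hoelder_def)

lemma flag_decompose:
 assumes j: "j \<in> {1..DIM('a)}" and Y: "Y \<in> flag D j"
 shows "EX k. Y - k *R jh D j \<in> flag D (j - 1)"
proof -
 have sub: "subspace (flag D (j - 1))" "subspace (flag D j)" using j by (auto intro: subspace_flag)
 have incl: "flag D (j - 1) <= flag D j" and dim: "dim (flag D j) = Suc (dim (flag D (j - 1)))"
  using jh j by (auto simp: jordan_hoelder_def)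
 have "span (insert (jh D j) (flag D (j - 1))) <= flag D j" using incl jh_in[OF j] sub(2) by (intro span_minimal) auto
 moreover have "dim (span (insert (jh D j) (flag D (j - 1)))) = dim (flag D j)"
  unfolding dim_span dim using dim_insert[of "jh D j" "flag D (j - 1)"] jh_notin[OF j] sub(1)
  by (simp add: span_eq_iff[THEN iffD2])
 ultimately have "span (insert (jh D j) (flag D (j - 1))) = flag D j" using sub(2) by (intro subspace_dim_equal) auto
 then have "Y \<in> span (insert (jh D j) (flag D (j - 1)))" using Y by simp
 then obtain k where "Y - k *R jh D j \<in> span (flag D (j - 1))" by (auto simp: span_breakdown_eq)
 then show ?thesis using sub(1) by (auto simp: span_eq_iff[THEN iffD2])
qed

lemma jh_basis_flag:
 "j <= DIM('a) ==> inj_on (jh D) {1..j} & independent (jh D ` {1..j}) & span (jh D ` {1..j}) = flag D j"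
proof (induction j)
 case 0
 then show ?case by (simp add: flag_zero independent_empty)
next
 case (Suc j)
 then have IH: "inj_on (jh D) {1..j}" "independent (jh D ` {1..j})" "span (jh D ` {1..j}) = flag D j" by auto
 have j: "Suc j \<in> {1..DIM('a)}" using Suc.prems by simp
 have nin: "jh D (Suc j) \<notin> span (jh D ` {1..j})" using jh_notin[OF j] IH(3) by simp
 have eq: "{1..Suc j} = insert (Suc j) {1..j}" by auto
 have "inj_on (jh D) {1..Suc j}"
  unfolding eq using IH(1) nin span_base[of "jh D (Suc j)" "jh D ` {1..j}"] by (auto simp: inj_on_insert)
 moreover have "independent (jh D ` {1..Suc j})" unfolding eq image_insert using IH(2) nin by (rule independent_insertI[rotated])
 moreover have "span (jh D ` {1..Suc j}) = flag D (Suc j)"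
 proof
  show "span (jh D ` {1..Suc j}) <= flag D (Suc j)"
  proof (rule span_minimal)
   have "jh D ` {1..j} <= flag D (Suc j)"
    using flag_step[OF j] IH(3) span_superset[of "jh D ` {1..j}"] by (auto simp: central_step_def)
   then show "jh D ` {1..Suc j} <= flag D (Suc j)" unfolding eq using jh_in[OF j] by auto
  qed (use Suc.prems subspace_flag in auto)
  show "flag D (Suc j) <= span (jh D ` {1..Suc j})"
  proof
   fix Y assume "Y \<in> flag D (Suc j)"
   then obtain k where "Y - k *R jh D (Suc j) \<in> flag D j" using flag_decompose[OF j] by auto
   then have "Y - k *R jh D (Suc j) \<in> span (jh D ` {1..j})" using IH(3) by simp
   then show "Y \<in> span (jh D ` {1..Suc j})" unfolding eq image_insert span_breakdown_eq by blast
  qed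
 qed
 ultimately show ?case by blast
qed

lemma inj_jh: "inj_on (jh D) {1..DIM('a)}" and independent_jh: "independent (jh D ` {1..DIM('a)})"
 and span_jh: "span (jh D ` {1..DIM('a)}) = UNIV" using jh_basis_flag[of "DIM('a)"] flag_top by auto

lemma flag_span: "j <= DIM('a) ==> flag D j = span (jh D ` {1..j})" using jh_basis_flag by blast

definition crd :: "nat => 'a => real" where
 "crd j v = representation (jh D ` {1..DIM('a)}) v (jh D j)"

definition jsum :: "(nat => real) => 'a" where
 "jsum t = (\<Sum>j\<in>{1..DIM('a)}. t j *R jh D j)"

lemma linear_crd: "linear (crd j)" by (rule linearI)
  (simp_all add: crd_def representation_add[OF independent_jh] representation_scale[OF independent_jh] span_jh)

lemma crd_jh:
 assumes "i \<in> {1..DIM('a)}" "j \<in> {1..DIM('a)}"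
 shows "crd i (jh D j) = (if i = j then 1 else 0)"
proof -
 have "representation (jh D ` {1..DIM('a)}) (jh D j) = (%v. if v = jh D j then 1 else 0)"
  by (rule representation_basis[OF independent_jh]) (use assms in blast)
 moreover have "jh D i = jh D j \<longleftrightarrow> i = j" using inj_jh assms by (simp add: inj_on_eq_iff)
 ultimately show ?thesis by (simp add: crd_def)
qed

lemma crd_jsum: "i \<in> {1..DIM('a)} ==> crd i (jsum t) = t i"
 unfolding jsum_def by (simp add: linear_sum[OF linear_crd] linear_scale[OF linear_crd] crd_jh if_distrib cong: if_cong)

lemma jsum_crd: "jsum (%j. crd j v) = v"
proof -
 have "(\<Sum>b\<in>jh D ` {1..DIM('a)}. representation (jh D ` {1..DIM('a)}) v b *R b) = v"
  by (rule sum_representation_eq) (auto simp: independent_jh span_jh)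
 then show ?thesis by (simp add: jsum_def crd_def sum.reindex[OF inj_jh] o_def)
qed

lemma crd_flag: "i \<in> {1..DIM('a)} ==> j < i ==> v \<in> flag D j ==> crd i v = 0"
proof -
 assume i: "i \<in> {1..DIM('a)}" "j < i" and v: "v \<in> flag D j"
 have "span (jh D ` {1..j}) <= {v. crd i v = 0}"
 proof (rule span_minimal)
  show "subspace {v. crd i v = 0}" by (rule linear_subspace_kernel[OF linear_crd])
 qed (use i in \<open>auto simp: crd_jh\<close>)
 then show ?thesis using v i flag_span[of j] by auto
qed

lemma flag_crdI: "j <= DIM('a) ==> (!!i. i \<in> {1..DIM('a)} ==> j < i ==> crd i v = 0) ==> v \<in> flag D j"
proof -
 assume j: "j <= DIM('a)" and z: "!!i. i \<in> {1..DIM('a)} ==> j < i ==> crd i v = 0"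
 have "v = (\<Sum>i\<in>{1..DIM('a)}. crd i v *R jh D i)" using jsum_crd[of v] by (simp add: jsum_def)
 also have "... \<in> flag D j"
 proof (rule subspace_sum[OF subspace_flag[OF j]])
  fix i assume i: "i \<in> {1..DIM('a)}"
  show "crd i v *R jh D i \<in> flag D j"
  proof (cases "i <= j")
   case True
   then have "jh D i \<in> span (jh D ` {1..j})" using i by (intro span_base) auto
   then show ?thesis using flag_span[OF j] subspace_flag[OF j] by (auto intro: subspace_scale)
  next
   case False
   then show ?thesis using z[OF i] subspace_flag[OF j] by (simp add: subspace_0)
  qed
 qed
 finally show ?thesis .
qed

lemma jsum_measurable: "jsum \<in> borel_measurable (lborel_on {1..DIM('a)})" unfolding jsum_def[abs_def]
 by (intro borel_measurable_sum borel_measurable_scaleR measurable_const)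
  (auto intro: measurable_component_singleton[where M = "%_. lborel", simplified])

text \<open>Lebesgue measure in the Jordan-Hoelder coordinates; \<open>haar_left_invariant\<close>
  shows that it is a left Haar measure transported by the logarithm.\<close>

definition haar :: "'a measure" where
 "haar = distr (lborel_on {1..DIM('a)}) borel jsum"

lemma sets_haar [simp]: "sets haar = sets borel" and space_haar [simp]: "space haar = UNIV" by (auto simp: haar_def)

text \<open>The difference \<open>y - x\<close> lies in \<open>flag D i\<close>, and
  \<open>bch_right_step\<close> adds it to the product modulo \<open>flag D (i - 1)\<close>, where
  the coordinate \<open>i\<close> vanishes.\<close>

lemma bch_crd_dep:
 assumes i: "i \<in> {1..DIM('a)}" and eq: "!!l. l \<in> {1..DIM('a)} ==> i < l ==> crd l x = crd l y"
 shows "crd i (bch Y x) - crd i x = crd i (bch Y y) - crd i y"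
proof -
 have "y - x \<in> flag D i" using i eq by (intro flag_crdI) (auto simp: linear_diff[OF linear_crd])
 then have "bch Y (x + (y - x)) - bch Y x - (y - x) \<in> flag D (i - 1)" by (rule bch_right_step[OF flag_step[OF i]])
 moreover have "i - 1 < i" using i by auto
 ultimately have "crd i (bch Y (x + (y - x)) - bch Y x - (y - x)) = 0" using crd_flag[OF i] by blast
 then show ?thesis by (simp add: linear_diff[OF linear_crd])
qed

lemma continuous_bch:
 assumes "continuous_on S f" "continuous_on S g"
 shows "continuous_on S (%x. bch (f x) (g x))"
 using continuous_on_compose2[OF Ck_on_imp_continuous_on[OF smooth_bch[of 0]] continuous_on_Pair[OF assms] subset_UNIV] by simp

lemma continuous_crd: "continuous_on S f ==> continuous_on S (%x. crd j (f x))"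
 by (rule bounded_linear.continuous_on[OF linear_conv_bounded_linear[THEN iffD1, OF linear_crd]])

lemma haar_left_invariant: "distr haar borel (bch Y) = haar"
proof -
 let ?M = "lborel_on {1..DIM('a)}"
 define q where "q i t = crd i (bch Y (jsum t)) - t i" for i t
 define theta where "theta t = (\<lambda>i\<in>{1..DIM('a)}. crd i (bch Y (jsum t)))" for t
 have bch_meas: "bch Y \<in> borel_measurable borel" by (intro borel_measurable_continuous_onI continuous_bch continuous_intros)
 have crd_meas: "crd i \<in> borel_measurable borel" for i
  by (intro borel_measurable_continuous_onI continuous_crd continuous_intros)
 \<comment> \<open>Negative ranks, because coordinate \<open>i\<close> is shifted by a function of
   the coordinates with larger index.\<close>
 have "inj_on (%i. - int i) {1..DIM('a)}" by (auto simp: inj_on_def)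
 moreover have "q i \<in> borel_measurable ?M" if "i \<in> {1..DIM('a)}" for i unfolding q_def[abs_def]
  by (intro borel_measurable_diff measurable_compose[OF measurable_compose[OF jsum_measurable bch_meas] crd_meas])
   (use that in \<open>auto intro: measurable_component_singleton[where M = "%_. lborel", simplified]\<close>)
 moreover have "q i t = q i t'" if i: "i \<in> {1..DIM('a)}"
  and tt: "!!l. l \<in> {1..DIM('a)} ==> - int l < - int i ==> t l = t' l" for i t t'
 proof -
  have "crd i (bch Y (jsum t)) - crd i (jsum t) = crd i (bch Y (jsum t')) - crd i (jsum t')"
  proof (rule bch_crd_dep[OF i])
   fix l assume l: "l \<in> {1..DIM('a)}" "i < l"
   show "crd l (jsum t) = crd l (jsum t')" unfolding crd_jsum[OF l(1)] using l by (intro tt) auto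
  qed
  then show ?thesis unfolding q_def crd_jsum[OF i] .
 qed
 moreover have "theta t i = t i + q i t" if "i \<in> {1..DIM('a)}" for t i using that by (simp add: theta_def q_def)
 moreover have "theta t \<in> extensional {1..DIM('a)}" for t by (simp add: theta_def)
 ultimately have inv: "theta \<in> measurable ?M ?M" "distr ?M ?M theta = ?M"
  using distr_PiM_triangular[of "{1..DIM('a)}" "%i. - int i" theta q] by blast+
 have "jsum (theta t) = bch Y (jsum t)" for t
 proof -
  have "jsum (theta t) = jsum (%j. crd j (bch Y (jsum t)))" by (simp add: jsum_def theta_def)
  then show ?thesis by (simp add: jsum_crd)
 qed
 then have "distr ?M borel (%t. bch Y (jsum t)) = distr ?M borel (jsum \<circ> theta)" by (simp add: o_def)
 also have "... = distr (distr ?M ?M theta) borel jsum" by (rule distr_distr[symmetric]) (simp_all add: jsum_measurable inv)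
 finally show ?thesis unfolding haar_def inv(2) using distr_distr[OF bch_meas jsum_measurable] by (simp add: o_def)
qed

lemma haar_bounded_finite:
 assumes "bounded A" "A \<in> sets borel"
 shows "emeasure haar A < \<infinity>"
proof -
 interpret product_sigma_finite "%_::nat. lborel :: real measure" by standard
 obtain B where B: "!!x. x \<in> A ==> norm x <= B" using assms(1) by (auto simp: bounded_iff)
 have "ALL i. EX B. ALL x. \<bar>crd i x\<bar> <= B * norm x" using linear_bounded[OF linear_crd] by simp
 from choice[OF this] obtain K where K: "!!i x. \<bar>crd i x\<bar> <= K i * norm x" by blast
 define C where "C i = \<bar>K i\<bar> * \<bar>B\<bar>" for i
 have "emeasure haar A = emeasure (lborel_on {1..DIM('a)}) (jsum -` A \<inter> space (lborel_on {1..DIM('a)}))"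
  unfolding haar_def using assms(2) by (intro emeasure_distr jsum_measurable) auto
 also have "... <= emeasure (lborel_on {1..DIM('a)}) (\<Pi>\<^sub>E i\<in>{1..DIM('a)}. {- C i..C i})"
 proof (rule emeasure_mono)
  show "jsum -` A \<inter> space (lborel_on {1..DIM('a)}) <= (\<Pi>\<^sub>E i\<in>{1..DIM('a)}. {- C i..C i})"
  proof
   fix t assume t: "t \<in> jsum -` A \<inter> space (lborel_on {1..DIM('a)})"
   have "t i \<in> {- C i..C i}" if i: "i \<in> {1..DIM('a)}" for i
   proof -
    have "\<bar>t i\<bar> <= K i * norm (jsum t)" using K[of i "jsum t"] by (simp add: crd_jsum[OF i])
    also have "... <= C i" unfolding C_def using B[of "jsum t"] t by (intro mult_mono) auto
    finally show ?thesis by (simp add: abs_le_iff)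
   qed
   then show "t \<in> (\<Pi>\<^sub>E i\<in>{1..DIM('a)}. {- C i..C i})" using t by (auto simp: space_PiM PiE_def)
  qed
 qed (intro sets_PiM_I_finite, auto)
 also have "... = (\<Prod>i\<in>{1..DIM('a)}. emeasure lborel {- C i..C i})" by (rule emeasure_PiM) auto
 also have "... = (\<Prod>i\<in>{1..DIM('a)}. ennreal (2 * C i))" by (intro prod.cong) (simp_all add: C_def)
 also have "... = ennreal (\<Prod>i\<in>{1..DIM('a)}. 2 * C i)" by (rule prod_ennreal) (simp add: C_def)
 also have "... < \<infinity>" by simp
 finally show ?thesis .
qed

lemma haar_ball_pos:
 assumes "0 < e"
 shows "emeasure haar (ball 0 e) > 0"
proof -
 interpret product_sigma_finite "%_::nat. lborel :: real measure" by standard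
 define S where "S = (\<Sum>i\<in>{1..DIM('a)}. norm (jh D i)) + 1"
 have S: "S > 0" unfolding S_def by (intro add_nonneg_pos sum_nonneg) auto
 define d where "d = e / S"
 have d: "d > 0" using S assms by (simp add: d_def)
 have "0 < ennreal (\<Prod>i\<in>{1..DIM('a)}. 2 * d)" using d by (simp del: prod_constant add: prod_pos)
 also have "... = (\<Prod>i\<in>{1..DIM('a)}. ennreal (2 * d))" using d by (intro prod_ennreal[symmetric]) simp
 also have "... = (\<Prod>i\<in>{1..DIM('a)}. emeasure lborel {- d<..<d})" using d by (intro prod.cong) simp_all
 also have "... = emeasure (lborel_on {1..DIM('a)}) (\<Pi>\<^sub>E i\<in>{1..DIM('a)}. {- d<..<d})"
  by (rule emeasure_PiM[symmetric]) auto
 also have "... <= emeasure (lborel_on {1..DIM('a)}) (jsum -` ball 0 e \<inter> space (lborel_on {1..DIM('a)}))"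
 proof (rule emeasure_mono)
  show "(\<Pi>\<^sub>E i\<in>{1..DIM('a)}. {- d<..<d}) <= jsum -` ball 0 e \<inter> space (lborel_on {1..DIM('a)})"
  proof
   fix t assume t: "t \<in> (\<Pi>\<^sub>E i\<in>{1..DIM('a)}. {- d<..<d})"
   have "norm (jsum t) <= (\<Sum>i\<in>{1..DIM('a)}. \<bar>t i\<bar> * norm (jh D i))"
    unfolding jsum_def by (rule order_trans[OF norm_sum]) simp
   also have "... <= (\<Sum>i\<in>{1..DIM('a)}. d * norm (jh D i))"
    using t by (intro sum_mono mult_right_mono) (auto simp: PiE_def Pi_def abs_le_iff less_imp_le minus_le_iff)
   also have "... = d * (S - 1)" by (simp add: S_def sum_distrib_left)
   also have "... < e" using d S by (simp add: d_def field_simps assms)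
   finally show "t \<in> jsum -` ball 0 e \<inter> space (lborel_on {1..DIM('a)})"
    using t by (auto simp: space_PiM PiE_def)
  qed
  show "jsum -` ball 0 e \<inter> space (lborel_on {1..DIM('a)}) \<in> sets (lborel_on {1..DIM('a)})"
   using measurable_sets[OF jsum_measurable, of "ball 0 e"] by simp
 qed
 also have "... = emeasure haar (ball 0 e)" unfolding haar_def by (intro emeasure_distr[symmetric] jsum_measurable) auto
 finally show ?thesis .
qed

end

section \<open>Smooth vectors\<close>

lemma compact_norm_bound:
 fixes f :: "'a::topological_space => 'b::real_normed_vector"
 assumes "compact K" "continuous_on K f"
 shows "EX B. \<forall>x\<in>K. norm (f x) <= B"
 using compact_imp_bounded[OF compact_continuous_image[OF assms(2,1)]] by (auto simp: bounded_iff)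

lemma max_power_has_derivative:
 assumes "2 <= j"
 shows "((%s::real. (max 0 s) ^ j) has_real_derivative real j * (max 0 s) ^ (j - 1)) (at s)"
proof -
 consider "0 < s" | "s < 0" | "s = 0" by linarith
 then show ?thesis
 proof cases
  case 1
  have "((%s::real. s ^ j) has_real_derivative real j * s ^ (j - 1)) (at s)" using DERIV_pow[of j s] by (simp add: One_nat_def)
  then have "((%s::real. (max 0 s) ^ j) has_real_derivative real j * s ^ (j - 1)) (at s)"
   by (rule has_field_derivative_transform_within_open[where S = "{0<..}"]) (use 1 in auto)
  then show ?thesis using 1 by simp
 next
  case 2
  have "((%s::real. 0) has_real_derivative 0) (at s)" by simp
  then have "((%s::real. (max 0 s) ^ j) has_real_derivative 0) (at s)"
   by (rule has_field_derivative_transform_within_open[where S = "{..<0}"]) (use 2 assms in auto)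
  then show ?thesis using 2 assms by (simp add: power_0_left)
 next
  case 3
  have "((%h::real. ((max 0 (0 + h)) ^ j - (max 0 0) ^ j) / h) ---> 0) (at 0)"
  proof (rule Lim_null_comparison)
   have j: "j = Suc (Suc (j - 2))" using assms by simp
   show "\<forall>\<^sub>F h in at 0. norm (((max 0 (0 + h)) ^ j - (max 0 0) ^ j) / h) <= \<bar>h\<bar> ^ (j - 1)"
   proof (rule eventually_mono[OF eventually_neq_at_within[of 0]])
    fix h :: real assume "h ~= 0"
    have "\<bar>max 0 h\<bar> ^ j <= \<bar>h\<bar> ^ j" by (intro power_mono) auto
    also have "... = \<bar>h\<bar> ^ (j - 1) * \<bar>h\<bar>" by (subst j, subst (2) j) simp
    finally show "norm (((max 0 (0 + h)) ^ j - (max 0 0) ^ j) / h) <= \<bar>h\<bar> ^ (j - 1)"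
     using \<open>h ~= 0\<close> assms by (simp add: abs_divide power_abs divide_le_eq power_0_left)
   qed
   have "((%h::real. \<bar>h\<bar> ^ (j - 1)) ---> \<bar>0\<bar> ^ (j - 1)) (at 0)" by (intro tendsto_intros)
   then show "((%h::real. \<bar>h\<bar> ^ (j - 1)) ---> 0) (at 0)" using assms by (simp add: power_0_left)
  qed
  then have "((%s::real. (max 0 s) ^ j) has_real_derivative 0) (at 0)" unfolding DERIV_def .
  then show ?thesis using 3 assms by (simp add: power_0_left)
 qed
qed

text \<open>The exponent \<open>j > k\<close> pays for \<open>k\<close> derivatives; the free factor
  \<open>q\<close> absorbs the polynomials produced by differentiation and lets the induction
  close.\<close>

lemma Ck_on_bump:
 fixes q :: "'a::euclidean_space => real"
 assumes "k < j" "!!k. Ck_on k UNIV q"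
 shows "Ck_on k UNIV (%x. (max 0 (c - inner x x)) ^ j * q x)" using assms
proof (induction k arbitrary: j q)
 case 0
 have "continuous_on UNIV q" using Ck_on_imp_continuous_on[OF 0(2)] .
 then show ?case by (auto intro!: continuous_intros)
next
 case (Suc k)
 define q' where "q' x = frechet_derivative q (at x)" for x
 have q': "(q has_derivative q' x) (at x)" for x
  using Ck_on_differentiable[OF Suc.prems(2)[of "Suc 0"], of x] frechet_derivative_works by (auto simp: q'_def)
 have q'k: "Ck_on k UNIV (%x. q' x v)" for k v by (rule Ck_on_SucD[OF open_UNIV Suc.prems(2) q'])
 have j: "2 <= j" "k < j - 1" "k < j" using Suc.prems(1) by auto
 show ?case
 proof (rule Ck_on_SucI[where f' = "%x v. (max 0 (c - inner x x)) ^ j * q' x v + (max 0 (c - inner x x)) ^ (j - 1) * (- (2 * real j) * inner x v * q x)"])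
  fix x :: 'a
  have "((%x. c - inner x x) has_derivative (%v. - (2 * inner x v))) (at x)"
   by (auto intro!: derivative_eq_intros simp: inner_commute)
  then have "((%x. (max 0 (c - inner x x)) ^ j) has_derivative
    (%v. (real j * (max 0 (c - inner x x)) ^ (j - 1)) * - (2 * inner x v))) (at x)"
   by (rule has_derivative_compose[OF _ max_power_has_derivative[OF j(1), unfolded has_field_derivative_def]])
  from has_derivative_mult[OF this q']
  show "((%x. (max 0 (c - inner x x)) ^ j * q x) has_derivative
    (%v. (max 0 (c - inner x x)) ^ j * q' x v + (max 0 (c - inner x x)) ^ (j - 1) * (- (2 * real j) * inner x v * q x))) (at x)"
   by (rule has_derivative_eq_rhs) (auto simp: fun_eq_iff)
 next
  fix v :: 'a
  have "Ck_on k UNIV (%x. - (2 * real j) * inner x v * q x)" for k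
   by (intro Ck_on_bounded_bilinear[OF bounded_bilinear_mult] Ck_on_const Suc.prems(2)
     Ck_on_linear bounded_linear_inner_left)
  then show "Ck_on k UNIV (%x. (max 0 (c - inner x x)) ^ j * q' x v + (max 0 (c - inner x x)) ^ (j - 1) * (- (2 * real j) * inner x v * q x))"
   using j by (intro Ck_on_add Suc.IH q'k)
 qed
qed

locale nilpotent_rep = jh_lie_group D
 for D :: "('g::{t2_space, second_countable_topology}, 'a::euclidean_space, 'h::chilbert_space) kdata" +
 assumes uni: "unitary_rep D" and irr: "irreducible_rep D"
begin

lemma rep_linear: "clinear_op (rep D g)" and rep_isometry: "cinner (rep D g u) (rep D g v) = cinner u v"
 and rep_one [simp]: "rep D gone v = v" and rep_mult: "rep D (g \<cdot> h) v = rep D g (rep D h v)"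
 and rep_continuous: "continuous_on UNIV (%g. rep D g v)" using uni by (auto simp: unitary_rep_def)

lemma rep_inv [simp]: "rep D (ginv g) (rep D g v) = v" "rep D g (rep D (ginv g) v) = v" by (simp_all flip: rep_mult)

sublocale irreducible_family "rep D"
proof
 show "clinear_op (rep D g)" for g by (rule rep_linear)
 show "cinner (rep D g u) (rep D g v) = cinner u v" for g u v by (rule rep_isometry)
 show "EX g'. ALL u. rep D g' (rep D g u) = u & rep D g (rep D g' u) = u" for g by (rule exI[of _ "ginv g"]) simp
 show "EX v::'h. v ~= 0" using irr by (simp add: irreducible_rep_def)
 show "V = {0} \<or> V = UNIV"
  if "closed V" "0 \<in> V" "!!u v. u \<in> V ==> v \<in> V ==> u + v \<in> V" "!!c v. v \<in> V ==> c *C v \<in> V"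
   "!!g v. v \<in> V ==> rep D g v \<in> V" for V
 proof -
  have "closed V & 0 \<in> V & (\<forall>u\<in>V. \<forall>v\<in>V. u + v \<in> V) & (ALL c. \<forall>v\<in>V. c *C v \<in> V) & (ALL g. \<forall>v\<in>V. rep D g v \<in> V)"
   using that by simp
  then show ?thesis by (rule irr[unfolded irreducible_rep_def, THEN conjunct2, THEN spec, THEN mp])
 qed
qed

lemma rep_zero [simp]: "rep D g 0 = 0" using U_scaleR[of g 0 0] by simp

lemma rep_cinner_inv: "cinner (rep D g u) v = cinner u (rep D (ginv g) v)" using rep_isometry[of g u "rep D (ginv g) v"] by simp

lemma lexp_continuous: "continuous_on UNIV (lexp D)" and llog_continuous: "continuous_on UNIV (llog D)"
 using expd by (auto simp: exp_diffeomorphism_def smooth_map_continuous)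

lemma rep_lexp_continuous: "continuous_on UNIV (%x. rep D (lexp D x) u)"
 by (rule continuous_on_compose2[OF rep_continuous lexp_continuous]) simp

lemma rep_lexp_commute: "rep D (lexp D X) (rep D g w) = rep D g (rep D (lexp D (Ad D (ginv g) X)) w)"
 by (simp add: lexp_Ad rep_mult)

section \<open>Smeared vectors\<close>

definition test :: "nat => ('a => real) => bool" where
 "test k psi \<longleftrightarrow> Ck_on k UNIV psi & (EX R. ALL x. R < norm x --> psi x = 0)"

lemma test_continuous: "test k psi ==> continuous_on UNIV psi" by (auto simp: test_def Ck_on_imp_continuous_on)

lemma integrable_haar:
 fixes f :: "'a => 'b::{banach, second_countable_topology}"
 assumes "continuous_on UNIV f" "!!x. R < norm x ==> f x = 0"
 shows "integrable haar f"
proof -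
 have "EX B. \<forall>x\<in>cball 0 R. norm (f x) <= B" by (intro compact_norm_bound continuous_on_subset[OF assms(1)]) auto
 then obtain B where B: "!!x. x \<in> cball 0 R ==> norm (f x) <= B" by blast
 show ?thesis
 proof (rule integrableI_bounded_set[where A = "cball 0 R" and B = B])
  show "f \<in> borel_measurable haar" unfolding haar_def using borel_measurable_continuous_onI[OF assms(1)] by simp
  show "emeasure haar (cball 0 R) < \<infinity>" by (intro haar_bounded_finite) auto
 qed (use B assms(2) in auto)
qed

text \<open>Garding's operator, the weak integral of \<open>psi(x) pi(exp x)\<close>; it regularises
  vectors as far as \<open>psi\<close> is differentiable.\<close>

definition smear :: "('a => real) => 'h => 'h" where
 "smear psi u = (SOME w. ALL v. cinner w v = (LINT x|haar. psi x *R cinner (rep D (lexp D x) u) v))"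

lemma smear_integrable: "test k psi ==> integrable haar (%x. psi x *R cinner (rep D (lexp D x) u) v)"
proof -
 assume t: "test k psi"
 then obtain R where R: "!!x. R < norm x ==> psi x = 0" by (auto simp: test_def)
 show ?thesis by (rule integrable_haar[of _ R])
   (auto intro!: continuous_intros test_continuous[OF t] rep_lexp_continuous simp: R)
qed

lemma test_abs_integrable: "test k psi ==> integrable haar (%x. \<bar>psi x\<bar>)"
proof -
 assume t: "test k psi"
 then obtain R where R: "!!x. R < norm x ==> psi x = 0" by (auto simp: test_def)
 show ?thesis by (rule integrable_haar[of _ R]) (auto intro!: continuous_intros test_continuous[OF t] simp: R)
qed

lemma smear_bound:
 assumes "test k psi"
 shows "cmod (LINT x|haar. psi x *R cinner (rep D (lexp D x) u) v) <= (LINT x|haar. \<bar>psi x\<bar>) * norm u * norm v"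
proof -
 have "cmod (LINT x|haar. psi x *R cinner (rep D (lexp D x) u) v) <= (LINT x|haar. \<bar>psi x\<bar> * (norm u * norm v))"
 proof (rule Bochner_Integration.integral_norm_bound_integral[OF smear_integrable[OF assms]])
  show "integrable haar (%x. \<bar>psi x\<bar> * (norm u * norm v))"
   by (intro integrable_mult_left test_abs_integrable[OF assms])
  show "norm (psi x *R cinner (rep D (lexp D x) u) v) <= \<bar>psi x\<bar> * (norm u * norm v)" for x
   using cmod_cinner_le[of "rep D (lexp D x) u" v] by (simp add: norm_U mult_left_mono)
 qed
 then show ?thesis by (simp add: mult.assoc)
qed

lemma cinner_smear:
 assumes t: "test k psi"
 shows "cinner (smear psi u) v = (LINT x|haar. psi x *R cinner (rep D (lexp D x) u) v)"
proof -
 have "EX w. ALL v. cinner w v = (LINT x|haar. psi x *R cinner (rep D (lexp D x) u) v)"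
 proof (rule riesz_antilinear)
  fix a b :: 'h and c
  show "(LINT x|haar. psi x *R cinner (rep D (lexp D x) u) (a + b)) =
   (LINT x|haar. psi x *R cinner (rep D (lexp D x) u) a) + (LINT x|haar. psi x *R cinner (rep D (lexp D x) u) b)"
   unfolding cinner_add_right scaleR_add_right by (intro Bochner_Integration.integral_add smear_integrable[OF t])
  show "(LINT x|haar. psi x *R cinner (rep D (lexp D x) u) (c *C a)) =
   cnj c * (LINT x|haar. psi x *R cinner (rep D (lexp D x) u) a)"
   unfolding cinner_scaleC_right mult_scaleR_right[symmetric] by (rule Bochner_Integration.integral_mult_right_zero)
  show "cmod (LINT x|haar. psi x *R cinner (rep D (lexp D x) u) a) <= (LINT x|haar. \<bar>psi x\<bar>) * norm u * norm a"
   by (rule smear_bound[OF t])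
 qed
 from someI_ex[OF this] show ?thesis unfolding smear_def by blast
qed

lemma norm_smear_le:
 assumes t: "test k psi"
 shows "norm (smear psi u) <= (LINT x|haar. \<bar>psi x\<bar>) * norm u"
proof -
 let ?w = "smear psi u"
 have "(norm ?w)^2 = cmod (cinner ?w ?w)" by (simp only: cinner_self norm_of_real) simp
 also have "... <= (LINT x|haar. \<bar>psi x\<bar>) * norm u * norm ?w" unfolding cinner_smear[OF t] by (rule smear_bound[OF t])
 finally have "norm ?w * norm ?w <= ((LINT x|haar. \<bar>psi x\<bar>) * norm u) * norm ?w" by (simp add: power2_eq_square)
 moreover have "0 <= (LINT x|haar. \<bar>psi x\<bar>) * norm u" by (simp add: integral_nonneg_AE)
 ultimately show ?thesis by (cases "norm ?w = 0") (auto simp: mult_le_cancel_right)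
qed

lemma test_diff:
 assumes "test 0 psi" "test 0 phi" shows "test 0 (%x. psi x - phi x)"
proof -
 obtain R S where "!!x. R < norm x ==> psi x = 0" "!!x. S < norm x ==> phi x = 0" using assms by (auto simp: test_def)
 then have "ALL x. max R S < norm x --> psi x - phi x = 0" by simp
 then have "EX R. ALL x. R < norm x --> psi x - phi x = 0" by (rule exI)
 moreover have "continuous_on UNIV (%x. psi x - phi x)" using assms by (intro continuous_on_diff) (auto simp: test_def)
 ultimately show ?thesis by (simp add: test_def)
qed

lemma test_lower: "test k psi ==> j <= k ==> test j psi" using Ck_on_mono by (auto simp: test_def)

lemma smear_diff:
 assumes "test 0 psi" "test 0 phi"
 shows "smear (%x. psi x - phi x) u = smear psi u - smear phi u"
proof (rule cinner_eqI)
 fix v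
 show "cinner (smear (%x. psi x - phi x) u) v = cinner (smear psi u - smear phi u) v"
  unfolding cinner_simps cinner_smear[OF assms(1)] cinner_smear[OF assms(2)] cinner_smear[OF test_diff[OF assms]]
   scaleR_left_diff_distrib
  by (intro Bochner_Integration.integral_diff smear_integrable[OF assms(1)] smear_integrable[OF assms(2)])
qed

lemma smear_scale:
 assumes "test 0 psi"
 shows "smear (%x. r * psi x) u = r *R smear psi u"
proof (rule cinner_eqI)
 fix v
 have "test 0 (%x. r * psi x)" using assms by (auto simp: test_def intro!: continuous_intros)
 moreover have "(r * psi x) *R z = of_real r * (psi x *R z)" for x and z :: complex by (simp add: scaleR_conv_of_real)
 ultimately show "cinner (smear (%x. r * psi x) u) v = cinner (r *R smear psi u) v"
  unfolding cinner_scaleR_left cinner_smear[OF assms] by (simp only: cinner_smear Bochner_Integration.integral_mult_right_zero)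
qed

text \<open>The left translate of \<open>psi\<close> by \<open>exp Y\<close>, kept as a function of
  the pair \<open>(Y, x)\<close> so that it can be differentiated in \<open>Y\<close>.\<close>

definition shift :: "('a => real) => 'a \<times> 'a => real" where
 "shift psi p = psi (bch (- fst p) (snd p))"

definition Lder :: "('a => real) => 'a => 'a => real" where
 "Lder psi Y x = frechet_derivative (shift psi) (at (0, x)) (Y, 0)"

lemma Ck_shift: "Ck_on k UNIV psi ==> Ck_on k UNIV (shift psi)"
proof -
 assume psi: "Ck_on k UNIV psi"
 have "Ck_on k UNIV (%p. bch (fst (- fst p, snd p)) (snd (- fst p, snd p)))" by (rule Ck_on_compose[OF smooth_bch])
   (intro Ck_on_Pair Ck_on_linear[OF bounded_linear_minus[OF bounded_linear_fst]]
    Ck_on_linear[OF bounded_linear_snd] UNIV_I)+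
 from Ck_on_compose[OF psi this] show ?thesis by (simp add: shift_def[abs_def])
qed

text \<open>For \<open>Y\<close> in the unit ball, the support of the translate lies in the image
  under \<open>bch\<close> of a compact product, hence in one ball.\<close>

lemma shift_support:
 assumes "test k psi"
 shows "EX R'. ALL Y x. norm Y <= 1 --> R' < norm x --> shift psi (Y, x) = 0"
proof -
 obtain R where R: "!!x. R < norm x ==> psi x = 0" using assms by (auto simp: test_def)
 have "EX B. \<forall>p\<in>cball 0 1 \<times> cball 0 R. norm (bch (fst p) (snd p)) <= B"
  by (intro compact_norm_bound continuous_on_subset[OF Ck_on_imp_continuous_on[OF smooth_bch[of 0]]] compact_Times) auto
 then obtain R' where B: "\<forall>p\<in>cball 0 1 \<times> cball 0 R. norm (bch (fst p) (snd p)) <= R'" by blast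
 have R': "norm (bch Y x) <= R'" if "norm Y <= 1" "norm x <= R" for Y x using bspec[OF B, of "(Y, x)"] that by simp
 have "shift psi (Y, x) = 0" if "norm Y <= 1" "R' < norm x" for Y x
 proof -
  have "bch Y (bch (- Y) x) = x" by simp
  then have "\<not> norm (bch (- Y) x) <= R" using R'[OF that(1), of "bch (- Y) x"] that(2) by auto
  then show ?thesis using R by (simp add: shift_def)
 qed
 then show ?thesis by blast
qed

lemma shift_derivative:
 assumes "Ck_on (Suc k) UNIV psi"
 shows "((%Y. shift psi (Y, x)) has_derivative (%V. frechet_derivative (shift psi) (at (Y, x)) (V, 0))) (at Y within S)"
proof -
 have "(shift psi has_derivative frechet_derivative (shift psi) (at (Y, x))) (at (Y, x))"
  using Ck_on_differentiable[OF Ck_shift[OF assms]] frechet_derivative_works by blast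
 moreover have "((%Y. (Y, x)) has_derivative (%V. (V, 0))) (at Y within S)"
  by (intro has_derivative_Pair has_derivative_ident has_derivative_const)
 ultimately show ?thesis by (rule has_derivative_compose[rotated])
qed

lemma test_Lder:
 assumes "test (Suc k) psi"
 shows "test k (Lder psi Y)"
proof -
 have C: "Ck_on (Suc k) UNIV psi" using assms by (simp add: test_def)
 obtain R' where R': "!!Y x. norm Y <= 1 ==> R' < norm x ==> shift psi (Y, x) = 0" using shift_support[OF assms] by blast
 have d: "(shift psi has_derivative frechet_derivative (shift psi) (at p)) (at p)" for p
  using Ck_on_differentiable[OF Ck_shift[OF C]] frechet_derivative_works by blast
 have "Ck_on k UNIV (%p. frechet_derivative (shift psi) (at p) (Y, 0))" by (rule Ck_on_SucD[OF open_UNIV Ck_shift[OF C] d])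
 moreover have "bounded_linear (%x::'a. (0::'a, x))" by (intro bounded_linear_Pair bounded_linear_zero bounded_linear_ident)
 ultimately have "Ck_on k UNIV (Lder psi Y)" unfolding Lder_def[abs_def] by (rule Ck_on_compose[OF _ Ck_on_linear]) simp
 moreover have "Lder psi Y x = 0" if "R' < norm x" for x
 proof -
  have "((%Y. shift psi (Y, x)) has_derivative (%V. 0)) (at 0)"
   by (rule has_derivative_transform_within_open[of "%_. 0" _ _ _ "ball 0 1"]) (auto simp: R' that)
  from has_derivative_unique[OF this shift_derivative[OF C, of x 0 UNIV]] show ?thesis by (simp add: Lder_def fun_eq_iff)
 qed
 ultimately show ?thesis by (auto simp: test_def)
qed

text \<open>Left invariance of Haar measure moves the translation from the operators to
  \<open>psi\<close>.\<close>

lemma rep_smear: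
 assumes "test k psi"
 shows "rep D (lexp D Y) (smear psi u) = smear (%x. shift psi (Y, x)) u" and "test 0 (%x. shift psi (Y, x))"
proof -
 obtain R where R: "!!x. R < norm x ==> psi x = 0" using assms by (auto simp: test_def)
 have "continuous_on UNIV (%x. shift psi (Y, x))"
  unfolding shift_def using continuous_on_compose2[OF test_continuous[OF assms] continuous_bch[OF continuous_on_const continuous_on_id]]
  by simp
 moreover have "EX R'. ALL x. R' < norm x --> shift psi (Y, x) = 0"
 proof -
  have "EX B. \<forall>x\<in>cball 0 R. norm (bch Y x) <= B"
   by (intro compact_norm_bound continuous_bch continuous_intros compact_cball)
  then obtain R' where B: "\<forall>x\<in>cball 0 R. norm (bch Y x) <= R'" by blast
  have R': "norm (bch Y x) <= R'" if "norm x <= R" for x using bspec[OF B, of x] that by simp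
  have "shift psi (Y, x) = 0" if "R' < norm x" for x
  proof -
   have "bch Y (bch (- Y) x) = x" by simp
   then have "\<not> norm (bch (- Y) x) <= R" using R'[of "bch (- Y) x"] that by auto
   then show ?thesis using R by (simp add: shift_def)
  qed
  then show ?thesis by blast
 qed
 ultimately show t: "test 0 (%x. shift psi (Y, x))" by (simp add: test_def)
 show "rep D (lexp D Y) (smear psi u) = smear (%x. shift psi (Y, x)) u"
 proof (rule cinner_eqI)
  fix v
  let ?f = "%x. shift psi (Y, x) *R cinner (rep D (lexp D x) u) v"
  have f: "?f \<in> borel_measurable borel" using borel_measurable_integrable[OF smear_integrable[OF t]] by (simp add: haar_def)
  have b: "bch Y \<in> measurable haar borel"
   using borel_measurable_continuous_onI[OF continuous_bch[OF continuous_on_const continuous_on_id]] by (simp add: haar_def)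
  have "cinner (rep D (lexp D Y) (smear psi u)) v = (LINT x|haar. psi x *R cinner (rep D (lexp D x) u) (rep D (lexp D (- Y)) v))"
   using rep_cinner_inv[of "lexp D Y" "smear psi u" v] by (simp add: cinner_smear[OF assms] lexp_minus)
  also have "... = (LINT x|haar. ?f (bch Y x))" by (intro Bochner_Integration.integral_cong refl)
    (simp add: shift_def lexp_bch rep_mult lexp_minus flip: rep_cinner_inv)
  also have "... = (LINT x|distr haar borel (bch Y). ?f x)" by (rule integral_distr[symmetric, OF b f])
  also have "... = cinner (smear (%x. shift psi (Y, x)) u) v" by (simp add: haar_left_invariant cinner_smear[OF t])
  finally show "cinner (rep D (lexp D Y) (smear psi u)) v = cinner (smear (%x. shift psi (Y, x)) u) v" .
 qed
qed

text \<open>By \<open>rep_smear\<close> the derivative falls on \<open>psi\<close>. The remainder is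
  at most \<open>e' * norm Y\<close> on a fixed ball and zero outside, and
  \<open>norm_smear_le\<close> turns this into a norm estimate.\<close>

lemma smear_derivative:
 assumes t: "test (Suc k) psi"
 shows "((%Y. rep D (lexp D Y) (smear psi u)) has_derivative (%Y. smear (Lder psi Y) u)) (at 0)" unfolding has_derivative_at_alt
proof (intro conjI allI impI)
 have C: "Ck_on (Suc k) UNIV psi" using t by (simp add: test_def)
 have t0: "test 0 psi" using test_lower[OF t] by simp
 have L0: "test 0 (Lder psi Y)" for Y by (rule test_lower[OF test_Lder[OF t]]) simp
 obtain R' where R': "!!Y x. norm Y <= 1 ==> R' < norm x ==> shift psi (Y, x) = 0" using shift_support[OF t] by blast
 define G' where "G' p = frechet_derivative (shift psi) (at p)" for p
 have d: "(shift psi has_derivative G' p) (at p)" for p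
  using Ck_on_differentiable[OF Ck_shift[OF C]] frechet_derivative_works unfolding G'_def by blast
 have linG: "linear (G' p)" for p using d has_derivative_linear by blast
 have L: "Lder psi Y x = G' (0, x) (Y, 0)" for Y x by (simp add: Lder_def G'_def)
 have Llin: "Lder psi (r *R Y - Z) x = r * Lder psi Y x - Lder psi Z x" for r Y Z x
 proof -
  have "(r *R Y - Z, 0) = r *R (Y, 0) - (Z, 0 :: 'a)" by simp
  then show ?thesis unfolding L by (simp only: linear_diff[OF linG] linear_scale[OF linG] real_scaleR_def)
 qed
 have sc: "smear (Lder psi (r *R Y - Z)) u = r *R smear (Lder psi Y) u - smear (Lder psi Z) u" for r Y Z
 proof -
  have "test 0 (%x. r * Lder psi Y x)" using L0[of Y] by (auto simp: test_def intro!: continuous_intros)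
  then show ?thesis unfolding Llin[abs_def] by (simp add: smear_diff L0 smear_scale)
 qed
 have s0: "smear (Lder psi 0) u = 0" using sc[of 1 0 0] by simp
 have sneg: "smear (Lder psi (- Z)) u = - smear (Lder psi Z) u" for Z using sc[of 0 0 Z] by simp
 have "linear (%Y. smear (Lder psi Y) u)"
 proof (rule linearI)
  show "smear (Lder psi (Y + Z)) u = smear (Lder psi Y) u + smear (Lder psi Z) u" for Y Z
   using sc[of 1 Y "- Z"] by (simp add: sneg)
  show "smear (Lder psi (r *R Y)) u = r *R smear (Lder psi Y) u" for r Y using sc[of r Y 0] by (simp add: s0)
 qed
 then show "bounded_linear (%Y. smear (Lder psi Y) u)" by (simp add: linear_conv_bounded_linear)
 fix e :: real assume e: "0 < e"
 define m where "m = measure haar (cball 0 R')"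
 \<comment> \<open>Scaled so that integration over the ball of radius \<open>R'\<close> leaves an
   error of at most \<open>e\<close>.\<close>
 define e' where "e' = e / (m * norm u + 1)"
 have mu: "0 < m * norm u + 1" unfolding m_def by (intro add_nonneg_pos mult_nonneg_nonneg) auto
 then have e': "0 < e'" using e by (simp add: e'_def)
 \<comment> \<open>The sum over basis directions dominates the operator norm of the difference
   between the derivatives at \<open>Y\<close> and at 0. It vanishes at \<open>Y = 0\<close>, so
   uniform continuity makes it small.\<close>
 define F where "F p = (\<Sum>b\<in>Basis. \<bar>G' p (b, 0) - G' (0, snd p) (b, 0)\<bar>)" for p :: "'a \<times> 'a"
 have cG: "continuous_on UNIV (%p. G' p v)" for v by (rule Ck_on_imp_continuous_on[OF Ck_on_SucD[OF open_UNIV Ck_shift[OF C] d]])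
 have cG0: "continuous_on UNIV (%p::'a \<times> 'a. G' (0, snd p) v)" for v
 proof -
  have "continuous_on UNIV (%p::'a \<times> 'a. (0::'a, snd p))"
   by (intro continuous_on_Pair continuous_on_const continuous_on_snd continuous_on_id)
  from continuous_on_compose2[OF cG this subset_UNIV] show ?thesis .
 qed
 have "continuous_on UNIV F" unfolding F_def[abs_def] by (intro continuous_on_sum continuous_on_rabs continuous_on_diff cG cG0)
 then have "continuous_on (cball 0 1 \<times> cball 0 R') F" by (rule continuous_on_subset) simp
 then have "uniformly_continuous_on (cball 0 1 \<times> cball 0 R') F"
  by (rule compact_uniformly_continuous) (intro compact_Times compact_cball)
 then obtain d0 where d0: "0 < d0" "!!p p'. p \<in> cball 0 1 \<times> cball 0 R' ==> p' \<in> cball 0 1 \<times> cball 0 R' ==>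
   dist p' p < d0 ==> dist (F p') (F p) < e'" unfolding uniformly_continuous_on_def using e' by blast
 define d1 where "d1 = min d0 1"
 have d1: "0 < d1" "d1 <= 1" "d1 <= d0" using d0(1) by (auto simp: d1_def)
 have Fsmall: "F (Y, x) <= e'" if "norm Y < d1" "norm x <= R'" for Y x
 proof -
  have "dist (F (Y, x)) (F (0, x)) < e'" by (rule d0(2)) (use that d1 in \<open>auto simp: dist_Pair_Pair\<close>)
  moreover have "F (0, x) = 0" by (simp add: F_def)
  ultimately show ?thesis by (simp add: dist_real_def)
 qed
 show "\<exists>da>0. ALL Y. norm (Y - 0) < da -->
   norm (rep D (lexp D Y) (smear psi u) - rep D (lexp D 0) (smear psi u) - smear (Lder psi (Y - 0)) u) <= e * norm (Y - 0)"
 proof (intro exI conjI allI impI)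
  show "0 < d1" by (rule d1)
  fix Y :: 'a assume "norm (Y - 0) < d1"
  then have Y: "norm Y < d1" by simp
  define \<Delta> where "\<Delta> x = shift psi (Y, x) - psi x - Lder psi Y x" for x
  have t\<Delta>: "test 0 \<Delta>" unfolding \<Delta>_def[abs_def] by (intro test_diff rep_smear(2)[OF t0] t0 L0)
  have eq: "rep D (lexp D Y) (smear psi u) - rep D (lexp D 0) (smear psi u) - smear (Lder psi (Y - 0)) u = smear \<Delta> u"
  proof -
   have "rep D (lexp D Y) (smear psi u) - smear psi u = smear (%x. shift psi (Y, x) - psi x) u"
    using smear_diff[OF rep_smear(2)[OF t0] t0] rep_smear(1)[OF t0] by simp
   then show ?thesis unfolding \<Delta>_def[abs_def] by (simp add: smear_diff[OF test_diff[OF rep_smear(2)[OF t0] t0] L0])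
  qed
  have bound: "\<bar>\<Delta> x\<bar> <= indicator (cball 0 R') x * (e' * norm Y)" for x
  proof (cases "norm x <= R'")
   case True
   have "norm (shift psi (Y, x) - shift psi (0, x) - (%V. G' (0, x) (V, 0)) (Y - 0)) <= norm (Y - 0) * e'"
   proof (rule differentiable_bound_linearization[where S = "ball 0 d1" and f' = "%Y V. G' (Y, x) (V, 0)"])
    show "0 + t *R (Y - 0) \<in> ball 0 d1" if "t \<in> {0..1}" for t
    proof -
     have "norm (t *R Y) <= norm Y" using that mult_left_le_one_le[of "norm Y" t] by simp
     then show ?thesis using Y by simp
    qed
    show "((%Y. shift psi (Y, x)) has_derivative (%V. G' (Z, x) (V, 0))) (at Z within ball 0 d1)" for Z
     unfolding G'_def by (rule shift_derivative[OF C])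
    show "onorm ((%V. G' (Z, x) (V, 0)) - (%V. G' (0, x) (V, 0))) <= e'" if Z: "Z \<in> ball 0 d1" for Z
    proof (rule onorm_le)
     fix V :: 'a
     define A where "A v = G' (Z, x) (v, 0) - G' (0, x) (v, 0)" for v
     have linA: "linear A"
     proof (rule linearI)
      show "A (v + w) = A v + A w" for v w using linear_add[OF linG, of _ "(v, 0)" "(w, 0)"] by (simp add: A_def)
      show "A (r *R v) = r *R A v" for r v using linear_scale[OF linG, of _ r "(v, 0)"] by (simp add: A_def algebra_simps)
     qed
     have "A V = A (\<Sum>b\<in>Basis. (V \<bullet> b) *R b)" by (simp add: euclidean_representation)
     also have "... = (\<Sum>b\<in>Basis. (V \<bullet> b) *R A b)" by (simp add: linear_sum[OF linA] linear_scale[OF linA])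
     also have "norm ... <= (\<Sum>b\<in>Basis. norm V * \<bar>A b\<bar>)"
      by (rule order_trans[OF norm_sum]) (auto intro!: sum_mono mult_right_mono simp: Basis_le_norm abs_mult)
     also have "... = F (Z, x) * norm V" by (simp add: F_def A_def sum_distrib_left mult.commute)
     also have "... <= e' * norm V" using Fsmall[of Z x] Z True by (intro mult_right_mono) auto
     finally show "norm (((%V. G' (Z, x) (V, 0)) - (%V. G' (0, x) (V, 0))) V) <= e' * norm V" by (simp add: A_def)
    qed
    show "0 \<in> ball 0 d1" using d1 by simp
   qed
   then show ?thesis using True by (simp add: \<Delta>_def L shift_def mult.commute)
  next
   case False
   have "Lder psi Y x = 0"
   proof -
    have "((%Y. shift psi (Y, x)) has_derivative (%V. 0)) (at 0)"
     by (rule has_derivative_transform_within_open[of "%_. 0" _ _ _ "ball 0 1"]) (use False R' in auto)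
    from has_derivative_unique[OF this shift_derivative[OF C, of x 0 UNIV]] show ?thesis by (simp add: Lder_def fun_eq_iff)
   qed
   moreover have "shift psi (Y, x) = 0" "shift psi (0, x) = 0" using R'[of _ x] False Y d1 by auto
   ultimately show ?thesis using False by (simp add: \<Delta>_def shift_def)
  qed
  have fin: "emeasure haar (cball 0 R') < \<infinity>" by (intro haar_bounded_finite) auto
  have "(LINT x|haar. \<bar>\<Delta> x\<bar>) <= (LINT x|haar. indicator (cball 0 R') x * (e' * norm Y))"
   using fin by (intro integral_mono test_abs_integrable[OF t\<Delta>] integrable_mult_left integrable_real_indicator bound) auto
  also have "... = m * (e' * norm Y)" by (simp add: m_def)
  finally have "(LINT x|haar. \<bar>\<Delta> x\<bar>) * norm u <= m * (e' * norm Y) * norm u" by (rule mult_right_mono) simp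
  then have "norm (smear \<Delta> u) <= (m * norm u) * (e' * norm Y)"
   using norm_smear_le[OF t\<Delta>, of u] by (simp add: mult_ac)
  also have "... <= (m * norm u + 1) * (e' * norm Y)" using e' by (intro mult_right_mono) auto
  also have "... = e * norm Y" using mu by (simp add: e'_def)
  finally show "norm (rep D (lexp D Y) (smear psi u) - rep D (lexp D 0) (smear psi u) - smear (Lder psi (Y - 0)) u) <= e * norm (Y - 0)"
   unfolding eq by simp
 qed
qed

section \<open>The derived representation\<close>

definition dpi :: "'a => 'h => 'h" where
 "dpi Y w = frechet_derivative (%X. rep D (lexp D X) w) (at 0) Y"

text \<open>The vectors of class \<open>C^k\<close>, described by repeated differentiability at the
  identity. A finite order suffices because the operators to be applied have bounded degree.\<close>

primrec Wk :: "nat => 'h set" where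
 "Wk 0 = UNIV"
| "Wk (Suc k) = {w. (%X. rep D (lexp D X) w) differentiable (at 0) & (ALL Y. dpi Y w \<in> Wk k)}"

lemma dpi_eqI: "((%X. rep D (lexp D X) w) has_derivative f) (at 0) ==> dpi Y w = f Y"
 unfolding dpi_def by (simp add: frechet_derivative_at[symmetric])

lemma dpi_derivative: "w \<in> Wk (Suc k) ==> ((%X. rep D (lexp D X) w) has_derivative (%Y. dpi Y w)) (at 0)"
 unfolding dpi_def by (simp add: frechet_derivative_works[symmetric])

lemma dpi_Wk: "w \<in> Wk (Suc k) ==> dpi Y w \<in> Wk k" by simp

lemma Wk_SucI:
 assumes "((%X. rep D (lexp D X) w) has_derivative f) (at 0)" "!!Y. f Y \<in> Wk k"
 shows "w \<in> Wk (Suc k)" using assms dpi_eqI[OF assms(1)] by (auto simp: differentiable_def)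

lemma smear_Wk: "test k psi ==> smear psi u \<in> Wk k"
proof (induction k arbitrary: psi)
 case (Suc k)
 show ?case by (rule Wk_SucI[OF smear_derivative[OF Suc.prems]]) (rule Suc.IH[OF test_Lder[OF Suc.prems]])
qed simp

text \<open>Smear \<open>u\<close> with a nonnegative bump supported where the real part of
  \<open>(pi(exp x) u | u)\<close> stays above half its value at 0; the result has positive scalar
  product with \<open>u\<close>.\<close>

lemma Wk_nontrivial: "\<exists>w\<in>Wk k. w ~= 0"
proof -
 obtain u :: 'h where u: "u ~= 0" using nontrivial by blast
 have "continuous (at 0) (%x. Re (cinner (rep D (lexp D x) u) u))"
  using continuous_on_eq_continuous_at[of UNIV "%x. Re (cinner (rep D (lexp D x) u) u)"]
  by (auto intro!: continuous_intros rep_lexp_continuous)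
 then obtain e where e: "0 < e" "!!x. dist x 0 < e ==>
   dist (Re (cinner (rep D (lexp D x) u) u)) (Re (cinner (rep D (lexp D 0) u) u)) < (norm u)^2 / 2"
  unfolding continuous_at_eps_delta using u by (metis half_gt_zero zero_less_norm_iff zero_less_power)
 have pos: "(norm u)^2 / 2 <= Re (cinner (rep D (lexp D x) u) u)" if "norm x < e" for x
  using e(2)[of x] that by (auto simp: dist_real_def cinner_self abs_if split: if_splits)
 define psi where "psi x = (max 0 (e^2 - inner x x)) ^ Suc k * 1" for x :: 'a
 have supp: "psi x = 0" if "e <= norm x" for x
 proof -
  have "e^2 <= inner x x" using that e(1) by (simp flip: power2_norm_eq_inner add: power_mono)
  then show ?thesis by (simp add: psi_def)
 qed
 have t: "test k psi" unfolding test_def psi_def[abs_def]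
  by (intro conjI Ck_on_bump Ck_on_const exI[of _ e] allI impI) (use supp in \<open>auto simp: psi_def\<close>)
 have psi0: "0 <= psi x" for x by (simp add: psi_def)
 have psipos: "0 < psi x" if "norm x < e" for x
 proof -
  have "inner x x < e^2" using that by (simp flip: power2_norm_eq_inner add: power_strict_mono)
  then show ?thesis by (simp add: psi_def)
 qed
 have intpsi: "integrable haar psi" using test_abs_integrable[OF t] by (simp add: psi0)
 have I: "0 < (LINT x|haar. psi x)"
 proof (rule ccontr)
  assume "\<not> 0 < (LINT x|haar. psi x)"
  moreover have "0 <= (LINT x|haar. psi x)" by (intro Bochner_Integration.integral_nonneg_AE AE_I2 psi0)
  ultimately have "(LINT x|haar. psi x) = 0" by simp
  then have "AE x in haar. psi x = 0" using integral_nonneg_eq_0_iff_AE[OF intpsi] psi0 by simp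
  then have "AE x in haar. x \<notin> ball 0 e" by (rule AE_mp) (rule AE_I2, use psipos in fastforce)
  then have "emeasure haar (ball 0 e) = 0" by (subst (asm) AE_iff_measurable[of "ball 0 e"]) auto
  then show False using haar_ball_pos[OF e(1)] by simp
 qed
 have J: "(LINT x|haar. psi x * ((norm u)^2 / 2)) <= (LINT x|haar. Re (psi x *R cinner (rep D (lexp D x) u) u))"
 proof (rule Bochner_Integration.integral_mono)
  show "psi x * ((norm u)^2 / 2) <= Re (psi x *R cinner (rep D (lexp D x) u) u)" for x
   using mult_left_mono[OF pos[of x] psi0[of x]] supp[of x] by (cases "norm x < e") auto
 qed (use intpsi integrable_Re[OF smear_integrable[OF t], of u u] in auto)
 have K: "(LINT x|haar. Re (psi x *R cinner (rep D (lexp D x) u) u)) = Re (cinner (smear psi u) u)"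
  unfolding cinner_smear[OF t] by (rule integral_Re[OF smear_integrable[OF t]])
 have "0 < (LINT x|haar. psi x) * ((norm u)^2 / 2)" using I u by simp
 also have "... = (LINT x|haar. psi x * ((norm u)^2 / 2))" by simp
 finally have "0 < Re (cinner (smear psi u) u)" using J unfolding K by linarith
 then have "smear psi u ~= 0" by (auto simp: cinner.zero_left)
 then show ?thesis using smear_Wk[OF t] by blast
qed

lemma Wk_antimono: "j <= k ==> Wk k <= Wk j"
proof (induction k arbitrary: j)
 case (Suc k)
 show ?case
 proof (cases j)
  case (Suc i)
  then have "Wk k <= Wk i" using Suc.prems Suc.IH by simp
  then show ?thesis unfolding Suc by auto
 qed simp
qed simp

lemma Wk_combination:
 "w \<in> Wk k ==> v \<in> Wk k ==> w + c *C v \<in> Wk k & (0 < k --> dpi Y (w + c *C v) = dpi Y w + c *C dpi Y v)"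
proof (induction k arbitrary: w v Y)
 case (Suc k)
 have "((%X. rep D (lexp D X) w + c *C rep D (lexp D X) v) has_derivative (%Y. dpi Y w + c *C dpi Y v)) (at 0)"
  by (intro has_derivative_add dpi_derivative[OF Suc.prems(1)]
    bounded_linear.has_derivative[OF bounded_linear_scaleC dpi_derivative[OF Suc.prems(2)]])
 then have d: "((%X. rep D (lexp D X) (w + c *C v)) has_derivative (%Y. dpi Y w + c *C dpi Y v)) (at 0)"
  by (simp add: U_add U_scaleC)
 have "w + c *C v \<in> Wk (Suc k)"
  by (rule Wk_SucI[OF d]) (use Suc.IH[OF dpi_Wk[OF Suc.prems(1)] dpi_Wk[OF Suc.prems(2)]] in blast)
 then show ?case using dpi_eqI[OF d] by simp
qed simp

lemma Wk_zero: "0 \<in> Wk k"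
proof -
 obtain w where "w \<in> Wk k" using Wk_nontrivial by blast
 from Wk_combination[OF this this, of "-1"] show ?thesis by (simp add: scaleC_minus_one)
qed

lemma Wk_add: "w \<in> Wk k ==> v \<in> Wk k ==> w + v \<in> Wk k" using Wk_combination[of w k v 1] by simp

lemma Wk_scaleC: "v \<in> Wk k ==> c *C v \<in> Wk k" using Wk_combination[OF Wk_zero, of v k c] by simp

lemma Wk_scaleR: "v \<in> Wk k ==> r *R v \<in> Wk k" by (simp add: scaleR_scaleC Wk_scaleC)

lemma Wk_sum: "finite I ==> (!!i. i \<in> I ==> f i \<in> Wk k) ==> (\<Sum>i\<in>I. f i) \<in> Wk k"
 by (induction I rule: finite_induct) (auto intro: Wk_zero Wk_add)

lemma dpi_combination: "w \<in> Wk (Suc k) ==> v \<in> Wk (Suc k) ==> dpi Y (w + c *C v) = dpi Y w + c *C dpi Y v"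
 using Wk_combination[of w "Suc k" v] by blast

lemma linear_dpi: "w \<in> Wk (Suc k) ==> linear (%Y. dpi Y w)" using dpi_derivative has_derivative_linear by blast

lemma rep_Wk: "w \<in> Wk k ==> rep D g w \<in> Wk k & (0 < k --> dpi Y (rep D g w) = rep D g (dpi (Ad D (ginv g) Y) w))"
proof (induction k arbitrary: w Y)
 case (Suc k)
 have blA: "bounded_linear (Ad D (ginv g))" by (simp add: linear_conv_bounded_linear[symmetric] linear_Ad)
 have "((%X. rep D (lexp D X) w) has_derivative (%Y. dpi Y w)) (at (Ad D (ginv g) 0))" using dpi_derivative[OF Suc.prems] by simp
 from has_derivative_compose[OF bounded_linear.has_derivative[OF blA has_derivative_ident] this]
 have "((%X. rep D (lexp D (Ad D (ginv g) X)) w) has_derivative (%Y. dpi (Ad D (ginv g) Y) w)) (at 0)" .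
 from bounded_linear.has_derivative[OF bounded_linear_U this, of g]
 have d: "((%X. rep D (lexp D X) (rep D g w)) has_derivative (%Y. rep D g (dpi (Ad D (ginv g) Y) w))) (at 0)"
  by (simp add: rep_lexp_commute)
 have "rep D g w \<in> Wk (Suc k)" by (rule Wk_SucI[OF d]) (use Suc.IH[OF dpi_Wk[OF Suc.prems]] in blast)
 then show ?case using dpi_eqI[OF d] by simp
qed simp

lemma dpi_curve:
 assumes "w \<in> Wk (Suc k)"
 shows "((%t. rep D (lexp D (t *R Y)) w) has_vector_derivative dpi Y w) (at 0)"
proof -
 have "((%X. rep D (lexp D X) w) has_derivative (%Y. dpi Y w)) (at (0 *R Y))" using dpi_derivative[OF assms] by simp
 from has_derivative_compose[OF has_vector_derivative_scaleR_id[unfolded has_vector_derivative_def] this]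
 show ?thesis by (simp add: has_vector_derivative_def linear_scale[OF linear_dpi[OF assms]])
qed

lemma dpi_skew:
 assumes "w \<in> Wk (Suc k)" "v \<in> Wk (Suc j)"
 shows "cinner (dpi Y w) v = - cinner w (dpi Y v)"
proof -
 have "((%t. cinner (rep D (lexp D (t *R Y)) w) (rep D (lexp D (t *R Y)) v)) has_vector_derivative
   cinner (rep D (lexp D (0 *R Y)) w) (dpi Y v) + cinner (dpi Y w) (rep D (lexp D (0 *R Y)) v)) (at 0)"
  by (intro cinner.has_vector_derivative dpi_curve[OF assms(1)] dpi_curve[OF assms(2)])
 moreover have "((%t. cinner (rep D (lexp D (t *R Y)) w) (rep D (lexp D (t *R Y)) v)) has_vector_derivative 0) (at 0)"
  by (simp add: rep_isometry)
 ultimately have "cinner w (dpi Y v) + cinner (dpi Y w) v = 0" using vector_derivative_unique_at by fastforce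
 then show ?thesis by (simp add: eq_neg_iff_add_eq_0 add.commute)
qed

lemma invariant_subspace_dense:
 assumes W: "!!u v. u \<in> W ==> v \<in> W ==> u + v \<in> W" "!!c v. v \<in> W ==> c *C v \<in> W"
  "!!g v. v \<in> W ==> rep D g v \<in> W" "e \<in> W" "e ~= 0"
 shows "closure W = UNIV"
proof -
 have "closure W = {0} \<or> closure W = UNIV"
 proof (rule irreducible)
  show "0 \<in> closure W" using W(2)[OF W(4), of 0] closure_subset by auto
  show "u + v \<in> closure W" if "u \<in> closure W" "v \<in> closure W" for u v
  proof -
   obtain a b where "!!n. a n \<in> W" "a ----> u" "!!n. b n \<in> W" "b ----> v"
    using \<open>u \<in> closure W\<close> \<open>v \<in> closure W\<close> unfolding closure_sequential by blast
   then have "ALL n. a n + b n \<in> W" "(%n. a n + b n) ----> u + v" by (auto intro: W(1) tendsto_add)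
   then show ?thesis unfolding closure_sequential by (intro exI[of _ "%n. a n + b n"] conjI)
  qed
  have lin: "T u \<in> closure W" if T: "bounded_linear T" "!!v. v \<in> W ==> T v \<in> W" and u: "u \<in> closure W" for T u
  proof -
   obtain a where "!!n. a n \<in> W" "a ----> u" using u unfolding closure_sequential by blast
   then have "ALL n. T (a n) \<in> W" "(%n. T (a n)) ----> T u" using T(2) bounded_linear.tendsto[OF T(1)] by auto
   then show ?thesis unfolding closure_sequential by (intro exI[of _ "%n. T (a n)"] conjI)
  qed
  show "c *C v \<in> closure W" if "v \<in> closure W" for c v by (rule lin[OF bounded_linear_scaleC W(2) that])
  show "rep D g v \<in> closure W" if "v \<in> closure W" for g v by (rule lin[OF bounded_linear_U W(3) that])
 qed simp
 then show ?thesis using W(4,5) closure_subset[of W] by auto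
qed

end

section \<open>Polynomial functions on the dual\<close>

lemma poly_coeffs_zero:
 fixes c :: "nat => real"
 assumes "!!s. (\<Sum>j\<le>n. c j * s ^ j) = 0" "j <= n"
 shows "c j = 0" using assms polyfun_eq_0[of c n] by auto

text \<open>Replacing \<open>s\<close> by \<open>2 s\<close> and subtracting \<open>2^(n+1)\<close>
  times the original cancels the top coefficient and multiplies the others by nonzero numbers, so
  induction on the degree extracts each of them.\<close>

lemma coeffs_in_subspace:
 fixes v :: "nat => 'x => real" and S :: "('x => real) set"
 assumes add: "!!p q. p \<in> S ==> q \<in> S ==> (%x. p x + q x) \<in> S"
  and scale: "!!c p. p \<in> S ==> (%x. c * p x) \<in> S"
  and mem: "!!s::real. (%x. \<Sum>j\<le>n. s ^ j * v j x) \<in> S" and j: "j <= n"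
 shows "v j \<in> S" using mem j
proof (induction n arbitrary: v j)
 case 0
 then show ?case using 0(1)[of 1] by simp
next
 case (Suc n)
 have sub: "(%x. p x - q x) \<in> S" if "p \<in> S" "q \<in> S" for p q using add[OF that(1) scale[OF that(2), of "-1"]] by simp
 have low: "v j \<in> S" if j: "j <= n" for j
 proof -
  define v' where "v' j x = (2 ^ j - 2 ^ Suc n) * v j x" for j x
  have "(%x. \<Sum>j\<le>n. s ^ j * v' j x) \<in> S" for s
  proof -
   have "(%x. (\<Sum>j\<le>Suc n. (2 * s) ^ j * v j x) - 2 ^ Suc n * (\<Sum>j\<le>Suc n. s ^ j * v j x)) \<in> S"
    by (intro sub scale Suc.prems(1))
   moreover have "(\<Sum>j\<le>Suc n. (2 * s) ^ j * v j x) - 2 ^ Suc n * (\<Sum>j\<le>Suc n. s ^ j * v j x) = (\<Sum>j\<le>n. s ^ j * v' j x)" for x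
   proof -
    have "(\<Sum>j\<le>Suc n. (2 * s) ^ j * v j x) - 2 ^ Suc n * (\<Sum>j\<le>Suc n. s ^ j * v j x)
      = (\<Sum>j\<le>Suc n. s ^ j * v' j x)" unfolding sum_distrib_left sum_subtractf[symmetric]
     by (rule sum.cong) (simp_all add: v'_def power_mult_distrib algebra_simps)
    then show ?thesis by (simp add: v'_def)
   qed
   ultimately show ?thesis by simp
  qed
  then have "v' j \<in> S" using j by (rule Suc.IH)
  moreover have "(2::real) ^ j ~= 2 ^ Suc n"
  proof -
   have "(2::real) ^ j < 2 ^ Suc n" using j by (intro power_strict_increasing) auto
   then show ?thesis by simp
  qed
  ultimately have "(%x. (1 / (2 ^ j - 2 ^ Suc n)) * v' j x) \<in> S" by (intro scale)
  then show ?thesis using \<open>(2::real) ^ j ~= 2 ^ Suc n\<close> by (simp add: v'_def)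
 qed
 show ?case
 proof (cases "j <= n")
  case False
  then have j: "j = Suc n" using Suc.prems(2) by simp
  have part: "m <= Suc n ==> (%x. \<Sum>j<m. v j x) \<in> S" for m
  proof (induction m)
   case 0
   show ?case using scale[OF Suc.prems(1)[of 1], of 0] by simp
  next
   case (Suc m)
   then show ?case using add[OF Suc.IH low[of m]] by simp
  qed
  have "(%x. (\<Sum>j\<le>Suc n. 1 ^ j * v j x) - (\<Sum>j<Suc n. v j x)) \<in> S" by (intro sub part Suc.prems(1)) simp
  then show ?thesis unfolding j by (simp add: lessThan_Suc_atMost)
 qed (rule low)
qed

text \<open>Entries are coefficient, vector, exponent. Sums of powers of linear forms are used since
  symmetrisation sends such a power to the same power of one operator, without any ordering of
  factors.\<close>

type_synonym 'a power_sum = "(real \<times> 'a \<times> nat) list"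

definition ev :: "'a::real_normed_vector power_sum => ('a =>L real) => real" where
 "ev L xi = (\<Sum>(c, Y, k)\<leftarrow>L. c * xi Y ^ k)"

lemma ev_simps [simp]: "ev [] xi = 0" "ev ((c, Y, k) # L) xi = c * xi Y ^ k + ev L xi" "ev (L @ L') xi = ev L xi + ev L' xi"
 by (simp_all add: ev_def)

definition PF :: "'a::real_normed_vector set => (('a =>L real) => real) set" where
 "PF h = {p. EX L. (\<forall>(c, Y, k)\<in>set L. Y \<in> h) & p = ev L}"

lemma PF_mono: "h <= h' ==> PF h <= PF h'" unfolding PF_def by fast

lemma PF_power: "Y \<in> h ==> (%xi::'a::real_normed_vector =>L real. xi Y ^ k) \<in> PF h"
 unfolding PF_def by (intro CollectI exI[of _ "[(1, Y, k)]"]) auto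

lemma PF_add: "p \<in> PF h ==> q \<in> PF h ==> (%xi::'a::real_normed_vector =>L real. p xi + q xi) \<in> PF h"
proof -
 assume "p \<in> PF h" "q \<in> PF h"
 then obtain L L' where "\<forall>(c, Y, k)\<in>set L. Y \<in> h" "p = ev L" "\<forall>(c, Y, k)\<in>set L'. Y \<in> h" "q = ev L'"
  by (auto simp: PF_def)
 then show ?thesis unfolding PF_def by (intro CollectI exI[of _ "L @ L'"]) auto
qed

lemma PF_scale: "p \<in> PF h ==> (%xi::'a::real_normed_vector =>L real. r * p xi) \<in> PF h"
proof -
 assume "p \<in> PF h"
 then obtain L where L: "\<forall>(c, Y, k)\<in>set L. Y \<in> h" "p = ev L" by (auto simp: PF_def)
 have "r * ev L xi = ev (map (%(c, Y, k). (r * c, Y, k)) L) xi" for xi by (induction L) (auto simp: algebra_simps)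
 then show ?thesis using L unfolding PF_def by (intro CollectI exI[of _ "map (%(c, Y, k). (r * c, Y, k)) L"]) auto
qed

lemma PF_induct [consumes 2, case_names power add scale]:
 fixes P :: "(('a::real_normed_vector =>L real) => real) => bool"
 assumes "p \<in> PF h" "0 \<in> h" "!!Y k. Y \<in> h ==> P (%xi::'a =>L real. xi Y ^ k)"
  "!!p q. P p ==> P q ==> P (%xi::'a =>L real. p xi + q xi)" "!!r p. P p ==> P (%xi::'a =>L real. r * p xi)"
 shows "P p"
proof -
 obtain L where L: "\<forall>(c, Y, k)\<in>set L. Y \<in> h" "p = ev L" using assms(1) by (auto simp: PF_def)
 have "P (ev L)" using L(1)
 proof (induction L)
  case Nil
  have "P (%xi::'a =>L real. 0 * xi 0 ^ 0)" by (intro assms)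
  moreover have "ev [] = (%xi::'a =>L real. 0 * xi 0 ^ 0)" by auto
  ultimately show ?case by simp
 next
  case (Cons a L)
  obtain c Y k where a: "a = (c, Y, k)" by (cases a)
  have "P (%xi::'a =>L real. c * blinfun_apply xi Y ^ k + ev L xi)" using Cons a by (intro assms(3-5)) auto
  moreover have "ev (a # L) = (%xi::'a =>L real. c * blinfun_apply xi Y ^ k + ev L xi)" by (auto simp: a)
  ultimately show ?case by simp
 qed
 then show ?thesis by (simp add: L(2))
qed

text \<open>Polarisation: up to a binomial coefficient, \<open>Y^k Y'^l\<close> is the coefficient
  of \<open>s^l\<close> in \<open>(Y + s Y')^(k+l)\<close>, and \<open>coeffs_in_subspace\<close>
  extracts it.\<close>

lemma PF_mult:
 fixes h :: "'a::real_normed_vector set"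
 assumes h: "subspace h" and p: "p \<in> PF h" and q: "q \<in> PF h"
 shows "(%xi::'a =>L real. p xi * q xi) \<in> PF h"
proof -
 have pw: "(%xi::'a =>L real. xi Y ^ k * xi Y' ^ l) \<in> PF h" if Y: "Y \<in> h" "Y' \<in> h" for Y Y' k l
 proof -
  define n where "n = k + l"
  have "(%xi::'a =>L real. real (n choose l) * (xi Y ^ (n - l) * xi Y' ^ l)) \<in> PF h"
  proof (rule coeffs_in_subspace[where v = "%j (xi::'a =>L real). real (n choose j) * (xi Y ^ (n - j) * xi Y' ^ j)" and n = n and j = l])
   fix s :: real
   have "xi (Y + s *R Y') ^ n = (\<Sum>j\<le>n. s ^ j * (real (n choose j) * (xi Y ^ (n - j) * xi Y' ^ j)))" for xi :: "'a =>L real"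
    unfolding blinfun.add_right blinfun.scaleR_right real_scaleR_def
    by (subst add.commute, subst binomial_ring) (simp add: power_mult_distrib mult_ac)
   moreover have "(%xi::'a =>L real. xi (Y + s *R Y') ^ n) \<in> PF h"
    using h Y by (intro PF_power) (simp add: subspace_add subspace_scale)
   ultimately show "(%xi::'a =>L real. \<Sum>j\<le>n. s ^ j * (real (n choose j) * (xi Y ^ (n - j) * xi Y' ^ j))) \<in> PF h" by simp
  qed (auto intro: PF_add PF_scale simp: n_def)
  from PF_scale[OF this, of "1 / real (n choose l)"] show ?thesis by (simp add: n_def)
 qed
 have h0: "0 \<in> h" using h by (rule subspace_0)
 have pw2: "(%xi::'a =>L real. blinfun_apply xi Y ^ k * q xi) \<in> PF h" if Y: "Y \<in> h" for Y k using q h0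
 proof (induction rule: PF_induct)
  case (power Y' l)
  then show ?case using pw[OF Y] by simp
 next
  case (add q1 q2)
  then show ?case using PF_add by (simp add: distrib_left)
 next
  case (scale r q1)
  then show ?case using PF_scale[of _ h r] by (simp add: mult.left_commute)
 qed
 show ?thesis using p h0
 proof (induction rule: PF_induct)
  case (power Y k)
  then show ?case by (rule pw2)
 next
  case (add q1 q2)
  then show ?case using PF_add by (simp add: distrib_right)
 next
  case (scale r q1)
  then show ?case using PF_scale[of _ h r] by (simp add: mult.assoc)
 qed
qed

lemma PF_const: "0 \<in> h ==> (%xi::'a::real_normed_vector =>L real. c) \<in> PF h"
 using PF_scale[OF PF_power[of 0 h 0], of c] by simp

lemma PF_linear: "Y \<in> h ==> (%xi::'a::real_normed_vector =>L real. xi Y) \<in> PF h"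
 using PF_power[of Y h 1] by simp

lemma PF_pow: "subspace h ==> p \<in> PF h ==> (%xi::'a::real_normed_vector =>L real. p xi ^ k) \<in> PF h"
 by (induction k) (auto intro: PF_const PF_mult subspace_0)

lemma PF_sum:
 fixes p :: "'i => ('a::real_normed_vector =>L real) => real"
 assumes "0 \<in> h" "finite I" "!!i. i \<in> I ==> p i \<in> PF h"
 shows "(%xi. \<Sum>i\<in>I. p i xi) \<in> PF h" using assms(2,3)
proof (induction I rule: finite_induct)
 case empty
 then show ?case using PF_const[OF assms(1), of 0] by simp
next
 case (insert i I)
 then show ?case using PF_add[of "p i" h "%xi. \<Sum>i\<in>I. p i xi"] by simp
qed

section \<open>The central character and symmetrised differential operators\<close>

locale kirillov_rep = nilpotent_rep D
 for D :: "('g::{t2_space, second_countable_topology}, 'a::euclidean_space, 'h::chilbert_space) kdata" +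
 assumes assoc_orbit: "associated_with_orbit D"
begin

lemma bounded_linear_Ad: "bounded_linear (Ad D g)" by (simp add: linear_conv_bounded_linear[symmetric] linear_Ad)

lemma CoAd_apply: "CoAd D g xi Y = xi (Ad D (ginv g) Y)" unfolding CoAd_def by (rule bounded_linear_Blinfun_apply[THEN fun_cong])
  (rule bounded_linear_compose[OF blinfun.bounded_linear_right bounded_linear_Ad])

lemma CoAd_mult: "CoAd D (g \<cdot> k) xi = CoAd D g (CoAd D k xi)" by (rule blinfun_eqI) (simp add: CoAd_apply ginv_mult Ad_mult)

lemma CoAd_one [simp]: "CoAd D gone xi = xi" by (rule blinfun_eqI) (simp add: CoAd_apply)

lemma CoAd_inv [simp]: "CoAd D (ginv g) (CoAd D g xi) = xi" "CoAd D g (CoAd D (ginv g) xi) = xi" by (simp_all flip: CoAd_mult)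

lemma CoAd_zc: "Z \<in> zc ==> CoAd D g xi Z = xi Z" by (simp add: CoAd_apply Ad_zc)

lemma orbit_iff: "xi \<in> orbit D \<longleftrightarrow> (EX g. xi = CoAd D g (base D))" by (auto simp: orbit_def)

lemma CoAd_orbit: "xi \<in> orbit D \<longleftrightarrow> CoAd D g xi \<in> orbit D"
proof
 assume "xi \<in> orbit D"
 then obtain k where "xi = CoAd D k (base D)" by (auto simp: orbit_iff)
 then show "CoAd D g xi \<in> orbit D" unfolding orbit_iff by (intro exI[of _ "g \<cdot> k"]) (simp add: CoAd_mult)
next
 assume "CoAd D g xi \<in> orbit D"
 then obtain k where "CoAd D g xi = CoAd D k (base D)" by (auto simp: orbit_iff)
 then have "CoAd D (ginv g) (CoAd D g xi) = CoAd D (ginv g \<cdot> k) (base D)" unfolding CoAd_mult by simp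
 then have "xi = CoAd D (ginv g \<cdot> k) (base D)" by simp
 then show "xi \<in> orbit D" unfolding orbit_iff by blast
qed

text \<open>Adjoining a central \<open>Z\<close> to a polarization keeps it isotropic, so maximality
  puts \<open>Z\<close> inside. Functions of the induced model therefore transform under
  \<open>exp Z\<close> by a scalar, and the isometry \<open>J\<close> carries this back.\<close>

lemma central_character:
 assumes Z: "Z \<in> zc"
 shows "rep D (lexp D Z) u = cis (base D Z) *C u"
proof -
 obtain xi V where xi: "xi \<in> orbit D" and V: "polarization D xi V" and eq: "equivalent_to_induced D xi V"
  using assoc_orbit unfolding associated_with_orbit_def by blast
 have xiZ: "xi Z = base D Z" using xi CoAd_zc[OF Z] by (auto simp: orbit_iff)
 have brZ: "br X Z = 0" "br Z X = 0" for X using Z br_antisym[of Z X] by (auto simp: zc_def)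
 have subV: "subspace V" and isoV: "!!X Y. X \<in> V ==> Y \<in> V ==> xi (br X Y) = 0"
  and maxV: "!!W. isotropic D xi W ==> V <= W ==> W = V" using V by (auto simp: polarization_def isotropic_def)
 define W where "W = {x + y | x y. x \<in> V & y \<in> span {Z}}"
 have "isotropic D xi W" unfolding isotropic_def
 proof (intro conjI ballI)
  show "subspace W" unfolding W_def by (intro subspace_sums subV subspace_span)
  fix A B assume "A \<in> W" "B \<in> W"
  then obtain x r y s where "A = x + r *R Z" "x \<in> V" "B = y + s *R Z" "y \<in> V" by (auto simp: W_def span_singleton)
  then show "xi (br A B) = 0" using isoV by (simp add: br_simps brZ)
 qed
 moreover have "V <= W" unfolding W_def using span_zero[of "{Z}"] by force
 ultimately have "W = V" by (rule maxV)
 moreover have "Z \<in> W" unfolding W_def using subspace_0[OF subV] span_base[of Z "{Z}"] by force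
 ultimately have "- Z \<in> V" using subV by (auto intro: subspace_neg)
 obtain \<nu> J where \<nu>: "invariant_measure (grp D) (lexp D ` V) \<nu>" and J: "!!u. J u \<in> induced_space D xi V \<nu>"
   "!!u v. AE C in \<nu>. \<forall>x\<in>C. J (u + v) x = J u x + J v x"
   "!!c u. AE C in \<nu>. \<forall>x\<in>C. J (c *C u) x = c * J u x"
   "!!u::'h. (LINT C|\<nu>. on_coset (%x. (cmod (J u x))\<^sup>2) C) = (norm u)^2"
   "!!g u. AE C in \<nu>. \<forall>x\<in>C. J (rep D g u) x = J u (ginv g \<cdot> x)"
  using eq unfolding equivalent_to_induced_def by blast
 define c where "c = cis (base D Z)"
 have central: "ginv (lexp D Z) \<cdot> x = x \<cdot> lexp D (- Z)" for x
 proof -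
  have "lexp D (- Z) \<in> center D" unfolding center_iff using Z subspace_neg[OF subspace_zc] by simp
  then show ?thesis by (simp add: center_def lexp_minus)
 qed
 \<comment> \<open>\<open>J\<close> respects the operations only almost everywhere, so the equality
   is obtained from the vanishing norm of this difference.\<close>
 define w where "w = rep D (lexp D Z) u + (- c) *C u"
 have "AE C in \<nu>. \<forall>x\<in>C. J w x = 0"
  using J(2)[of "rep D (lexp D Z) u" "(- c) *C u"] J(3)[of "- c" u] J(5)[of "lexp D Z" u]
 proof eventually_elim
  case (elim C)
  show ?case
  proof
   fix x assume x: "x \<in> C"
   have "J u (x \<cdot> lexp D (- Z)) = cis (- xi (- Z)) * J u x"
    using J(1)[of u] \<open>- Z \<in> V\<close> unfolding induced_space_def by blast
   then have "J (rep D (lexp D Z) u) x = c * J u x" using elim x by (simp add: central c_def xiZ blinfun.minus_right)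
   then show "J w x = 0" using elim x by (simp add: w_def)
  qed
 qed
 moreover have "C ~= {}" if "C \<in> space \<nu>" for C
 proof -
  have "C \<in> left_cosets (grp D) (lexp D ` V)" using \<nu> that by (simp add: invariant_measure_def)
  then obtain x where "C = x <#\<^bsub>grp D\<^esub> (lexp D ` V)" by (auto simp: left_cosets_def)
  moreover have "lexp D 0 \<in> lexp D ` V" using subspace_0[OF subV] by blast
  ultimately show ?thesis by (auto simp: l_coset_def)
 qed
 ultimately have "AE C in \<nu>. on_coset (%x. (cmod (J w x))\<^sup>2) C = 0"
 proof -
  assume a: "AE C in \<nu>. \<forall>x\<in>C. J w x = 0" and ne: "!!C. C \<in> space \<nu> ==> C ~= {}"
  show ?thesis using a
  proof (rule AE_mp, intro AE_I2 impI)
   fix C assume "C \<in> space \<nu>" "\<forall>x\<in>C. J w x = 0"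
   then show "on_coset (%x. (cmod (J w x))\<^sup>2) C = 0" using ne[of C] some_in_eq[of C] by (simp add: on_coset_def)
  qed
 qed
 then have "(norm w)^2 = 0" unfolding J(4)[symmetric] by (rule integral_eq_zero_AE)
 then have "rep D (lexp D Z) u = c *C u" by (simp add: w_def scaleC_minus_left)
 then show ?thesis by (simp add: c_def)
qed

text \<open>The factor makes the skew operator \<open>dpi Y\<close> symmetric; for central
  \<open>Y\<close> it is then the real scalar \<open>base D Y\<close>.\<close>

definition PP :: "'a => 'h => 'h" where "PP Y w = (- \<i>) *C dpi Y w"

text \<open>After subtraction of the scalar the operator vanishes for central \<open>Y\<close>, so
  it depends only on \<open>Y\<close> modulo the centre.\<close>

definition QQ :: "'a => 'h => 'h" where "QQ Y w = PP Y w - base D Y *R w"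

lemma has_vector_derivative_cis_scale:
 "((%t. cis (t * b)) has_vector_derivative (\<i> * of_real b) * cis (t * b)) (at t)"
proof -
 have "((%t. exp ((\<i> * of_real b) * of_real t)) has_vector_derivative (\<i> * of_real b) * exp ((\<i> * of_real b) * of_real t)) (at t)"
  by (rule has_vector_derivative_eq_rhs[OF has_vector_derivative_real_field]) (auto intro!: derivative_eq_intros)
 then show ?thesis by (simp add: cis_conv_exp mult_ac)
qed

lemma dpi_zc:
 assumes "Z \<in> zc" "w \<in> Wk (Suc k)"
 shows "dpi Z w = (\<i> * base D Z) *C w"
proof -
 have "rep D (lexp D (t *R Z)) w = cis (t * base D Z) *C w" for t
  using central_character[of "t *R Z" w] subspace_scale[OF subspace_zc assms(1)] by (simp add: blinfun.scaleR_right)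
 moreover have "((%t. cis (t * base D Z) *C w) has_vector_derivative (\<i> * base D Z) *C w) (at 0)"
 proof -
  have "((%t. cis (t * base D Z)) has_vector_derivative (\<i> * base D Z)) (at 0)"
   using has_vector_derivative_cis_scale[of "base D Z" 0] by simp
  from bounded_bilinear.has_vector_derivative[OF bounded_bilinear_scaleC this has_vector_derivative_const]
  show ?thesis by simp
 qed
 ultimately show ?thesis using vector_derivative_unique_at[OF dpi_curve[OF assms(2), of Z]] by simp
qed

declare Wk.simps(2) [simp del]

lemma PP_linear: "w \<in> Wk (Suc k) ==> linear (%Y. PP Y w)" unfolding PP_def
 by (rule linear_compose[OF linear_dpi, unfolded o_def]) (auto simp: bounded_linear_scaleC bounded_linear.linear)

lemma QQ_linear: "w \<in> Wk (Suc k) ==> linear (%Y. QQ Y w)" unfolding QQ_def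
 by (intro linear_compose_sub PP_linear linearI) (auto simp: blinfun.bilinear_simps algebra_simps)

lemma QQ_zc: "Z \<in> zc ==> w \<in> Wk (Suc k) ==> QQ Z w = 0" by (simp add: QQ_def PP_def dpi_zc scaleC_scaleC scaleR_scaleC)

lemma PP_Wk: "w \<in> Wk (Suc k) ==> PP Y w \<in> Wk k" unfolding PP_def by (intro Wk_scaleC dpi_Wk)

lemma QQ_Wk: "w \<in> Wk (Suc k) ==> QQ Y w \<in> Wk k"
proof -
 assume w: "w \<in> Wk (Suc k)"
 have "w \<in> Wk k" using w Wk_antimono[of k "Suc k"] by auto
 then have "PP Y w + (- base D Y) *R w \<in> Wk k" by (intro Wk_add PP_Wk[OF w] Wk_scaleR)
 then show ?thesis by (simp add: QQ_def)
qed

lemma PP_comb: "w \<in> Wk (Suc k) ==> v \<in> Wk (Suc k) ==> PP Y (w + c *C v) = PP Y w + c *C PP Y v"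
 unfolding PP_def by (simp add: dpi_combination scaleC_add_right scaleC_scaleC mult.commute)

lemma QQ_comb: "w \<in> Wk (Suc k) ==> v \<in> Wk (Suc k) ==> QQ Y (w + c *C v) = QQ Y w + c *C QQ Y v"
 unfolding QQ_def by (simp add: PP_comb scaleC_diff_right scaleR_scaleC_commute algebra_simps)

lemma funpow_comb:
 assumes F: "!!k w. w \<in> Wk (Suc k) ==> F w \<in> Wk k"
  and comb: "!!k w v c. w \<in> Wk (Suc k) ==> v \<in> Wk (Suc k) ==> F (w + c *C v) = F w + c *C F v"
 shows "w \<in> Wk k ==> v \<in> Wk k ==> (F ^^ k) (w + c *C v) = (F ^^ k) w + c *C (F ^^ k) v"
proof (induction k arbitrary: w v)
 case (Suc k)
 have "(F ^^ Suc k) (w + c *C v) = (F ^^ k) (F w + c *C F v)"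
  using comb[OF Suc.prems] by (simp add: funpow_Suc_right del: funpow.simps)
 also have "... = (F ^^ k) (F w) + c *C (F ^^ k) (F v)" by (rule Suc.IH) (auto intro: F Suc.prems)
 finally show ?case by (simp add: funpow_Suc_right del: funpow.simps)
qed simp

lemma funpow_Wk_sum:
 assumes F: "!!k w. w \<in> Wk (Suc k) ==> F w \<in> Wk k"
  and comb: "!!k w v c. w \<in> Wk (Suc k) ==> v \<in> Wk (Suc k) ==> F (w + c *C v) = F w + c *C F v"
  and "finite I" "!!i. i \<in> I ==> w i \<in> Wk k"
 shows "(F ^^ k) (\<Sum>i\<in>I. r i *R w i) = (\<Sum>i\<in>I. r i *R (F ^^ k) (w i))" using assms(3,4)
proof (induction I rule: finite_induct)
 case empty
 have "(F ^^ k) (0 + (-1) *C 0) = (F ^^ k) 0 + (-1) *C (F ^^ k) 0" by (rule funpow_comb[OF F comb]) (auto intro: Wk_zero)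
 then show ?case by (simp add: scaleC_minus_one)
next
 case (insert i I)
 have s: "(\<Sum>i\<in>I. r i *R w i) \<in> Wk k" using insert by (intro Wk_sum Wk_scaleR) auto
 have "(F ^^ k) ((\<Sum>i\<in>I. r i *R w i) + of_real (r i) *C w i) = (F ^^ k) (\<Sum>i\<in>I. r i *R w i) + of_real (r i) *C (F ^^ k) (w i)"
  by (rule funpow_comb[OF F comb]) (use s insert in auto)
 then show ?case using insert by (simp add: scaleR_scaleC add.commute)
qed

lemma QQ_pow_sum: "finite I ==> (!!i. i \<in> I ==> w i \<in> Wk k) ==>
  (QQ Y ^^ k) (\<Sum>i\<in>I. r i *R w i) = (\<Sum>i\<in>I. r i *R (QQ Y ^^ k) (w i))" by (rule funpow_Wk_sum[OF QQ_Wk QQ_comb])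

text \<open>Supplies functionals that vanish on the centre and are coordinates modulo it; they are
  the directions of differentiation in \<open>power_relation_QQ\<close>.\<close>

lemma zc_complement: "EX E eta. finite E & (\<forall>e\<in>E. \<forall>Z\<in>zc. (eta e :: 'a =>L real) Z = 0) &
  (ALL Y. Y - (\<Sum>e\<in>E. eta e Y *R e) \<in> zc)" proof -
 have sub: "subspace {x. \<forall>z\<in>zc. orthogonal x z}" by (auto simp: subspace_def orthogonal_def inner_add_left)
 obtain B where B: "B <= {x. \<forall>z\<in>zc. orthogonal x z}" "pairwise orthogonal B" "!!x. x \<in> B ==> norm x = 1"
  "independent B" "card B = dim {x. \<forall>z\<in>zc. orthogonal x z}" "span B = {x. \<forall>z\<in>zc. orthogonal x z}"
  by (rule orthonormal_basis_subspace[OF sub]) (rule that; blast)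
 have fin: "finite B" using B(4) by (rule independent_imp_finite)
 define eta where "eta e = Blinfun (%Y. inner e Y)" for e :: 'a
 have eta: "eta e Y = inner e Y" for e Y
  unfolding eta_def by (rule bounded_linear_Blinfun_apply[THEN fun_cong, OF bounded_linear_inner_right])
 have "Y - (\<Sum>e\<in>B. eta e Y *R e) \<in> zc" for Y
 proof (rule subspaceI_annihilator[OF subspace_zc])
  fix w assume w: "!!y. y \<in> zc ==> inner w y = 0"
  then have "w \<in> span B" unfolding B(6) by (simp add: orthogonal_def)
  moreover have "span B <= {w. inner w (Y - (\<Sum>e\<in>B. eta e Y *R e)) = 0}"
  proof (rule span_minimal)
   show "B <= {w. inner w (Y - (\<Sum>e\<in>B. eta e Y *R e)) = 0}"
   proof (intro subsetI CollectI)
    fix b assume b: "b \<in> B"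
    have "inner b (\<Sum>e\<in>B. eta e Y *R e) = (\<Sum>e\<in>B. if e = b then inner b Y else 0)" unfolding inner_sum_right
    proof (rule sum.cong[OF refl])
     fix e assume e: "e \<in> B"
     have "inner b b = 1" using B(3)[OF b] by (simp add: norm_eq_1)
     then show "inner b (eta e Y *R e) = (if e = b then inner b Y else 0)"
      using B(2) b e by (auto simp: pairwise_def orthogonal_def eta)
    qed
    also have "... = inner b Y" using b fin by simp
    finally show "inner b (Y - (\<Sum>e\<in>B. eta e Y *R e)) = 0" by (simp add: inner_diff_right)
   qed
   show "subspace {w. inner w (Y - (\<Sum>e\<in>B. eta e Y *R e)) = 0}" by (auto simp: subspace_def inner_add_left)
  qed
  ultimately show "inner w (Y - (\<Sum>e\<in>B. eta e Y *R e)) = 0" by auto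
 qed
 moreover have "\<forall>e\<in>B. \<forall>Z\<in>zc. eta e Z = 0" using B(1) by (auto simp: eta orthogonal_def)
 ultimately show ?thesis using fin by (intro exI[of _ B] exI[of _ eta]) auto
qed

text \<open>Polarisation: a linear relation between \<open>l\<close>-th powers of linear forms vanishing on the centre also
 holds for the \<open>l\<close>-th powers of the corresponding operators.\<close>

lemma power_relation_QQ:
 assumes "finite S" "!!eta::'a =>L real. (!!Z. Z \<in> zc ==> eta Z = 0) ==> (\<Sum>i\<in>S. m i * eta (Y i) ^ l) = 0" "w \<in> Wk l"
 shows "(\<Sum>i\<in>S. m i *R (QQ (Y i) ^^ l) w) = 0" using assms(2,3)
proof (induction l arbitrary: m w)
 case 0
 have "(\<Sum>i\<in>S. m i) = 0" using 0(1)[of 0] by simp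
 then show ?case by (simp add: scaleR_sum_left[symmetric])
next
 case (Suc l)
 obtain E eta where E: "finite E" "!!e Z. e \<in> E ==> Z \<in> zc ==> (eta e :: 'a =>L real) Z = 0"
  "!!Y. Y - (\<Sum>e\<in>E. eta e Y *R e) \<in> zc" using zc_complement by blast
 have exp: "QQ Y w = (\<Sum>e\<in>E. eta e Y *R QQ e w)" for Y
 proof -
  note lin = QQ_linear[OF Suc.prems(2)]
  have "QQ (Y - (\<Sum>e\<in>E. eta e Y *R e)) w = 0" by (rule QQ_zc[OF E(3) Suc.prems(2)])
  then show ?thesis by (simp add: linear_diff[OF lin] linear_sum[OF lin] linear_scale[OF lin])
 qed
 \<comment> \<open>Differentiating the relation at \<open>theta + s * eta e\<close> lowers the
   exponent by one and multiplies the coefficients by \<open>eta e (Y i)\<close>.\<close>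
 have rel: "(\<Sum>i\<in>S. (m i * eta e (Y i)) * theta (Y i) ^ l) = 0" if e: "e \<in> E" and theta: "!!Z. Z \<in> zc ==> theta Z = 0" for e and theta :: "'a =>L real"
 proof -
  have "(%s. \<Sum>i\<in>S. m i * (theta (Y i) + s * eta e (Y i)) ^ Suc l) = (%s. 0)"
  proof
   fix s :: real
   have "(\<Sum>i\<in>S. m i * (theta + s *R eta e) (Y i) ^ Suc l) = 0"
    by (rule Suc.prems(1)) (simp add: blinfun.bilinear_simps theta E(2)[OF e])
   then show "(\<Sum>i\<in>S. m i * (theta (Y i) + s * eta e (Y i)) ^ Suc l) = 0" by (simp add: blinfun.bilinear_simps)
  qed
  moreover have "((%s. m i * (theta (Y i) + s * eta e (Y i)) ^ Suc l) has_real_derivative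
    m i * (real (Suc l) * theta (Y i) ^ l * eta e (Y i))) (at 0)" for i by (rule derivative_eq_intros refl)+ simp
  then have "((%s. \<Sum>i\<in>S. m i * (theta (Y i) + s * eta e (Y i)) ^ Suc l) has_real_derivative
    (\<Sum>i\<in>S. m i * (real (Suc l) * theta (Y i) ^ l * eta e (Y i)))) (at 0)" by (rule DERIV_sum)
  ultimately have "((%s. 0) has_real_derivative
    (\<Sum>i\<in>S. m i * (real (Suc l) * theta (Y i) ^ l * eta e (Y i)))) (at 0)" by argo
  from DERIV_unique[OF this DERIV_const]
  have "(\<Sum>i\<in>S. m i * (real (Suc l) * theta (Y i) ^ l * eta e (Y i))) = 0" .
  then have "real (Suc l) * (\<Sum>i\<in>S. (m i * eta e (Y i)) * theta (Y i) ^ l) = 0"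
   unfolding sum_distrib_left by (simp only: mult_ac)
  then show ?thesis by simp
 qed
 have "(\<Sum>i\<in>S. m i *R (QQ (Y i) ^^ Suc l) w) = (\<Sum>i\<in>S. m i *R (QQ (Y i) ^^ l) (\<Sum>e\<in>E. eta e (Y i) *R QQ e w))"
  unfolding funpow_Suc_right o_apply by (simp only: exp[symmetric])
 also have "... = (\<Sum>i\<in>S. m i *R (\<Sum>e\<in>E. eta e (Y i) *R (QQ (Y i) ^^ l) (QQ e w)))"
  using E(1) Suc.prems(2) by (simp add: QQ_pow_sum QQ_Wk)
 also have "... = (\<Sum>e\<in>E. \<Sum>i\<in>S. (m i * eta e (Y i)) *R (QQ (Y i) ^^ l) (QQ e w))"
  unfolding scaleR_sum_right scaleR_scaleR by (rule sum.swap)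
 also have "... = (\<Sum>e\<in>E. 0)" by (rule sum.cong[OF refl]) (rule Suc.IH[OF rel QQ_Wk[OF Suc.prems(2)]])
 finally show ?case by simp
qed

lemma PP_pow_binomial:
 "w \<in> Wk k ==> (PP Y ^^ k) w = (\<Sum>l\<le>k. (real (k choose l) * base D Y ^ (k - l)) *R (QQ Y ^^ l) w)"
proof (induction k arbitrary: w)
 case (Suc k)
 let ?b = "base D Y"
 have wk: "w \<in> Wk k" using Suc.prems Wk_antimono[of k "Suc k"] by auto
 have "(PP Y ^^ Suc k) w = (PP Y ^^ k) (QQ Y w + of_real ?b *C w)"
  by (simp add: funpow_Suc_right QQ_def scaleR_scaleC del: funpow.simps)
 also have "... = (PP Y ^^ k) (QQ Y w) + ?b *R (PP Y ^^ k) w"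
  unfolding scaleR_scaleC by (rule funpow_comb[OF PP_Wk PP_comb]) (auto intro: QQ_Wk Suc.prems wk)
 also have "(PP Y ^^ k) (QQ Y w) = (\<Sum>l\<le>k. (real (k choose l) * ?b ^ (k - l)) *R (QQ Y ^^ Suc l) w)"
  unfolding Suc.IH[OF QQ_Wk[OF Suc.prems]] by (simp add: funpow_Suc_right del: funpow.simps)
 also have "?b *R (PP Y ^^ k) w = (\<Sum>l\<le>k. (real (k choose l) * ?b ^ (Suc k - l)) *R (QQ Y ^^ l) w)"
  unfolding Suc.IH[OF wk] scaleR_sum_right by (rule sum.cong) (simp_all add: Suc_diff_le mult_ac)
 also have "(\<Sum>l\<le>k. (real (k choose l) * ?b ^ (k - l)) *R (QQ Y ^^ Suc l) w) + ...
   = (\<Sum>l\<le>Suc k. (real (Suc k choose l) * ?b ^ (Suc k - l)) *R (QQ Y ^^ l) w)" proof -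
  have a: "(\<Sum>l\<le>k. (real (k choose l) * ?b ^ (Suc k - l)) *R (QQ Y ^^ l) w)
    = ?b ^ Suc k *R w + (\<Sum>l\<le>k. (real (k choose Suc l) * ?b ^ (k - l)) *R (QQ Y ^^ Suc l) w)" proof -
   have "(\<Sum>l\<le>k. (real (k choose l) * ?b ^ (Suc k - l)) *R (QQ Y ^^ l) w)
     = (\<Sum>l\<le>Suc k. (real (k choose l) * ?b ^ (Suc k - l)) *R (QQ Y ^^ l) w)" by (simp add: binomial_eq_0)
   then show ?thesis unfolding sum.atMost_Suc_shift by simp
  qed
  have b: "(\<Sum>l\<le>Suc k. (real (Suc k choose l) * ?b ^ (Suc k - l)) *R (QQ Y ^^ l) w)
    = ?b ^ Suc k *R w + (\<Sum>l\<le>k. (real (Suc k choose Suc l) * ?b ^ (k - l)) *R (QQ Y ^^ Suc l) w)"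
   unfolding sum.atMost_Suc_shift by simp
  have c: "(\<Sum>l\<le>k. (real (Suc k choose Suc l) * ?b ^ (k - l)) *R (QQ Y ^^ Suc l) w)
    = (\<Sum>l\<le>k. (real (k choose l) * ?b ^ (k - l)) *R (QQ Y ^^ Suc l) w)
     + (\<Sum>l\<le>k. (real (k choose Suc l) * ?b ^ (k - l)) *R (QQ Y ^^ Suc l) w)"
   unfolding binomial_Suc_Suc of_nat_add distrib_right scaleR_left_distrib by (rule sum.distrib)
  show ?thesis unfolding a b c by (simp only: add_ac)
 qed
 finally show ?case .
qed simp

text \<open>The relation holds only on the affine space of functionals equal to
  \<open>base D\<close> on the centre. Along \<open>base D + s * eta\<close>, comparison of the
  powers of \<open>s\<close> splits it into homogeneous relations for \<open>QQ\<close>, and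
  \<open>PP_pow_binomial\<close> reassembles them.\<close>

lemma power_relation_PP:
 assumes S: "finite S" and k: "!!i. i \<in> S ==> k i <= K"
  and rel: "!!xi::'a =>L real. (!!Z. Z \<in> zc ==> xi Z = base D Z) ==> (\<Sum>i\<in>S. c i * xi (Y i) ^ k i) = 0"
  and w: "w \<in> Wk K"
 shows "(\<Sum>i\<in>S. c i *R (PP (Y i) ^^ k i) w) = 0"
proof -
 define m where "m l i = c i * (real (k i choose l) * base D (Y i) ^ (k i - l))" for l i
 have ml: "(\<Sum>i\<in>S. m l i * eta (Y i) ^ l) = 0" if "l <= K" and eta: "!!Z. Z \<in> zc ==> eta Z = 0" for l and eta :: "'a =>L real"
 proof (rule poly_coeffs_zero[where n = K and c = "%l. \<Sum>i\<in>S. m l i * eta (Y i) ^ l"])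
  fix s :: real
  have "(\<Sum>l\<le>K. (\<Sum>i\<in>S. m l i * eta (Y i) ^ l) * s ^ l) = (\<Sum>i\<in>S. \<Sum>l\<le>K. m l i * (s * eta (Y i)) ^ l)"
   unfolding sum_distrib_right by (subst sum.swap) (simp add: power_mult_distrib mult_ac)
  also have "... = (\<Sum>i\<in>S. c i * (base D + s *R eta) (Y i) ^ k i)"
  proof (rule sum.cong[OF refl])
   fix i assume i: "i \<in> S"
   have "(base D + s *R eta) (Y i) ^ k i = (s * eta (Y i) + base D (Y i)) ^ k i"
    by (simp add: blinfun.bilinear_simps add.commute)
   also have "... = (\<Sum>l\<le>k i. real (k i choose l) * (s * eta (Y i)) ^ l * base D (Y i) ^ (k i - l))"
    by (rule binomial_ring)
   also have "... = (\<Sum>l\<le>K. real (k i choose l) * (s * eta (Y i)) ^ l * base D (Y i) ^ (k i - l))"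
    using k[OF i] by (intro sum.mono_neutral_left) (auto simp: binomial_eq_0)
   finally show "(\<Sum>l\<le>K. m l i * (s * eta (Y i)) ^ l) = c i * (base D + s *R eta) (Y i) ^ k i"
    by (simp add: m_def sum_distrib_left mult_ac)
  qed
  also have "... = 0" by (rule rel) (simp add: blinfun.bilinear_simps eta)
  finally show "(\<Sum>l\<le>K. (\<Sum>i\<in>S. m l i * eta (Y i) ^ l) * s ^ l) = 0" .
 qed (rule that(1))
 have "(\<Sum>i\<in>S. c i *R (PP (Y i) ^^ k i) w) = (\<Sum>i\<in>S. \<Sum>l\<le>K. m l i *R (QQ (Y i) ^^ l) w)"
 proof (rule sum.cong[OF refl])
  fix i assume i: "i \<in> S"
  have "w \<in> Wk (k i)" using Wk_antimono[OF k[OF i]] w by blast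
  then have "c i *R (PP (Y i) ^^ k i) w = (\<Sum>l\<le>k i. m l i *R (QQ (Y i) ^^ l) w)"
   by (simp add: PP_pow_binomial scaleR_sum_right m_def)
  also have "... = (\<Sum>l\<le>K. m l i *R (QQ (Y i) ^^ l) w)"
   using k[OF i] by (intro sum.mono_neutral_left) (auto simp: m_def binomial_eq_0)
  finally show "c i *R (PP (Y i) ^^ k i) w = (\<Sum>l\<le>K. m l i *R (QQ (Y i) ^^ l) w)" .
 qed
 also have "... = (\<Sum>l\<le>K. \<Sum>i\<in>S. m l i *R (QQ (Y i) ^^ l) w)" by (rule sum.swap)
 also have "... = (\<Sum>l\<le>K. 0)"
 proof (rule sum.cong[OF refl])
  fix l assume l: "l \<in> {..K}"
  then have "w \<in> Wk l" using Wk_antimono[of l K] w by auto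
  then show "(\<Sum>i\<in>S. m l i *R (QQ (Y i) ^^ l) w) = 0" using l by (intro power_relation_QQ[OF S] ml) auto
 qed
 finally show ?thesis by simp
qed

end

section \<open>An invariant polynomial\<close>

lemma affine_of_const_derivative:
 fixes f :: "real => real"
 assumes "!!s. (f has_real_derivative c) (at s)"
 shows "f s = f 0 + c * s"
proof -
 have "((%s. f s - c * s) has_real_derivative 0) (at s)" for s by (rule derivative_eq_intros assms refl | simp)+
 then have "f s - c * s = f 0 - c * 0" by (intro DERIV_isconst_all) blast
 then show ?thesis by simp
qed

context kirillov_rep
begin

text \<open>The centre is added because the values on it are prescribed on the orbit; the index
  \<open>j\<close> matters only when \<open>jh D j\<close> lies outside
  \<open>hh (j - 1)\<close>.\<close>

definition hh :: "nat => 'a set" where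
 "hh j = {U + Z | U Z. U \<in> flag D j & Z \<in> zc}"

lemma subspace_hh: "j <= DIM('a) ==> subspace (hh j)" unfolding hh_def by (rule subspace_sums[OF subspace_flag subspace_zc])

lemma flag_hh: "U \<in> flag D j ==> U \<in> hh j" unfolding hh_def using subspace_0[OF subspace_zc] by force

lemma zc_hh: "j <= DIM('a) ==> Z \<in> zc ==> Z \<in> hh j" unfolding hh_def using subspace_0[OF subspace_flag[of j]] by force

lemma flag_mono: "i <= j ==> j <= DIM('a) ==> flag D i <= flag D j"
proof (induction rule: dec_induct)
 case (step k)
 then show ?case using flag_step[of "Suc k"] by (auto simp: central_step_def)
qed simp

lemma hh_mono: "i <= j ==> j <= DIM('a) ==> hh i <= hh j" unfolding hh_def using flag_mono[of i j] by blast

lemma br_zc [simp]: "Z \<in> zc ==> br X Z = 0" "Z \<in> zc ==> br Z X = 0" using br_antisym[of Z X] by (auto simp: zc_def)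

lemma br_hh: "j \<in> {1..DIM('a)} ==> U \<in> hh j ==> br X U \<in> flag D (j - 1)"
 unfolding hh_def using flag_step[of j] by (auto simp: central_step_def br_simps)

lemma hh_step: "j \<in> {1..DIM('a)} ==> central_step (hh j) (hh (j - 1))"
 unfolding central_step_def using subspace_hh[of j] subspace_hh[of "j - 1"] hh_mono[of "j - 1" j] br_hh flag_hh by auto

lemma hh_zero: "hh 0 = zc" unfolding hh_def flag_zero by auto

lemma Ad_hh: "j <= DIM('a) ==> U \<in> hh j ==> Ad D g U \<in> hh j"
 by (cases "j = 0") (auto simp: hh_zero Ad_zc intro: central_step_Ad(2)[OF hh_step])

lemma br_hh_le: "i <= DIM('a) ==> U \<in> hh i ==> br X U \<in> hh i"
 using br_hh[of i U X] flag_hh hh_mono[of "i - 1" i] subspace_0[OF subspace_zc] by (cases "i = 0") (auto simp: hh_zero)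

lemma hh_decompose:
 assumes "Suc i <= DIM('a)" "U \<in> hh (Suc i)"
 obtains k V where "U = k *R jh D (Suc i) + V" "V \<in> hh i"
proof -
 obtain F Z where U: "U = F + Z" "F \<in> flag D (Suc i)" "Z \<in> zc" using assms(2) by (auto simp: hh_def)
 obtain k where k: "F - k *R jh D (Suc i) \<in> flag D i" using flag_decompose[of "Suc i" F] assms(1) U(2) by auto
 have "(F - k *R jh D (Suc i)) + Z \<in> hh i" using k U(3) by (auto simp: hh_def)
 then show ?thesis using that[of k "F - k *R jh D (Suc i) + Z"] by (simp add: U(1))
qed

lemma subspace_stab: "subspace (stab D)" by (auto simp: subspace_def stab_def br_simps blinfun.bilinear_simps)

lemma zc_stab: "zc <= stab D" by (auto simp: stab_def)

lemma jump_iff: "j \<in> jump D \<longleftrightarrow> j \<in> {1..DIM('a)} & jh D j \<notin> {X + Y | X Y. X \<in> flag D (j - 1) & Y \<in> stab D}"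
proof (cases "j \<in> {1..DIM('a)}")
 case True
 have sub: "subspace {X + Y | X Y. X \<in> flag D (j - 1) & Y \<in> stab D}" (is "subspace ?V")
  using True by (intro subspace_sums subspace_flag subspace_stab) auto
 have "flag D j <= ?V" if "jh D j \<in> ?V"
 proof
  fix U assume "U \<in> flag D j"
  then obtain k where "U - k *R jh D j \<in> flag D (j - 1)" using flag_decompose[OF True] by blast
  then have "U - k *R jh D j \<in> ?V" using subspace_0[OF subspace_stab] by force
  then have "(U - k *R jh D j) + k *R jh D j \<in> ?V" using sub that by (intro subspace_add subspace_scale)
  then show "U \<in> ?V" by simp
 qed
 then show ?thesis using True jh_in[OF True] by (auto simp: jump_def)
qed (auto simp: jump_def)

text \<open>The image of a skew form is the annihilator of its kernel; for the form of
  \<open>eta\<close> this describes the tangent space of the coadjoint orbit at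
  \<open>eta\<close>.\<close>

lemma coadjoint_tangent:
 fixes eta :: "'a =>L real"
 assumes f: "!!X. (!!Y. eta (br X Y) = 0) ==> inner f X = 0"
 shows "EX Y. ALL U. eta (br Y U) = inner f U"
proof -
 define b where "b Y = (\<Sum>e\<in>Basis. eta (br Y e) *R e)" for Y
 have b: "inner (b Y) U = eta (br Y U)" for Y U
 proof -
  have lin: "linear (%U. eta (br Y U))" by (rule linearI) (simp_all add: br_simps blinfun.bilinear_simps)
  have "eta (br Y U) = eta (br Y (\<Sum>e\<in>Basis. inner U e *R e))" by (simp only: euclidean_representation)
  also have "... = (\<Sum>e\<in>Basis. inner U e * eta (br Y e))" by (simp add: linear_sum[OF lin] linear_scale[OF lin])
  finally show ?thesis by (simp add: b_def inner_sum_left inner_commute[of U] mult.commute)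
 qed
 have linb: "linear b"
  by (rule linearI) (simp_all add: b_def br_simps blinfun.bilinear_simps sum.distrib scaleR_left_distrib scaleR_sum_right)
 have "f \<in> range b"
 proof (rule subspaceI_annihilator)
  show "subspace (range b)" using linb by (rule linear_subspace_image) simp
  fix w assume w: "!!y. y \<in> range b ==> inner w y = 0"
  have "eta (br w Y) = 0" for Y using w[of "b Y"] b[of Y w] br_antisym[of w Y] by (simp add: inner_commute blinfun.minus_right)
  then have "inner f w = 0" by (rule f)
  then show "inner w f = 0" by (simp only: inner_commute)
 qed
 then show ?thesis using b by auto
qed

lemma jump_dual_exists:
 assumes i: "i \<in> jump D"
 shows "EX Y. (\<forall>U\<in>hh (i - 1). base D (br Y U) = 0) & base D (br Y (jh D i)) = 1"
proof -
 have i': "i \<in> {1..DIM('a)}" and jh: "jh D i \<notin> {X + Y | X Y. X \<in> flag D (i - 1) & Y \<in> stab D}" (is "_ \<notin> ?V")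
  using i by (auto simp: jump_iff)
 have sub: "subspace ?V" using i' by (intro subspace_sums subspace_flag subspace_stab) auto
 obtain f where f: "!!y. y \<in> ?V ==> inner f y = 0" "inner f (jh D i) ~= 0"
  using subspace_annihilator_exists[OF sub jh] by blast
 define r where "r = 1 / inner f (jh D i)"
 have "EX Y. ALL U. base D (br Y U) = inner (r *R f) U"
 proof (rule coadjoint_tangent)
  fix X assume "!!Y. base D (br X Y) = 0"
  then have "X \<in> stab D" by (simp add: stab_def)
  then have "X \<in> ?V" using subspace_0[OF subspace_flag[of "i - 1"]] i' by force
  then show "inner (r *R f) X = 0" using f(1)[of X] by simp
 qed
 then obtain Y where Y: "!!U. base D (br Y U) = r * inner f U" by auto
 have "inner f U = 0" if "U \<in> hh (i - 1)" for U using that zc_stab by (intro f(1)) (auto simp: hh_def)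
 then show ?thesis using Y f(2) by (intro exI[of _ Y]) (simp add: r_def)
qed

text \<open>At \<open>base D\<close>, this direction moves the value at \<open>jh D i\<close> with
  unit speed and leaves all values on \<open>hh (i - 1)\<close> stationary.\<close>

definition yd :: "nat => 'a" where
 "yd i = (SOME Y. (\<forall>U\<in>hh (i - 1). base D (br Y U) = 0) & base D (br Y (jh D i)) = 1)"

lemma yd:
 assumes "i \<in> jump D"
 shows "U \<in> hh (i - 1) ==> base D (br (yd i) U) = 0" and "base D (br (yd i) (jh D i)) = 1"
 using someI_ex[OF jump_dual_exists[OF assms]] unfolding yd_def[symmetric] by auto

section \<open>Pushing functionals to the base point\<close>

lemma CoAd_curve:
 fixes eta :: "'a =>L real"
 shows "((%s. CoAd D (lexp D (s *R Y)) eta U) has_real_derivative - eta (br Y (Ad D (ginv (lexp D (s *R Y))) U))) (at s)"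
proof -
 have "((%s. Ad D (lexp D (s *R (- Y))) U) has_vector_derivative br (- Y) (Ad D (lexp D (s *R (- Y))) U)) (at s)"
  by (rule Ad_deriv)
 from bounded_linear.has_vector_derivative[OF blinfun.bounded_linear_right this, of eta]
 show ?thesis by (simp add: CoAd_apply lexp_minus br_simps blinfun.minus_right has_real_derivative_iff_has_vector_derivative)
qed

lemma CoAd_lexp_sum:
 fixes eta :: "'a =>L real"
 assumes "!!X Y. (br X ^^ K) Y = 0"
 shows "CoAd D (lexp D (s *R Y)) eta U = (\<Sum>m<K. ((-1) ^ m / fact m * eta ((br Y ^^ m) U)) * s ^ m)"
proof -
 have p: "(br (- (s *R Y)) ^^ m) U = ((-1) ^ m * s ^ m) *R (br Y ^^ m) U" for m by (induction m) (simp_all add: br_simps)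
 show ?thesis unfolding CoAd_apply lexp_minus[symmetric] Ad_lexp_sum[OF assms] p
  by (simp add: blinfun.bilinear_simps blinfun.sum_right field_simps)
qed

text \<open>The velocity along the curve evaluates \<open>eta\<close> only on
  \<open>hh (i - 1)\<close>, where it agrees with \<open>base D\<close>. It is therefore constant, 0
  on \<open>hh (i - 1)\<close> and -1 at \<open>jh D i\<close>.\<close>

lemma CoAd_push:
 fixes eta :: "'a =>L real"
 assumes i: "i \<in> jump D" and eta: "!!U. U \<in> hh (i - 1) ==> eta U = base D U"
 shows "U \<in> hh (i - 1) ==> CoAd D (lexp D (s *R yd i)) eta U = base D U"
  and "CoAd D (lexp D (s *R yd i)) eta (jh D i) = eta (jh D i) - s"
proof -
 have i': "i \<in> {1..DIM('a)}" using i by (simp add: jump_iff)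
 show "CoAd D (lexp D (s *R yd i)) eta U = base D U" if U: "U \<in> hh (i - 1)"
 proof -
  have "eta (br (yd i) V) = 0" if "V \<in> hh (i - 1)" for V
   using eta[of "br (yd i) V"] br_hh_le[of "i - 1" V] that i' yd(1)[OF i that] by auto
  then have "eta (br (yd i) (Ad D (ginv (lexp D (s *R yd i))) U)) = 0" for s using Ad_hh[of "i - 1" U] U i' by auto
  then have "((%s. CoAd D (lexp D (s *R yd i)) eta U) has_real_derivative 0) (at s)" for s
   using CoAd_curve[of "yd i" eta U s] by simp
  then show ?thesis using affine_of_const_derivative[of "%s. CoAd D (lexp D (s *R yd i)) eta U" 0 s] eta[OF U] by simp
 qed
 have "eta (br (yd i) (Ad D g (jh D i))) = 1" for g
 proof -
  have jhi: "jh D i \<in> hh i" using jh_in[OF i'] by (rule flag_hh)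
  have "Ad D g (jh D i) - jh D i \<in> hh (i - 1)" by (rule central_step_Ad(1)[OF hh_step[OF i'] jhi])
  from yd(1)[OF i this] yd(2)[OF i] have "base D (br (yd i) (Ad D g (jh D i))) = 1" by (simp add: br_simps blinfun.diff_right)
  moreover have "br (yd i) (Ad D g (jh D i)) \<in> hh (i - 1)" using br_hh[OF i' Ad_hh[OF _ jhi]] i' by (intro flag_hh) auto
  ultimately show ?thesis using eta by simp
 qed
 then have "((%s. CoAd D (lexp D (s *R yd i)) eta (jh D i)) has_real_derivative - 1) (at s)" for s
  using CoAd_curve[of "yd i" eta "jh D i" s] by simp
 from affine_of_const_derivative[OF this, of s]
 show "CoAd D (lexp D (s *R yd i)) eta (jh D i) = eta (jh D i) - s" by simp
qed

text \<open>Normalises \<open>xi\<close> index by index: at a jump the pushing time is exactly the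
  remaining excess over \<open>base D\<close>. As that time is a value of the previous stage, the
  result stays polynomial in \<open>xi\<close>.\<close>

primrec red :: "nat => ('a =>L real) => ('a =>L real)" where
 "red 0 xi = xi"
| "red (Suc i) xi = (if Suc i \<in> jump D
   then CoAd D (lexp D ((blinfun_apply (red i xi) (jh D (Suc i)) - blinfun_apply (base D) (jh D (Suc i))) *R yd (Suc i))) (red i xi)
   else red i xi)"

lemma red_CoAd: "EX g. red i xi = CoAd D g xi"
proof (induction i)
 case 0
 show ?case by (rule exI[of _ gone]) simp
next
 case (Suc i)
 then show ?case by (auto simp flip: CoAd_mult)
qed

text \<open>At a non-jump index, \<open>min\<close> says that \<open>hh\<close> does not grow, so
  nothing has to be adjusted; at a jump \<open>CoAd_push\<close> corrects the new value and
  preserves the old ones.\<close>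

lemma red_agrees:
 fixes xi :: "'a =>L real"
 assumes min: "!!l. l \<in> {1..i} ==> l \<notin> jump D ==> jh D l \<in> hh (l - 1)"
  and i: "i <= DIM('a)" and xi: "!!Z. Z \<in> zc ==> xi Z = base D Z" and U: "U \<in> hh i"
 shows "red i xi U = base D U" using min i U
proof (induction i arbitrary: U)
 case 0
 then show ?case using xi by (simp add: hh_zero)
next
 case (Suc i)
 have IH: "red i xi V = base D V" if "V \<in> hh i" for V using Suc.prems by (intro Suc.IH that) auto
 obtain k V where U: "U = k *R jh D (Suc i) + V" "V \<in> hh i" using hh_decompose[OF Suc.prems(2,3)] by blast
 show ?case
 proof (cases "Suc i \<in> jump D")
  case True
  let ?s = "red i xi (jh D (Suc i)) - base D (jh D (Suc i))"
  have "red (Suc i) xi V = base D V" using CoAd_push(1)[OF True, of "red i xi" V ?s] IH U(2) True by simp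
  moreover have "red (Suc i) xi (jh D (Suc i)) = base D (jh D (Suc i))"
   using CoAd_push(2)[OF True, of "red i xi" ?s] IH True by simp
  ultimately show ?thesis by (simp add: U(1) blinfun.bilinear_simps)
 next
  case False
  then have "jh D (Suc i) \<in> hh i" using Suc.prems(1)[of "Suc i"] by simp
  then have "U \<in> hh i" unfolding U(1) using U(2) Suc.prems(2) by (intro subspace_add subspace_scale subspace_hh) auto
  then show ?thesis using False IH by simp
 qed
qed

lemma br_pow_hh: "k <= DIM('a) ==> U \<in> hh k ==> (br X ^^ m) U \<in> hh k" by (induction m) (auto intro: br_hh_le)

text \<open>The push is a finite exponential series in \<open>ad (yd (Suc i))\<close> whose
  parameter is polynomial in \<open>xi\<close>. Its term of order 0 is the value before the push and
  cancels in the difference.\<close>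

lemma red_PF_step:
 fixes U :: 'a
 assumes i: "Suc i \<in> jump D" and k: "k <= DIM('a)" "Suc i <= k"
  and s: "!!V. V \<in> hh (Suc i) ==> (%xi. red i xi V) \<in> PF (hh (Suc i))"
  and U: "!!m. 0 < m ==> (%xi. red i xi ((br (yd (Suc i)) ^^ m) U)) \<in> PF (hh k)"
 shows "(%xi. red (Suc i) xi U - red i xi U) \<in> PF (hh k)"
proof -
 obtain K where K: "!!X Y. (br X ^^ K) Y = 0" using br_pow_nilpotent by blast
 have K': "(br X ^^ Suc K) Y = 0" for X Y using K by (simp add: br_simps)
 have sub: "subspace (hh k)" using k(1) by (rule subspace_hh)
 have h0: "0 \<in> hh k" using sub by (rule subspace_0)
 have i': "Suc i \<in> {1..DIM('a)}" using i by (simp add: jump_iff)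
 define p :: "('a =>L real) => real" where "p xi = red i xi (jh D (Suc i)) + (- base D (jh D (Suc i)))" for xi
 have "(%xi. red i xi (jh D (Suc i))) \<in> PF (hh k)"
  using s[OF flag_hh[OF jh_in[OF i']]] PF_mono[OF hh_mono[OF k(2,1)]] by blast
 then have p: "p \<in> PF (hh k)" unfolding p_def by (rule PF_add[OF _ PF_const[OF h0]])
 define c where "c m = (-1) ^ m / (fact m :: real)" for m
 have "red (Suc i) xi U - red i xi U = (\<Sum>m\<in>{1..<Suc K}. c m * (red i xi ((br (yd (Suc i)) ^^ m) U) * p xi ^ m))" for xi :: "'a =>L real"
 proof -
  have "red (Suc i) xi U = (\<Sum>m<Suc K. c m * (red i xi ((br (yd (Suc i)) ^^ m) U) * p xi ^ m))"
   using i by (simp only: red.simps if_True CoAd_lexp_sum[OF K'] c_def p_def mult.assoc diff_conv_add_uminus)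
  also have "... = red i xi U + (\<Sum>m\<in>{1..<Suc K}. c m * (red i xi ((br (yd (Suc i)) ^^ m) U) * p xi ^ m))"
   by (simp add: lessThan_atLeast0 sum.atLeast_Suc_lessThan c_def One_nat_def del: sum.op_ivl_Suc)
  finally show ?thesis by simp
 qed
 moreover have "(%xi. \<Sum>m\<in>{1..<Suc K}. c m * (red i xi ((br (yd (Suc i)) ^^ m) U) * p xi ^ m)) \<in> PF (hh k)"
  by (intro PF_sum[OF h0] PF_scale PF_mult[OF sub] PF_pow[OF sub] p U) auto
 ultimately show ?thesis by simp
qed

lemma red_PF:
 assumes "k <= DIM('a)" "i <= k" "V \<in> hh k"
 shows "(%xi. red i xi V) \<in> PF (hh k)" using assms
proof (induction i arbitrary: k V)
 case 0
 then show ?case using PF_linear by simp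
next
 case (Suc i)
 show ?case
 proof (cases "Suc i \<in> jump D")
  case True
  have "(%xi. red (Suc i) xi V - red i xi V) \<in> PF (hh k)"
  proof (rule red_PF_step[OF True Suc.prems(1,2)])
   show "(%xi. red i xi V) \<in> PF (hh (Suc i))" if "V \<in> hh (Suc i)" for V using Suc.prems that by (intro Suc.IH) auto
   show "(%xi. red i xi ((br (yd (Suc i)) ^^ m) V)) \<in> PF (hh k)" for m using Suc.prems by (intro Suc.IH br_pow_hh) auto
  qed
  moreover have "(%xi. red i xi V) \<in> PF (hh k)" using Suc.prems by (intro Suc.IH) auto
  ultimately have "(%xi. (red (Suc i) xi V - red i xi V) + red i xi V) \<in> PF (hh k)" by (rule PF_add)
  then show ?thesis by simp
 next
  case False
  then show ?thesis using Suc by simp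
 qed
qed

text \<open>Each correction contains at least one bracket, which lowers \<open>U\<close> from
  \<open>hh j\<close> to \<open>hh (j - 1)\<close>; thus \<open>xi U\<close> itself remains the only
  term from above.\<close>

lemma red_PF_diff:
 assumes j: "j \<in> {1..DIM('a)}" and i: "i <= j - 1" and U: "U \<in> hh j"
 shows "(%xi. red i xi U - xi U) \<in> PF (hh (j - 1))" using i
proof (induction i)
 case 0
 have "0 \<in> hh (j - 1)" using j by (intro subspace_0 subspace_hh) auto
 then show ?case using PF_const[of "hh (j - 1)" 0] by simp
next
 case (Suc i)
 then have IH: "(%xi. red i xi U - xi U) \<in> PF (hh (j - 1))" by simp
 show ?case
 proof (cases "Suc i \<in> jump D")
  case True
  have "(%xi. red (Suc i) xi U - red i xi U) \<in> PF (hh (j - 1))"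
  proof (rule red_PF_step[OF True])
   show "j - 1 <= DIM('a)" "Suc i <= j - 1" using j Suc.prems by auto
   show "(%xi. red i xi V) \<in> PF (hh (Suc i))" if "V \<in> hh (Suc i)" for V using j Suc.prems that by (intro red_PF) auto
   fix m :: nat assume "0 < m"
   then obtain m' where m: "m = Suc m'" by (cases m) auto
   have "br (yd (Suc i)) U \<in> hh (j - 1)" using br_hh[OF j U] by (rule flag_hh)
   then have "(br (yd (Suc i)) ^^ m) U \<in> hh (j - 1)" unfolding m funpow_Suc_right o_apply using j by (intro br_pow_hh) auto
   then show "(%xi. red i xi ((br (yd (Suc i)) ^^ m) U)) \<in> PF (hh (j - 1))" using j Suc.prems by (intro red_PF) auto
  qed
  from PF_add[OF this IH] show ?thesis by simp
 next
  case False
  then show ?thesis using IH by simp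
 qed
qed

text \<open>If \<open>exp X\<close> fixes the restriction of \<open>eta\<close> to
  \<open>hh i\<close>, so does \<open>exp(r X)\<close> for all natural \<open>r\<close>. A
  polynomial in \<open>r\<close> then has infinitely many zeros, and its linear coefficient is
  \<open>-eta [X, U]\<close>.\<close>

lemma stabilizer_restricted:
 fixes eta :: "'a =>L real"
 assumes i: "i <= DIM('a)" and eta: "!!U. U \<in> hh i ==> eta U = base D U"
  and m: "!!U. U \<in> hh i ==> CoAd D (lexp D X) eta U = base D U" and U: "U \<in> hh i"
 shows "base D (br X U) = 0"
proof -
 have nat: "CoAd D (lexp D (real r *R X)) eta U = base D U" if "U \<in> hh i" for r U using that
 proof (induction r arbitrary: U)
  case 0
  then show ?case using eta by simp
 next
  case (Suc r)
  have A: "Ad D (ginv (lexp D X)) U \<in> hh i" using i Suc.prems by (rule Ad_hh)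
  have "lexp D (real (Suc r) *R X) = lexp D X \<cdot> lexp D (real r *R X)" using lexp_add_scale[of 1 "real r" X] by simp
  then have "CoAd D (lexp D (real (Suc r) *R X)) eta U = CoAd D (lexp D (real r *R X)) eta (Ad D (ginv (lexp D X)) U)"
   by (simp only: CoAd_mult CoAd_apply[of "lexp D X"])
  also have "... = base D (Ad D (ginv (lexp D X)) U)" by (rule Suc.IH[OF A])
  also have "... = CoAd D (lexp D X) eta U" unfolding CoAd_apply[of "lexp D X"] by (rule eta[OF A, symmetric])
  also have "... = base D U" by (rule m[OF Suc.prems])
  finally show ?case .
 qed
 obtain K where "!!X Y. (br X ^^ K) Y = 0" using br_pow_nilpotent by blast
 \<comment> \<open>Enlarging the exponent to at least 2 guarantees that the linear coefficient
   occurs in the sum.\<close>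
 then have K: "(br X ^^ Suc (Suc K)) Y = 0" for X Y by (simp add: br_simps)
 define c where "c m = (-1) ^ m / fact m * eta ((br X ^^ m) U) - (if m = 0 then base D U else 0)" for m
 have "(\<Sum>m\<le>Suc K. c m * real r ^ m) = 0" for r
 proof -
  have "(\<Sum>m\<le>Suc K. c m * real r ^ m) = (\<Sum>m<Suc (Suc K). ((-1) ^ m / fact m * eta ((br X ^^ m) U)) * real r ^ m)
    - (\<Sum>m\<le>Suc K. if m = 0 then base D U else 0)" unfolding c_def left_diff_distrib sum_subtractf lessThan_Suc_atMost
   by (intro arg_cong2[where f = minus] refl sum.cong) auto
  also have "(\<Sum>m\<le>Suc K. if m = 0 then base D U else 0) = base D U" by (simp only: sum.delta finite_atMost) simp
  also have "(\<Sum>m<Suc (Suc K). ((-1) ^ m / fact m * eta ((br X ^^ m) U)) * real r ^ m) = base D U"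
   unfolding CoAd_lexp_sum[OF K, symmetric] by (rule nat[OF U])
  finally show ?thesis by simp
 qed
 then have "range real <= {x. (\<Sum>m\<le>Suc K. c m * x ^ m) = 0}" by auto
 moreover have "infinite (range real)" by (simp add: range_inj_infinite)
 ultimately have "infinite {x. (\<Sum>m\<le>Suc K. c m * x ^ m) = 0}" by (rule infinite_super)
 then have "c 1 = 0" unfolding polyfun_finite_roots by (auto simp: One_nat_def)
 then have "eta (br X U) = 0" by (simp add: c_def One_nat_def)
 then show ?thesis using eta[OF br_hh_le[OF i U, of X]] by simp
qed

text \<open>Two reductions from the same orbit differ by some \<open>exp X\<close> that fixes
  \<open>base D\<close> on \<open>hh (j - 1)\<close>. Since \<open>j\<close> is not a jump,
  \<open>jh D j\<close> is a lower element plus a stabiliser element, so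
  \<open>base D [X, jh D j]\<close> vanishes too and the reduced value at \<open>jh D j\<close> is
  invariant.\<close>

lemma invariant_polynomial:
 assumes j: "j \<in> {1..DIM('a)}" "j \<notin> jump D"
  and min: "!!l. l \<in> {1..<j} ==> l \<notin> jump D ==> jh D l \<in> hh (l - 1)"
 shows "\<exists>a\<in>PF (hh (j - 1)). ALL g (xi :: 'a =>L real). (\<forall>Z\<in>zc. blinfun_apply xi Z = base D Z) -->
   blinfun_apply (CoAd D g xi) (jh D j) + a (CoAd D g xi) = blinfun_apply xi (jh D j) + a xi" proof -
 define a where "a xi = red (j - 1) xi (jh D j) - blinfun_apply xi (jh D j)" for xi :: "'a =>L real"
 have a: "a \<in> PF (hh (j - 1))" unfolding a_def using jh_in[OF j(1)] by (intro red_PF_diff[OF j(1)] flag_hh) auto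
 have inv: "red (j - 1) (CoAd D g xi) (jh D j) = red (j - 1) xi (jh D j)"
  if xi: "!!Z. Z \<in> zc ==> xi Z = base D Z" for g and xi :: "'a =>L real"
 proof -
  define eta where "eta = red (j - 1) xi"
  have ag: "red (j - 1) \<zeta> U = base D U" if "!!Z. Z \<in> zc ==> \<zeta> Z = base D Z" "U \<in> hh (j - 1)" for \<zeta> :: "'a =>L real" and U
  proof (rule red_agrees[OF min _ that])
   show "l \<in> {1..<j}" if "l \<in> {1..j - 1}" for l using that j(1) by auto
   show "j - 1 <= DIM('a)" using j(1) by auto
  qed
  obtain k where k: "eta = CoAd D k xi" using red_CoAd unfolding eta_def by blast
  obtain k' where k': "red (j - 1) (CoAd D g xi) = CoAd D k' (CoAd D g xi)" using red_CoAd by blast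
  define X where "X = llog D (k' \<cdot> g \<cdot> ginv k)"
  have X: "red (j - 1) (CoAd D g xi) = CoAd D (lexp D X) eta" by (simp add: X_def k k' CoAd_mult)
  have eta: "eta U = base D U" if "U \<in> hh (j - 1)" for U unfolding eta_def using xi that by (rule ag)
  have Xeta: "CoAd D (lexp D X) eta U = base D U" if "U \<in> hh (j - 1)" for U
   unfolding X[symmetric] using that by (intro ag) (auto simp: CoAd_zc xi)
  have j1: "j - 1 <= DIM('a)" using j(1) by auto
  have st: "base D (br X U) = 0" if "U \<in> hh (j - 1)" for U by (rule stabilizer_restricted[OF j1 eta Xeta that])
  obtain V T where VT: "jh D j = V + T" "V \<in> flag D (j - 1)" "T \<in> stab D" using j by (auto simp: jump_iff)
  have "base D (br X T) = 0" using VT(3) br_antisym[of X T] by (simp add: stab_def blinfun.minus_right)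
  then have bj: "base D (br X (jh D j)) = 0" using st[OF flag_hh[OF VT(2)]] by (simp add: VT(1) br_simps blinfun.add_right)
  have jh: "jh D j \<in> hh j" using jh_in[OF j(1)] by (rule flag_hh)
  have "eta (br X (Ad D h (jh D j))) = 0" for h
  proof -
   have "Ad D h (jh D j) - jh D j \<in> hh (j - 1)" by (rule central_step_Ad(1)[OF hh_step[OF j(1)] jh])
   from st[OF this] bj have "base D (br X (Ad D h (jh D j))) = 0" by (simp add: br_simps blinfun.diff_right)
   moreover have "br X (Ad D h (jh D j)) \<in> hh (j - 1)" using j(1) by (intro flag_hh br_hh Ad_hh jh) auto
   ultimately show ?thesis using eta by simp
  qed
  then have "((%s. CoAd D (lexp D (s *R X)) eta (jh D j)) has_real_derivative 0) (at s)" for s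
   using CoAd_curve[of X eta "jh D j" s] by simp
  from affine_of_const_derivative[OF this, of 1] show ?thesis by (simp add: X) (simp add: eta_def)
 qed
 show ?thesis
 proof (intro bexI[OF _ a] allI impI)
  fix g and xi :: "'a =>L real" assume "\<forall>Z\<in>zc. blinfun_apply xi Z = base D Z"
  then show "blinfun_apply (CoAd D g xi) (jh D j) + a (CoAd D g xi) = blinfun_apply xi (jh D j) + a xi"
   using inv[of xi g] by (simp add: a_def)
 qed
qed

end

section \<open>Schur's lemma for symmetric operators\<close>

context kirillov_rep
begin

text \<open>The form \<open>inner (T u) (T v)\<close> is complete because \<open>T\<close> is
  closed, so \<open>closed_form_scalar\<close> applies to it.\<close>

lemma closed_operator_scalar:
 assumes E: "subspace E" and EC: "!!c u. u \<in> E ==> c *C u \<in> E" and EU: "!!g u. u \<in> E ==> rep D g u \<in> E"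
  and Enz: "e \<in> E" "e ~= 0" and add: "!!u v. u \<in> E ==> v \<in> E ==> T (u + v) = T u + T v"
  and scale: "!!c u. u \<in> E ==> T (c *C u) = c *C T u" and U: "!!g u. u \<in> E ==> T (rep D g u) = rep D g (T u)"
  and closed: "!!s w z. (!!n. s n \<in> E) ==> s ----> w ==> (%n. T (s n)) ----> z ==> w \<in> E & T w = z"
 shows "E = UNIV & (EX c. ALL u v. inner (T u) (T v) = c * inner u v)"
proof (rule closed_form_scalar[where e = e])
 have scaleR: "T (r *R u) = r *R T u" if "u \<in> E" for r u using scale[OF that, of "of_real r"] by (simp add: scaleR_scaleC)
 have diff: "T (u - v) = T u - T v" if "u \<in> E" "v \<in> E" for u v
  using add[OF that(1) subspace_scale[OF E that(2)], of "-1"] scaleR[OF that(2), of "-1"] by simp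
 show "inner (T (u + v)) (T w) = inner (T u) (T w) + inner (T v) (T w)" if "u \<in> E" "v \<in> E" for u v w
  using add[OF that] by (simp add: inner_add_left)
 show "inner (T (r *R u)) (T v) = r * inner (T u) (T v)" if "u \<in> E" for r u v using scaleR[OF that] by simp
 show "inner (T (\<i> *C u)) (T (\<i> *C v)) = inner (T u) (T v)" if "u \<in> E" "v \<in> E" for u v
  using scale that by (simp add: inner_scaleC_i)
 show "inner (T (rep D g u)) (T (rep D g v)) = inner (T u) (T v)" if "u \<in> E" "v \<in> E" for g u v
  using U that by (simp add: inner_U)
 fix s assume s: "!!n. s n \<in> E" "Cauchy s"
  "!!e. 0 < e ==> EX N. \<forall>m\<ge>N. \<forall>n\<ge>N. inner (T (s m - s n)) (T (s m - s n)) < e"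
 have "Cauchy (%n. T (s n))" unfolding Cauchy_def
 proof (intro allI impI)
  fix e :: real assume e: "0 < e"
  obtain N where N: "!!m n. m >= N ==> n >= N ==> inner (T (s m - s n)) (T (s m - s n)) < e^2" using s(3)[of "e^2"] e by auto
  have "dist (T (s m)) (T (s n)) < e" if "m >= N" "n >= N" for m n
  proof -
   have "(norm (T (s m) - T (s n)))^2 < e^2" using N[OF that] diff[OF s(1) s(1)] by (simp add: power2_norm_eq_inner)
   then show ?thesis using e unfolding dist_norm by (intro power_less_imp_less_base[of _ 2 e]) auto
  qed
  then show "EX N. \<forall>m\<ge>N. \<forall>n\<ge>N. dist (T (s m)) (T (s n)) < e" by blast
 qed
 then obtain z where z: "(%n. T (s n)) ----> z" using Cauchy_convergent_iff convergent_def by blast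
 obtain w where w: "s ----> w" using s(2) Cauchy_convergent_iff convergent_def by blast
 have wE: "w \<in> E" "T w = z" using closed[OF s(1) w z] by auto
 have "(%n. inner (T (s n) - z) (T (s n) - z)) ----> inner (z - z) (z - z)" by (intro tendsto_intros z)
 then have "(%n. inner (T (s n - w)) (T (s n - w))) ----> 0" using diff[OF s(1) wE(1)] by (simp add: wE(2))
 then show "\<exists>w\<in>E. s ----> w & (%n. inner (T (s n - w)) (T (s n - w))) ----> 0" using w wE by blast
qed (use E EC EU Enz in \<open>auto simp: inner_commute\<close>)

text \<open>\<open>W\<close> is dense, so \<open>A\<close> has an adjoint \<open>T\<close>, which is
  closed, invariant and extends \<open>A\<close>. The forms of \<open>T\<close> and of
  \<open>T + 1\<close> are both multiples of the inner product; their difference determines the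
  symmetric part of \<open>T\<close>, which on \<open>W\<close> is \<open>A\<close>.\<close>

lemma symmetric_operator_scalar:
 assumes W: "!!u v. u \<in> W ==> v \<in> W ==> u + v \<in> W" "!!c v. v \<in> W ==> c *C v \<in> W"
   "!!g v. v \<in> W ==> rep D g v \<in> W" and e: "e \<in> W" "e ~= 0"
  and U: "!!g u. u \<in> W ==> A (rep D g u) = rep D g (A u)"
  and sym: "!!u v. u \<in> W ==> v \<in> W ==> cinner (A u) v = cinner u (A v)"
 shows "EX r::real. \<forall>w\<in>W. A w = r *R w"
proof -
 have dense: "closure W = UNIV" by (rule invariant_subspace_dense[OF W e])
 have zero: "z = 0" if "!!w. w \<in> W ==> cinner w z = 0" for z
 proof -
  have "closure W <= {w. cinner w z = 0}"
   using that by (intro closure_minimal closed_Collect_eq continuous_intros cinner.continuous_on) auto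
  then have "cinner z z = 0" using dense by auto
  then show ?thesis by (simp add: cinner_self)
 qed
 have zero2: "z = 0" if "!!w. w \<in> W ==> inner w z = 0" for z
 proof -
  have "closure W <= {w. inner w z = 0}" using that by (intro closure_minimal closed_Collect_eq continuous_intros) auto
  then have "z \<in> {w. inner w z = 0}" using dense by blast
  then show ?thesis by simp
 qed
 define E where "E = {u. EX z. \<forall>w\<in>W. cinner (A w) u = cinner w z}"
 define T where "T u = (SOME z. \<forall>w\<in>W. cinner (A w) u = cinner w z)" for u
 have T: "cinner (A w) u = cinner w (T u)" if "u \<in> E" "w \<in> W" for u w
  using someI_ex[of "%z. \<forall>w\<in>W. cinner (A w) u = cinner w z"] that unfolding E_def T_def by blast
 have TI: "u \<in> E & T u = z" if z: "!!w. w \<in> W ==> cinner (A w) u = cinner w z" for u z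
 proof -
  have uE: "u \<in> E" unfolding E_def using z by blast
  have "T u - z = 0" by (rule zero) (simp add: cinner_simps T[OF uE, symmetric] z)
  then show ?thesis using uE by simp
 qed
 have TW: "u \<in> E" "T u = A u" if "u \<in> W" for u using TI[of u "A u"] sym that by auto
 have E0: "0 \<in> E" using TI[of 0 0] by (simp add: cinner_simps)
 have Eadd: "u + v \<in> E & T (u + v) = T u + T v" if "u \<in> E" "v \<in> E" for u v
  using that by (intro TI) (simp add: cinner_simps T)
 have Esc: "c *C u \<in> E & T (c *C u) = c *C T u" if "u \<in> E" for c u using that by (intro TI) (simp add: cinner_simps T)
 have EU: "rep D g u \<in> E & T (rep D g u) = rep D g (T u)" if "u \<in> E" for g u
 proof (rule TI)
  fix w assume w: "w \<in> W"
  have "cinner (A w) (rep D g u) = cinner (rep D (ginv g) (A w)) u" using rep_cinner_inv[of "ginv g" "A w" u] by simp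
  also have "... = cinner (rep D (ginv g) w) (T u)" using T[OF that W(3)[OF w]] U[OF w] by simp
  also have "... = cinner w (rep D g (T u))" using rep_cinner_inv[of "ginv g" w "T u"] by simp
  finally show "cinner (A w) (rep D g u) = cinner w (rep D g (T u))" .
 qed
 have sub: "subspace E" using E0 Eadd Esc by (auto simp: subspace_def scaleR_scaleC)
 have closed: "w \<in> E & T w = z" if s: "!!n. s n \<in> E" "s ----> w" "(%n. T (s n)) ----> z" for s w z
 proof (rule TI)
  fix v assume v: "v \<in> W"
  have "(%n. cinner (A v) (s n)) ----> cinner (A v) w" by (intro cinner.tendsto tendsto_const s)
  moreover have "(%n. cinner v (T (s n))) ----> cinner v z" by (intro cinner.tendsto tendsto_const s)
  ultimately show "cinner (A v) w = cinner v z" using T[OF s(1) v] LIMSEQ_unique by auto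
 qed
 have 1: "E = UNIV & (EX c. ALL u v. inner (T u) (T v) = c * inner u v)"
  by (rule closed_operator_scalar[OF sub _ _ TW(1)[OF e(1)] e(2)]) (simp_all add: Eadd Esc EU, rule closed, assumption+)
 have 2: "E = UNIV & (EX c. ALL u v. inner (T u + u) (T v + v) = c * inner u v)"
 proof (rule closed_operator_scalar[OF sub _ _ TW(1)[OF e(1)] e(2)])
  fix s w z assume s: "!!n. s n \<in> E" "s ----> w" "(%n. T (s n) + s n) ----> z"
  have "(%n. (T (s n) + s n) - s n) ----> z - w" by (intro tendsto_diff s)
  then have "(%n. T (s n)) ----> z - w" by simp
  from closed[OF s(1,2) this] show "w \<in> E & T w + w = z" by simp
 qed (use Eadd Esc EU in \<open>auto simp: scaleC_add_right U_add\<close>)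
 obtain c where c: "!!u v. inner (T u) (T v) = c * inner u v" using 1 by blast
 obtain c' where c': "!!u v. inner (T u + u) (T v + v) = c' * inner u v" using 2 by blast
 \<comment> \<open>Expanding \<open>inner (A v + v) (A w + w)\<close> on \<open>W\<close> gives
   \<open>c + 1\<close> times the inner product plus twice \<open>inner v (A w)\<close>.\<close>
 define r where "r = (c' - c - 1) / 2"
 show ?thesis
 proof (intro exI[of _ r] ballI)
  fix w assume w: "w \<in> W"
  have "inner v (A w - r *R w) = 0" if v: "v \<in> W" for v
  proof -
   have "inner v (A w) = inner (A v) w" using sym[OF v w] by (simp add: inner_eq_Re_cinner)
   then show ?thesis using c'[of v w] c[of v w] TW(2)[OF v] TW(2)[OF w]
    by (simp add: inner_add_left inner_add_right inner_diff_right r_def field_simps)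
  qed
  then have "A w - r *R w = 0" by (rule zero2)
  then show "A w = r *R w" by simp
 qed
qed

section \<open>Operators commuting with the representation\<close>

text \<open>The symmetrisation map, written on lists representing polynomials.\<close>

definition opL :: "'a power_sum => 'h => 'h" where
 "opL L w = (\<Sum>(c, Y, k)\<leftarrow>L. c *R (PP Y ^^ k) w)"

lemma opL_simps [simp]: "opL [] w = 0" "opL ((c, Y, k) # L) w = c *R (PP Y ^^ k) w + opL L w"
 "opL (L @ L') w = opL L w + opL L' w" by (simp_all add: opL_def)

text \<open>Makes symmetrisation well defined: on \<open>Wk K\<close> the operator depends only on
  the function \<open>ev L\<close> on functionals with the prescribed values on the centre.\<close>

lemma power_relation_opL:
 assumes k: "!!c Y k. (c, Y, k) \<in> set L ==> k <= K"
  and rel: "!!xi::'a =>L real. (!!Z. Z \<in> zc ==> blinfun_apply xi Z = base D Z) ==> ev L xi = 0"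
  and w: "w \<in> Wk K"
 shows "opL L w = 0"
proof -
 define c where "c i = fst (L ! i)" for i
 define Y where "Y i = fst (snd (L ! i))" for i
 define m where "m i = snd (snd (L ! i))" for i
 have L: "L ! i = (c i, Y i, m i)" for i by (simp add: c_def Y_def m_def)
 have "(\<Sum>i\<in>{0..<length L}. c i *R (PP (Y i) ^^ m i) w) = 0"
 proof (rule power_relation_PP[OF _ _ _ w])
  show "m i <= K" if "i \<in> {0..<length L}" for i using k[of "c i" "Y i" "m i"] nth_mem[of i L] that by (simp add: L)
  fix xi :: "'a =>L real" assume xi: "!!Z. Z \<in> zc ==> xi Z = base D Z"
  have "ev L xi = 0" using xi by (rule rel)
  then show "(\<Sum>i\<in>{0..<length L}. c i * xi (Y i) ^ m i) = 0" by (simp add: ev_def sum_list_sum_nth L)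
 qed simp
 then show ?thesis by (simp add: opL_def sum_list_sum_nth L)
qed

lemma PP_pow_rep: "w \<in> Wk k ==> (PP Y ^^ k) (rep D g w) = rep D g ((PP (Ad D (ginv g) Y) ^^ k) w)"
proof (induction k arbitrary: w)
 case (Suc k)
 have "PP Y (rep D g w) = rep D g (PP (Ad D (ginv g) Y) w)" using rep_Wk[OF Suc.prems] by (simp add: PP_def U_scaleC)
 then show ?case using Suc.IH[OF PP_Wk[OF Suc.prems]] by (simp add: funpow_Suc_right del: funpow.simps)
qed simp

lemma PP_symmetric: "u \<in> Wk (Suc k) ==> v \<in> Wk (Suc k) ==> cinner (PP Y u) v = cinner u (PP Y v)"
 using dpi_skew[of u k v k Y] by (simp add: PP_def cinner_simps)

text \<open>Stated for an arbitrary form, to serve both the scalar product and the weighted form on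
  \<open>G/Z\<close>.\<close>

lemma PP_pow_form:
 assumes B: "!!j u v. u \<in> Wk (Suc j) ==> v \<in> Wk (Suc j) ==> B (PP Y u) v = B u (PP Y v)"
  and "u \<in> Wk k" "v \<in> Wk k"
 shows "B ((PP Y ^^ k) u) v = B u ((PP Y ^^ k) v)"
proof -
 have "B ((PP Y ^^ k) u) v = B u ((PP Y ^^ k) v)" if "u \<in> Wk k" "v \<in> Wk k" for k u v using that
 proof (induction k arbitrary: u v)
  case (Suc k)
   have uk: "(PP Y ^^ j) u \<in> Wk (Suc k - j)" if "j <= Suc k" for j using that
  proof (induction j)
   case (Suc j)
   have "(PP Y ^^ j) u \<in> Wk (Suc (k - j))" using Suc by (simp add: Suc_diff_le)
   from PP_Wk[OF this, of Y] show ?case by simp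
  qed (simp add: Suc.prems)
  have "(PP Y ^^ k) u \<in> Wk (Suc 0)" using uk[of k] by simp
  moreover have "v \<in> Wk (Suc 0)" using Suc.prems(2) Wk_antimono[of "Suc 0" "Suc k"] by auto
  ultimately have "B ((PP Y ^^ Suc k) u) v = B ((PP Y ^^ k) u) (PP Y v)" using B[of _ 0] by simp
  also have "... = B u ((PP Y ^^ k) (PP Y v))" using Suc.prems Wk_antimono[of k "Suc k"] by (intro Suc.IH PP_Wk) auto
  finally show ?case by (simp add: funpow_Suc_right del: funpow.simps)
 qed simp
 then show ?thesis using assms(2,3) .
qed

lemma invariant_opL_scalar:
 assumes k: "!!c Y k. (c, Y, k) \<in> set L ==> k <= K"
  and inv: "!!g (xi::'a =>L real). (!!Z. Z \<in> zc ==> blinfun_apply xi Z = base D Z) ==> ev L (CoAd D g xi) = ev L xi"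
 shows "EX r::real. \<forall>w\<in>Wk K. opL L w = r *R w"
proof -
 obtain e where e: "e \<in> Wk K" "e ~= 0" using Wk_nontrivial by blast
 show ?thesis
 proof (rule symmetric_operator_scalar[OF Wk_add Wk_scaleC _ e])
  show "rep D g w \<in> Wk K" if "w \<in> Wk K" for g w using rep_Wk[OF that] by blast
  show "opL L (rep D g w) = rep D g (opL L w)" if w: "w \<in> Wk K" for g w
  proof -
   \<comment> \<open>\<open>L1\<close> is the polynomial of \<open>L\<close> moved by the coadjoint
     action and \<open>L2\<close> is minus the polynomial of \<open>L\<close>. Invariance makes the
     concatenation a relation among powers.\<close>
   define L1 where "L1 = map (%(c, Y, k). (c, Ad D (ginv g) Y, k)) L"
   define L2 where "L2 = map (%(c, Y, k). (- c, Y, k)) L"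
   have "opL (L1 @ L2) w = 0"
   proof (rule power_relation_opL[OF _ _ w])
    show "k' <= K" if "(c, Y, k') \<in> set (L1 @ L2)" for c Y k' using that k by (auto simp: L1_def L2_def)
    fix xi :: "'a =>L real" assume xi: "!!Z. Z \<in> zc ==> xi Z = base D Z"
    have "ev L1 xi = ev L (CoAd D g xi)" unfolding L1_def by (induction L) (auto simp: CoAd_apply)
    moreover have "ev L2 xi = - ev L xi" unfolding L2_def by (induction L) auto
    ultimately show "ev (L1 @ L2) xi = 0" using inv[of xi g, OF xi] by simp
   qed
   moreover have "opL L2 w = - opL L w" unfolding L2_def by (induction L) auto
   ultimately have eq: "opL L1 w = opL L w" by simp
   have "opL L (rep D g w) = rep D g (opL L1 w)" using k unfolding L1_def
   proof (induction L)
    case (Cons a L)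
    obtain c Y m where a: "a = (c, Y, m)" by (cases a)
    have "m <= K" using Cons.prems[of c Y m] by (simp add: a)
    then have "w \<in> Wk m" using w Wk_antimono by blast
    moreover have "opL L (rep D g w) = rep D g (opL (map (%(c, Y, k). (c, Ad D (ginv g) Y, k)) L) w)"
     proof (rule Cons.IH)
     fix c' Y' k' assume "(c', Y', k') \<in> set L"
     then show "k' <= K" using Cons.prems[of c' Y' k'] by simp
    qed
    ultimately show ?case by (simp add: a PP_pow_rep U_add U_scaleR)
   qed simp
   then show ?thesis by (simp add: eq)
  qed
  show "cinner (opL L u) v = cinner u (opL L v)" if uv: "u \<in> Wk K" "v \<in> Wk K" for u v using k
  proof (induction L)
   case (Cons a L)
   obtain c Y m where a: "a = (c, Y, m)" by (cases a)
   have "m <= K" using Cons.prems[of c Y m] by (simp add: a)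
   then have "u \<in> Wk m" "v \<in> Wk m" using uv Wk_antimono by blast+
   then have "cinner ((PP Y ^^ m) u) v = cinner u ((PP Y ^^ m) v)" by (rule PP_pow_form[where B = cinner, rotated]) (rule PP_symmetric)
   moreover have "cinner (opL L u) v = cinner u (opL L v)" proof (rule Cons.IH)
     fix c' Y' k' assume "(c', Y', k') \<in> set L"
     then show "k' <= K" using Cons.prems[of c' Y' k'] by simp
    qed
   ultimately show ?case by (simp add: a cinner_simps scaleR_scaleC)
  qed (simp add: cinner_simps)
 qed auto
qed

end

section \<open>Integration over the group modulo its centre\<close>

locale square_integrable_rep = kirillov_rep D
 for D :: "('g::{t2_space, second_countable_topology}, 'a::euclidean_space, 'h::chilbert_space) kdata" +
 assumes square_int: "square_integrable_mod_center D"
begin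

lemma lmult_continuous: "continuous_on UNIV (%x. g \<cdot> x)"
proof -
 have "continuous_on UNIV (%x. lexp D (bch (llog D g) (llog D x)))"
  by (intro continuous_on_compose2[OF lexp_continuous] continuous_bch continuous_on_const llog_continuous) auto
 then show ?thesis by (simp add: lexp_bch)
qed

definition qnu :: "'g set measure" where
 "qnu = (SOME \<nu>. invariant_measure (grp D) (center D) \<nu> &
   (EX phi. phi ~= 0 & integrable \<nu> (on_coset (%g. (cmod (cinner (rep D g phi) phi))\<^sup>2))))"

lemma qnu_ex: "invariant_measure (grp D) (center D) qnu &
  (EX phi. phi ~= 0 & integrable qnu (on_coset (%g. (cmod (cinner (rep D g phi) phi))\<^sup>2)))" proof -
 have "\<exists>\<nu>. invariant_measure (grp D) (center D) \<nu> &
   (EX phi. phi ~= 0 & integrable \<nu> (on_coset (%g. (cmod (cinner (rep D g phi) phi))\<^sup>2)))"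
  using square_int unfolding square_integrable_mod_center_def by blast
 from someI_ex[OF this] show ?thesis unfolding qnu_def .
qed

definition rp :: "'g set => 'g" where "rp C = (SOME x. x \<in> C)"

lemma on_coset_rp: "on_coset F = (%C. F (rp C))" by (simp add: on_coset_def rp_def fun_eq_iff)

abbreviation cs :: "'g => 'g set" where "cs x \<equiv> x <#\<^bsub>grp D\<^esub> center D"

lemma cs_eq: "cs x = {x \<cdot> z | z. z \<in> center D}" by (auto simp: l_coset_def)

lemma one_center: "gone \<in> center D" by (simp add: center_def)

lemma space_qnu: "space qnu = range cs"
 and sets_qnu: "sets qnu = sets (sigma (range cs) {\<U>. \<U> <= range cs & open (\<Union>\<U>)})"
 and qnu_invariant: "\<A> \<in> sets qnu ==> emeasure qnu ((%C. g <#\<^bsub>grp D\<^esub> C) ` \<A>) = emeasure qnu \<A>"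
 and qnu_nonzero: "emeasure qnu (space qnu) ~= 0" using qnu_ex by (auto simp: invariant_measure_def left_cosets_def)

lemma center_mult: "z \<in> center D ==> w \<in> center D ==> z \<cdot> w \<in> center D"
 and center_inv: "z \<in> center D ==> ginv z \<in> center D"
proof -
 assume z: "z \<in> center D"
 have "llog D (ginv z) = - llog D z" using lexp_minus[of "llog D z"] llog_lexp[of "- llog D z"] by simp
 then show "ginv z \<in> center D" using z subspace_neg[OF subspace_zc] by (simp add: center_iff)
 assume w: "w \<in> center D"
 have "llog D (z \<cdot> w) = llog D z + llog D w" using bch_zc[of "llog D w" "llog D z"] w by (simp add: center_iff bch_def)
 then show "z \<cdot> w \<in> center D" using z w subspace_add[OF subspace_zc] by (simp add: center_iff)
qed

lemma cs_center:
 assumes z: "z \<in> center D"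
 shows "cs (x \<cdot> z) = cs x"
proof
 show "cs (x \<cdot> z) <= cs x" using center_mult[OF z] by (auto simp: cs_eq assoc)
 show "cs x <= cs (x \<cdot> z)"
 proof
  fix y assume "y \<in> cs x"
  then obtain w where w: "w \<in> center D" "y = x \<cdot> w" by (auto simp: cs_eq)
  then have "y = x \<cdot> z \<cdot> (ginv z \<cdot> w)" by (simp add: assoc)
  then show "y \<in> cs (x \<cdot> z)" unfolding cs_eq using center_mult[OF center_inv[OF z] w(1)] by blast
 qed
qed

lemma rp_cs: "\<exists>z\<in>center D. rp (cs x) = x \<cdot> z"
proof -
 have "x \<cdot> gone \<in> cs x" using one_center unfolding cs_eq by blast
 then have "rp (cs x) \<in> cs x" unfolding rp_def by (rule someI)
 then show ?thesis by (auto simp: cs_eq)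
qed

lemma lmult_cs: "g <#\<^bsub>grp D\<^esub> cs x = cs (g \<cdot> x)" by (auto simp: l_coset_def assoc)

text \<open>The continuous functions that descend to \<open>G/Z\<close>; for them the choice of the
  representative \<open>rp\<close> is immaterial.\<close>

definition cfun :: "('g => 'b::topological_space) => bool" where
 "cfun F \<longleftrightarrow> continuous_on UNIV F & (ALL x. \<forall>z\<in>center D. F (x \<cdot> z) = F x)"

lemma cfun_rp: "cfun F ==> F (rp (cs x)) = F x" using rp_cs[of x] by (auto simp: cfun_def)

lemma cfun_lmult: "cfun F ==> cfun (%x. F (g \<cdot> x))"
 unfolding cfun_def using continuous_on_compose2[OF _ lmult_continuous[of g], of UNIV F] by (auto simp: assoc[symmetric])

lemma cfun_rp_lmult:
 assumes F: "cfun F" and C: "C \<in> space qnu"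
 shows "F (g \<cdot> rp C) = F (rp (g <#\<^bsub>grp D\<^esub> C))"
proof -
 obtain x where x: "C = cs x" using C by (auto simp: space_qnu)
 show ?thesis unfolding x lmult_cs cfun_rp[OF F] cfun_rp[OF cfun_lmult[OF F]] ..
qed

lemma cfun_measurable:
 fixes F :: "'g => 'b::topological_space"
 assumes F: "cfun F"
 shows "(%C. F (rp C)) \<in> borel_measurable qnu"
proof (rule borel_measurableI)
 fix S :: "'b set" assume S: "open S"
 let ?\<U> = "(%C. F (rp C)) -` S \<inter> space qnu"
 have "\<Union>?\<U> = F -` S"
 proof
  show "\<Union>?\<U> <= F -` S"
  proof
   fix y assume "y \<in> \<Union>?\<U>"
   then obtain x where x: "F (rp (cs x)) \<in> S" "y \<in> cs x" by (auto simp: space_qnu)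
   then have "F y = F x" using F by (auto simp: cs_eq cfun_def)
   then show "y \<in> F -` S" using x(1) by (simp add: cfun_rp[OF F])
  qed
  show "F -` S <= \<Union>?\<U>"
  proof
   fix x assume "x \<in> F -` S"
   then have "cs x \<in> ?\<U>" by (simp add: space_qnu cfun_rp[OF F])
   moreover have "x \<in> cs x" unfolding cs_eq using one_center by force
   ultimately show "x \<in> \<Union>?\<U>" by blast
  qed
 qed
 moreover have "open (F -` S)" using F S by (auto simp: cfun_def open_vimage)
 ultimately have "?\<U> \<in> {\<U>. \<U> <= range cs & open (\<Union>\<U>)}" by (auto simp: space_qnu)
 then show "?\<U> \<in> sets qnu" unfolding sets_qnu by (rule in_measure_of[rotated]) auto
qed

lemma lmult_measurable: "(%C. g <#\<^bsub>grp D\<^esub> C) \<in> measurable qnu qnu"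
proof -
 let ?G = "{\<U>. \<U> <= range cs & open (\<Union>\<U>)}"
 have "(%C. g <#\<^bsub>grp D\<^esub> C) \<in> measurable qnu (sigma (range cs) ?G)"
 proof (rule measurable_measure_of)
  show "?G <= Pow (range cs)" by blast
  show "(%C. g <#\<^bsub>grp D\<^esub> C) \<in> space qnu \<rightarrow> range cs" by (auto simp: space_qnu lmult_cs)
  fix \<U> assume U: "\<U> \<in> ?G"
  let ?V = "(%C. g <#\<^bsub>grp D\<^esub> C) -` \<U> \<inter> space qnu"
  have "\<Union>?V = (%x. g \<cdot> x) -` (\<Union>\<U>)"
  proof
   show "\<Union>?V <= (%x. g \<cdot> x) -` (\<Union>\<U>)"
   proof
    fix y assume "y \<in> \<Union>?V"
    then obtain C where C: "g <#\<^bsub>grp D\<^esub> C \<in> \<U>" "y \<in> C" by auto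
    have "g \<cdot> y \<in> g <#\<^bsub>grp D\<^esub> C" using C(2) by (auto simp: l_coset_def)
    then show "y \<in> (%x. g \<cdot> x) -` (\<Union>\<U>)" using C(1) by blast
   qed
   show "(%x. g \<cdot> x) -` (\<Union>\<U>) <= \<Union>?V"
   proof
    fix y assume "y \<in> (%x. g \<cdot> x) -` (\<Union>\<U>)"
    then obtain C where C: "C \<in> \<U>" "g \<cdot> y \<in> C" by auto
    then obtain x where x: "C = cs x" using U by blast
    then obtain z where z: "z \<in> center D" "g \<cdot> y = x \<cdot> z" using C(2) by (auto simp: cs_eq)
    have "cs (g \<cdot> y) = cs x" unfolding z(2) by (rule cs_center[OF z(1)])
    then have "cs y \<in> ?V" using C(1) x by (simp add: lmult_cs space_qnu)
    moreover have "y \<in> cs y" unfolding cs_eq using one_center by force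
    ultimately show "y \<in> \<Union>?V" by blast
   qed
  qed
  moreover have "open ((%x. g \<cdot> x) -` (\<Union>\<U>))" using U lmult_continuous by (auto intro: open_vimage)
  ultimately have "?V \<in> ?G" by (auto simp: space_qnu)
  then show "?V \<in> sets qnu" unfolding sets_qnu by (rule in_measure_of[rotated]) auto
 qed
 then show ?thesis using measurable_cong_sets[OF refl sets_qnu] by blast
qed

lemma lmult_inverse: "C \<in> space qnu ==> ginv g <#\<^bsub>grp D\<^esub> (g <#\<^bsub>grp D\<^esub> C) = C"
 by (auto simp: space_qnu lmult_cs)

lemma lmult_space: "C \<in> space qnu ==> g <#\<^bsub>grp D\<^esub> C \<in> space qnu" by (auto simp: space_qnu lmult_cs)

lemma emeasure_lmult_vimage:
 assumes A: "A \<in> sets qnu"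
 shows "emeasure qnu ((%C. g <#\<^bsub>grp D\<^esub> C) -` A \<inter> space qnu) = emeasure qnu A"
proof -
 have "(%C. g <#\<^bsub>grp D\<^esub> C) -` A \<inter> space qnu = (%C. ginv g <#\<^bsub>grp D\<^esub> C) ` A"
 proof
  show "(%C. g <#\<^bsub>grp D\<^esub> C) -` A \<inter> space qnu <= (%C. ginv g <#\<^bsub>grp D\<^esub> C) ` A"
  proof
   fix C assume C: "C \<in> (%C. g <#\<^bsub>grp D\<^esub> C) -` A \<inter> space qnu"
   then have "C = ginv g <#\<^bsub>grp D\<^esub> (g <#\<^bsub>grp D\<^esub> C)" using lmult_inverse by simp
   then show "C \<in> (%C. ginv g <#\<^bsub>grp D\<^esub> C) ` A" using C by blast
  qed
  show "(%C. ginv g <#\<^bsub>grp D\<^esub> C) ` A <= (%C. g <#\<^bsub>grp D\<^esub> C) -` A \<inter> space qnu"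
  proof
   fix C assume "C \<in> (%C. ginv g <#\<^bsub>grp D\<^esub> C) ` A"
   then obtain B where B: "B \<in> A" "C = ginv g <#\<^bsub>grp D\<^esub> B" by blast
   have Bs: "B \<in> space qnu" using sets.sets_into_space[OF A] B(1) by blast
   have "g <#\<^bsub>grp D\<^esub> C = B" using lmult_inverse[OF Bs, of "ginv g"] by (simp add: B(2))
   then show "C \<in> (%C. g <#\<^bsub>grp D\<^esub> C) -` A \<inter> space qnu" using B lmult_space[OF Bs] by simp
  qed
 qed
 then show ?thesis using qnu_invariant[OF A, of "ginv g"] by simp
qed

lemma distr_lmult: "distr qnu qnu (%C. g <#\<^bsub>grp D\<^esub> C) = qnu"
 by (rule measure_eqI) (auto simp: emeasure_distr lmult_measurable emeasure_lmult_vimage)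

lemma cfun_translate:
 fixes F :: "'g => 'b::{banach, second_countable_topology}"
 assumes F: "cfun F"
 shows "(LINT C|qnu. F (g \<cdot> rp C)) = (LINT C|qnu. F (rp C))"
  and "integrable qnu (%C. F (rp C)) ==> integrable qnu (%C. F (g \<cdot> rp C))"
proof -
 have "(LINT C|qnu. F (g \<cdot> rp C)) = (LINT C|qnu. F (rp (g <#\<^bsub>grp D\<^esub> C)))"
  by (rule Bochner_Integration.integral_cong[OF refl cfun_rp_lmult[OF F]])
 also have "... = (LINT C|distr qnu qnu (%C. g <#\<^bsub>grp D\<^esub> C). F (rp C))"
  by (rule integral_distr[OF lmult_measurable cfun_measurable[OF F], symmetric])
 finally show "(LINT C|qnu. F (g \<cdot> rp C)) = (LINT C|qnu. F (rp C))" by (simp add: distr_lmult)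
 assume "integrable qnu (%C. F (rp C))"
 then have "integrable qnu (%C. F (rp (g <#\<^bsub>grp D\<^esub> C)))"
  using integrable_distr_eq[OF lmult_measurable cfun_measurable[OF F], of g] by (simp add: distr_lmult)
 then show "integrable qnu (%C. F (g \<cdot> rp C))" by (subst Bochner_Integration.integrable_cong[OF refl cfun_rp_lmult[OF F]])
qed

text \<open>The invariant measure has full support: by Lindelof, countably many translates of the
  open set where \<open>F\<close> is nonzero cover the group. If one of them were null, all would
  be, and the measure would vanish.\<close>

lemma cfun_nonzero:
 fixes F :: "'g => real"
 assumes F: "cfun F" and x: "F x ~= 0"
 shows "\<not> (AE C in qnu. F (rp C) = 0)"
proof
 assume AE: "AE C in qnu. F (rp C) = 0"
 define N where "N = {C\<in>space qnu. F (rp C) ~= 0}"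
 have N: "N \<in> sets qnu" unfolding N_def using cfun_measurable[OF F] by measurable
 have N0: "emeasure qnu N = 0" using AE N unfolding N_def by (subst (asm) AE_iff_measurable[OF _ refl]) auto
 define V where "V g = (%y. g \<cdot> y) -` {y. F y ~= 0}" for g
 have "open {y. F y ~= 0}" using F by (intro open_Collect_neq continuous_on_const) (auto simp: cfun_def)
 then have Vo: "open (V g)" for g unfolding V_def by (rule open_vimage[OF _ lmult_continuous])
 have cover: "y \<in> V (x \<cdot> ginv y)" for y using x by (simp add: V_def assoc)
 obtain \<F> where \<F>: "\<F> <= range V" "countable \<F>" "\<Union>\<F> = \<Union>(range V)"
  by (rule Lindelof[of "range V"]) (use Vo in auto)
 then obtain I where I: "countable I" "\<F> = V ` I" using countable_subset_image[of \<F> V UNIV] by blast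
 have "space qnu <= (\<Union>g\<in>I. (%C. g <#\<^bsub>grp D\<^esub> C) -` N \<inter> space qnu)"
 proof
  fix C assume C: "C \<in> space qnu"
  then obtain y where y: "C = cs y" by (auto simp: space_qnu)
  have "y \<in> \<Union>(V ` I)" using \<F>(3) I(2) cover by blast
  then obtain g where g: "g \<in> I" "F (g \<cdot> y) ~= 0" by (auto simp: V_def)
  then have "cs (g \<cdot> y) \<in> N" by (simp add: N_def space_qnu cfun_rp[OF F])
  then show "C \<in> (\<Union>g\<in>I. (%C. g <#\<^bsub>grp D\<^esub> C) -` N \<inter> space qnu)"
   using g(1) C by (auto simp: y lmult_cs)
 qed
 moreover have "(\<Union>g\<in>I. (%C. g <#\<^bsub>grp D\<^esub> C) -` N \<inter> space qnu) \<in> null_sets qnu"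
 proof (rule null_sets_UN'[OF I(1)])
  fix g
  show "(%C. g <#\<^bsub>grp D\<^esub> C) -` N \<inter> space qnu \<in> null_sets qnu"
   using measurable_sets[OF lmult_measurable N] emeasure_lmult_vimage[OF N] N0 by (intro null_setsI) simp_all
 qed
 ultimately have "emeasure qnu (space qnu) <= 0" using emeasure_mono[of "space qnu" _ qnu] null_setsD1 null_setsD2 by metis
 then show False using qnu_nonzero by auto
qed

end

section \<open>Square integrability forces flat orbits\<close>

context square_integrable_rep
begin

definition phi0 :: 'h where
 "phi0 = (SOME phi. phi ~= 0 & integrable qnu (on_coset (%g. (cmod (cinner (rep D g phi) phi))\<^sup>2)))"

definition Cf :: "'h => 'g => complex" where "Cf u g = cinner u (rep D g phi0)"

text \<open>In the product the central phases of the two coefficients cancel, so it is a function on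
  \<open>G/Z\<close>.\<close>

definition Kf :: "'h => 'h => 'g => complex" where "Kf u v g = Cf u g * cnj (Cf v g)"

lemma phi0: "phi0 ~= 0" and phi0_integrable: "integrable qnu (%C. (cmod (Cf phi0 (rp C)))\<^sup>2)"
proof -
 have "cmod (cinner (rep D g phi0) phi0) = cmod (Cf phi0 g)" for g by (subst cinner_commute) (simp only: Cf_def complex_mod_cnj)
 then show "phi0 ~= 0" "integrable qnu (%C. (cmod (Cf phi0 (rp C)))\<^sup>2)"
  using someI_ex[OF conjunct2[OF qnu_ex]] unfolding phi0_def[symmetric] by (simp_all add: on_coset_rp)
qed

lemma Cf_simps: "Cf (u + v) g = Cf u g + Cf v g" "Cf (c *C u) g = c * Cf u g" "Cf (r *R u) g = r * Cf u g"
 "Cf (u - v) g = Cf u g - Cf v g" "Cf (rep D h u) g = Cf u (ginv h \<cdot> g)" "Cf 0 g = 0"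
 by (simp_all add: Cf_def cinner_simps scaleR_scaleC rep_cinner_inv rep_mult)

lemma Cf_continuous: "continuous_on UNIV (Cf u)" unfolding Cf_def by (intro cinner.continuous_on continuous_intros rep_continuous)

lemma Cf_center:
 assumes "z \<in> center D"
 shows "EX t. ALL u g. Cf u (g \<cdot> z) = cis t * Cf u g"
proof -
 have "rep D (lexp D (llog D z)) phi0 = cis (base D (llog D z)) *C phi0"
  using assms by (intro central_character) (simp add: center_iff)
 then have "Cf u (g \<cdot> z) = cis (- base D (llog D z)) * Cf u g" for u g
  by (simp add: Cf_def rep_mult U_scaleC cinner_simps cis_cnj)
 then show ?thesis by blast
qed

lemma cfun_Kf: "cfun (Kf u v)" unfolding cfun_def
proof (intro conjI allI ballI)
 show "continuous_on UNIV (Kf u v)" unfolding Kf_def by (intro continuous_intros Cf_continuous)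
 fix x z assume "z \<in> center D"
 then obtain t where "!!u g. Cf u (g \<cdot> z) = cis t * Cf u g" using Cf_center by blast
 then have "Kf u v (x \<cdot> z) = (cis t * cnj (cis t)) * Kf u v x" by (simp add: Kf_def)
 then show "Kf u v (x \<cdot> z) = Kf u v x" by (simp add: cis_cnj cis_mult)
qed

lemma cfun_compose:
 assumes "cfun F" "continuous_on UNIV f"
 shows "cfun (%x. f (F x))" using assms continuous_on_compose2[of UNIV f UNIV F] by (auto simp: cfun_def)

lemma Kf_self: "Kf u u g = of_real ((cmod (Cf u g))^2)" by (simp only: Kf_def complex_norm_square)

lemma norm_Kf: "cmod (Kf u v g) <= ((cmod (Cf u g))^2 + (cmod (Cf v g))^2) / 2"
proof -
 have "0 <= (cmod (Cf u g) - cmod (Cf v g))^2" by simp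
 then show ?thesis by (simp add: Kf_def norm_mult power2_diff)
qed

lemma cfun_Cf2: "cfun (%g. (cmod (Cf u g))\<^sup>2)"
proof -
 have "cfun (%g. Re (Kf u u g))" by (intro cfun_compose[OF cfun_Kf] continuous_intros)
 then show ?thesis by (simp only: Kf_self Re_complex_of_real)
qed

section \<open>The form of square integrable coefficients\<close>

definition sq_dom :: "'h set" where "sq_dom = {u. integrable qnu (%C. (cmod (Cf u (rp C)))\<^sup>2)}"

lemma Kf_integrable:
 assumes "u \<in> sq_dom" "v \<in> sq_dom"
 shows "integrable qnu (%C. Kf u v (rp C))"
proof (rule Bochner_Integration.integrable_bound)
 show "integrable qnu (%C. ((cmod (Cf u (rp C)))^2 + (cmod (Cf v (rp C)))^2) / 2)" using assms unfolding sq_dom_def by auto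
 show "AE C in qnu. norm (Kf u v (rp C)) <= norm (((cmod (Cf u (rp C)))^2 + (cmod (Cf v (rp C)))^2) / 2)"
 proof (intro AE_I2)
  fix C
  have "0 <= ((cmod (Cf u (rp C)))^2 + (cmod (Cf v (rp C)))^2) / 2" by simp
  then show "norm (Kf u v (rp C)) <= norm (((cmod (Cf u (rp C)))^2 + (cmod (Cf v (rp C)))^2) / 2)"
   using norm_Kf[of u v "rp C"] by (simp only: real_norm_def abs_of_nonneg)
 qed
qed (rule cfun_measurable[OF cfun_Kf])

definition sq_form :: "'h => 'h => real" where
 "sq_form u v = (LINT C|qnu. Re (Kf u v (rp C)))"

lemma Re_Kf_integrable: "u \<in> sq_dom ==> v \<in> sq_dom ==> integrable qnu (%C. Re (Kf u v (rp C)))"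
 using Kf_integrable by (rule integrable_Re)

lemma sq_form_self: "sq_form u u = (LINT C|qnu. (cmod (Cf u (rp C)))\<^sup>2)"
 by (simp only: sq_form_def Kf_self Re_complex_of_real)

lemma sq_dom_add: "u \<in> sq_dom ==> v \<in> sq_dom ==> u + v \<in> sq_dom"
proof -
 assume uv: "u \<in> sq_dom" "v \<in> sq_dom"
 have "integrable qnu (%C. (cmod (Cf (u + v) (rp C)))\<^sup>2)"
 proof (rule Bochner_Integration.integrable_bound)
  show "integrable qnu (%C. 2 * (cmod (Cf u (rp C)))^2 + 2 * (cmod (Cf v (rp C)))^2)" using uv unfolding sq_dom_def by auto
  have "(cmod (a + b))^2 <= 2 * (cmod a)^2 + 2 * (cmod b)^2" for a b
  proof -
   have "(cmod (a + b))^2 <= (cmod a + cmod b)^2" by (intro power_mono norm_triangle_ineq) simp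
   also have "... <= 2 * (cmod a)^2 + 2 * (cmod b)^2" using sum_squares_bound[of "cmod a" "cmod b"] by (simp add: power2_sum)
   finally show ?thesis .
  qed
  then show "AE C in qnu. norm ((cmod (Cf (u + v) (rp C)))^2) <= norm (2 * (cmod (Cf u (rp C)))^2 + 2 * (cmod (Cf v (rp C)))^2)"
   by (simp add: Cf_simps)
 qed (rule cfun_measurable[OF cfun_Cf2])
 then show ?thesis by (simp add: sq_dom_def)
qed

lemma sq_dom_scaleC: "u \<in> sq_dom ==> c *C u \<in> sq_dom" by (simp add: sq_dom_def Cf_simps norm_mult power_mult_distrib)

lemma subspace_sq_dom: "subspace sq_dom"
 using sq_dom_add sq_dom_scaleC by (auto simp: subspace_def scaleR_scaleC) (simp add: sq_dom_def Cf_simps)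

lemma Kf_rep: "Kf (rep D h u) (rep D h v) g = Kf u v (ginv h \<cdot> g)" by (simp add: Kf_def Cf_simps)

lemma sq_dom_rep: "u \<in> sq_dom ==> rep D g u \<in> sq_dom"
 using cfun_translate(2)[OF cfun_Cf2] by (simp add: sq_dom_def Cf_simps)

text \<open>Fatou's lemma: coefficients converge pointwise along \<open>s\<close>, so the form at
  \<open>s n - w\<close> is at most the lower limit of its values at
  \<open>s n - s m\<close>.\<close>

lemma sq_form_complete:
 assumes s: "!!n. s n \<in> sq_dom" "Cauchy s"
  and c: "!!e. 0 < e ==> EX N. \<forall>m\<ge>N. \<forall>n\<ge>N. sq_form (s m - s n) (s m - s n) < e"
 shows "\<exists>w\<in>sq_dom. s ----> w & (%n. sq_form (s n - w) (s n - w)) ----> 0"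
proof -
 obtain w where w: "s ----> w" using s(2) Cauchy_convergent_iff convergent_def by blast
 have sd: "s m - s n \<in> sq_dom" for m n using s(1) by (intro subspace_diff subspace_sq_dom)
 have nonneg: "0 <= sq_form u u" for u unfolding sq_form_self by simp
 have key: "EX N. \<forall>n\<ge>N. s n - w \<in> sq_dom & sq_form (s n - w) (s n - w) <= e" if e: "0 < e" for e
 proof -
  obtain N where N: "!!m n. m >= N ==> n >= N ==> sq_form (s m - s n) (s m - s n) < e" using c[OF e] by blast
  have "s n - w \<in> sq_dom & sq_form (s n - w) (s n - w) <= e" if n: "n >= N" for n
  proof -
   define F where "F m C = ennreal ((cmod (Cf (s n - s m) (rp C)))^2)" for m C
   define G where "G C = (cmod (Cf (s n - w) (rp C)))^2" for C
   have "liminf (%m. F m C) = ennreal (G C)" for C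
   proof (rule lim_imp_Liminf)
    have "(%m. s n - s m) ----> s n - w" by (intro tendsto_intros w)
    then have "(%m. Cf (s n - s m) (rp C)) ----> Cf (s n - w) (rp C)" unfolding Cf_def by (intro cinner.tendsto tendsto_const)
    then show "(%m. F m C) ----> ennreal (G C)" unfolding F_def G_def by (intro tendsto_ennrealI tendsto_intros)
   qed simp
   then have "(\<integral>\<^sup>+C. ennreal (G C) \<partial>qnu) = (\<integral>\<^sup>+C. liminf (%m. F m C) \<partial>qnu)" by simp
   also have "... <= liminf (%m. \<integral>\<^sup>+C. F m C \<partial>qnu)"
    unfolding F_def by (intro nn_integral_liminf measurable_compose[OF cfun_measurable[OF cfun_Cf2] measurable_ennreal])
   also have "... <= ennreal e"
   proof (rule Liminf_le)
    have "(\<integral>\<^sup>+C. F m C \<partial>qnu) = ennreal (sq_form (s n - s m) (s n - s m))" for m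
     unfolding F_def sq_form_self using sd by (intro nn_integral_eq_integral) (auto simp: sq_dom_def)
    then have "(\<integral>\<^sup>+C. F m C \<partial>qnu) <= ennreal e" if "m >= N" for m
     using N[OF n that] by (simp add: ennreal_leI)
    then show "\<forall>\<^sub>F m in sequentially. (\<integral>\<^sup>+C. F m C \<partial>qnu) <= ennreal e"
     unfolding eventually_sequentially by blast
   qed simp
   finally have le: "(\<integral>\<^sup>+C. ennreal (G C) \<partial>qnu) <= ennreal e" .
   have int: "integrable qnu G"
   proof (rule integrableI_bounded)
    show "G \<in> borel_measurable qnu" unfolding G_def by (rule cfun_measurable[OF cfun_Cf2])
    have "(\<integral>\<^sup>+C. ennreal (norm (G C)) \<partial>qnu) <= ennreal e" using le by (simp add: G_def)
    then show "(\<integral>\<^sup>+C. ennreal (norm (G C)) \<partial>qnu) < \<infinity>" using ennreal_less_top le_less_trans by fastforce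
   qed
   moreover have "(\<integral>\<^sup>+C. ennreal (G C) \<partial>qnu) = ennreal (sq_form (s n - w) (s n - w))"
    using nn_integral_eq_integral[OF int] unfolding sq_form_self G_def by simp
   ultimately show ?thesis using le e nonneg unfolding sq_dom_def G_def by simp
  qed
  then show ?thesis by blast
 qed
 obtain N where N: "s N - w \<in> sq_dom" using key[of 1] by auto
 have "s N - (s N - w) \<in> sq_dom" by (rule subspace_diff[OF subspace_sq_dom s(1) N])
 then have "w \<in> sq_dom" by simp
 moreover have "(%n. sq_form (s n - w) (s n - w)) ----> 0"
 proof (rule LIMSEQ_I)
  fix e :: real assume "0 < e"
  obtain N where N: "!!n. n >= N ==> sq_form (s n - w) (s n - w) <= e / 2" using key[of "e / 2"] \<open>0 < e\<close> by auto
  have "norm (sq_form (s n - w) (s n - w) - 0) < e" if "n >= N" for n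
   using nonneg[of "s n - w"] \<open>0 < e\<close> N[OF that] by simp
  then show "EX N. \<forall>n\<ge>N. norm (sq_form (s n - w) (s n - w) - 0) < e" by blast
 qed
 ultimately show ?thesis using w by blast
qed

text \<open>An orthogonality relation. One admissible \<open>phi0\<close> makes the invariant domain
  nontrivial, and Schur's lemma for closed forms does the rest.\<close>

lemma sq_form_scalar: "sq_dom = UNIV & (EX c. ALL u v. sq_form u v = c * inner u v)"
proof (rule closed_form_scalar[where e = phi0])
 show "subspace sq_dom" by (rule subspace_sq_dom)
 show "\<i> *C u \<in> sq_dom" if "u \<in> sq_dom" for u using that by (rule sq_dom_scaleC)
 show "rep D g u \<in> sq_dom" if "u \<in> sq_dom" for g u using that by (rule sq_dom_rep)
 show "phi0 \<in> sq_dom" "phi0 ~= 0" using phi0 phi0_integrable by (auto simp: sq_dom_def)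
 show "sq_form u v = sq_form v u" for u v
  unfolding sq_form_def by (rule Bochner_Integration.integral_cong) (simp_all add: Kf_def)
 show "sq_form (u + v) w = sq_form u w + sq_form v w" if "u \<in> sq_dom" "v \<in> sq_dom" "w \<in> sq_dom" for u v w
 proof -
  have "sq_form (u + v) w = (LINT C|qnu. Re (Kf u w (rp C)) + Re (Kf v w (rp C)))"
   unfolding sq_form_def by (rule Bochner_Integration.integral_cong) (simp_all add: Kf_def Cf_simps algebra_simps)
  then show ?thesis using that by (simp add: sq_form_def Re_Kf_integrable)
 qed
 show "sq_form (r *R u) v = r * sq_form u v" for r u v
 proof -
  have "sq_form (r *R u) v = (LINT C|qnu. r * Re (Kf u v (rp C)))"
   unfolding sq_form_def by (rule Bochner_Integration.integral_cong) (simp_all add: Kf_def Cf_simps algebra_simps)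
  then show ?thesis by (simp add: sq_form_def)
 qed
 show "0 <= sq_form u u" for u unfolding sq_form_self by simp
 show "sq_form (\<i> *C u) (\<i> *C v) = sq_form u v" for u v
  unfolding sq_form_def by (rule Bochner_Integration.integral_cong) (simp_all add: Kf_def Cf_simps)
 show "sq_form (rep D g u) (rep D g v) = sq_form u v" for g u v unfolding sq_form_def Kf_rep
  by (rule cfun_translate(1)) (intro cfun_compose[OF cfun_Kf] continuous_intros)
 show "\<exists>w\<in>sq_dom. s ----> w & (%n. sq_form (s n - w) (s n - w)) ----> 0" if "!!n. s n \<in> sq_dom" "Cauchy s"
   "!!e. 0 < e ==> EX N. \<forall>m\<ge>N. \<forall>n\<ge>N. sq_form (s m - s n) (s m - s n) < e" for s
  using that by (rule sq_form_complete)
qed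

lemma in_sq_dom: "u \<in> sq_dom" using sq_form_scalar by blast

text \<open>In classical terms this is the squared norm of \<open>phi0\<close> divided by the formal
  degree for the measure \<open>qnu\<close>.\<close>

definition fdeg :: real where "fdeg = (SOME c. ALL u v. sq_form u v = c * inner u v)"

lemma sq_form_eq: "sq_form u v = fdeg * inner u v"
 using someI_ex[OF conjunct2[OF sq_form_scalar]] unfolding fdeg_def[symmetric] by blast

lemma fdeg_pos: "0 < fdeg"
proof -
 have "Cf phi0 gone ~= 0" using phi0 by (simp add: Cf_def cinner_self)
 then have "\<not> (AE C in qnu. (cmod (Cf phi0 (rp C)))\<^sup>2 = 0)" by (intro cfun_nonzero[OF cfun_Cf2, of _ gone]) simp
 moreover have "AE C in qnu. 0 <= (cmod (Cf phi0 (rp C)))^2" by simp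
 ultimately have "sq_form phi0 phi0 ~= 0" unfolding sq_form_self using integral_nonneg_eq_0_iff_AE[OF phi0_integrable] by blast
 moreover have "0 <= sq_form phi0 phi0" unfolding sq_form_self by simp
 ultimately have "0 < fdeg * inner phi0 phi0" unfolding sq_form_eq by argo
 then show ?thesis using inner_ge_zero[of phi0] unfolding zero_less_mult_iff by argo
qed

end

section \<open>Forms with a bounded weight\<close>

lemma has_vector_derivative_quotient:
 fixes f :: "real => 'x::real_normed_vector"
 assumes "(f has_vector_derivative d) (at 0)"
 shows "((%t. (f t - f 0) /\<^sub>R t) ---> d) (at 0)"
proof -
 have "((%t. (f t - f 0 - t *R d) /\<^sub>R norm t) ---> 0) (at 0)"
  using assms by (simp add: has_vector_derivative_def has_derivative_at_within)
 then have "((%t. norm ((f t - f 0 - t *R d) /\<^sub>R norm t)) ---> 0) (at 0)" by (rule tendsto_norm_zero)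
 moreover have "norm ((f t - f 0 - t *R d) /\<^sub>R norm t) = norm ((f t - f 0) /\<^sub>R t - d)" if "t ~= 0" for t
 proof -
  have "(f t - f 0) /\<^sub>R t - d = (f t - f 0 - t *R d) /\<^sub>R t" using that by (simp add: scaleR_diff_right)
  then show ?thesis by simp
 qed
 then have "\<forall>\<^sub>F t in at 0. norm ((f t - f 0 - t *R d) /\<^sub>R norm t) = norm ((f t - f 0) /\<^sub>R t - d)"
  by (simp add: eventually_at_filter)
 ultimately have "((%t. norm ((f t - f 0) /\<^sub>R t - d)) ---> 0) (at 0)" by (rule Lim_transform_eventually)
 then show ?thesis by (rule Lim_null[THEN iffD2, OF tendsto_norm_zero_cancel])
qed

lemma arctan_lipschitz: "\<bar>arctan x - arctan y\<bar> <= \<bar>x - y\<bar>"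
proof -
 have "norm (arctan x - arctan y) <= 1 * norm (x - y)"
 proof (rule field_differentiable_bound[of UNIV])
  show "(arctan has_field_derivative inverse (1 + z^2)) (at z within UNIV)" for z using DERIV_arctan by simp
  show "norm (inverse (1 + z^2)) <= 1" for z :: real using zero_le_power2[of z] by (simp add: inverse_le_1_iff)
 qed auto
 then show ?thesis by simp
qed

context square_integrable_rep
begin

text \<open>The weight depends on one linear coordinate of \<open>log g\<close>. For
  \<open>a\<close> annihilating \<open>hh (j - 1)\<close> this coordinate is additive under left
  translation by \<open>exp\<close> of \<open>hh j\<close>.\<close>

definition wform :: "(real => real) => 'a => 'h => 'h => complex" where
 "wform eta a u v = (LINT C|qnu. eta (inner a (llog D (rp C))) *R Kf u v (rp C))"

lemma cfun_weight:
 assumes a: "!!Z. Z \<in> zc ==> inner a Z = 0" and eta: "continuous_on UNIV eta"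
 shows "cfun (%g. eta (inner a (llog D g)) *R Kf u v g)" unfolding cfun_def
proof (intro conjI allI ballI)
 have "continuous_on UNIV (%g. eta (inner a (llog D g)))"
  by (intro continuous_on_compose2[OF eta] continuous_intros llog_continuous) auto
 moreover have "continuous_on UNIV (Kf u v)" using cfun_Kf by (simp add: cfun_def)
 ultimately show "continuous_on UNIV (%g. eta (inner a (llog D g)) *R Kf u v g)" by (rule continuous_on_scaleR)
 fix x z assume z: "z \<in> center D"
 have "llog D (x \<cdot> z) = llog D x + llog D z" using bch_zc[of "llog D z" "llog D x"] z by (simp add: center_iff bch_def)
 then have "inner a (llog D (x \<cdot> z)) = inner a (llog D x)" using a z by (simp add: center_iff inner_add_right)
 moreover have "Kf u v (x \<cdot> z) = Kf u v x" using cfun_Kf[of u v] z by (simp add: cfun_def)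
 ultimately show "eta (inner a (llog D (x \<cdot> z))) *R Kf u v (x \<cdot> z) = eta (inner a (llog D x)) *R Kf u v x" by simp
qed

lemma weight_integrable:
 assumes a: "!!Z. Z \<in> zc ==> inner a Z = 0" and eta: "continuous_on UNIV eta" and M: "!!s. \<bar>eta s\<bar> <= M"
 shows "integrable qnu (%C. eta (inner a (llog D (rp C))) *R Kf u v (rp C))"
proof (rule Bochner_Integration.integrable_bound)
 show "integrable qnu (%C. M *R Kf u v (rp C))" using Kf_integrable[OF in_sq_dom in_sq_dom, of u v] by simp
 have "0 <= M" using M[of 0] by simp
 then show "AE C in qnu. norm (eta (inner a (llog D (rp C))) *R Kf u v (rp C)) <= norm (M *R Kf u v (rp C))"
  using M by (intro AE_I2) (simp add: mult_right_mono)
qed (rule cfun_measurable[OF cfun_weight[OF a eta]])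

lemma wform_bounded_bilinear:
 assumes a: "!!Z. Z \<in> zc ==> inner a Z = 0" and eta: "continuous_on UNIV eta" and M: "!!s. \<bar>eta s\<bar> <= M"
 shows "bounded_bilinear (wform eta a)"
proof -
 note int = weight_integrable[OF a eta M]
 have add1: "wform eta a (u + u') v = wform eta a u v + wform eta a u' v" for u u' v
 proof -
  have "wform eta a (u + u') v = (LINT C|qnu. eta (inner a (llog D (rp C))) *R Kf u v (rp C) + eta (inner a (llog D (rp C))) *R Kf u' v (rp C))"
   unfolding wform_def by (rule Bochner_Integration.integral_cong) (simp_all add: Kf_def Cf_simps algebra_simps)
  then show ?thesis unfolding wform_def using Bochner_Integration.integral_add[OF int int] by simp
 qed
 have add2: "wform eta a u (v + v') = wform eta a u v + wform eta a u v'" for u v v'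
 proof -
  have "wform eta a u (v + v') = (LINT C|qnu. eta (inner a (llog D (rp C))) *R Kf u v (rp C) + eta (inner a (llog D (rp C))) *R Kf u v' (rp C))"
   unfolding wform_def by (rule Bochner_Integration.integral_cong) (simp_all add: Kf_def Cf_simps algebra_simps)
  then show ?thesis unfolding wform_def using Bochner_Integration.integral_add[OF int int] by simp
 qed
 have sc: "wform eta a (r *R u) v = r *R wform eta a u v" "wform eta a u (r *R v) = r *R wform eta a u v" for r u v
  unfolding wform_def integral_scaleR_right[symmetric]
  by (rule Bochner_Integration.integral_cong, simp, simp add: Kf_def Cf_simps scaleR_conv_of_real mult_ac)+
 have M0: "0 <= M" using M[of 0] by simp
 have b0: "cmod (wform eta a u v) <= M * (fdeg * (norm u)^2 + fdeg * (norm v)^2) / 2" for u v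
 proof -
  have i: "integrable qnu (%C. (cmod (Cf u (rp C)))\<^sup>2)" for u using in_sq_dom[of u] by (simp add: sq_dom_def)
  have "cmod (wform eta a u v) <= (LINT C|qnu. M / 2 * ((cmod (Cf u (rp C)))^2 + (cmod (Cf v (rp C)))^2))" unfolding wform_def
  proof (rule order_trans[OF integral_norm_bound Bochner_Integration.integral_mono])
   show "integrable qnu (%C. M / 2 * ((cmod (Cf u (rp C)))^2 + (cmod (Cf v (rp C)))^2))" using i by simp
   fix C
   have "norm (eta (inner a (llog D (rp C))) *R Kf u v (rp C)) <= M * (((cmod (Cf u (rp C)))^2 + (cmod (Cf v (rp C)))^2) / 2)"
    unfolding norm_scaleR by (intro mult_mono M norm_Kf M0) simp
   then show "norm (eta (inner a (llog D (rp C))) *R Kf u v (rp C)) <= M / 2 * ((cmod (Cf u (rp C)))^2 + (cmod (Cf v (rp C)))^2)" by argo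
  qed (rule integrable_norm[OF int])
  also have "... = M / 2 * (sq_form u u + sq_form v v)" using i by (simp add: sq_form_self)
  finally show ?thesis unfolding sq_form_eq power2_norm_eq_inner by argo
 qed
 \<comment> \<open>The bound by squares is applied to unit vectors and extended by
   homogeneity.\<close>
 have b: "cmod (wform eta a u v) <= norm u * norm v * (M * fdeg)" for u v
 proof (cases "u = 0 \<or> v = 0")
  case True
  then have "wform eta a u v = 0" using sc(1)[of 0 u v] sc(2)[of u 0 v] by auto
  then show ?thesis using M0 fdeg_pos by simp
 next
  case False
  define u1 where "u1 = u /\<^sub>R norm u"
  define v1 where "v1 = v /\<^sub>R norm v"
  have n: "norm u1 = 1" "norm v1 = 1" and uv: "u = norm u *R u1" "v = norm v *R v1" using False by (auto simp: u1_def v1_def)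
  have "wform eta a u v = norm u *R (norm v *R wform eta a u1 v1)"
   by (subst uv(1), subst uv(2)) (simp only: sc mult_ac scaleR_scaleR)
  then have "cmod (wform eta a u v) = norm u * norm v * cmod (wform eta a u1 v1)" by simp
  also have "... <= norm u * norm v * (M * fdeg)" using b0[of u1 v1] by (intro mult_left_mono) (simp_all add: n)
  finally show ?thesis .
 qed
 show ?thesis by (rule bounded_bilinear.intro) (use add1 add2 sc b in auto)
qed

lemma wform_scaleC: "wform eta a (c *C u) v = c * wform eta a u v" "wform eta a u (c *C v) = cnj c * wform eta a u v"
proof -
 have "wform eta a (c *C u) v = (LINT C|qnu. c * (eta (inner a (llog D (rp C))) *R Kf u v (rp C)))"
  unfolding wform_def by (rule Bochner_Integration.integral_cong) (simp_all add: Kf_def Cf_simps scaleR_conv_of_real mult_ac)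
 then show "wform eta a (c *C u) v = c * wform eta a u v" unfolding wform_def integral_mult_right_zero .
 have "wform eta a u (c *C v) = (LINT C|qnu. cnj c * (eta (inner a (llog D (rp C))) *R Kf u v (rp C)))"
  unfolding wform_def by (rule Bochner_Integration.integral_cong) (simp_all add: Kf_def Cf_simps scaleR_conv_of_real mult_ac)
 then show "wform eta a u (c *C v) = cnj c * wform eta a u v" unfolding wform_def integral_mult_right_zero .
qed

text \<open>By \<open>bch_left_step\<close> left translation by \<open>exp U\<close> adds
  \<open>U\<close> to the logarithm modulo \<open>hh (j - 1)\<close>, on which \<open>a\<close>
  vanishes; so the argument of the weight shifts by exactly \<open>inner a U\<close>.\<close>

lemma wform_translate:
 assumes j: "j \<in> {1..DIM('a)}" and a: "!!U. U \<in> hh (j - 1) ==> inner a U = 0" and U: "U \<in> hh j"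
  and eta: "continuous_on UNIV eta"
 shows "wform eta a (rep D (lexp D U) u) (rep D (lexp D U) v) = wform (%s. eta (s + inner a U)) a u v"
proof -
 have az: "inner a Z = 0" if "Z \<in> zc" for Z
 proof (rule a[OF zc_hh[OF _ that]])
  show "j - 1 <= DIM('a)" using j by auto
 qed
 define F where "F g = eta (inner a (llog D g) + inner a U) *R Kf u v g" for g
 have F: "cfun F" unfolding F_def by (rule cfun_weight[of a "%s. eta (s + inner a U)"])
   (use az in \<open>auto intro!: continuous_on_compose2[OF eta] continuous_intros\<close>)
 have "F (ginv (lexp D U) \<cdot> g) = eta (inner a (llog D g)) *R Kf (rep D (lexp D U) u) (rep D (lexp D U) v) g" for g
 proof -
  have "bch U (bch (- U) (llog D g)) - bch (- U) (llog D g) - U \<in> hh (j - 1)" by (rule bch_left_step[OF hh_step[OF j] U])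
  from a[OF this] have "inner a (llog D g) = inner a (bch (- U) (llog D g)) + inner a U" by (simp add: inner_diff_right)
  moreover have "bch (- U) (llog D g) = llog D (ginv (lexp D U) \<cdot> g)" by (simp add: bch_def lexp_minus)
  ultimately show ?thesis by (simp add: F_def Kf_rep)
 qed
 then show ?thesis using cfun_translate(1)[OF F, of "ginv (lexp D U)"] by (simp add: wform_def F_def)
qed

lemma wform_derivative:
 assumes a: "!!Z. Z \<in> zc ==> inner a Z = 0" and eta: "continuous_on UNIV eta" and M: "!!s. \<bar>eta s\<bar> <= M"
  and u: "u \<in> Wk (Suc k)" and v: "v \<in> Wk (Suc l)"
 shows "((%t. wform eta a (rep D (lexp D (t *R U)) u) (rep D (lexp D (t *R U)) v)) has_vector_derivative
  (wform eta a u (dpi U v) + wform eta a (dpi U u) v)) (at 0)"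
 using bounded_bilinear.has_vector_derivative[OF wform_bounded_bilinear[OF a eta M] dpi_curve[OF u, of U] dpi_curve[OF v, of U]]
 by simp

text \<open>Existence of the derivative is assumed, so it can be identified along
  \<open>1/(n+1)\<close>, where the Lipschitz bound of \<open>arctan\<close> permits dominated
  convergence.\<close>

lemma wform_arctan_derivative:
 assumes a: "!!Z. Z \<in> zc ==> inner a Z = 0"
  and d: "((%t. wform (%s. arctan (s + t * c)) a u v) has_vector_derivative d) (at 0)"
 shows "d = c *R wform (%s. inverse (1 + s^2)) a u v"
proof -
 define x where "x C = inner a (llog D (rp C))" for C
 define K where "K C = Kf u v (rp C)" for C
 define h where "h n = inverse (real (Suc n))" for n
 have h: "h n ~= 0" "h n > 0" for n by (simp_all add: h_def)
 have hlim: "filterlim h (at 0) sequentially" using LIMSEQ_inverse_real_of_nat h unfolding filterlim_at h_def[abs_def] by auto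
 have ca: "continuous_on UNIV (%s. arctan (s + r))" for r by (intro continuous_intros)
 have ba: "\<bar>arctan (s + r)\<bar> <= pi" for s r
  using arctan_lbound[of "s + r"] arctan_ubound[of "s + r"] pi_gt_zero unfolding abs_le_iff by linarith
 note int = weight_integrable[OF a ca ba]
 have q: "(wform (%s. arctan (s + h n * c)) a u v - wform (%s. arctan (s + 0 * c)) a u v) /\<^sub>R h n
   = (LINT C|qnu. ((arctan (x C + h n * c) - arctan (x C)) / h n) *R K C)" for n proof -
  have "(wform (%s. arctan (s + h n * c)) a u v - wform (%s. arctan (s + 0 * c)) a u v)
    = (LINT C|qnu. arctan (x C + h n * c) *R K C - arctan (x C + 0 * c) *R K C)"
   unfolding wform_def x_def K_def by (rule Bochner_Integration.integral_diff[OF int int, symmetric])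
  then show ?thesis unfolding integral_scaleR_right[symmetric]
   by (simp add: integral_scaleR_right[symmetric] scaleR_diff_left[symmetric] divide_inverse mult.commute del: integral_scaleR_right)
 qed
 have "((%t. (wform (%s. arctan (s + t * c)) a u v - wform (%s. arctan (s + 0 * c)) a u v) /\<^sub>R t) ---> d) (at 0)"
  using has_vector_derivative_quotient[OF d] .
 from filterlim_compose[OF this hlim]
 have l1: "(%n. LINT C|qnu. ((arctan (x C + h n * c) - arctan (x C)) / h n) *R K C) ----> d" by (simp only: q)
 have l2: "(%n. LINT C|qnu. ((arctan (x C + h n * c) - arctan (x C)) / h n) *R K C)
   ----> (LINT C|qnu. (c * inverse (1 + (x C)^2)) *R K C)"
 proof (rule integral_dominated_convergence[where w = "%C. \<bar>c\<bar> * norm (K C)"])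
  have ci: "continuous_on UNIV (%s::real. c * inverse (1 + s^2))" by (intro continuous_intros) (auto simp: add_nonneg_eq_0_iff)
  show "(%C. (c * inverse (1 + (x C)^2)) *R K C) \<in> borel_measurable qnu"
   unfolding x_def K_def by (rule cfun_measurable[OF cfun_weight[OF a ci]])
  have cq: "continuous_on UNIV (%s. (arctan (s + h n * c) - arctan s) / h n)" for n using h by (intro continuous_intros) auto
  show "(%C. ((arctan (x C + h n * c) - arctan (x C)) / h n) *R K C) \<in> borel_measurable qnu" for n
   unfolding x_def K_def by (rule cfun_measurable[OF cfun_weight[OF a cq]])
  show "integrable qnu (%C. \<bar>c\<bar> * norm (K C))"
   unfolding K_def using Kf_integrable[OF in_sq_dom in_sq_dom, of u v] by simp
  show "AE C in qnu. norm (((arctan (x C + h n * c) - arctan (x C)) / h n) *R K C) <= \<bar>c\<bar> * norm (K C)" for n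
  proof (intro AE_I2)
   fix C
   have "\<bar>arctan (x C + h n * c) - arctan (x C)\<bar> <= h n * \<bar>c\<bar>"
    using arctan_lipschitz[of "x C + h n * c" "x C"] h(2)[of n] by (simp add: abs_mult)
   then have "\<bar>(arctan (x C + h n * c) - arctan (x C)) / h n\<bar> <= \<bar>c\<bar>"
    using h(2)[of n] by (simp add: divide_le_eq mult.commute)
   then show "norm (((arctan (x C + h n * c) - arctan (x C)) / h n) *R K C) <= \<bar>c\<bar> * norm (K C)"
    unfolding norm_scaleR by (rule mult_right_mono) simp
  qed
  show "AE C in qnu. (%n. ((arctan (x C + h n * c) - arctan (x C)) / h n) *R K C) ----> (c * inverse (1 + (x C)^2)) *R K C"
  proof (intro AE_I2 tendsto_scaleR tendsto_const)
   fix C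
   have "((%t. arctan (x C + t * c)) has_real_derivative c * inverse (1 + (x C)^2)) (at 0)"
    by (auto intro!: derivative_eq_intros)
   then have "((%t. (arctan (x C + t * c) - arctan (x C)) / t) ---> c * inverse (1 + (x C)^2)) (at 0)"
    by (simp add: has_field_derivative_iff)
   from filterlim_compose[OF this hlim]
   show "(%n. (arctan (x C + h n * c) - arctan (x C)) / h n) ----> c * inverse (1 + (x C)^2)" .
  qed
 qed
 have "d = (LINT C|qnu. c *R (inverse (1 + (x C)^2) *R K C))" using LIMSEQ_unique[OF l1 l2] by simp
 also have "... = c *R wform (%s. inverse (1 + s^2)) a u v" unfolding wform_def x_def K_def by (rule integral_scaleR_right)
 finally show ?thesis .
qed

lemma noncentral_jump_first:
 assumes j: "j \<in> {1..DIM('a)}" "jh D j \<notin> hh (j - 1)"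
  and min: "!!l. l \<in> {1..<j} ==> l \<notin> jump D ==> jh D l \<in> hh (l - 1)"
 shows "j \<in> jump D"
proof (rule ccontr)
 assume nj: "j \<notin> jump D"
 obtain p where p: "p \<in> PF (hh (j - 1))" and inv: "ALL g (xi :: 'a =>L real). (\<forall>Z\<in>zc. blinfun_apply xi Z = base D Z) -->
   blinfun_apply (CoAd D g xi) (jh D j) + p (CoAd D g xi) = blinfun_apply xi (jh D j) + p xi"
  using invariant_polynomial[OF j(1) nj min] by blast
 obtain L where L: "\<forall>(c, Y, k)\<in>set L. Y \<in> hh (j - 1)" "p = ev L" using p by (auto simp: PF_def)
 \<comment> \<open>The invariant polynomial as a list: the linear term \<open>jh D j\<close>
   followed by the lower terms.\<close>
 define L' where "L' = (1, jh D j, 1) # L"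
 define K where "K = Max ((%(c, Y, k). k) ` set L')"
 have K: "k <= K" if "(c, Y, k) \<in> set L'" for c Y k unfolding K_def using that by (intro Max_ge) force+
 have K1: "1 <= K" using K[of 1 "jh D j" 1] by (simp add: L'_def)
 have "EX r::real. \<forall>w\<in>Wk K. opL L' w = r *R w"
 proof (rule invariant_opL_scalar[OF K])
  fix g and xi :: "'a =>L real" assume "!!Z. Z \<in> zc ==> xi Z = base D Z"
  then show "ev L' (CoAd D g xi) = ev L' xi" using inv L(2) by (simp add: L'_def)
 qed
 then obtain r :: real where r: "!!w. w \<in> Wk K ==> opL L' w = r *R w" by blast
 have sub: "subspace (hh (j - 1))" using j(1) by (intro subspace_hh) auto
 obtain a where a: "!!U. U \<in> hh (j - 1) ==> inner a U = 0" "inner a (jh D j) ~= 0"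
  using subspace_annihilator_exists[OF sub j(2)] by blast
 have az: "inner a Z = 0" if "Z \<in> zc" for Z
 proof (rule a(1)[OF zc_hh[OF _ that]])
  show "j - 1 <= DIM('a)" using j(1) by auto
 qed
 have ca: "continuous_on UNIV (%s. arctan s)" by (intro continuous_intros)
 have ba: "\<bar>arctan s\<bar> <= pi" for s
  using arctan_lbound[of s] arctan_ubound[of s] pi_gt_zero unfolding abs_le_iff by linarith
 let ?B = "wform arctan a"
 interpret B: bounded_bilinear ?B by (rule wform_bounded_bilinear[OF az ca ba])
 have der: "?B u (dpi U v) + ?B (dpi U u) v = inner a U *R wform (%s. inverse (1 + s^2)) a u v"
  if U: "U \<in> hh j" and u: "u \<in> Wk (Suc k)" and v: "v \<in> Wk (Suc l)" for U u v k l
 proof (rule wform_arctan_derivative[OF az])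
  have "wform arctan a (rep D (lexp D (t *R U)) u) (rep D (lexp D (t *R U)) v) = wform (%s. arctan (s + t * inner a U)) a u v" for t
  proof -
   have "t *R U \<in> hh j" using U j(1) by (intro subspace_scale subspace_hh) auto
   from wform_translate[OF j(1) a(1) this ca, of u v] show ?thesis by simp
  qed
  then show "((%t. wform (%s. arctan (s + t * inner a U)) a u v) has_vector_derivative ?B u (dpi U v) + ?B (dpi U u) v) (at 0)"
   using wform_derivative[OF az ca ba u v, of U] by simp
 qed
 \<comment> \<open>The asymmetry of \<open>PP U\<close> is proportional to \<open>inner a U\<close>:
   zero on \<open>hh (j - 1)\<close>, and for \<open>jh D j\<close> a nonzero multiple of the form
   with weight \<open>arctan'\<close>.\<close>
 have PPd: "?B (PP U u) v - ?B u (PP U v) = (- \<i>) * (inner a U *R wform (%s. inverse (1 + s^2)) a u v)"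
  if U: "U \<in> hh j" and u: "u \<in> Wk (Suc k)" and v: "v \<in> Wk (Suc l)" for U u v k l
  unfolding der[OF that, symmetric] PP_def wform_scaleC by (simp add: algebra_simps)
 have jh: "jh D j \<in> hh j" using jh_in[OF j(1)] by (rule flag_hh)
 have hj: "hh (j - 1) <= hh j" using j(1) by (intro hh_mono) auto
 have symL: "?B (opL L u) v = ?B u (opL L v)" if uv: "u \<in> Wk K" "v \<in> Wk K" for u v
 proof -
  have "?B (opL M u) v = ?B u (opL M v)" if "set M <= set L" for M using that
  proof (induction M)
   case (Cons b M)
   obtain c Y m where b: "b = (c, Y, m)" by (cases b)
   have "(c, Y, m) \<in> set L" using Cons.prems by (simp add: b)
   then have Y: "Y \<in> hh (j - 1)" and "m <= K" using L(1) K[of c Y m] by (auto simp: L'_def)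
   then have "u \<in> Wk m" "v \<in> Wk m" using uv Wk_antimono by blast+
   moreover have "?B (PP Y u') v' = ?B u' (PP Y v')" if "u' \<in> Wk (Suc i)" "v' \<in> Wk (Suc i)" for i u' v'
    using PPd[OF _ that, of Y] Y hj a(1)[OF Y] by auto
   ultimately have "?B ((PP Y ^^ m) u) v = ?B u ((PP Y ^^ m) v)" by (intro PP_pow_form[where B = ?B])
   then show ?case using Cons by (simp add: b B.add_left B.add_right B.scaleR_left B.scaleR_right)
  qed (simp add: B.zero_left B.zero_right)
  then show ?thesis by blast
 qed
 obtain w where w: "w \<in> Wk K" "w ~= 0" using Wk_nontrivial by blast
 have w1: "w \<in> Wk (Suc 0)" using w(1) Wk_antimono[of "Suc 0" K] K1 by auto
 have "?B (opL L' w) w = ?B w (opL L' w)" by (simp add: r[OF w(1)] B.scaleR_left B.scaleR_right)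
 then have "?B (PP (jh D j) w) w - ?B w (PP (jh D j) w) = 0"
  using symL[OF w(1) w(1)] by (simp add: L'_def B.add_left B.add_right One_nat_def)
 then have "wform (%s. inverse (1 + s^2)) a w w = 0" using PPd[OF jh w1 w1] a(2) by simp
 \<comment> \<open>The integrand of that form on the diagonal. It is nonnegative and its weight
   never vanishes, so a zero integral would annihilate the coefficient of \<open>w\<close>.\<close>
 define G where "G C = inverse (1 + (inner a (llog D (rp C)))^2) * (cmod (Cf w (rp C)))^2" for C
 have ci: "continuous_on UNIV (%s::real. inverse (1 + s^2))" by (intro continuous_intros) (auto simp: add_nonneg_eq_0_iff)
 have bi: "\<bar>inverse (1 + s^2)\<bar> <= 1" for s :: real using zero_le_power2[of s] by (simp add: inverse_le_1_iff)
 have ic: "integrable qnu (%C. complex_of_real (G C))"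
  using weight_integrable[OF az ci bi, of w w] by (simp add: Kf_self G_def scaleR_conv_of_real)
 have "(LINT C|qnu. complex_of_real (G C)) = wform (%s. inverse (1 + s^2)) a w w"
  unfolding wform_def G_def Kf_self by (simp add: scaleR_conv_of_real)
 then have "(LINT C|qnu. G C) = 0" using \<open>wform _ a w w = 0\<close> by simp
 moreover have "integrable qnu G" using integrable_Re[OF ic] by simp
 moreover have "AE C in qnu. 0 <= G C" by (simp add: G_def)
 ultimately have "AE C in qnu. G C = 0" using integral_nonneg_eq_0_iff_AE by blast
 moreover have "G C = 0 \<longleftrightarrow> (cmod (Cf w (rp C)))\<^sup>2 = 0" for C
  unfolding G_def using zero_le_power2[of "inner a (llog D (rp C))"] by (auto simp: add_nonneg_eq_0_iff)
 ultimately have "AE C in qnu. (cmod (Cf w (rp C)))\<^sup>2 = 0" by simp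
 then have "sq_form w w = 0" unfolding sq_form_self by (rule integral_eq_zero_AE)
 then show False using fdeg_pos w(2) by (simp add: sq_form_eq)
qed

lemma noncentral_jump: "j \<in> {1..DIM('a)} ==> jh D j \<notin> hh (j - 1) ==> j \<in> jump D"
proof (induction j rule: less_induct)
 case (less j)
 show ?case
 proof (rule noncentral_jump_first[OF less.prems])
  fix l assume "l \<in> {1..<j}" "l \<notin> jump D"
  then show "jh D l \<in> hh (l - 1)" using less.IH[of l] less.prems(1) by auto
 qed
qed

end

section \<open>The geometry of flat orbits\<close>

locale flat_rep = square_integrable_rep D
 for D :: "('g::{t2_space, second_countable_topology}, 'a::euclidean_space, 'h::chilbert_space) kdata" +
 assumes liou_norm: "liouville_normalized D" and leb_norm: "lebesgue_normalized D"
begin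

lemma jump_range: "j \<in> jump D ==> j \<in> {1..DIM('a)}" and finite_jump [simp]: "finite (jump D)" by (auto simp: jump_def)

lemma inj_jump: "inj_on (jh D) (jump D)" by (rule inj_on_subset[OF inj_jh]) (auto simp: jump_def)

definition psum :: "(nat => real) => 'a" where
 "psum x = (\<Sum>j\<in>jump D. x j *R jh D j)"

text \<open>The largest index with nonzero coefficient could be solved for, exhibiting its basis
  vector in \<open>flag D (m - 1)\<close> plus the stabiliser, against the definition of a
  jump.\<close>

lemma psum_stab:
 assumes c: "psum c \<in> stab D" and i: "i \<in> jump D"
 shows "c i = 0"
proof (rule ccontr)
 assume "c i ~= 0"
 define T where "T = {i\<in>jump D. c i ~= 0}"
 have T: "finite T" "T ~= {}" using i \<open>c i ~= 0\<close> by (auto simp: T_def)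
 define m where "m = Max T"
 have m: "m \<in> jump D" "c m ~= 0" using Max_in[OF T] by (auto simp: T_def m_def)
 have m1: "m - 1 <= DIM('a)" using jump_range[OF m(1)] by auto
 have sub: "subspace (flag D (m - 1))" by (rule subspace_flag[OF m1])
 have low: "(\<Sum>i\<in>jump D - {m}. c i *R jh D i) \<in> flag D (m - 1)"
 proof (intro subspace_sum sub)
  fix l assume l: "l \<in> jump D - {m}"
  show "c l *R jh D l \<in> flag D (m - 1)"
  proof (cases "l \<in> T")
   case True
   then have "l <= m" unfolding m_def using T(1) by (rule Max_ge[rotated])
   then have "l <= m - 1" using l by auto
   then have "jh D l \<in> flag D (m - 1)" using jh_in[OF jump_range[of l]] l flag_mono[of l "m - 1"] m1 by blast
   then show ?thesis by (rule subspace_scale[OF sub])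
  qed (use l subspace_0[OF sub] in \<open>auto simp: T_def\<close>)
 qed
 have "jh D m = - (1 / c m) *R (\<Sum>i\<in>jump D - {m}. c i *R jh D i) + (1 / c m) *R psum c"
  using m by (simp add: psum_def sum.remove[of _ m] scaleR_add_right)
 moreover have "- (1 / c m) *R (\<Sum>i\<in>jump D - {m}. c i *R jh D i) \<in> flag D (m - 1)"
  by (rule subspace_scale[OF sub low])
 moreover have "(1 / c m) *R psum c \<in> stab D" by (rule subspace_scale[OF subspace_stab c])
 ultimately have "jh D m \<in> {X + Y | X Y. X \<in> flag D (m - 1) & Y \<in> stab D}" by blast
 then show False using m(1) unfolding jump_iff by blast
qed

lemma jump_covector_exists:
 assumes j: "j \<in> jump D"
 shows "EX w. (\<forall>i\<in>jump D. inner w (jh D i) = (if i = j then 1 else 0)) & (\<forall>Z\<in>zc. inner w Z = 0)"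
proof -
 define S where "S = {X + Z | X Z. X \<in> span (jh D ` (jump D - {j})) & Z \<in> zc}"
 have sub: "subspace S" unfolding S_def by (intro subspace_sums subspace_span subspace_zc)
 have nin: "jh D j \<notin> S"
 proof
  assume "jh D j \<in> S"
  then obtain X Z where XZ: "jh D j = X + Z" "X \<in> span (jh D ` (jump D - {j}))" "Z \<in> zc" by (auto simp: S_def)
  obtain u where "X = (\<Sum>v\<in>jh D ` (jump D - {j}). u v *R v)" using XZ(2) by (auto simp: span_finite)
  then have X: "X = (\<Sum>i\<in>jump D - {j}. u (jh D i) *R jh D i)"
   using inj_on_subset[OF inj_jump, of "jump D - {j}"] by (simp add: sum.reindex)
  define c where "c i = (if i = j then 1 else - u (jh D i))" for i
  have "psum c = jh D j - X" using j by (simp add: psum_def sum.remove[of _ j] c_def X sum_negf)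
  also have "... = Z" using XZ(1) by simp
  finally have "psum c \<in> stab D" using XZ(3) zc_stab by auto
  then have "c j = 0" using j by (rule psum_stab)
  then show False by (simp add: c_def)
 qed
 obtain w where w: "!!y. y \<in> S ==> inner w y = 0" "inner w (jh D j) ~= 0"
  using subspace_annihilator_exists[OF sub nin] by blast
 have "inner w (jh D i) = 0" if "i \<in> jump D" "i ~= j" for i
 proof (rule w(1))
  have "jh D i + 0 \<in> S" unfolding S_def using that subspace_0[OF subspace_zc] by (blast intro: span_base)
  then show "jh D i \<in> S" by simp
 qed
 moreover have "inner w Z = 0" if "Z \<in> zc" for Z
 proof (rule w(1))
  have "0 + Z \<in> S" unfolding S_def using that span_zero by blast
  then show "Z \<in> S" by simp
 qed
 ultimately show ?thesis using w(2) by (intro exI[of _ "w /\<^sub>R inner w (jh D j)"]) auto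
qed

text \<open>Coordinates on the predual, extended by zero to the centre; vectors represent the
  functionals.\<close>

definition wd :: "nat => 'a" where
 "wd j = (SOME w. (\<forall>i\<in>jump D. inner w (jh D i) = (if i = j then 1 else 0)) & (\<forall>Z\<in>zc. inner w Z = 0))"

lemma wd: "j \<in> jump D ==> i \<in> jump D ==> inner (wd j) (jh D i) = (if i = j then 1 else 0)"
 and wd_zc: "j \<in> jump D ==> Z \<in> zc ==> inner (wd j) Z = 0"
 using someI_ex[OF jump_covector_exists[of j]] unfolding wd_def[symmetric] by auto

text \<open>The projection onto the predual along the centre, once \<open>pj_zc\<close> is
  known.\<close>

definition pj :: "'a => 'a" where
 "pj X = psum (%j. inner (wd j) X)"

lemma linear_pj: "linear pj"
 by (rule linearI) (simp_all add: pj_def psum_def inner_add_right scaleR_left_distrib sum.distrib scaleR_sum_right)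

lemma wd_psum: "j \<in> jump D ==> inner (wd j) (psum x) = x j"
 by (simp add: psum_def inner_sum_right wd if_distrib[of "%y. x _ * y"] cong: if_cong)

lemma pj_psum [simp]: "pj (psum x) = psum x"
 unfolding pj_def psum_def by (rule sum.cong) (simp_all add: wd_psum[unfolded psum_def])

text \<open>Flatness enters here: by \<open>noncentral_jump\<close> a non-jump basis vector lies in
  the lower flag plus the centre. The statement on \<open>wd k\<close> is carried along because it
  gives the triangularity of the adjoint action.\<close>

lemma pj_flag:
 "m <= DIM('a) ==> X \<in> flag D m ==> X - pj X \<in> zc & (\<forall>k\<in>jump D. m < k --> inner (wd k) X = 0)"
proof (induction m arbitrary: X)
 case 0
 then show ?case using subspace_0[OF subspace_zc] by (simp add: flag_zero linear_0[OF linear_pj])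
next
 case (Suc m)
 let ?P = "%X. X - pj X \<in> zc & (\<forall>k\<in>jump D. Suc m < k --> inner (wd k) X = 0)"
 have add: "?P (X + Y)" if "?P X" "?P Y" for X Y using that subspace_add[OF subspace_zc, of "X - pj X" "Y - pj Y"]
  by (simp add: linear_add[OF linear_pj] inner_add_right algebra_simps)
 have scale: "?P (r *R X)" if "?P X" for X r using that subspace_scale[OF subspace_zc, of "X - pj X" r]
  by (simp add: linear_scale[OF linear_pj] scaleR_diff_right)
 have IH: "?P X" if "X \<in> flag D m" for X using Suc.IH[OF _ that] Suc.prems(1) by auto
 have zcP: "?P Z" if "Z \<in> zc" for Z using that by (simp add: pj_def psum_def wd_zc)
 have "?P (jh D (Suc m))"
 proof (cases "Suc m \<in> jump D")
  case True
  have "jh D (Suc m) = psum (%i. if i = Suc m then 1 else 0)"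
   using True by (simp add: psum_def if_distrib[of "%y. y *R _"] cong: if_cong)
  then have "pj (jh D (Suc m)) = jh D (Suc m)" by simp
  then show ?thesis using True subspace_0[OF subspace_zc] by (simp add: wd)
 next
  case False
  then have "jh D (Suc m) \<in> hh m" using noncentral_jump[of "Suc m"] Suc.prems(1) by auto
  then obtain F Z where FZ: "jh D (Suc m) = F + Z" "F \<in> flag D m" "Z \<in> zc" by (auto simp: hh_def)
  show ?thesis unfolding FZ(1) by (rule add[OF IH[OF FZ(2)] zcP[OF FZ(3)]])
 qed
 note jhP = this
 obtain k where k: "X - k *R jh D (Suc m) \<in> flag D m" using flag_decompose[of "Suc m" X] Suc.prems by auto
 from add[OF scale[OF jhP, of k] IH[OF k]] show ?case by simp
qed

lemma pj_zc: "X - pj X \<in> zc" using pj_flag[of "DIM('a)" X] by (simp add: flag_top)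

lemma pj_eq_0_iff: "pj X = 0 \<longleftrightarrow> X \<in> zc" using pj_zc[of X] by (auto simp: pj_def psum_def wd_zc)

lemma stab_eq_zc: "stab D = zc"
proof
 show "stab D <= zc"
 proof
  fix X assume X: "X \<in> stab D"
  have P: "psum (%j. inner (wd j) X) \<in> stab D"
   using subspace_diff[OF subspace_stab X, of "X - pj X"] pj_zc zc_stab by (auto simp: pj_def)
  have "inner (wd j) X = 0" if "j \<in> jump D" for j using P that by (rule psum_stab)
  then have "pj X = 0" by (simp add: pj_def psum_def)
  then show "X \<in> zc" by (simp add: pj_eq_0_iff)
 qed
qed (rule zc_stab)

text \<open>With all non-jump steps central, \<open>red\<close> runs through every index and ends at
  \<open>base D\<close>; so the central values are the only invariants and the orbit is an affine
  subspace.\<close>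

lemma orbit_eq: "xi \<in> orbit D \<longleftrightarrow> (\<forall>Z\<in>zc. blinfun_apply xi Z = base D Z)"
proof
 assume "xi \<in> orbit D"
 then show "\<forall>Z\<in>zc. blinfun_apply xi Z = base D Z" by (auto simp: orbit_iff CoAd_zc)
next
 assume xi: "\<forall>Z\<in>zc. blinfun_apply xi Z = base D Z"
 have "red DIM('a) xi U = base D U" for U
  by (rule red_agrees) (use xi noncentral_jump flag_hh[of U "DIM('a)"] in \<open>auto simp: flag_top\<close>)
 then have "red DIM('a) xi = base D" by (rule blinfun_eqI)
 then obtain g where "CoAd D g xi = base D" using red_CoAd[of "DIM('a)" xi] by auto
 then have "xi = CoAd D (ginv g) (base D)" using CoAd_inv(1)[of g xi] by simp
 then show "xi \<in> orbit D" by (auto simp: orbit_iff)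
qed

lemma orbit_stab:
 fixes xi :: "'a =>L real"
 assumes xi: "xi \<in> orbit D" and X: "!!Y. xi (br X Y) = 0"
 shows "X \<in> zc"
proof -
 obtain g where g: "xi = CoAd D g (base D)" using xi by (auto simp: orbit_iff)
 have "base D (br (Ad D (ginv g) X) Y) = 0" for Y using X[of "Ad D g Y"] by (simp add: g CoAd_apply Ad_br)
 then have "Ad D (ginv g) X \<in> stab D" unfolding stab_def by blast
 then have "Ad D (ginv g) X \<in> zc" unfolding stab_eq_zc .
 from Ad_zc[OF this, of g] this show ?thesis by simp
qed

section \<open>Coordinates on the orbit and its predual\<close>

definition riesz_base :: 'a where "riesz_base = (\<Sum>e\<in>Basis. base D e *R e)"

lemma riesz_base: "inner riesz_base X = base D X"
proof -
 have "base D X = base D (\<Sum>e\<in>Basis. inner X e *R e)" by (simp only: euclidean_representation)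
 then show ?thesis by (simp add: riesz_base_def inner_sum_left blinfun.sum_right blinfun.scaleR_right inner_commute[of X] mult.commute)
qed

text \<open>Representing functionals by vectors exhibits the inverse of the coordinate map as an
  affine map of \<open>t\<close>, from which its measurability is immediate.\<close>

definition sv :: "(nat => real) => 'a" where
 "sv t = riesz_base + (\<Sum>j\<in>jump D. (t j - base D (jh D j)) *R wd j)"

definition sc :: "(nat => real) => ('a =>L real)" where
 "sc t = blinfun_inner_left (sv t)"

lemma sc_apply: "sc t X = base D X + (\<Sum>j\<in>jump D. (t j - base D (jh D j)) * inner (wd j) X)"
 by (simp add: sc_def sv_def inner_add_right inner_sum_right riesz_base inner_commute[of X])

lemma sc_jh: "j \<in> jump D ==> sc t (jh D j) = t j" by (simp add: sc_apply wd if_distrib[of "%y. _ * y"] cong: if_cong)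

lemma sc_orbit: "sc t \<in> orbit D" by (simp add: orbit_eq sc_apply wd_zc)

lemma orbit_apply:
 fixes xi :: "'a =>L real"
 assumes "xi \<in> orbit D"
 shows "xi X = (\<Sum>j\<in>jump D. inner (wd j) X * xi (jh D j)) + base D (X - pj X)"
proof -
 have "xi X = xi (pj X) + xi (X - pj X)" by (simp add: blinfun.diff_right)
 also have "xi (X - pj X) = base D (X - pj X)" using assms pj_zc by (simp add: orbit_eq)
 finally show ?thesis by (simp add: pj_def psum_def blinfun.sum_right blinfun.scaleR_right)
qed

lemma coords_apply: "j \<in> jump D ==> coords D xi j = blinfun_apply xi (jh D j)" by (simp add: coords_def)

lemma coords_ext [simp]: "coords D xi \<in> extensional (jump D)" by (simp add: coords_def)

lemma coords_sc: "t \<in> extensional (jump D) ==> coords D (sc t) = t"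
 by (rule extensionalityI[of _ "jump D"]) (simp_all add: coords_apply sc_jh)

lemma inj_coords: "inj_on (coords D) (orbit D)"
proof (rule inj_onI)
 fix xi eta :: "'a =>L real" assume o: "xi \<in> orbit D" "eta \<in> orbit D" and eq: "coords D xi = coords D eta"
 have "xi (jh D j) = eta (jh D j)" if "j \<in> jump D" for j using fun_cong[OF eq, of j] that by (simp add: coords_apply)
 then have "xi X = eta X" for X unfolding orbit_apply[OF o(1), of X] orbit_apply[OF o(2), of X] by (simp cong: sum.cong)
 then show "xi = eta" by (rule blinfun_eqI)
qed

lemma sec_eq: "t \<in> extensional (jump D) ==> sec D t = sc t"
 unfolding sec_def by (rule the_inv_into_f_eq[OF inj_coords coords_sc sc_orbit])

lemma sc_coords: "xi \<in> orbit D ==> sc (coords D xi) = xi" by (rule inj_onD[OF inj_coords coords_sc[OF coords_ext] sc_orbit])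

abbreviation T :: "(nat => real) measure" where "T \<equiv> \<Pi>\<^sub>M j\<in>jump D. lborel"

lemma space_T [simp]: "space T = extensional (jump D)" by (simp add: space_PiM PiE_UNIV_domain PiE_def extensional_def)

text \<open>The matrix of \<open>Ad (g^(-1)) - 1\<close> in jump coordinates modulo the centre;
  \<open>Adc_triangular\<close> shows that it is strictly triangular.\<close>

definition Adc :: "'g => nat => nat => real" where
 "Adc g j k = inner (wd k) (Ad D (ginv g) (jh D j) - jh D j)"

lemma Adc_triangular: "j \<in> jump D ==> k \<in> jump D ==> j <= k ==> Adc g j k = 0"
proof -
 assume j: "j \<in> jump D" and k: "k \<in> jump D" "j <= k"
 have "Ad D (ginv g) (jh D j) - jh D j \<in> flag D (j - 1)"
  by (rule central_step_Ad(1)[OF flag_step[OF jump_range[OF j]] jh_in[OF jump_range[OF j]]])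
 then show ?thesis using pj_flag[of "j - 1"] jump_range[OF j] k by (auto simp: Adc_def)
qed

definition cth :: "'g => (nat => real) => nat => real" where
 "cth g t = (\<lambda>j\<in>jump D. t j + ((\<Sum>k\<in>jump D. Adc g j k * t k)
   + base D ((Ad D (ginv g) (jh D j) - jh D j) - pj (Ad D (ginv g) (jh D j) - jh D j))))"

lemma coords_CoAd:
 assumes "xi \<in> orbit D"
 shows "coords D (CoAd D g xi) = cth g (coords D xi)"
proof (rule extensionalityI[of _ "jump D"])
 fix j assume j: "j \<in> jump D"
 have "CoAd D g xi (jh D j) = xi (jh D j) + xi (Ad D (ginv g) (jh D j) - jh D j)" by (simp add: CoAd_apply blinfun.diff_right)
 then show "coords D (CoAd D g xi) j = cth g (coords D xi) j" using j orbit_apply[OF assms, of "Ad D (ginv g) (jh D j) - jh D j"]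
  by (simp add: coords_apply cth_def Adc_def cong: sum.cong)
qed (simp_all add: cth_def)

lemma sc_cth: "t \<in> extensional (jump D) ==> sc (cth g t) = CoAd D g (sc t)"
 using coords_CoAd[OF sc_orbit, of g t] sc_coords[of "CoAd D g (sc t)"] CoAd_orbit[of "sc t" g] sc_orbit[of t]
 by (simp add: coords_sc)

lemma cth_ext [simp]: "cth g t \<in> extensional (jump D)" by (simp add: cth_def)

lemma cth_inv: "t \<in> extensional (jump D) ==> cth (ginv g) (cth g t) = t"
proof -
 assume t: "t \<in> extensional (jump D)"
 have "sc (cth (ginv g) (cth g t)) = sc t" using t by (simp add: sc_cth)
 then show ?thesis using coords_sc[OF t] coords_sc[of "cth (ginv g) (cth g t)"] by simp
qed

lemma distr_cth: "cth g \<in> measurable T T" "distr T T (cth g) = T"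
proof -
 define q where "q j t = (\<Sum>k\<in>jump D. Adc g j k * t k)
   + base D ((Ad D (ginv g) (jh D j) - jh D j) - pj (Ad D (ginv g) (jh D j) - jh D j))" for j t
 have m: "q j \<in> borel_measurable T" for j unfolding q_def by measurable
 have dep: "q j t = q j t'" if "j \<in> jump D" "!!l. l \<in> jump D ==> int l < int j ==> t l = t' l" for j t t' unfolding q_def
 proof (intro arg_cong2[where f = plus] sum.cong refl)
  fix k assume "k \<in> jump D"
  then show "Adc g j k * t k = Adc g j k * t' k" using that Adc_triangular[of j k g] by (cases "k < j") auto
 qed
 show "cth g \<in> measurable T T" "distr T T (cth g) = T" by ((rule distr_PiM_triangular[where r = int and q = q];
    (intro m)?; (rule dep, assumption, assumption)?; (simp add: cth_def q_def inj_on_def)?)+)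
qed

text \<open>Against \<open>cth\<close> the two indices of \<open>Adc\<close> are exchanged, so the
  shift of a coordinate involves those of larger index and the rank below is
  \<open>- int k\<close>.\<close>

definition pth :: "'g => (nat => real) => nat => real" where
 "pth g x = (\<lambda>k\<in>jump D. x k + (\<Sum>j\<in>jump D. Adc (ginv g) j k * x j))"

lemma pj_Ad_psum: "pj (Ad D g (psum x)) = psum (pth g x)"
proof -
 have "inner (wd k) (Ad D g (psum x)) = pth g x k" if k: "k \<in> jump D" for k
 proof -
  have "Ad D g (psum x) = psum x + (\<Sum>j\<in>jump D. x j *R (Ad D g (jh D j) - jh D j))"
   by (simp add: psum_def linear_sum[OF linear_Ad] Ad_scaleR scaleR_diff_right sum_subtractf)
  then show ?thesis using k by (simp add: inner_add_right wd_psum pth_def inner_sum_right Adc_def mult.commute)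
 qed
 then show ?thesis unfolding pj_def psum_def by (intro sum.cong) simp_all
qed

lemma distr_pth: "pth g \<in> measurable T T" "distr T T (pth g) = T"
proof -
 define q where "q k x = (\<Sum>j\<in>jump D. Adc (ginv g) j k * x j)" for k x
 have m: "q j \<in> borel_measurable T" for j unfolding q_def by measurable
 have dep: "q k t = q k t'" if "k \<in> jump D" "!!l. l \<in> jump D ==> - int l < - int k ==> t l = t' l" for k t t'
  unfolding q_def
 proof (intro sum.cong refl)
  fix j assume "j \<in> jump D"
  then show "Adc (ginv g) j k * t j = Adc (ginv g) j k * t' j" using that Adc_triangular[of j k "ginv g"] by (cases "k < j") auto
 qed
 show "pth g \<in> measurable T T" "distr T T (pth g) = T" by ((rule distr_PiM_triangular[where r = "%k. - int k" and q = q];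
    (intro m)?; (rule dep, assumption, assumption)?; (simp add: pth_def q_def inj_on_def)?)+)
qed

end

section \<open>Determinants over finite index sets\<close>

lemma det_on_transpose:
 assumes I: "finite I"
 shows "det_on I (%i j. A j i) = det_on I A" unfolding det_on_def
proof (rule sum.reindex_bij_witness[of _ "inv_into UNIV" "inv_into UNIV"])
 fix p assume "p \<in> {p. p permutes I}"
 then have p: "p permutes I" by simp
 show "inv_into UNIV (inv_into UNIV p) = p" "inv_into UNIV p \<in> {p. p permutes I}"
  "inv_into UNIV (inv_into UNIV p) = p" "inv_into UNIV p \<in> {p. p permutes I}"
  using permutes_inv_inv[OF p] permutes_inv[OF p] by auto
 have "(\<Prod>i\<in>I. A (p i) i) = (\<Prod>i\<in>I. A i (inv_into UNIV p i))"
  using prod.permute[OF p, of "%i. A i (inv_into UNIV p i)"] permutes_inverses(2)[OF p] by (simp add: o_def)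
 then show "real_of_int (sign (inv_into UNIV p)) * (\<Prod>i\<in>I. A i (inv_into UNIV p i)) = real_of_int (sign p) * (\<Prod>i\<in>I. A (p i) i)"
  using sign_inverse[OF permutes_imp_permutation[OF I p]] by simp
qed

text \<open>The additional sum changes sign when a permutation is composed with the transposition of
  \<open>i\<close> and \<open>k\<close>, so it vanishes.\<close>

lemma det_on_row_combination:
 assumes I: "finite I" and ik: "i \<in> I" "k \<in> I" "i ~= k"
 shows "det_on I (%r c. if r = i then A i c + x * A k c else A r c) = det_on I A"
proof -
 define R where "R p = (\<Prod>r\<in>I - {i}. A r (p r))" for p :: "nat => nat"
 define S where "S p = real_of_int (sign p) * (A k (p i) * R p)" for p
 have "det_on I (%r c. if r = i then A i c + x * A k c else A r c)
   = (\<Sum>p | p permutes I. real_of_int (sign p) * (A i (p i) * R p) + x * S p)" unfolding det_on_def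
 proof (rule sum.cong[OF refl])
  fix p
  have "(\<Prod>r\<in>I - {i}. if r = i then A i (p r) + x * A k (p r) else A r (p r)) = R p"
   unfolding R_def by (rule prod.cong) auto
  then show "real_of_int (sign p) * (\<Prod>r\<in>I. if r = i then A i (p r) + x * A k (p r) else A r (p r))
    = real_of_int (sign p) * (A i (p i) * R p) + x * S p" unfolding prod.remove[OF I ik(1)] by (simp add: S_def algebra_simps)
 qed
 also have "... = det_on I A + x * (\<Sum>p | p permutes I. S p)"
  unfolding det_on_def sum.distrib sum_distrib_left R_def prod.remove[OF I ik(1)] ..
 also have "(\<Sum>p | p permutes I. S p) = 0"
 proof -
  define t where "t = Transposition.transpose i k"
  have t: "t permutes I" "t \<circ> t = id" using ik by (auto simp: t_def permutes_swap_id)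
  have St: "S (p \<circ> t) = - S p" if p: "p permutes I" for p
  proof -
   have "sign (p \<circ> t) = - sign p"
    using sign_compose[OF permutes_imp_permutation[OF I p] permutes_imp_permutation[OF I t(1)]] ik
    by (simp add: t_def sign_swap_id)
   moreover have ki: "k \<in> I - {i}" "finite (I - {i})" using ik I by auto
   moreover have "(\<Prod>r\<in>I - {i} - {k}. A r ((p \<circ> t) r)) = (\<Prod>r\<in>I - {i} - {k}. A r (p r))"
    by (rule prod.cong) (auto simp: t_def transpose_def)
   ultimately show ?thesis unfolding S_def R_def prod.remove[OF ki(2,1)] by (simp add: t_def)
  qed
  have "(\<Sum>p | p permutes I. S p) = (\<Sum>p | p permutes I. S (p \<circ> t))"
   by (rule sum.reindex_bij_witness[of _ "%p. p \<circ> t" "%p. p \<circ> t"])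
    (auto simp: o_assoc[symmetric] t permutes_compose)
  also have "... = - (\<Sum>p | p permutes I. S p)" using St by (simp add: sum_negf)
  finally show ?thesis by simp
 qed
 finally show ?thesis by simp
qed

lemma det_on_cong: "(!!i j. i \<in> I ==> j \<in> I ==> A i j = B i j) ==> det_on I A = det_on I B"
 unfolding det_on_def by (intro sum.cong arg_cong2[where f = times] prod.cong) (auto simp: permutes_in_image)

text \<open>In a Gram matrix the change of one vector is a row operation followed by the same column
  operation; transposition reduces the second to the first.\<close>

lemma det_on_gram_step:
 fixes B :: "'v::real_vector => 'v => real"
 assumes I: "finite I" and B: "bilinear B" and ik: "i \<in> I" "k \<in> I" "i ~= k"
 shows "det_on I (%r c. B ((W(i := W i + x *R W k)) r) ((W(i := W i + x *R W k)) c)) = det_on I (%r c. B (W r) (W c))"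
proof -
 define W' where "W' = W(i := W i + x *R W k)"
 note bl = bilinear_ladd[OF B] bilinear_radd[OF B] bilinear_lmul[OF B] bilinear_rmul[OF B]
 have "det_on I (%r c. B (W r) (W c)) = det_on I (%r c. if r = i then B (W i) (W c) + x * B (W k) (W c) else B (W r) (W c))"
  by (rule det_on_row_combination[OF I ik, symmetric])
 also have "... = det_on I (%r c. B (W' r) (W c))" by (rule det_on_cong) (simp add: W'_def bl)
 also have "... = det_on I (%r c. B (W' c) (W r))" by (rule det_on_transpose[OF I, symmetric])
 also have "... = det_on I (%r c. if r = i then B (W' c) (W i) + x * B (W' c) (W k) else B (W' c) (W r))"
  by (rule det_on_row_combination[OF I ik, symmetric])
 also have "... = det_on I (%r c. B (W' c) (W' r))" by (rule det_on_cong) (simp add: W'_def bl)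
 also have "... = det_on I (%r c. B (W' r) (W' c))" by (rule det_on_transpose[OF I])
 finally show ?thesis by (simp add: W'_def)
qed

lemma det_on_gram_sum:
 fixes B :: "'v::real_vector => 'v => real"
 assumes I: "finite I" and B: "bilinear B" and i: "i \<in> I" and K: "finite K" "K <= I - {i}"
 shows "det_on I (%r c. B ((W(i := W i + (\<Sum>k\<in>K. x k *R W k))) r) ((W(i := W i + (\<Sum>k\<in>K. x k *R W k))) c))
  = det_on I (%r c. B (W r) (W c))" using K proof (induction K rule: finite_induct)
 case (insert k K)
 define V where "V = W(i := W i + (\<Sum>k\<in>K. x k *R W k))"
 have ki: "k \<in> I" "i ~= k" using insert.prems by auto
 have "V(i := V i + x k *R V k) = W(i := W i + (\<Sum>k\<in>insert k K. x k *R W k))"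
  using insert.hyps ki by (auto simp: V_def fun_eq_iff add_ac)
 moreover have "det_on I (%r c. B (V r) (V c)) = det_on I (%r c. B (W r) (W c))" using insert unfolding V_def by auto
 ultimately show ?case using det_on_gram_step[OF I B i ki, of V "x k"] by simp
qed simp

text \<open>Vectors are replaced in increasing order of index, so the ones added at step
  \<open>m\<close> have not been altered yet.\<close>

lemma det_on_gram_triangular:
 fixes B :: "'v::real_vector => 'v => real" and W :: "nat => 'v"
 assumes I: "finite I" and B: "bilinear B"
 shows "det_on I (%r c. B (W r + (\<Sum>k\<in>{k\<in>I. r < k}. Q r k *R W k)) (W c + (\<Sum>k\<in>{k\<in>I. c < k}. Q c k *R W k)))
  = det_on I (%r c. B (W r) (W c))" proof -
 define V where "V r = W r + (\<Sum>k\<in>{k\<in>I. r < k}. Q r k *R W k)" for r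
 define U where "U m r = (if r < m then V r else W r)" for m r
 have step: "det_on I (%r c. B (U m r) (U m c)) = det_on I (%r c. B (W r) (W c))" for m
 proof (induction m)
  case 0
  show ?case by (simp add: U_def)
 next
  case (Suc m)
  show ?case
  proof (cases "m \<in> I")
   case True
   have "U (Suc m) = (U m)(m := U m m + (\<Sum>k\<in>{k\<in>I. m < k}. Q m k *R U m k))"
    by (auto simp: U_def V_def fun_eq_iff intro!: sum.cong)
   then show ?thesis using det_on_gram_sum[OF I B True, of "{k\<in>I. m < k}" "U m" "Q m"] Suc.IH I by auto
  next
   case False
   have "det_on I (%r c. B (U (Suc m) r) (U (Suc m) c)) = det_on I (%r c. B (U m r) (U m c))"
    by (rule det_on_cong) (use False in \<open>auto simp: U_def less_Suc_eq\<close>)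
   then show ?thesis using Suc.IH by simp
  qed
 qed
 obtain m where m: "I <= {..<m}" using finite_nat_iff_bounded[of I] I by blast
 have "det_on I (%r c. B (V r) (V c)) = det_on I (%r c. B (U m r) (U m c))"
  by (rule det_on_cong) (use m in \<open>auto simp: U_def\<close>)
 then show ?thesis using step by (simp add: V_def)
qed

section \<open>Invariance of the measures\<close>

text \<open>\<open>theta\<close> is \<open>F\<close> read in the coordinates \<open>s\<close>, so
  invariance of the coordinate measure is pushed forward; a constant factor does no harm.\<close>

lemma scaled_distr_invariant:
 assumes s: "s \<in> measurable T R" and theta: "theta \<in> measurable T T" "distr T T theta = T"
  and F: "F \<in> measurable R R" "!!t. t \<in> space T ==> F (s t) = s (theta t)" and M: "M = scale_measure c (distr T R s)"
 shows "distr M M F = M" and "F \<in> measurable M M"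
proof -
 have sets: "sets M = sets R" by (simp add: M)
 then show FM: "F \<in> measurable M M" using F(1) by (simp cong: measurable_cong_sets)
 have e: "emeasure M A = c * emeasure T (s -` A \<inter> space T)" if "A \<in> sets R" for A
  using that s by (simp add: M emeasure_distr)
 show "distr M M F = M"
 proof (rule measure_eqI)
  fix A assume "A \<in> sets (distr M M F)"
  then have A: "A \<in> sets R" by (simp add: sets)
  have FA: "F -` A \<inter> space R \<in> sets R" using F(1) A by (rule measurable_sets)
  have spM: "space M = space R" using sets by (rule sets_eq_imp_space_eq)
  have sA: "s -` A \<inter> space T \<in> sets T" using s A by (rule measurable_sets)
  have "emeasure (distr M M F) A = emeasure M (F -` A \<inter> space R)" using A by (simp add: emeasure_distr[OF FM] sets spM)
  also have "... = c * emeasure T (s -` (F -` A \<inter> space R) \<inter> space T)" by (rule e[OF FA])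
  also have "s -` (F -` A \<inter> space R) \<inter> space T = theta -` (s -` A \<inter> space T) \<inter> space T"
   using measurable_space[OF s] measurable_space[OF theta(1)] F(2) by auto
  also have "emeasure T ... = emeasure (distr T T theta) (s -` A \<inter> space T)"
   by (rule emeasure_distr[OF theta(1) sA, symmetric])
  also have "c * ... = emeasure M A" using theta(2) by (simp add: e[OF A])
  finally show "emeasure (distr M M F) A = emeasure M A" .
 qed simp
qed

context flat_rep
begin

lemma coord_field:
 assumes xi: "xi \<in> orbit D" and ij: "i \<in> jump D" "j \<in> jump D"
 shows "- blinfun_apply xi (br (coord_field D xi i) (jh D j)) = (if i = j then 1 else 0)"
proof -
 have "EX Y. ALL U. blinfun_apply xi (br Y U) = inner (- wd i) U"
 proof (rule coadjoint_tangent)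
  fix X assume "!!Y. blinfun_apply xi (br X Y) = 0"
  then have "X \<in> zc" by (rule orbit_stab[OF xi])
  then show "inner (- wd i) X = 0" using wd_zc[OF ij(1)] by simp
 qed
 then obtain Y where "!!U. blinfun_apply xi (br Y U) = inner (- wd i) U" by blast
 then have "\<forall>j\<in>jump D. - blinfun_apply xi (br Y (jh D j)) = (if i = j then 1 else 0)" using wd[OF ij(1)] by auto
 from someI[of "%X. \<forall>j\<in>jump D. - blinfun_apply xi (br X (jh D j)) = (if i = j then 1 else 0)", OF this]
 show ?thesis using ij(2) unfolding coord_field_def by blast
qed

lemma bilinear_orbit_form: "bilinear (%X Y. blinfun_apply xi (br X Y))"
 by (auto intro!: linearI simp: bilinear_def br_simps blinfun.bilinear_simps)

text \<open>\<open>W\<close> consists of the coordinate fields at the moved point carried back to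
  \<open>xi\<close>. Modulo the centre they arise from the coordinate fields at \<open>xi\<close> by
  the unitriangular matrix \<open>Q\<close>, which preserves the Gram determinant of the orbit
  form.\<close>

lemma liouville_density_CoAd:
 assumes xi: "xi \<in> orbit D"
 shows "liouville_density D (CoAd D g xi) = liouville_density D xi"
proof -
 define X where "X = coord_field D xi"
 define W where "W i = Ad D (ginv g) (coord_field D (CoAd D g xi) i)" for i
 define Q where "Q i k = - blinfun_apply xi (br (W i) (jh D k))" for i k
 have xi': "CoAd D g xi \<in> orbit D" using xi CoAd_orbit by blast
 have W: "- blinfun_apply xi (br (W i) (Ad D (ginv g) (jh D j))) = (if i = j then 1 else 0)"
  if "i \<in> jump D" "j \<in> jump D" for i j using coord_field[OF xi' that] by (simp add: W_def CoAd_apply Ad_br)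
 have rel: "Q i j + (\<Sum>k\<in>jump D. Adc g j k * Q i k) = (if i = j then 1 else 0)" if ij: "i \<in> jump D" "j \<in> jump D" for i j
 proof -
  define V where "V = Ad D (ginv g) (jh D j) - jh D j"
  have pjV: "pj V = psum (Adc g j)" by (simp add: pj_def psum_def Adc_def V_def)
  have "br (W i) (V - pj V) = 0" using pj_zc by simp
  then have "br (W i) (Ad D (ginv g) (jh D j)) = br (W i) (jh D j) + br (W i) (psum (Adc g j))"
   unfolding pjV[symmetric] by (simp add: V_def br_simps algebra_simps)
  moreover have "blinfun_apply xi (br (W i) (psum (Adc g j))) = (\<Sum>k\<in>jump D. Adc g j k * blinfun_apply xi (br (W i) (jh D k)))"
   by (simp add: psum_def linear_sum[OF linear_br] br_simps blinfun.sum_right blinfun.scaleR_right)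
  ultimately show ?thesis using W[OF ij] by (simp add: Q_def blinfun.add_right sum_negf)
 qed
 \<comment> \<open>Strong induction in \<open>j\<close>: the sum in \<open>rel\<close> only involves
   \<open>k < j\<close>, and those \<open>Q i k\<close> vanish because \<open>k < i\<close>.\<close>
 have Qlow: "Q i j = (if i = j then 1 else 0)" if "i \<in> jump D" "j \<in> jump D" "j <= i" for i j using that(2,3)
 proof (induction j rule: less_induct)
  case (less j)
  have "(\<Sum>k\<in>jump D. Adc g j k * Q i k) = (\<Sum>k\<in>jump D. 0)"
  proof (rule sum.cong[OF refl])
   fix k assume k: "k \<in> jump D"
   show "Adc g j k * Q i k = 0" using Adc_triangular[of j k g] less.IH[of k] less.prems k by (cases "k < j") auto
  qed
  then show ?case using rel[OF that(1) less.prems(1)] by simp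
 qed
 have Wz: "W i - (\<Sum>k\<in>jump D. Q i k *R X k) \<in> zc" if i: "i \<in> jump D" for i
 proof (rule orbit_stab[OF xi])
  fix Y
  define R where "R = W i - (\<Sum>k\<in>jump D. Q i k *R X k)"
  have lin: "linear (%X. br X Y)" for Y by (rule linearI) (simp_all add: br_simps)
  have "blinfun_apply xi (br R (jh D j)) = 0" if j: "j \<in> jump D" for j
  proof -
   have "blinfun_apply xi (br R (jh D j)) = - Q i j - (\<Sum>k\<in>jump D. Q i k * blinfun_apply xi (br (X k) (jh D j)))"
    by (simp add: R_def br_simps linear_sum[OF lin] blinfun.bilinear_simps blinfun.sum_right Q_def)
   also have "(\<Sum>k\<in>jump D. Q i k * blinfun_apply xi (br (X k) (jh D j))) = (\<Sum>k\<in>jump D. if k = j then - Q i j else 0)"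
   proof (rule sum.cong[OF refl])
    fix k assume "k \<in> jump D"
    from coord_field[OF xi this j] have "blinfun_apply xi (br (X k) (jh D j)) = (if k = j then - 1 else 0)"
     unfolding X_def by (simp split: if_splits)
    then show "Q i k * blinfun_apply xi (br (X k) (jh D j)) = (if k = j then - Q i j else 0)" by simp
   qed
   finally show ?thesis using j by simp
  qed
  then have "blinfun_apply xi (br R (pj Y)) = 0"
   by (simp add: pj_def psum_def linear_sum[OF linear_br] br_simps blinfun.sum_right blinfun.scaleR_right)
  moreover have "br R (Y - pj Y) = 0" using pj_zc by simp
  ultimately show "blinfun_apply xi (br (W i - (\<Sum>k\<in>jump D. Q i k *R X k)) Y) = 0"
   unfolding R_def[symmetric] by (simp add: br_simps)
 qed
 have Weq: "blinfun_apply xi (br (W i) (W j)) = blinfun_apply xi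
   (br (X i + (\<Sum>k\<in>{k\<in>jump D. i < k}. Q i k *R X k)) (X j + (\<Sum>k\<in>{k\<in>jump D. j < k}. Q j k *R X k)))"
  if ij: "i \<in> jump D" "j \<in> jump D" for i j
 proof -
  have s: "(\<Sum>k\<in>jump D. Q i k *R X k) = X i + (\<Sum>k\<in>{k\<in>jump D. i < k}. Q i k *R X k)" if i: "i \<in> jump D" for i
  proof -
   have "(\<Sum>k\<in>jump D. Q i k *R X k) = Q i i *R X i + (\<Sum>k\<in>jump D - {i}. Q i k *R X k)"
    using i by (simp add: sum.remove[of _ i])
   also have "(\<Sum>k\<in>jump D - {i}. Q i k *R X k) = (\<Sum>k\<in>{k\<in>jump D. i < k}. Q i k *R X k)"
    using Qlow[OF i] by (intro sum.mono_neutral_right) (auto simp: not_less)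
   finally show ?thesis using Qlow[OF i i] by simp
  qed
  have "br (W i) (W j) = br (\<Sum>k\<in>jump D. Q i k *R X k) (\<Sum>k\<in>jump D. Q j k *R X k)"
  proof -
   have "br (W i - (\<Sum>k\<in>jump D. Q i k *R X k)) (W j) = 0" "br (\<Sum>k\<in>jump D. Q i k *R X k) (W j - (\<Sum>k\<in>jump D. Q j k *R X k)) = 0"
    using Wz ij by simp_all
   then show ?thesis by (simp add: br_simps)
  qed
  then show ?thesis by (simp only: s ij)
 qed
 have "liouville_density D (CoAd D g xi) = sqrt (det_on (jump D) (%i j. blinfun_apply xi (br (W i) (W j))))"
  by (simp add: liouville_density_def CoAd_apply Ad_br W_def)
 also have "det_on (jump D) (%i j. blinfun_apply xi (br (W i) (W j))) = det_on (jump D) (%i j. blinfun_apply xi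
   (br (X i + (\<Sum>k\<in>{k\<in>jump D. i < k}. Q i k *R X k)) (X j + (\<Sum>k\<in>{k\<in>jump D. j < k}. Q j k *R X k))))"
  by (rule det_on_cong) (rule Weq)
 also have "... = det_on (jump D) (%i j. blinfun_apply xi (br (X i) (X j)))"
  by (rule det_on_gram_triangular[OF finite_jump bilinear_orbit_form])
 finally show ?thesis by (simp add: liouville_density_def X_def)
qed

section \<open>The two measures as images of Lebesgue measure\<close>

definition Ro :: "('a =>L real) measure" where "Ro = restrict_space borel (orbit D)"

definition Rp :: "'a measure" where "Rp = restrict_space borel (predual D)"

lemma space_Ro [simp]: "space Ro = orbit D" and space_Rp [simp]: "space Rp = predual D"
 by (simp_all add: Ro_def Rp_def space_restrict_space)

lemma sc_measurable: "sc \<in> measurable T Ro" unfolding Ro_def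
proof (rule measurable_restrict_space2)
 have "sv \<in> borel_measurable T" unfolding sv_def by measurable
 moreover have "blinfun_inner_left \<in> borel_measurable (borel :: 'a measure)"
  by (rule borel_measurable_continuous_onI, rule bounded_linear.continuous_on[OF bounded_linear_blinfun_inner_left])
   (rule continuous_on_id)
 ultimately show "sc \<in> borel_measurable T" unfolding sc_def by (rule measurable_compose)
qed (simp add: sc_orbit)

lemma psum_predual: "psum x \<in> predual D" unfolding psum_def predual_def by (intro span_sum span_scale span_base) auto

lemma psum_measurable: "psum \<in> measurable T Rp" unfolding Rp_def
proof (rule measurable_restrict_space2)
 show "psum \<in> borel_measurable T" unfolding psum_def by measurable
qed (simp add: psum_predual)

text \<open>The density is invariant and the orbit homogeneous, so the density is constant in
  coordinates.\<close>

lemma liou_eq: "\<exists>c>0. \<exists>d\<ge>0. liou D = scale_measure (ennreal c) (distr (density T (%t. ennreal d)) Ro sc)"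
proof -
 obtain c where c: "0 < c" "liou D = scale_measure (ennreal c) (liouville D)"
  using liou_norm by (auto simp: liouville_normalized_def)
 define d where "d = liouville_density D (base D)"
 have base: "base D \<in> orbit D" by (simp add: orbit_eq)
 have dens: "liouville_density D (sc t) = d" for t
 proof -
  obtain g where "sc t = CoAd D g (base D)" using sc_orbit[of t] by (auto simp: orbit_iff)
  then show ?thesis using liouville_density_CoAd[OF base] by (simp add: d_def)
 qed
 \<comment> \<open>\<open>ennreal\<close> truncates negative numbers, which \<open>max 0 d\<close>
   makes explicit; the sign of the determinant is left open.\<close>
 have "density T (%t. ennreal (liouville_density D (sec D t))) = density T (%t. ennreal (max 0 d))"
 proof (rule measure_eqI)
  fix A assume "A \<in> sets (density T (%t. ennreal (liouville_density D (sec D t))))"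
  then have A: "A \<in> sets T" by simp
  have "(%t. ennreal (liouville_density D (sec D t))) \<in> borel_measurable T \<longleftrightarrow> (%t. ennreal d) \<in> borel_measurable T"
   by (rule measurable_cong) (simp add: sec_eq dens)
  then have m: "(%t. ennreal (liouville_density D (sec D t))) \<in> borel_measurable T" by simp
  show "emeasure (density T (%t. ennreal (liouville_density D (sec D t)))) A = emeasure (density T (%t. ennreal (max 0 d))) A"
   unfolding emeasure_density[OF m A] emeasure_density[OF borel_measurable_const A]
   by (rule nn_integral_cong) (simp add: sec_eq dens max_def ennreal_neg)
 qed simp
 moreover have "distr M Ro (sec D) = distr M Ro sc" if "sets M = sets T" for M
  using sets_eq_imp_space_eq[OF that] by (intro distr_cong) (auto simp: sec_eq)
 ultimately have "liouville D = distr (density T (%t. ennreal (max 0 d))) Ro sc"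
  unfolding liouville_def Ro_def[symmetric] by simp
 then show ?thesis using c by (intro exI[of _ c] conjI exI[of _ "max 0 d"]) auto
qed

end

lemma density_scale:
 assumes s: "s \<in> measurable T R" and c: "0 <= c" "0 <= d"
 shows "scale_measure (ennreal c) (distr (density T (%t. ennreal d)) R s) = distr (density T (%t. ennreal (c * d))) R s"
proof (rule measure_eqI)
 fix A assume "A \<in> sets (scale_measure (ennreal c) (distr (density T (%t. ennreal d)) R s))"
 then have A: "A \<in> sets R" by simp
 have sA: "s -` A \<inter> space T \<in> sets T" using s A by (rule measurable_sets)
 show "emeasure (scale_measure (ennreal c) (distr (density T (%t. ennreal d)) R s)) A
   = emeasure (distr (density T (%t. ennreal (c * d))) R s) A"
  using A s c sA by (simp add: emeasure_distr emeasure_density_const ennreal_mult mult.assoc)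
qed simp

lemma scale_measure_density:
 assumes s: "s \<in> measurable T R" and c: "0 <= c"
 shows "scale_measure (ennreal c) (distr T R s) = distr (density T (%t. ennreal c)) R s"
 using density_scale[OF s c, of 1] by (simp add: density_1)

context flat_rep
begin

definition lc :: real where
 "lc = (SOME c. 0 <= c & liou D = distr (density T (%_. ennreal c)) Ro sc)"

definition pc :: real where
 "pc = (SOME c. 0 < c & leb D = distr (density T (%_. ennreal c)) Rp psum)"

lemma lc: "0 <= lc" and liou_density: "liou D = distr (density T (%_. ennreal lc)) Ro sc"
proof -
 have "EX c. 0 <= c & liou D = distr (density T (%_. ennreal c)) Ro sc"
  using liou_eq density_scale[OF sc_measurable] by (metis less_imp_le mult_nonneg_nonneg)
 from someI_ex[OF this] show "0 <= lc" "liou D = distr (density T (%_. ennreal lc)) Ro sc" unfolding lc_def by auto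
qed

lemma pc: "0 < pc" and leb_density: "leb D = distr (density T (%_. ennreal pc)) Rp psum"
proof -
 obtain c where c: "0 < c" "leb D = scale_measure (ennreal c) (distr T Rp psum)"
  using leb_norm unfolding lebesgue_normalized_def psum_def[abs_def] Rp_def by blast
 then have "EX c. 0 < c & leb D = distr (density T (%_. ennreal c)) Rp psum"
  using scale_measure_density[OF psum_measurable, of c] by (intro exI[of _ c]) simp
 from someI_ex[OF this] show "0 < pc" "leb D = distr (density T (%_. ennreal pc)) Rp psum" unfolding pc_def by auto
qed

lemma sets_liou: "sets (liou D) = sets Ro" and sets_leb: "sets (leb D) = sets Rp" by (simp_all add: liou_density leb_density)

lemma space_liou [simp]: "space (liou D) = orbit D" and space_leb [simp]: "space (leb D) = predual D"
 using sets_eq_imp_space_eq[OF sets_liou] sets_eq_imp_space_eq[OF sets_leb] by simp_all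

lemma integral_liou:
 fixes f :: "('a =>L real) => 'b::{banach, second_countable_topology}"
 assumes f: "f \<in> borel_measurable (liou D)"
 shows "(LINT xi|liou D. f xi) = lc *R (LINT t|T. f (sc t))" and "integrable T (%t. f (sc t)) ==> integrable (liou D) f"
proof -
 have fR: "f \<in> borel_measurable Ro" using f by (simp cong: measurable_cong_sets add: sets_liou)
 have s: "sc \<in> measurable (density T (%_. ennreal lc)) Ro" using sc_measurable by simp
 have m: "(%t. f (sc t)) \<in> borel_measurable T" by (rule measurable_compose[OF sc_measurable fR])
 show "(LINT xi|liou D. f xi) = lc *R (LINT t|T. f (sc t))"
  unfolding liou_density integral_distr[OF s fR] using lc m by (subst integral_density) simp_all
 assume "integrable T (%t. f (sc t))"
 then show "integrable (liou D) f"
  unfolding liou_density integrable_distr_eq[OF s fR] using lc m by (subst integrable_density) simp_all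
qed

lemma integral_leb:
 fixes f :: "'a => 'b::{banach, second_countable_topology}"
 assumes f: "f \<in> borel_measurable (leb D)"
 shows "integrable T (%x. f (psum x)) ==> integrable (leb D) f"
proof -
 have fR: "f \<in> borel_measurable Rp" using f by (simp cong: measurable_cong_sets add: sets_leb)
 have s: "psum \<in> measurable (density T (%_. ennreal pc)) Rp" using psum_measurable by simp
 have m: "(%t. f (psum t)) \<in> borel_measurable T" by (rule measurable_compose[OF psum_measurable fR])
 assume "integrable T (%x. f (psum x))"
 then show "integrable (leb D) f"
  unfolding leb_density integrable_distr_eq[OF s fR] using pc m by (subst integrable_density) simp_all
qed

lemma bounded_linear_CoAd: "bounded_linear (CoAd D g)"
proof -
 have "CoAd D g = (%xi. xi o\<^sub>L Blinfun (Ad D (ginv g)))"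
  by (rule ext, rule blinfun_eqI) (simp add: CoAd_apply bounded_linear_Blinfun_apply bounded_linear_Ad)
 then show ?thesis
  using bounded_bilinear.bounded_linear_left[OF bounded_bilinear_blinfun_compose, of "Blinfun (Ad D (ginv g))"] by simp
qed

lemma bounded_linear_pj: "bounded_linear pj" using linear_pj by (simp add: linear_conv_bounded_linear)

lemma liou_CoAd: "distr (liou D) (liou D) (CoAd D g) = liou D" "CoAd D g \<in> measurable (liou D) (liou D)"
proof -
 have F: "CoAd D g \<in> measurable Ro Ro" unfolding Ro_def
  by (intro measurable_restrict_space3 borel_measurable_continuous_onI bounded_linear.continuous_on[OF bounded_linear_CoAd])
   (use CoAd_orbit in \<open>auto simp: continuous_on_id\<close>)
 have M: "liou D = scale_measure (ennreal lc) (distr T Ro sc)"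
  using liou_density scale_measure_density[OF sc_measurable lc] by simp
 show "distr (liou D) (liou D) (CoAd D g) = liou D" "CoAd D g \<in> measurable (liou D) (liou D)"
  using scaled_distr_invariant[OF sc_measurable distr_cth[of g] F _ M] by (auto simp: sc_cth)
qed

text \<open>\<open>Ad g\<close> need not preserve the predual. Projecting back changes the argument
  by a central vector, which affects transforms and operators only through phases.\<close>

definition al :: "'g => 'a => 'a" where "al g Y = pj (Ad D g Y)"

lemma pj_predual: "pj X \<in> predual D" by (simp add: pj_def psum_predual)

lemma leb_al: "distr (leb D) (leb D) (al g) = leb D" "al g \<in> measurable (leb D) (leb D)"
proof -
 have F: "al g \<in> measurable Rp Rp" unfolding Rp_def al_def
  by (intro measurable_restrict_space3 borel_measurable_continuous_onI bounded_linear.continuous_on[OF bounded_linear_pj]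
    bounded_linear.continuous_on[OF bounded_linear_Ad] continuous_on_id) (auto simp: pj_predual)
 have M: "leb D = scale_measure (ennreal pc) (distr T Rp psum)"
  using leb_density scale_measure_density[OF psum_measurable] pc by simp
 show "distr (leb D) (leb D) (al g) = leb D" "al g \<in> measurable (leb D) (leb D)"
  using scaled_distr_invariant[OF psum_measurable distr_pth[of g] F _ M] by (auto simp: al_def pj_Ad_psum)
qed

lemma integral_liou_CoAd:
 fixes f :: "('a =>L real) => 'b::{banach, second_countable_topology}"
 assumes "f \<in> borel_measurable (liou D)"
 shows "(LINT xi|liou D. f (CoAd D g xi)) = (LINT xi|liou D. f xi)"
 using integral_distr[OF liou_CoAd(2) assms, of g] by (simp add: liou_CoAd(1))

lemma nn_integral_liou_CoAd:
 "f \<in> borel_measurable (liou D) ==> (\<integral>\<^sup>+xi. f (CoAd D g xi) \<partial>liou D) = (\<integral>\<^sup>+xi. f xi \<partial>liou D)"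
 using nn_integral_distr[OF liou_CoAd(2), of f g] by (simp add: liou_CoAd(1))

lemma integrable_liou_CoAd:
 fixes f :: "('a =>L real) => 'b::{banach, second_countable_topology}"
 shows "integrable (liou D) f ==> integrable (liou D) (%xi. f (CoAd D g xi))"
 using integrable_distr[OF liou_CoAd(2), of g f] by (simp add: liou_CoAd(1))

lemma integral_leb_al:
 fixes f :: "'a => 'b::{banach, second_countable_topology}"
 assumes "f \<in> borel_measurable (leb D)"
 shows "(LINT X|leb D. f (al g X)) = (LINT X|leb D. f X)" using integral_distr[OF leb_al(2) assms, of g] by (simp add: leb_al(1))

lemma nn_integral_leb_al:
 "f \<in> borel_measurable (leb D) ==> (\<integral>\<^sup>+X. f (al g X) \<partial>leb D) = (\<integral>\<^sup>+X. f X \<partial>leb D)"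
 using nn_integral_distr[OF leb_al(2), of f g] by (simp add: leb_al(1))

lemma integrable_leb_al:
 fixes f :: "'a => 'b::{banach, second_countable_topology}"
 shows "integrable (leb D) f ==> integrable (leb D) (%X. f (al g X))"
 using integrable_distr[OF leb_al(2), of g f] by (simp add: leb_al(1))

section \<open>Covariance of the Fourier transform\<close>

lemma borel_liou: "f \<in> borel_measurable borel ==> f \<in> borel_measurable (liou D)"
 and borel_leb: "f' \<in> borel_measurable borel ==> f' \<in> borel_measurable (leb D)"
 by (simp_all cong: measurable_cong_sets add: sets_liou sets_leb Ro_def Rp_def measurable_restrict_space1)

lemma eval_measurable: "(%xi. blinfun_apply xi X) \<in> borel_measurable (liou D)"
 by (intro borel_liou borel_measurable_continuous_onI bounded_linear.continuous_on[OF blinfun.bounded_linear_left] continuous_on_id)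

lemma cis_eval_measurable: "(%xi. cis (- blinfun_apply xi X)) \<in> borel_measurable (liou D)"
 by (rule measurable_compose[OF eval_measurable, of "%x. cis (- x)"]) (intro borel_measurable_continuous_onI continuous_intros)

lemma fourier_CoAd:
 assumes b: "b \<in> borel_measurable (liou D)"
 shows "fourier D (%xi. b (CoAd D g xi)) X = fourier D b (Ad D g X)"
proof -
 have "(%eta. cis (- blinfun_apply eta (Ad D g X)) * b eta) \<in> borel_measurable (liou D)"
  by (intro borel_measurable_times cis_eval_measurable b)
 from integral_liou_CoAd[OF this, of g] show ?thesis by (simp add: fourier_def CoAd_apply)
qed

text \<open>All functionals on the orbit agree on the central part of \<open>X\<close>, so that part
  comes out of the integral as a phase.\<close>

lemma fourier_pj: "fourier D b X = cis (- base D (X - pj X)) * fourier D b (pj X)"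
proof -
 have "fourier D b X = (LINT xi|liou D. cis (- base D (X - pj X)) * (cis (- blinfun_apply xi (pj X)) * b xi))"
  unfolding fourier_def
 proof (rule Bochner_Integration.integral_cong[OF refl])
  fix xi assume "xi \<in> space (liou D)"
  then have "blinfun_apply xi (X - pj X) = base D (X - pj X)" using pj_zc by (simp add: orbit_eq)
  then have "blinfun_apply xi X = base D (X - pj X) + blinfun_apply xi (pj X)" by (simp add: blinfun.diff_right)
  then show "cis (- blinfun_apply xi X) * b xi = cis (- base D (X - pj X)) * (cis (- blinfun_apply xi (pj X)) * b xi)"
   by (simp add: cis_mult flip: mult.assoc)
 qed
 then show ?thesis by (simp add: fourier_def)
qed

text \<open>The phase is conjugate to the one in \<open>fourier_pj\<close>, so the two cancel in the
  integrand of \<open>Op\<close>.\<close>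

lemma rep_pj: "rep D (lexp D X) u = cis (base D (X - pj X)) *C rep D (lexp D (pj X)) u"
proof -
 have "lexp D X = lexp D (pj X) \<cdot> lexp D (X - pj X)" using lexp_add_zc[OF pj_zc, of "pj X" X] by simp
 then show ?thesis by (simp add: rep_mult central_character[OF pj_zc] U_scaleC)
qed

end

section \<open>Schwartz functions of finitely many variables\<close>

lemma fun_upd_ext [simp]: "t \<in> extensional I ==> j \<in> I ==> t(j := s) \<in> extensional I" by (auto simp: extensional_def)

definition partially_C1 :: "nat set => ((nat => real) => complex) => bool" where
 "partially_C1 I F \<longleftrightarrow> (\<forall>j\<in>I. continuous_on (extensional I) (partial j F) &
   (\<forall>t\<in>extensional I. (%s. F (t(j := s))) differentiable (at (t j))))"

lemma partial_derivative:
 assumes "partially_C1 I F" "t \<in> extensional I" "j \<in> I"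
 shows "((%s. F (t(j := s))) has_vector_derivative partial j F (t(j := s))) (at s)"
proof -
 have "t(j := s) \<in> extensional I" using assms by simp
 then have "(%x. F (t(j := s, j := x))) differentiable (at ((t(j := s)) j))" using assms(1,3) unfolding partially_C1_def by blast
 then have "(%x. F (t(j := x))) differentiable (at s)" by simp
 then show ?thesis using vector_derivative_works[of "%x. F (t(j := x))" "at s"] by (simp add: partial_def)
qed

text \<open>The chain rule from continuous partial derivatives, one coordinate at a time. Moving the
  old coordinates by \<open>x\<close> and setting the new one to \<open>y\<close> gives a function
  of two variables of which only the \<open>y\<close>-derivative has to be jointly
  continuous.\<close>

lemma line_derivative_zero:
 assumes F: "partially_C1 I F" and t: "t \<in> extensional I" and J: "finite J" "J <= I"
 shows "((%s. F (%i. if i \<in> J then t i + s * v i else t i)) has_vector_derivative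
  (\<Sum>j\<in>J. v j *R partial j F t)) (at 0)" using J proof (induction J rule: finite_induct)
 case empty
 then show ?case by simp
next
 case (insert k J)
 define c where "c x y = (%i. if i \<in> J then t i + x * v i else t i)(k := y)" for x y :: real
 have k: "k \<in> I" "k \<notin> J" using insert by auto
 have c: "c x y \<in> extensional I" for x y using t insert.prems by (auto simp: c_def extensional_def)
 define f where "f x y = F (c x y)" for x y
 define D where "D = (\<Sum>j\<in>J. v j *R partial j F t)"
 define p where "p x y = partial k F (c x y)" for x y
 have ctk: "c x (t k) = (%i. if i \<in> J then t i + x * v i else t i)" for x using k by (auto simp: c_def)
 have "((%x. f x (t k)) has_vector_derivative D) (at 0)" using insert by (simp add: f_def ctk D_def)
 then have 1: "((%x. f x (t k)) has_derivative (%h. h *R D)) (at 0 within UNIV)" by (simp add: has_vector_derivative_def)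
 have 2: "(f x has_derivative blinfun_apply (blinfun_scaleR_left (p x y))) (at y within UNIV)" for x y
  using partial_derivative[OF F c[of x y] k(1), of y] by (simp add: f_def[abs_def] p_def has_vector_derivative_def c_def)
 have cc: "continuous_on UNIV (%(x, y). c x y)" unfolding c_def case_prod_unfold
 proof (rule continuous_on_coordinatewise_then_product)
  fix i
  show "continuous_on UNIV (%z. ((%i. if i \<in> J then t i + fst z * v i else t i)(k := snd z)) i)"
   by (cases "i = k"; cases "i \<in> J") (auto intro!: continuous_intros)
 qed
 have pc: "continuous_on (extensional I) (partial k F)" using F k(1) by (simp add: partially_C1_def)
 have "(%(x, y). c x y) ` UNIV <= extensional I" by (auto intro: c)
 from continuous_on_compose2[OF pc cc this]
 have "continuous_on UNIV (%z. partial k F (case z of (x, y) => c x y))" .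
 then have "continuous_on UNIV (%z. blinfun_scaleR_left (partial k F (case z of (x, y) => c x y)) :: real =>L complex)"
  by (rule bounded_linear.continuous_on[OF bounded_linear_blinfun_scaleR_left])
 then have 3: "continuous (at (0, t k) within UNIV \<times> UNIV) (%(x, y). blinfun_scaleR_left (p x y) :: real =>L complex)"
  by (simp add: p_def continuous_on_eq_continuous_within case_prod_unfold)
 have "((%(x, y). f x y) has_derivative (%(a, b). a *R D + blinfun_scaleR_left (p 0 (t k)) b)) (at (0, t k) within UNIV \<times> UNIV)"
  by (rule has_derivative_partialsI[OF 1 2 3]) auto
 then have A: "((%(x, y). f x y) has_derivative (%(a, b). a *R D + b *R p 0 (t k))) (at (0, t k + 0 * v k))" by simp
 have B: "((%s::real. (s, t k + s * v k)) has_derivative (%h. (h, h * v k))) (at 0)" by (auto intro!: derivative_eq_intros)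
 have "((%s. f s (t k + s * v k)) has_derivative (%h. h *R D + (h * v k) *R p 0 (t k))) (at 0)"
  using has_derivative_compose[OF B A] by simp
 moreover have "f s (t k + s * v k) = F (%i. if i \<in> insert k J then t i + s * v i else t i)" for s
  unfolding f_def c_def using k by (intro arg_cong[where f = F]) auto
 moreover have "p 0 (t k) = partial k F t" by (simp add: p_def c_def fun_upd_idem_iff cong: if_cong)
 moreover have "h *R D + (h * v k) *R partial k F t = h *R (\<Sum>j\<in>insert k J. v j *R partial j F t)" for h
  using insert.hyps by (simp add: D_def scaleR_add_right)
 ultimately show ?case by (simp add: has_vector_derivative_def)
qed

lemma line_derivative:
 assumes F: "partially_C1 I F" and I: "finite I" and c: "!!s. c s \<in> extensional I"
  and lin: "!!i s. i \<in> I ==> c s i = a i + s * v i"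
 shows "((%s. F (c s)) has_vector_derivative (\<Sum>j\<in>I. v j *R partial j F (c s))) (at s)"
proof -
 have "c (s + h) = (%i. if i \<in> I then c s i + h * v i else c s i)" for h
  using c[of s] c[of "s + h"] by (auto simp: fun_eq_iff lin algebra_simps extensional_def)
 then have "((%h. F (c (s + h))) has_vector_derivative (\<Sum>j\<in>I. v j *R partial j F (c s))) (at 0)"
  using line_derivative_zero[OF F c I subset_refl, of s v] by simp
 moreover have "((%x. x - s) has_vector_derivative 1) (at s)" by (auto intro!: derivative_eq_intros)
 ultimately have "(((%h. F (c (s + h))) \<circ> (%x. x - s)) has_vector_derivative (1 *R (\<Sum>j\<in>I. v j *R partial j F (c s)))) (at s)"
  by (intro vector_diff_chain_at) simp_all
 then show ?thesis by (simp add: o_def)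
qed

definition decays :: "nat set => ((nat => real) => complex) => bool" where
 "decays I F \<longleftrightarrow> (ALL k::nat. EX C. \<forall>t\<in>extensional I. (1 + (\<Sum>i\<in>I. \<bar>t i\<bar>)) ^ k * cmod (F t) <= C)"

lemma partials_append: "partials (js @ ks) F = partials js (partials ks F)" by (simp add: partials_def)

lemma schwartz_partial: "schwartz I F ==> j \<in> I ==> schwartz I (partial j F)" unfolding schwartz_def
proof (intro ballI)
 fix js assume F: "\<forall>js\<in>lists I. continuous_on (extensional I) (partials js F) &
   (\<forall>j\<in>I. \<forall>t\<in>extensional I. (%s. partials js F (t(j := s))) differentiable (at (t j))) &
   (ALL k::nat. EX C. \<forall>t\<in>extensional I. (1 + (\<Sum>i\<in>I. \<bar>t i\<bar>)) ^ k * cmod (partials js F t) <= C)" and j: "j \<in> I" "js \<in> lists I"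
 have "partials js (partial j F) = partials (js @ [j]) F" by (simp add: partials_append) (simp add: partials_def)
 then show "continuous_on (extensional I) (partials js (partial j F)) &
   (\<forall>i\<in>I. \<forall>t\<in>extensional I. (%s. partials js (partial j F) (t(i := s))) differentiable (at (t i))) &
   (ALL k::nat. EX C. \<forall>t\<in>extensional I. (1 + (\<Sum>i\<in>I. \<bar>t i\<bar>)) ^ k * cmod (partials js (partial j F) t) <= C)"
  using F[rule_format, of "js @ [j]"] j by simp
qed

lemma schwartz_basic:
 assumes "schwartz I F"
 shows "continuous_on (extensional I) F" and "decays I F" and "partially_C1 I F"
 using assms[unfolded schwartz_def, rule_format, of "[]"] assms[unfolded schwartz_def, rule_format, of "[j]" for j]
 by (auto simp: partials_def decays_def partially_C1_def)

text \<open>Avoids formulas for iterated derivatives: a family of continuous decaying functions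
  closed under partial derivatives, up to equality on \<open>extensional I\<close>, consists of
  Schwartz functions.\<close>

lemma schwartz_coinduct:
 assumes F: "F \<in> \<F>"
  and cont: "!!G. G \<in> \<F> ==> continuous_on (extensional I) G" and dec: "!!G. G \<in> \<F> ==> decays I G"
  and der: "!!G j. G \<in> \<F> ==> j \<in> I ==> \<exists>G'\<in>\<F>. \<forall>t\<in>extensional I. ((%s. G (t(j := s))) has_vector_derivative G' t) (at (t j))"
 shows "schwartz I F"
proof -
 have step: "\<exists>G\<in>\<F>. \<forall>t\<in>extensional I. partials js F t = G t" if "js \<in> lists I" for js using that
 proof (induction js)
  case Nil
  then show ?case using F by (auto simp: partials_def)
 next
  case (Cons j js)
  then obtain G where G: "G \<in> \<F>" "!!t. t \<in> extensional I ==> partials js F t = G t" by auto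
  have j: "j \<in> I" using Cons by simp
  obtain G' where G': "G' \<in> \<F>" "!!t. t \<in> extensional I ==> ((%s. G (t(j := s))) has_vector_derivative G' t) (at (t j))"
   using der[OF G(1) j] by blast
  have "partials (j # js) F t = G' t" if t: "t \<in> extensional I" for t
  proof -
   have "partials (j # js) F t = vector_derivative (%s. G (t(j := s))) (at (t j))"
    using G(2) t j by (simp add: partials_def partial_def)
   then show ?thesis using vector_derivative_at[OF G'(2)[OF t]] by simp
  qed
  then show ?case using G'(1) by blast
 qed
 show ?thesis unfolding schwartz_def
 proof (intro ballI conjI)
  fix js assume js: "js \<in> lists I"
  obtain G where G: "G \<in> \<F>" "!!t. t \<in> extensional I ==> partials js F t = G t" using step[OF js] by blast
  show "continuous_on (extensional I) (partials js F)" using cont[OF G(1)] by (simp add: G(2) cong: continuous_on_cong)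
  show "ALL k::nat. EX C. \<forall>t\<in>extensional I. (1 + (\<Sum>i\<in>I. \<bar>t i\<bar>)) ^ k * cmod (partials js F t) <= C"
   using dec[OF G(1)] G(2) unfolding decays_def by simp
  fix j and t :: "nat => real" assume j: "j \<in> I" "t \<in> extensional I"
  obtain d where "((%s. G (t(j := s))) has_vector_derivative d) (at (t j))" using der[OF G(1) j(1)] j(2) by blast
  then show "(%s. partials js F (t(j := s))) differentiable (at (t j))" using G(2) j by (auto simp: differentiableI_vector)
 qed
qed

lemma schwartz_cong:
 assumes "schwartz I F" "!!t. t \<in> extensional I ==> F t = G t"
 shows "schwartz I G"
proof (rule schwartz_coinduct)
 show "G \<in> {G. EX F. schwartz I F & (\<forall>t\<in>extensional I. F t = G t)}" using assms by blast
 fix G assume "G \<in> {G. EX F. schwartz I F & (\<forall>t\<in>extensional I. F t = G t)}"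
 then obtain F where F: "schwartz I F" "!!t. t \<in> extensional I ==> F t = G t" by blast
 show "continuous_on (extensional I) G" using schwartz_basic(1)[OF F(1)] by (simp add: F(2) cong: continuous_on_cong)
 show "decays I G" using schwartz_basic(2)[OF F(1)] F(2) by (simp add: decays_def)
 fix j assume j: "j \<in> I"
 have "((%s. G (t(j := s))) has_vector_derivative partial j F t) (at (t j))" if t: "t \<in> extensional I" for t
  using partial_derivative[OF schwartz_basic(3)[OF F(1)] t j, of "t j"] F(2) t j by simp
 then show "\<exists>G'\<in>{G. EX F. schwartz I F & (\<forall>t\<in>extensional I. F t = G t)}.
   \<forall>t\<in>extensional I. ((%s. G (t(j := s))) has_vector_derivative G' t) (at (t j))"
  using schwartz_partial[OF F(1) j] by (intro bexI[of _ "partial j F"]) auto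
qed

lemma decays_linear:
 assumes "decays I F" "decays I G"
 shows "decays I (%t. z * F t + w * G t)" unfolding decays_def
proof
 fix k :: nat
 obtain C C' where C: "\<forall>t\<in>extensional I. (1 + (\<Sum>i\<in>I. \<bar>t i\<bar>)) ^ k * cmod (F t) <= C"
  "\<forall>t\<in>extensional I. (1 + (\<Sum>i\<in>I. \<bar>t i\<bar>)) ^ k * cmod (G t) <= C'"
  using assms unfolding decays_def by blast
 have "(1 + (\<Sum>i\<in>I. \<bar>t i\<bar>)) ^ k * cmod (z * F t + w * G t) <= cmod z * C + cmod w * C'" if t: "t \<in> extensional I" for t
 proof -
  let ?r = "(1 + (\<Sum>i\<in>I. \<bar>t i\<bar>)) ^ k"
  have r: "0 <= ?r" by (simp add: sum_nonneg)
  have "?r * cmod (z * F t + w * G t) <= ?r * (cmod z * cmod (F t) + cmod w * cmod (G t))"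
   by (intro mult_left_mono r) (metis norm_mult norm_triangle_ineq)
  also have "... = cmod z * (?r * cmod (F t)) + cmod w * (?r * cmod (G t))" by (simp add: algebra_simps)
  also have "... <= cmod z * C + cmod w * C'" using C t by (intro add_mono mult_left_mono) auto
  finally show ?thesis .
 qed
 then show "EX C. \<forall>t\<in>extensional I. (1 + (\<Sum>i\<in>I. \<bar>t i\<bar>)) ^ k * cmod (z * F t + w * G t) <= C" by blast
qed

lemma schwartz_linear:
 assumes "schwartz I F" "schwartz I G"
 shows "schwartz I (%t. z * F t + w * G t)"
proof (rule schwartz_coinduct)
 let ?\<F> = "{%t. z * F t + w * G t | F G. schwartz I F & schwartz I G}"
 show "(%t. z * F t + w * G t) \<in> ?\<F>" using assms by blast
 fix H assume "H \<in> ?\<F>"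
 then obtain F G where H: "H = (%t. z * F t + w * G t)" and F: "schwartz I F" and G: "schwartz I G" by blast
 show "continuous_on (extensional I) H" unfolding H by (intro continuous_intros schwartz_basic(1) F G)
 show "decays I H" unfolding H by (intro decays_linear schwartz_basic(2) F G)
 fix j assume j: "j \<in> I"
 show "\<exists>H'\<in>?\<F>. \<forall>t\<in>extensional I. ((%s. H (t(j := s))) has_vector_derivative H' t) (at (t j))"
 proof (intro bexI ballI)
  show "(%t. z * partial j F t + w * partial j G t) \<in> ?\<F>" using schwartz_partial[OF F j] schwartz_partial[OF G j] by blast
  fix t :: "nat => real" assume t: "t \<in> extensional I"
  show "((%s. H (t(j := s))) has_vector_derivative z * partial j F t + w * partial j G t) (at (t j))" unfolding H
   using partial_derivative[OF schwartz_basic(3)[OF F] t j, of "t j"] partial_derivative[OF schwartz_basic(3)[OF G] t j, of "t j"]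
   by (auto intro!: has_vector_derivative_add has_vector_derivative_mult_right)
 qed
qed

lemma schwartz_zero: "schwartz I F ==> schwartz I (%t. 0)" using schwartz_linear[of I F F 0 0] by simp

lemma schwartz_sum:
 assumes "schwartz I F" "finite J" "!!j. j \<in> J ==> schwartz I (G j)"
 shows "schwartz I (%t. \<Sum>j\<in>J. c j * G j t)" using assms(2,3)
proof (induction J rule: finite_induct)
 case empty
 then show ?case using schwartz_zero[OF assms(1)] by simp
next
 case (insert j J)
 then show ?case using schwartz_linear[of I "G j" "%t. \<Sum>j\<in>J. c j * G j t" "c j" 1] by simp
qed

text \<open>Composites with \<open>theta\<close> form a family closed under differentiation, since a
  derivative is a constant combination of composed partials. The hypothesis \<open>inv\<close>
  bounds growth of \<open>t\<close> by that of \<open>theta t\<close> and so transfers the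
  decay.\<close>

lemma schwartz_affine:
 assumes I: "finite I" and F: "schwartz I F" and theta: "!!t. t \<in> extensional I ==> theta t \<in> extensional I"
  and aff: "!!t i. t \<in> extensional I ==> i \<in> I ==> theta t i = a i + (\<Sum>k\<in>I. c i k * t k)"
  and inv: "!!t. t \<in> extensional I ==> 1 + (\<Sum>i\<in>I. \<bar>t i\<bar>) <= C * (1 + (\<Sum>i\<in>I. \<bar>theta t i\<bar>))"
 shows "schwartz I (%t. F (theta t))"
proof (rule schwartz_coinduct)
 let ?\<F> = "{%t. F (theta t) | F. schwartz I F}"
 show "(%t. F (theta t)) \<in> ?\<F>" using F by blast
 fix H assume "H \<in> ?\<F>"
 then obtain F where H: "H = (%t. F (theta t))" and F: "schwartz I F" by blast
 have "continuous_on (extensional I) (%t. if i \<in> I then a i + (\<Sum>k\<in>I. c i k * t k) else undefined)" for i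
  by (cases "i \<in> I") (auto intro!: continuous_intros continuous_on_subset[OF continuous_on_product_coordinates])
 moreover have "theta t i = (if i \<in> I then a i + (\<Sum>k\<in>I. c i k * t k) else undefined)" if "t \<in> extensional I" for t i
  using theta[OF that] aff[OF that] by (auto simp: extensional_def)
 ultimately have "continuous_on (extensional I) theta"
  by (intro continuous_on_coordinatewise_then_product) (simp cong: continuous_on_cong)
 then show "continuous_on (extensional I) H"
  unfolding H by (rule continuous_on_compose2[OF schwartz_basic(1)[OF F]]) (auto simp: theta)
 show "decays I H" unfolding decays_def
 proof
  fix k :: nat
  obtain B where B: "!!t. t \<in> extensional I ==> (1 + (\<Sum>i\<in>I. \<bar>t i\<bar>)) ^ k * cmod (F t) <= B"
   using schwartz_basic(2)[OF F] unfolding decays_def by blast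
  have "(1 + (\<Sum>i\<in>I. \<bar>t i\<bar>)) ^ k * cmod (H t) <= \<bar>C\<bar> ^ k * B" if t: "t \<in> extensional I" for t
  proof -
   have "0 <= 1 + (\<Sum>i\<in>I. \<bar>t i\<bar>)" by (simp add: sum_nonneg add_nonneg_nonneg)
   moreover have "1 + (\<Sum>i\<in>I. \<bar>t i\<bar>) <= \<bar>C\<bar> * (1 + (\<Sum>i\<in>I. \<bar>theta t i\<bar>))"
    using inv[OF t] by (rule order_trans) (intro mult_right_mono, simp_all add: sum_nonneg add_nonneg_nonneg)
   ultimately have "(1 + (\<Sum>i\<in>I. \<bar>t i\<bar>)) ^ k <= (\<bar>C\<bar> * (1 + (\<Sum>i\<in>I. \<bar>theta t i\<bar>))) ^ k" by (rule power_mono[rotated])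
   then have "(1 + (\<Sum>i\<in>I. \<bar>t i\<bar>)) ^ k * cmod (H t) <= \<bar>C\<bar> ^ k * ((1 + (\<Sum>i\<in>I. \<bar>theta t i\<bar>)) ^ k * cmod (F (theta t)))"
    unfolding H power_mult_distrib mult.assoc[symmetric] by (rule mult_right_mono) simp
   also have "... <= \<bar>C\<bar> ^ k * B" using B[OF theta[OF t]] by (intro mult_left_mono) auto
   finally show ?thesis .
  qed
  then show "EX C. \<forall>t\<in>extensional I. (1 + (\<Sum>i\<in>I. \<bar>t i\<bar>)) ^ k * cmod (H t) <= C" by blast
 qed
 fix j assume j: "j \<in> I"
 show "\<exists>H'\<in>?\<F>. \<forall>t\<in>extensional I. ((%s. H (t(j := s))) has_vector_derivative H' t) (at (t j))"
 proof (intro bexI ballI)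
  have "schwartz I (%t. \<Sum>i\<in>I. complex_of_real (c i j) * partial i F t)"
   by (rule schwartz_sum[OF F I schwartz_partial[OF F]])
  then show "(%t. \<Sum>i\<in>I. complex_of_real (c i j) * partial i F (theta t)) \<in> ?\<F>"
   by (intro CollectI exI[of _ "%t. \<Sum>i\<in>I. complex_of_real (c i j) * partial i F t"] conjI refl)
  fix t :: "nat => real" assume t: "t \<in> extensional I"
  have "((%s. F (theta (t(j := s)))) has_vector_derivative (\<Sum>i\<in>I. c i j *R partial i F (theta (t(j := t j))))) (at (t j))"
  proof (rule line_derivative[OF schwartz_basic(3)[OF F] I])
   show "theta (t(j := s)) \<in> extensional I" for s using t j by (intro theta) simp
   show "theta (t(j := s)) i = (a i + (\<Sum>k\<in>I - {j}. c i k * t k)) + s * c i j" if i: "i \<in> I" for i s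
   proof -
    have "(\<Sum>k\<in>I - {j}. c i k * (t(j := s)) k) = (\<Sum>k\<in>I - {j}. c i k * t k)" by (rule sum.cong) auto
    then show ?thesis using aff[of "t(j := s)" i] t j i by (simp add: sum.remove[OF I j])
   qed
  qed
  then show "((%s. H (t(j := s))) has_vector_derivative (\<Sum>i\<in>I. complex_of_real (c i j) * partial i F (theta t))) (at (t j))"
   by (simp add: H scaleR_conv_of_real)
 qed
qed

section \<open>Integrability from decay\<close>

lemma integrable_inverse_square: "integrable lborel (%x::real. inverse (1 + x^2))"
proof (rule integrableI_bounded)
 let ?f = "%x::real. ennreal (inverse (1 + x^2))"
 have half: "(\<integral>\<^sup>+x. ?f x * indicator {0..} x \<partial>lborel) = ennreal (pi / 2 - arctan 0)"
  by (rule nn_integral_FTC_atLeast) (auto intro!: tendsto_arctan_at_top DERIV_arctan add_nonneg_nonneg)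
 have half': "(\<integral>\<^sup>+x. ?f x * indicator {..0} x \<partial>lborel) = (\<integral>\<^sup>+x. ?f x * indicator {0..} x \<partial>lborel)"
  using nn_integral_real_affine[of "%x. ?f x * indicator {..0} x" "-1" 0] by (simp add: indicator_def)
 have "(\<integral>\<^sup>+x. ?f x \<partial>lborel) <= (\<integral>\<^sup>+x. ?f x * indicator {0..} x + ?f x * indicator {..0} x \<partial>lborel)"
  by (intro nn_integral_mono) (auto simp: indicator_def)
 also have "... = ennreal (pi / 2 - arctan 0) + ennreal (pi / 2 - arctan 0)" by (subst nn_integral_add) (auto simp: half half')
 also have "... < \<infinity>" by (simp add: less_top)
 finally have "(\<integral>\<^sup>+x. ?f x \<partial>lborel) < \<infinity>" .
 moreover have "norm (inverse (1 + x^2)) = inverse (1 + x^2)" for x :: real by (simp add: add_nonneg_nonneg)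
 ultimately show "(\<integral>\<^sup>+x. ennreal (norm (inverse (1 + x^2) :: real)) \<partial>lborel) < \<infinity>" by simp
qed simp

lemma integrable_prod_inverse_square:
 "finite I ==> integrable (lborel_on I) (%t. \<Prod>i\<in>I. inverse (1 + (t i)^2) :: real)"
 by (rule product_sigma_finite.product_integrable_prod) (auto simp: product_sigma_finite_def lborel.sigma_finite_measure_axioms integrable_inverse_square)

lemma prod_square_le:
 assumes "finite I"
 shows "(\<Prod>i\<in>I. 1 + (t i)^2) <= (1 + (\<Sum>i\<in>I. \<bar>t i :: real\<bar>)) ^ (2 * card I)"
proof -
 have "(\<Prod>i\<in>I. 1 + (t i)^2) <= (\<Prod>i\<in>I. (1 + (\<Sum>i\<in>I. \<bar>t i\<bar>))\<^sup>2)"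
 proof (rule prod_mono)
  fix i assume i: "i \<in> I"
  have "\<bar>t i\<bar> <= (\<Sum>i\<in>I. \<bar>t i\<bar>)" using assms i by (intro member_le_sum) auto
  then have "(1 + \<bar>t i\<bar>)^2 <= (1 + (\<Sum>i\<in>I. \<bar>t i\<bar>))^2" by (intro power_mono) auto
  then show "0 <= 1 + (t i)^2 & 1 + (t i)^2 <= (1 + (\<Sum>i\<in>I. \<bar>t i\<bar>))^2"
   by (simp add: power2_sum add_nonneg_nonneg)
 qed
 then show ?thesis by (simp add: power_mult[symmetric])
qed

lemma decays_product_bound:
 assumes I: "finite I" and F: "decays I F"
 shows "EX C. \<forall>t\<in>extensional I. cmod (F t) <= C * (\<Prod>i\<in>I. inverse (1 + (t i)^2))"
proof -
 obtain C where C: "!!t. t \<in> extensional I ==> (1 + (\<Sum>i\<in>I. \<bar>t i\<bar>)) ^ (2 * card I) * cmod (F t) <= C"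
  using F unfolding decays_def by blast
 have "cmod (F t) <= C * (\<Prod>i\<in>I. inverse (1 + (t i)^2))" if t: "t \<in> extensional I" for t
 proof -
  have p: "0 < (\<Prod>i\<in>I. 1 + (t i)^2)" by (intro prod_pos) (simp add: add_pos_nonneg)
  have "(\<Prod>i\<in>I. 1 + (t i)^2) * cmod (F t) <= C"
   using C[OF t] mult_right_mono[OF prod_square_le[OF I, of t], of "cmod (F t)"] by simp
  moreover have "(\<Prod>i\<in>I. inverse (1 + (t i)^2)) = inverse (\<Prod>i\<in>I. 1 + (t i)^2)"
   using prod_inversef[of "%i. 1 + (t i)^2" I] by (simp add: o_def)
  ultimately show ?thesis using p by (simp only: divide_inverse[symmetric] pos_le_divide_eq mult.commute)
 qed
 then show ?thesis by blast
qed

context flat_rep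
begin

section \<open>Schwartz functions on the orbit\<close>

definition ob :: "((nat => real) => complex) => ('a =>L real) => complex" where
 "ob G xi = (if xi \<in> orbit D then G (coords D xi) else 0)"

lemma schwartz_orbit_iff: "b \<in> schwartz_orbit D \<longleftrightarrow>
  (ALL xi. xi \<notin> orbit D --> b xi = 0) & schwartz (jump D) (%t. b (sc t))" proof -
 have "schwartz (jump D) (%t. b (sec D t)) \<longleftrightarrow> schwartz (jump D) (%t. b (sc t))"
  using schwartz_cong[of "jump D" "%t. b (sec D t)" "%t. b (sc t)"]
   schwartz_cong[of "jump D" "%t. b (sc t)" "%t. b (sec D t)"] by (auto simp: sec_eq)
 then show ?thesis by (simp add: schwartz_orbit_def)
qed

lemma ob_sc: "t \<in> extensional (jump D) ==> ob G (sc t) = G t" by (simp add: ob_def sc_orbit coords_sc)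

lemma ob_schwartz: "schwartz (jump D) G ==> ob G \<in> schwartz_orbit D"
 unfolding schwartz_orbit_iff using schwartz_cong[of "jump D" G "%t. ob G (sc t)"] by (auto simp: ob_sc) (simp add: ob_def)

lemma schwartz_orbit_linear:
 "b \<in> schwartz_orbit D ==> b' \<in> schwartz_orbit D ==> (%xi. z * b xi + w * b' xi) \<in> schwartz_orbit D"
 unfolding schwartz_orbit_iff using schwartz_linear[of "jump D" "%t. b (sc t)" "%t. b' (sc t)" z w] by simp

definition cc :: "'g => nat => nat => real" where
 "cc g i k = (if i = k then 1 else 0) + Adc g i k"

definition ca :: "'g => nat => real" where
 "ca g j = base D ((Ad D (ginv g) (jh D j) - jh D j) - pj (Ad D (ginv g) (jh D j) - jh D j))"

lemma cth_affine: "i \<in> jump D ==> cth g t i = ca g i + (\<Sum>k\<in>jump D. cc g i k * t k)"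
 by (simp add: cth_def ca_def cc_def distrib_right sum.distrib if_distrib[of "%x. x * _"] cong: if_cong)

lemma cth_bound: "EX C. ALL s. 1 + (\<Sum>i\<in>jump D. \<bar>cth g s i\<bar>) <= C * (1 + (\<Sum>i\<in>jump D. \<bar>s i\<bar>))"
proof -
 define K where "K i = \<bar>ca g i\<bar> + (\<Sum>k\<in>jump D. \<bar>cc g i k\<bar>)" for i
 have "1 + (\<Sum>i\<in>jump D. \<bar>cth g s i\<bar>) <= (1 + (\<Sum>i\<in>jump D. K i)) * (1 + (\<Sum>i\<in>jump D. \<bar>s i\<bar>))" for s
 proof -
  define S where "S = (\<Sum>i\<in>jump D. \<bar>s i\<bar>)"
  have S: "0 <= S" unfolding S_def by (simp add: sum_nonneg)
  have "\<bar>cth g s i\<bar> <= K i * (1 + S)" if i: "i \<in> jump D" for i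
  proof -
   have "\<bar>cth g s i\<bar> <= \<bar>ca g i\<bar> + \<bar>\<Sum>k\<in>jump D. cc g i k * s k\<bar>"
    unfolding cth_affine[OF i] by (rule abs_triangle_ineq)
   also have "\<bar>\<Sum>k\<in>jump D. cc g i k * s k\<bar> <= (\<Sum>k\<in>jump D. \<bar>cc g i k\<bar> * S)"
   proof (rule order_trans[OF sum_abs sum_mono])
    fix k assume k: "k \<in> jump D"
    have "\<bar>s k\<bar> <= S" unfolding S_def using k by (intro member_le_sum[of k "jump D" "%i. \<bar>s i\<bar>"]) auto
    then show "\<bar>cc g i k * s k\<bar> <= \<bar>cc g i k\<bar> * S" by (simp add: abs_mult mult_left_mono)
   qed
   also have "\<bar>ca g i\<bar> + (\<Sum>k\<in>jump D. \<bar>cc g i k\<bar> * S) <= K i * (1 + S)"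
    unfolding K_def sum_distrib_right[symmetric] using S by (simp add: algebra_simps sum_nonneg)
   finally show ?thesis by simp
  qed
  then have "(\<Sum>i\<in>jump D. \<bar>cth g s i\<bar>) <= (\<Sum>i\<in>jump D. K i) * (1 + S)"
   unfolding sum_distrib_right by (rule sum_mono)
  then show ?thesis using S unfolding S_def[symmetric] by (simp add: algebra_simps)
 qed
 then show ?thesis by blast
qed

lemma schwartz_orbit_CoAd:
 assumes b: "b \<in> schwartz_orbit D"
 shows "(%xi. b (CoAd D g xi)) \<in> schwartz_orbit D" unfolding schwartz_orbit_iff
proof (intro conjI allI impI)
 show "b (CoAd D g xi) = 0" if "xi \<notin> orbit D" for xi using b that CoAd_orbit[of xi g] by (simp add: schwartz_orbit_iff)
 \<comment> \<open>The growth bound is taken for the inverse action because decay has to be pulled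
   back from \<open>cth g t\<close> to \<open>t\<close>.\<close>
 obtain C where C: "!!s. 1 + (\<Sum>i\<in>jump D. \<bar>cth (ginv g) s i\<bar>) <= C * (1 + (\<Sum>i\<in>jump D. \<bar>s i\<bar>))"
  using cth_bound by blast
 have "schwartz (jump D) (%t. b (sc (cth g t)))"
 proof (rule schwartz_affine[where F = "%t. b (sc t)" and C = C])
  show "schwartz (jump D) (%t. b (sc t))" using b by (simp add: schwartz_orbit_iff)
  show "1 + (\<Sum>i\<in>jump D. \<bar>t i\<bar>) <= C * (1 + (\<Sum>i\<in>jump D. \<bar>cth g t i\<bar>))" if "t \<in> extensional (jump D)" for t
   using C[of "cth g t"] cth_inv[OF that, of g] by simp
 qed (auto simp: cth_affine)
 then show "schwartz (jump D) (%t. b (CoAd D g (sc t)))" by (rule schwartz_cong) (simp add: sc_cth)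
qed

lemma schwartz_orbit_measurable: "b \<in> schwartz_orbit D ==> b \<in> borel_measurable (liou D)"
 and fourier_measurable: "b \<in> schwartz_orbit D ==> fourier D b \<in> borel_measurable (leb D)"
 and parseval: "b \<in> schwartz_orbit D ==> b \<in> L2 (liou D) & fourier D b \<in> L2 (leb D) &
  (LINT X|leb D. (cmod (fourier D b X))\<^sup>2) = (LINT xi|liou D. (cmod (b xi))\<^sup>2)"
 using leb_norm unfolding lebesgue_normalized_def fourier_unitary_def by (auto simp: L2_def)

text \<open>Measurability is read off from the normalisation \<open>fourier_unitary\<close> by
  viewing \<open>G\<close> as a function on the orbit.\<close>

lemma schwartz_T_measurable:
 assumes "schwartz (jump D) G"
 shows "G \<in> borel_measurable T"
proof -
 have "ob G \<in> borel_measurable Ro"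
  using schwartz_orbit_measurable[OF ob_schwartz[OF assms]] by (simp cong: measurable_cong_sets add: sets_liou)
 from measurable_compose[OF sc_measurable this]
 have "(%t. ob G (sc t)) \<in> borel_measurable T" .
 moreover have "(%t. ob G (sc t)) \<in> borel_measurable T \<longleftrightarrow> G \<in> borel_measurable T"
  by (rule measurable_cong) (simp add: ob_sc)
 ultimately show ?thesis by simp
qed

lemma schwartz_T_integrable:
 assumes "schwartz (jump D) G"
 shows "integrable T G"
proof -
 obtain C where C: "!!t. t \<in> extensional (jump D) ==> cmod (G t) <= C * (\<Prod>i\<in>jump D. inverse (1 + (t i)^2))"
  using decays_product_bound[OF finite_jump schwartz_basic(2)[OF assms]] by blast
 show ?thesis
 proof (rule Bochner_Integration.integrable_bound)
  show "integrable T (%t. C * (\<Prod>i\<in>jump D. inverse (1 + (t i)^2)))"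
   using integrable_prod_inverse_square[OF finite_jump] by simp
  show "AE t in T. norm (G t) <= norm (C * (\<Prod>i\<in>jump D. inverse (1 + (t i)^2)))"
  proof (rule AE_I2)
   fix t assume "t \<in> space T"
   then have "cmod (G t) <= C * (\<Prod>i\<in>jump D. inverse (1 + (t i)^2))" using C by simp
   then show "norm (G t) <= norm (C * (\<Prod>i\<in>jump D. inverse (1 + (t i)^2)))" by simp
  qed
 qed (rule schwartz_T_measurable[OF assms])
qed

lemma schwartz_orbit_integrable: "b \<in> schwartz_orbit D ==> integrable (liou D) b"
 by (intro integral_liou(2) schwartz_orbit_measurable schwartz_T_integrable) (simp_all add: schwartz_orbit_iff)

lemma fourier_integrand:
 assumes b: "b \<in> schwartz_orbit D"
 shows "integrable (liou D) (%xi. cis (- blinfun_apply xi X) * b xi)"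
proof (rule Bochner_Integration.integrable_bound[OF schwartz_orbit_integrable[OF b]])
 show "(%xi. cis (- blinfun_apply xi X) * b xi) \<in> borel_measurable (liou D)"
  by (rule borel_measurable_times[OF cis_eval_measurable schwartz_orbit_measurable[OF b]])
qed (simp add: norm_mult)

lemma fourier_linear:
 assumes "b \<in> schwartz_orbit D" "b' \<in> schwartz_orbit D"
 shows "fourier D (%xi. z * b xi + w * b' xi) X = z * fourier D b X + w * fourier D b' X"
proof -
 have "fourier D (%xi. z * b xi + w * b' xi) X
   = (LINT xi|liou D. z * (cis (- blinfun_apply xi X) * b xi) + w * (cis (- blinfun_apply xi X) * b' xi))"
  unfolding fourier_def by (rule Bochner_Integration.integral_cong) (simp_all add: algebra_simps)
 also have "... = z * fourier D b X + w * fourier D b' X"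
  unfolding fourier_def using fourier_integrand[OF assms(1), of X] fourier_integrand[OF assms(2), of X] by simp
 finally show ?thesis .
qed

lemma fourier_bounded:
 assumes b: "b \<in> schwartz_orbit D"
 shows "cmod (fourier D b X) <= (LINT xi|liou D. cmod (b xi))"
proof -
 have "cmod (fourier D b X) <= (LINT xi|liou D. cmod (cis (- blinfun_apply xi X) * b xi))"
  unfolding fourier_def by (rule integral_norm_bound)
 then show ?thesis by (simp add: norm_mult)
qed

section \<open>Decay of the Fourier transform\<close>

lemma sc_psum: "blinfun_apply (sc t) (psum x) = (\<Sum>i\<in>jump D. t i * x i)"
 by (simp add: psum_def blinfun.sum_right blinfun.scaleR_right sc_jh mult.commute)

definition ph :: "(nat => real) => (nat => real) => complex" where
 "ph x t = cis (- (\<Sum>i\<in>jump D. t i * x i))"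

lemma ph_measurable: "ph x \<in> borel_measurable T"
proof -
 have "(%t. - (\<Sum>i\<in>jump D. t i * x i)) \<in> borel_measurable T" by measurable
 then show ?thesis unfolding ph_def by (rule measurable_compose) (intro borel_measurable_continuous_onI continuous_intros)
qed

lemma fourier_ob:
 assumes G: "schwartz (jump D) G"
 shows "fourier D (ob G) (psum x) = lc *R (LINT t|T. ph x t * G t)"
proof -
 have "fourier D (ob G) (psum x) = lc *R (LINT t|T. cis (- blinfun_apply (sc t) (psum x)) * ob G (sc t))" unfolding fourier_def
  by (intro integral_liou(1) borel_measurable_times cis_eval_measurable schwartz_orbit_measurable ob_schwartz G)
 also have "(LINT t|T. cis (- blinfun_apply (sc t) (psum x)) * ob G (sc t)) = (LINT t|T. ph x t * G t)"
  by (rule Bochner_Integration.integral_cong) (simp_all add: sc_psum ob_sc ph_def)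
 finally show ?thesis .
qed

lemma integral_shift:
 fixes f :: "(nat => real) => complex"
 assumes j: "j \<in> jump D" and f: "f \<in> borel_measurable T"
 shows "(%t. f (t(j := t j + h))) \<in> borel_measurable T" and "(LINT t|T. f (t(j := t j + h))) = (LINT t|T. f t)"
proof -
 have d: "(%t. t(j := t j + h)) \<in> measurable T T" "distr T T (%t. t(j := t j + h)) = T"
  by (rule distr_PiM_triangular[where r = int and q = "%i t. if i = j then h else 0"]; use j in auto)+
 show "(%t. f (t(j := t j + h))) \<in> borel_measurable T" by (rule measurable_compose[OF d(1) f])
 show "(LINT t|T. f (t(j := t j + h))) = (LINT t|T. f t)" using integral_distr[OF d(1) f] by (simp add: d(2))
qed

text \<open>The majorant for differentiation under the integral: moving one coordinate by at most 1
  changes its weight \<open>1 + t^2\<close> by a factor of at most 3.\<close>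

lemma schwartz_difference_bound:
 assumes G: "schwartz (jump D) G" and j: "j \<in> jump D"
 shows "EX C. \<forall>t\<in>extensional (jump D). ALL h. 0 < h --> h <= 1 -->
  cmod (G (t(j := t j + h)) - G t) <= h * (C * (\<Prod>i\<in>jump D. inverse (1 + (t i)^2)))" proof -
 obtain C where C: "!!t. t \<in> extensional (jump D) ==> cmod (partial j G t) <= C * (\<Prod>i\<in>jump D. inverse (1 + (t i)^2))"
  using decays_product_bound[OF finite_jump schwartz_basic(2)[OF schwartz_partial[OF G j]]] by blast
 have C0: "0 <= C"
 proof -
  have "0 <= cmod (partial j G (\<lambda>i\<in>jump D. 0))" by simp
  also have "... <= C * (\<Prod>i\<in>jump D. inverse (1 + ((\<lambda>i\<in>jump D. 0) i)^2))" by (rule C) simp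
  finally show ?thesis by simp
 qed
 have "cmod (G (t(j := t j + h)) - G t) <= h * ((3 * C) * (\<Prod>i\<in>jump D. inverse (1 + (t i)^2)))"
  if t: "t \<in> extensional (jump D)" and h: "0 < h" "h <= 1" for t h
 proof -
  define P where "P = (\<Prod>i\<in>jump D. inverse (1 + (t i)^2))"
  define R where "R = (\<Prod>i\<in>jump D - {j}. inverse (1 + (t i)^2))"
  have R: "0 <= R" unfolding R_def by (intro prod_nonneg) (simp add: add_nonneg_nonneg)
  have der: "((%s. G (t(j := s))) has_vector_derivative partial j G (t(j := s))) (at s)" for s
   by (rule partial_derivative[OF schwartz_basic(3)[OF G] t j])
  have bd: "norm (partial j G (t(j := s))) <= 3 * C * P" if s: "t j < s" "s < t j + h" for s
  proof -
   have "(\<Prod>i\<in>jump D - {j}. inverse (1 + ((t(j := s)) i)^2)) = R" unfolding R_def by (rule prod.cong) auto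
   then have "cmod (partial j G (t(j := s))) <= C * (inverse (1 + s^2) * R)"
    using C[of "t(j := s)"] t j by (simp add: prod.remove[OF finite_jump j])
   also have "... <= C * (3 * inverse (1 + (t j)^2) * R)"
   proof (intro mult_left_mono mult_right_mono C0 R)
    have "(t j - s)^2 <= 1" 
    proof -
     have "\<bar>t j - s\<bar>\<^sup>2 <= 1^2" by (rule power_mono) (use s h in auto)
     then show ?thesis by simp
    qed
    moreover have "(t j)^2 <= 2 * s^2 + 2 * (t j - s)^2"
     using zero_le_power2[of "t j - 2 * s"] by (simp add: power2_eq_square algebra_simps)
    ultimately have "1 + (t j)^2 <= 3 * (1 + s^2)" using zero_le_power2[of s] by argo
    moreover have "0 < 1 + (t j)^2" "0 < 1 + s^2" by (simp_all add: add_pos_nonneg)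
    ultimately show "inverse (1 + s^2) <= 3 * inverse (1 + (t j)^2)" by (simp add: field_simps)
   qed
   also have "... = 3 * C * P" by (simp add: P_def R_def prod.remove[OF finite_jump j])
   finally show ?thesis .
  qed
  have "norm (G (t(j := t j + h)) - G (t(j := t j))) <= (3 * C * P) * (t j + h) - (3 * C * P) * t j"
  proof (rule differentiable_bound_general[where f = "%s. G (t(j := s))" and \<phi> = "%s. (3 * C * P) * s" and \<phi>' = "%_. 3 * C * P"])
   show "continuous_on {t j..t j + h} (%s. G (t(j := s)))"
    using der by (intro continuous_at_imp_continuous_on ballI) (blast intro: has_vector_derivative_continuous)
   show "((%s. G (t(j := s))) has_vector_derivative partial j G (t(j := s))) (at s)" for s by (rule der)
  qed (use h bd in \<open>auto intro!: continuous_intros derivative_eq_intros simp: has_real_derivative_iff_has_vector_derivative[symmetric]\<close>)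
  then show ?thesis by (simp add: P_def algebra_simps)
 qed
 then show ?thesis by blast
qed

text \<open>Integration by parts through translation invariance: shifting the argument of
  \<open>G\<close> by \<open>h\<close> multiplies the integral by \<open>cis (h * x j)\<close>. The
  two ways of differentiating in \<open>h\<close> at 0 are compared.\<close>

lemma fourier_partial:
 assumes G: "schwartz (jump D) G" and j: "j \<in> jump D"
 shows "fourier D (ob (partial j G)) (psum x) = \<i> * of_real (x j) * fourier D (ob G) (psum x)"
proof -
 define \<Phi> where "\<Phi> h = (LINT t|T. ph x t * G (t(j := t j + h)))" for h
 note Gm = schwartz_T_measurable[OF G] and Gi = schwartz_T_integrable[OF G]
 have norm_ph: "cmod (ph x t) = 1" for t by (simp add: ph_def)
 have \<Phi>: "\<Phi> h = cis (h * x j) * \<Phi> 0" for h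
 proof -
  have "\<Phi> h = (LINT t|T. cis (h * x j) * (ph x (t(j := t j + h)) * G (t(j := t j + h))))" unfolding \<Phi>_def
  proof (rule Bochner_Integration.integral_cong[OF refl])
   fix t
   have "(\<Sum>i\<in>jump D - {j}. (t(j := t j + h)) i * x i) = (\<Sum>i\<in>jump D - {j}. t i * x i)" by (rule sum.cong) auto
   then have "ph x t = cis (h * x j) * ph x (t(j := t j + h))"
    by (simp add: ph_def cis_mult sum.remove[OF finite_jump j] algebra_simps)
   then show "ph x t * G (t(j := t j + h)) = cis (h * x j) * (ph x (t(j := t j + h)) * G (t(j := t j + h)))" by simp
  qed
  also have "... = cis (h * x j) * (LINT t|T. ph x (t(j := t j + h)) * G (t(j := t j + h)))" by simp
  also have "(LINT t|T. ph x (t(j := t j + h)) * G (t(j := t j + h))) = (LINT t|T. ph x t * G t)"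
   by (rule integral_shift(2)[OF j borel_measurable_times[OF ph_measurable Gm]])
  finally show ?thesis by (simp add: \<Phi>_def)
 qed
 define h where "h n = inverse (real (Suc n))" for n
 have h: "h n ~= 0" "0 < h n" "h n <= 1" for n by (simp_all add: h_def inverse_le_1_iff)
 have hlim: "filterlim h (at 0) sequentially" using LIMSEQ_inverse_real_of_nat h unfolding filterlim_at h_def[abs_def] by auto
 have "((%h. \<Phi> h) has_vector_derivative (\<i> * of_real (x j) * cis (0 * x j)) * \<Phi> 0) (at 0)"
  by (subst \<Phi>) (intro has_vector_derivative_mult_left has_vector_derivative_cis_scale)
 from filterlim_compose[OF has_vector_derivative_quotient[OF this] hlim]
 have l1: "(%n. (\<Phi> (h n) - \<Phi> 0) /\<^sub>R h n) ----> \<i> * of_real (x j) * \<Phi> 0" by simp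
 have int: "integrable T (%t. ph x t * G (t(j := t j + s)))" for s
 proof (rule Bochner_Integration.integrable_bound)
  have d: "(%t. t(j := t j + s)) \<in> measurable T T" "distr T T (%t. t(j := t j + s)) = T"
   by (rule distr_PiM_triangular[where r = int and q = "%i t. if i = j then s else 0"]; use j in auto)+
  show "integrable T (%t. G (t(j := t j + s)))" using integrable_distr[OF d(1), of G] Gi by (simp add: d(2))
  show "(%t. ph x t * G (t(j := t j + s))) \<in> borel_measurable T"
   by (intro borel_measurable_times ph_measurable integral_shift(1)[OF j Gm])
 qed (simp add: norm_mult norm_ph)
 obtain C where C: "!!t h. t \<in> extensional (jump D) ==> 0 < h ==> h <= 1 ==>
   cmod (G (t(j := t j + h)) - G t) <= h * (C * (\<Prod>i\<in>jump D. inverse (1 + (t i)^2)))"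
  using schwartz_difference_bound[OF G j] by blast
 have q: "(\<Phi> (h n) - \<Phi> 0) /\<^sub>R h n = (LINT t|T. ph x t * ((G (t(j := t j + h n)) - G t) /\<^sub>R h n))" for n
 proof -
  have "\<Phi> (h n) - \<Phi> 0 = (LINT t|T. ph x t * G (t(j := t j + h n)) - ph x t * G (t(j := t j + 0)))"
   unfolding \<Phi>_def by (rule Bochner_Integration.integral_diff[OF int int, symmetric])
  then show ?thesis
   by (simp add: integral_scaleR_right[symmetric] right_diff_distrib scaleR_diff_right del: integral_scaleR_right)
 qed
 have l2: "(%n. (\<Phi> (h n) - \<Phi> 0) /\<^sub>R h n) ----> (LINT t|T. ph x t * partial j G t)" unfolding q
 proof (rule integral_dominated_convergence[where w = "%t. C * (\<Prod>i\<in>jump D. inverse (1 + (t i)^2))"])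
  show "(%t. ph x t * partial j G t) \<in> borel_measurable T"
   by (intro borel_measurable_times ph_measurable schwartz_T_measurable schwartz_partial G j)
  show "(%t. ph x t * ((G (t(j := t j + h n)) - G t) /\<^sub>R h n)) \<in> borel_measurable T" for n
   by (intro borel_measurable_times ph_measurable borel_measurable_scaleR borel_measurable_const borel_measurable_diff
     integral_shift(1)[OF j Gm] Gm)
  show "integrable T (%t. C * (\<Prod>i\<in>jump D. inverse (1 + (t i)^2)))"
   using integrable_prod_inverse_square[OF finite_jump] by simp
  show "AE t in T. (%n. ph x t * ((G (t(j := t j + h n)) - G t) /\<^sub>R h n)) ----> ph x t * partial j G t"
  proof (rule AE_I2, rule tendsto_mult_left)
   fix t assume "t \<in> space T"
   then have "((%s. G (t(j := s))) has_vector_derivative partial j G t) (at (t j))"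
    using partial_derivative[OF schwartz_basic(3)[OF G] _ j, of t "t j"] by simp
   then have a: "((%s. G (t(j := s))) has_vector_derivative partial j G t) (at (t j + 0))" by simp
   have "((%s. t j + s) has_vector_derivative 1) (at 0)" by (rule derivative_eq_intros | simp)+
   from vector_diff_chain_at[OF this a]
   have "((%s. G (t(j := t j + s))) has_vector_derivative partial j G t) (at 0)" by (simp add: o_def)
   from filterlim_compose[OF has_vector_derivative_quotient[OF this] hlim]
   show "(%n. (G (t(j := t j + h n)) - G t) /\<^sub>R h n) ----> partial j G t" by simp
  qed
  show "AE t in T. norm (ph x t * ((G (t(j := t j + h n)) - G t) /\<^sub>R h n)) <= C * (\<Prod>i\<in>jump D. inverse (1 + (t i)^2))" for n
  proof (rule AE_I2)
   fix t assume "t \<in> space T"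
   then have "cmod (G (t(j := t j + h n)) - G t) <= h n * (C * (\<Prod>i\<in>jump D. inverse (1 + (t i)^2)))" using C h by simp
   then show "norm (ph x t * ((G (t(j := t j + h n)) - G t) /\<^sub>R h n)) <= C * (\<Prod>i\<in>jump D. inverse (1 + (t i)^2))"
    using h(2)[of n] by (simp add: norm_mult norm_ph) (simp add: field_simps)
  qed
 qed
 have "(LINT t|T. ph x t * partial j G t) = \<i> * of_real (x j) * \<Phi> 0" by (rule LIMSEQ_unique[OF l2 l1])
 then show ?thesis unfolding fourier_ob[OF G] fourier_ob[OF schwartz_partial[OF G j]] by (simp add: \<Phi>_def)
qed

text \<open>Each factor \<open>1 + (x j)^2\<close> is produced by applying one minus the second
  partial derivative in direction \<open>j\<close> to the symbol.\<close>

lemma fourier_weight: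
 assumes "finite J" "J <= jump D" "schwartz (jump D) G"
 shows "EX G'. schwartz (jump D) G' & (ALL x. fourier D (ob G') (psum x) = of_real (\<Prod>j\<in>J. 1 + (x j)^2) * fourier D (ob G) (psum x))"
 using assms(1,2)
proof (induction J rule: finite_induct)
 case empty
 then show ?case using assms(3) by auto
next
 case (insert j J)
 then obtain G1 where G1: "schwartz (jump D) G1"
  "!!x. fourier D (ob G1) (psum x) = of_real (\<Prod>j\<in>J. 1 + (x j)^2) * fourier D (ob G) (psum x)" by auto
 have j: "j \<in> jump D" using insert.prems by simp
 let ?P = "partial j (partial j G1)"
 have P: "schwartz (jump D) ?P" by (intro schwartz_partial G1 j)
 define G' where "G' t = 1 * G1 t + (- 1) * ?P t" for t
 have G': "schwartz (jump D) G'" unfolding G'_def by (rule schwartz_linear[OF G1(1) P])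
 have "ob G' = (%xi. 1 * ob G1 xi + (- 1) * ob ?P xi)" by (auto simp: ob_def G'_def)
 then have "fourier D (ob G') (psum x) = (1 + (of_real (x j))^2) * fourier D (ob G1) (psum x)" for x
  using fourier_linear[OF ob_schwartz[OF G1(1)] ob_schwartz[OF P], of 1 "- 1" "psum x"]
  by (simp add: fourier_partial[OF schwartz_partial[OF G1(1) j] j] fourier_partial[OF G1(1) j] power2_eq_square algebra_simps)
 then show ?case using G' G1(2) insert.hyps by (intro exI[of _ G']) (simp add: mult.assoc)
qed

text \<open>The transform times the product of all \<open>1 + (x i)^2\<close> is again a transform
  of a Schwartz function, hence bounded. Integrability makes the weak integral defining
  \<open>Op\<close> absolutely convergent.\<close>

lemma fourier_integrable:
 assumes b: "b \<in> schwartz_orbit D"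
 shows "integrable (leb D) (fourier D b)"
proof (rule integral_leb[OF fourier_measurable[OF b]])
 define G where "G t = b (sc t)" for t
 have G: "schwartz (jump D) G" using b by (simp add: schwartz_orbit_iff G_def[abs_def])
 have bG: "b = ob G" using b by (auto simp: ob_def G_def sc_coords schwartz_orbit_iff)
 obtain G' where G': "schwartz (jump D) G'"
  "!!x. fourier D (ob G') (psum x) = of_real (\<Prod>j\<in>jump D. 1 + (x j)^2) * fourier D (ob G) (psum x)"
  using fourier_weight[OF finite_jump subset_refl G] by blast
 define M where "M = (LINT xi|liou D. cmod (ob G' xi))"
 show "integrable T (%x. fourier D b (psum x))"
 proof (rule Bochner_Integration.integrable_bound)
  show "integrable T (%t. M * (\<Prod>i\<in>jump D. inverse (1 + (t i)^2)))"
   using integrable_prod_inverse_square[OF finite_jump] by simp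
  have "fourier D b \<in> borel_measurable Rp" using fourier_measurable[OF b] by (simp cong: measurable_cong_sets add: sets_leb)
  then show "(%x. fourier D b (psum x)) \<in> borel_measurable T" by (rule measurable_compose[OF psum_measurable])
  show "AE x in T. norm (fourier D b (psum x)) <= norm (M * (\<Prod>i\<in>jump D. inverse (1 + (x i)^2)))"
  proof (rule AE_I2)
   fix x :: "nat => real"
   define P where "P = (\<Prod>i\<in>jump D. 1 + (x i)^2)"
   have P: "0 < P" unfolding P_def by (intro prod_pos) (simp add: add_pos_nonneg)
   have "P * cmod (fourier D b (psum x)) <= M" using fourier_bounded[OF ob_schwartz[OF G'(1)], of "psum x"] P
    by (simp add: G'(2) bG norm_mult M_def P_def[symmetric] flip: of_real_prod)
   moreover have "(\<Prod>i\<in>jump D. inverse (1 + (x i)^2)) = inverse P"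
    unfolding P_def using prod_inversef[of "%i. 1 + (x i)^2" "jump D"] by (simp add: o_def)
   ultimately have "cmod (fourier D b (psum x)) <= M * (\<Prod>i\<in>jump D. inverse (1 + (x i)^2))"
    using P by (simp only: divide_inverse[symmetric] pos_le_divide_eq mult.commute)
   then show "norm (fourier D b (psum x)) <= norm (M * (\<Prod>i\<in>jump D. inverse (1 + (x i)^2)))" by simp
  qed
 qed
qed

end

section \<open>Covariance of cross-Wigner distributions\<close>

lemma nn_square_triangle:
 fixes f :: "'x => complex"
 assumes [measurable]: "f \<in> borel_measurable M" "g \<in> borel_measurable M" "h \<in> borel_measurable M"
 shows "(\<integral>\<^sup>+x. ennreal ((cmod (f x - h x))^2) \<partial>M)
  <= 2 * (\<integral>\<^sup>+x. ennreal ((cmod (f x - g x))^2) \<partial>M) + 2 * (\<integral>\<^sup>+x. ennreal ((cmod (g x - h x))^2) \<partial>M)"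
proof -
 have "ennreal ((cmod (f x - h x))^2) <= 2 * ennreal ((cmod (f x - g x))^2) + 2 * ennreal ((cmod (g x - h x))^2)" for x
 proof -
  have "(cmod (f x - h x))^2 <= (cmod (f x - g x) + cmod (g x - h x))^2"
   using norm_triangle_ineq[of "f x - g x" "g x - h x"] by (intro power_mono) simp_all
  also have "... <= 2 * (cmod (f x - g x))^2 + 2 * (cmod (g x - h x))^2"
   using sum_squares_bound[of "cmod (f x - g x)" "cmod (g x - h x)"] by (simp add: power2_sum)
  finally have "ennreal ((cmod (f x - h x))^2) <= ennreal (2 * (cmod (f x - g x))^2 + 2 * (cmod (g x - h x))^2)"
   by (rule ennreal_leI)
  then show ?thesis by (simp add: ennreal_plus ennreal_mult)
 qed
 then have "(\<integral>\<^sup>+x. ennreal ((cmod (f x - h x))^2) \<partial>M)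
   <= (\<integral>\<^sup>+x. 2 * ennreal ((cmod (f x - g x))^2) + 2 * ennreal ((cmod (g x - h x))^2) \<partial>M)"
  by (intro nn_integral_mono)
 also have "... = 2 * (\<integral>\<^sup>+x. ennreal ((cmod (f x - g x))^2) \<partial>M) + 2 * (\<integral>\<^sup>+x. ennreal ((cmod (g x - h x))^2) \<partial>M)"
  by (subst nn_integral_add) (simp_all add: nn_integral_cmult)
 finally show ?thesis .
qed

context flat_rep
begin

lemma parseval_nn:
 assumes "b \<in> schwartz_orbit D"
 shows "(\<integral>\<^sup>+xi. ennreal ((cmod (b xi))^2) \<partial>liou D) = (\<integral>\<^sup>+X. ennreal ((cmod (fourier D b X))^2) \<partial>leb D)"
proof -
 have b: "integrable (liou D) (%xi. (cmod (b xi))\<^sup>2)" "integrable (leb D) (%X. (cmod (fourier D b X))\<^sup>2)"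
  "(LINT X|leb D. (cmod (fourier D b X))\<^sup>2) = (LINT xi|liou D. (cmod (b xi))\<^sup>2)"
  using parseval[OF assms] by (auto simp: L2_def)
 show ?thesis using nn_integral_eq_integral[OF b(1)] nn_integral_eq_integral[OF b(2)] b(3) by simp
qed

text \<open>Two approximating sequences have transforms with the same limit \<open>v\<close>;
  Parseval for their difference carries this back to \<open>w\<close> and \<open>w'\<close>. Thus
  the representative picked in \<open>cross_wigner\<close> is determined up to null sets.\<close>

lemma fourier_L2_unique:
 assumes 1: "fourier_L2 D w v" and 2: "fourier_L2 D w' v"
 shows "AE xi in liou D. w xi = w' xi"
proof -
 have [measurable]: "w \<in> borel_measurable (liou D)" "w' \<in> borel_measurable (liou D)" "v \<in> borel_measurable (leb D)"
  using 1 2 by (auto simp: fourier_L2_def L2_def)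
 obtain a where a: "!!n. a n \<in> schwartz_orbit D"
  "(%n. \<integral>\<^sup>+xi. ennreal ((cmod (a n xi - w xi))^2) \<partial>liou D) ----> 0"
  "(%n. \<integral>\<^sup>+X. ennreal ((cmod (fourier D (a n) X - v X))^2) \<partial>leb D) ----> 0"
  using 1 unfolding fourier_L2_def by blast
 obtain b where b: "!!n. b n \<in> schwartz_orbit D"
  "(%n. \<integral>\<^sup>+xi. ennreal ((cmod (b n xi - w' xi))^2) \<partial>liou D) ----> 0"
  "(%n. \<integral>\<^sup>+X. ennreal ((cmod (fourier D (b n) X - v X))^2) \<partial>leb D) ----> 0"
  using 2 unfolding fourier_L2_def by blast
 note [measurable] = schwartz_orbit_measurable[OF a(1)] schwartz_orbit_measurable[OF b(1)]
  fourier_measurable[OF a(1)] fourier_measurable[OF b(1)]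
 define x where "x n = (\<integral>\<^sup>+xi. ennreal ((cmod (a n xi - w xi))^2) \<partial>liou D)" for n
 define y where "y n = (\<integral>\<^sup>+X. ennreal ((cmod (fourier D (a n) X - v X))^2) \<partial>leb D)" for n
 define x' where "x' n = (\<integral>\<^sup>+xi. ennreal ((cmod (b n xi - w' xi))^2) \<partial>liou D)" for n
 define y' where "y' n = (\<integral>\<^sup>+X. ennreal ((cmod (fourier D (b n) X - v X))^2) \<partial>leb D)" for n
 let ?N = "\<integral>\<^sup>+xi. ennreal ((cmod (w xi - w' xi))^2) \<partial>liou D"
 have "?N <= 2 * x n + 2 * (2 * (2 * y n + 2 * y' n) + 2 * x' n)" for n
 proof -
  have ab: "(%xi. a n xi - b n xi) \<in> schwartz_orbit D"
   using schwartz_orbit_linear[OF a(1)[of n] b(1)[of n], of 1 "- 1"] by simp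
  have "fourier D (%xi. a n xi - b n xi) X = fourier D (a n) X - fourier D (b n) X" for X
   using fourier_linear[OF a(1)[of n] b(1)[of n], of 1 "- 1" X] by simp
  then have "(\<integral>\<^sup>+xi. ennreal ((cmod (a n xi - b n xi))^2) \<partial>liou D)
    = (\<integral>\<^sup>+X. ennreal ((cmod (fourier D (a n) X - fourier D (b n) X))^2) \<partial>leb D)"
   using parseval_nn[OF ab] by simp
  also have "... <= 2 * y n + 2 * (\<integral>\<^sup>+X. ennreal ((cmod (v X - fourier D (b n) X))^2) \<partial>leb D)"
   unfolding y_def by (rule nn_square_triangle) simp_all
  finally have 3: "(\<integral>\<^sup>+xi. ennreal ((cmod (a n xi - b n xi))^2) \<partial>liou D) <= 2 * y n + 2 * y' n"
   by (simp add: y'_def norm_minus_commute)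
  have "?N <= 2 * (\<integral>\<^sup>+xi. ennreal ((cmod (w xi - a n xi))^2) \<partial>liou D) + 2 * (\<integral>\<^sup>+xi. ennreal ((cmod (a n xi - w' xi))^2) \<partial>liou D)"
   by (rule nn_square_triangle) simp_all
  also have "(\<integral>\<^sup>+xi. ennreal ((cmod (w xi - a n xi))^2) \<partial>liou D) = x n" by (simp add: x_def norm_minus_commute)
  also have "(\<integral>\<^sup>+xi. ennreal ((cmod (a n xi - w' xi))^2) \<partial>liou D)
    <= 2 * (\<integral>\<^sup>+xi. ennreal ((cmod (a n xi - b n xi))^2) \<partial>liou D) + 2 * x' n"
   unfolding x'_def by (rule nn_square_triangle) simp_all
  finally have "?N <= 2 * x n + 2 * (2 * (\<integral>\<^sup>+xi. ennreal ((cmod (a n xi - b n xi))^2) \<partial>liou D) + 2 * x' n)"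
   by (simp add: add_left_mono mult_left_mono)
  also have "... <= 2 * x n + 2 * (2 * (2 * y n + 2 * y' n) + 2 * x' n)"
   by (intro add_left_mono mult_left_mono add_right_mono 3) simp_all
  finally show ?thesis .
 qed
 moreover have "(%n. 2 * x n + 2 * (2 * (2 * y n + 2 * y' n) + 2 * x' n)) ----> 2 * 0 + 2 * (2 * (2 * 0 + 2 * 0) + 2 * 0)"
  using a(2,3) b(2,3) unfolding x_def[symmetric] y_def[symmetric] x'_def[symmetric] y'_def[symmetric]
  by (intro tendsto_add ennreal_tendsto_cmult) auto
 ultimately have "?N <= 2 * 0 + 2 * (2 * (2 * 0 + 2 * 0) + 2 * 0)" by (intro LIMSEQ_le_const) auto
 then have "?N = 0" by simp
 then have "AE xi in liou D. ennreal ((cmod (w xi - w' xi))^2) = 0" by (subst (asm) nn_integral_0_iff_AE) auto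
 then show ?thesis by (rule AE_mp) (simp add: ennreal_eq_0_iff)
qed

lemma ambiguity_pj: "ambiguity D h f X = cis (- base D (X - pj X)) * ambiguity D h f (pj X)"
 unfolding ambiguity_def by (subst rep_pj) (simp add: cinner_simps cis_cnj)

lemma ambiguity_rep: "ambiguity D (rep D g h) (rep D g f) X = ambiguity D h f (Ad D (ginv g) X)"
 by (simp add: ambiguity_def rep_lexp_commute rep_isometry)

lemma phase_measurable: "(%X. cis (- base D (Ad D g X - pj (Ad D g X)))) \<in> borel_measurable (leb D)"
 by (intro borel_leb borel_measurable_continuous_onI continuous_intros
   bounded_linear.continuous_on[OF bounded_linear_pj] bounded_linear.continuous_on[OF bounded_linear_Ad]
   bounded_linear.continuous_on[OF blinfun.bounded_linear_right])

text \<open>The ambiguity function and the transforms of the approximants acquire the same phase of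
  modulus one, and the changes of variable preserve both measures; so the approximating sequence is
  simply moved by the coadjoint action.\<close>

lemma fourier_L2_rep:
 assumes 1: "fourier_L2 D w (ambiguity D h f)"
 shows "fourier_L2 D (%xi. w (CoAd D (ginv g) xi)) (ambiguity D (rep D g h) (rep D g f))"
proof -
 define v where "v = ambiguity D h f"
 define k where "k = ginv g"
 have wm: "w \<in> borel_measurable (liou D)" and wi: "integrable (liou D) (%xi. (cmod (w xi))\<^sup>2)"
  and vm: "v \<in> borel_measurable (leb D)" and vi: "integrable (leb D) (%X. (cmod (v X))\<^sup>2)"
  using 1 by (auto simp: fourier_L2_def L2_def v_def)
 have v': "ambiguity D (rep D g h) (rep D g f) = (%X. cis (- base D (Ad D k X - pj (Ad D k X))) * v (al k X))"
  unfolding v_def al_def k_def by (rule ext) (simp only: ambiguity_rep, rule ambiguity_pj)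
 obtain a where a: "!!n. a n \<in> schwartz_orbit D"
  "(%n. \<integral>\<^sup>+xi. ennreal ((cmod (a n xi - w xi))^2) \<partial>liou D) ----> 0"
  "(%n. \<integral>\<^sup>+X. ennreal ((cmod (fourier D (a n) X - v X))^2) \<partial>leb D) ----> 0"
  using 1 unfolding fourier_L2_def v_def by blast
 have "(%xi. w (CoAd D k xi)) \<in> L2 (liou D)"
  using measurable_compose[OF liou_CoAd(2) wm] integrable_liou_CoAd[OF wi] by (simp add: L2_def)
 moreover have "ambiguity D (rep D g h) (rep D g f) \<in> L2 (leb D)" unfolding v' L2_def
  using borel_measurable_times[OF phase_measurable measurable_compose[OF leb_al(2) vm]] integrable_leb_al[OF vi, of k]
  by (simp add: norm_mult)
 moreover have "(\<integral>\<^sup>+xi. ennreal ((cmod (a n (CoAd D k xi) - w (CoAd D k xi)))^2) \<partial>liou D)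
   = (\<integral>\<^sup>+xi. ennreal ((cmod (a n xi - w xi))^2) \<partial>liou D)" for n proof -
  note [measurable] = wm schwartz_orbit_measurable[OF a(1)[of n]]
  show ?thesis by (rule nn_integral_liou_CoAd) measurable
 qed
 moreover have "(\<integral>\<^sup>+X. ennreal ((cmod (fourier D (%xi. a n (CoAd D k xi)) X - ambiguity D (rep D g h) (rep D g f) X))^2) \<partial>leb D)
   = (\<integral>\<^sup>+X. ennreal ((cmod (fourier D (a n) X - v X))^2) \<partial>leb D)" for n proof -
  note [measurable] = vm fourier_measurable[OF a(1)[of n]]
  have "cmod (fourier D (%xi. a n (CoAd D k xi)) X - ambiguity D (rep D g h) (rep D g f) X)
    = cmod (fourier D (a n) (al k X) - v (al k X))" for X proof -
   have "fourier D (%xi. a n (CoAd D k xi)) X = cis (- base D (Ad D k X - pj (Ad D k X))) * fourier D (a n) (al k X)"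
    unfolding fourier_CoAd[OF schwartz_orbit_measurable[OF a(1)]] al_def by (rule fourier_pj)
   then show ?thesis unfolding v' by (simp add: norm_mult flip: right_diff_distrib)
  qed
  then show ?thesis using nn_integral_leb_al[of "%X. ennreal ((cmod (fourier D (a n) X - v X))^2)" k] by simp
 qed
 ultimately show ?thesis unfolding fourier_L2_def k_def[symmetric]
  using a schwartz_orbit_CoAd[OF a(1)] by (intro conjI exI[of _ "%n xi. a n (CoAd D k xi)"]) simp_all
qed

lemma cross_wigner_rep:
 "AE xi in liou D. cross_wigner D (rep D g f) (rep D g h) xi = cross_wigner D f h (CoAd D (ginv g) xi)"
proof (cases "EX w. fourier_L2 D w (ambiguity D h f)")
 case True
 then have 1: "fourier_L2 D (cross_wigner D f h) (ambiguity D h f)" using someI_ex[OF True] by (simp add: cross_wigner_def)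
 have 2: "fourier_L2 D (%xi. cross_wigner D f h (CoAd D (ginv g) xi)) (ambiguity D (rep D g h) (rep D g f))"
  by (rule fourier_L2_rep[OF 1])
 then have ex: "EX w. fourier_L2 D w (ambiguity D (rep D g h) (rep D g f))" by blast
 then have 3: "fourier_L2 D (cross_wigner D (rep D g f) (rep D g h)) (ambiguity D (rep D g h) (rep D g f))"
  using someI_ex[OF ex] by (simp add: cross_wigner_def)
 show ?thesis by (rule fourier_L2_unique[OF 3 2])
next
 \<comment> \<open>Applying \<open>fourier_L2_rep\<close> to the inverse element shows that
   existence fails on both sides together, where both distributions take the default 0.\<close>
 case False
 have "\<not> (EX w. fourier_L2 D w (ambiguity D (rep D g h) (rep D g f)))"
 proof
  assume "EX w. fourier_L2 D w (ambiguity D (rep D g h) (rep D g f))"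
  then obtain w where "fourier_L2 D w (ambiguity D (rep D g h) (rep D g f))" by blast
  from fourier_L2_rep[OF this, of "ginv g"] False show False by auto
 qed
 then show ?thesis using False by (simp add: cross_wigner_def)
qed

text \<open>Identifies the composition in the first claim with the coadjoint action of the inverse
  of \<open>exp X\<close>.\<close>

lemma CoAd_exp_ad: "Blinfun (%Y. blinfun_apply xi (exp_ad D X Y)) = CoAd D (ginv (lexp D X)) xi"
 by (simp add: CoAd_def Ad_lexp_exp_ad)

section \<open>Covariance of the Weyl-Pedersen calculus\<close>

definition opform :: "(('a =>L real) => complex) => 'h => 'h => complex" where
 "opform b u v = (LINT X|leb D. fourier D b X * cinner (rep D (lexp D X) u) v)"

lemma coefficient_measurable: "(%X. cinner (rep D (lexp D X) u) v) \<in> borel_measurable (leb D)"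
 by (intro borel_leb borel_measurable_continuous_onI cinner.continuous_on rep_lexp_continuous continuous_on_const)

lemma norm_coefficient: "cmod (cinner (rep D (lexp D X) u) v) <= norm u * norm v"
 using cmod_cinner_le[of "rep D (lexp D X) u" v] by (simp add: norm_U)

lemma opform_integrable:
 assumes b: "b \<in> schwartz_orbit D"
 shows "integrable (leb D) (%X. fourier D b X * cinner (rep D (lexp D X) u) v)"
proof (rule Bochner_Integration.integrable_bound)
 show "integrable (leb D) (%X. fourier D b X * of_real (norm u * norm v))" using fourier_integrable[OF b] by simp
 show "AE X in leb D. norm (fourier D b X * cinner (rep D (lexp D X) u) v) <= norm (fourier D b X * of_real (norm u * norm v))"
  unfolding norm_mult by (intro AE_I2 mult_left_mono) (use norm_coefficient in \<open>auto simp: norm_mult\<close>)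
qed (intro borel_measurable_times fourier_measurable b coefficient_measurable)

lemma cinner_Op:
 assumes b: "b \<in> schwartz_orbit D"
 shows "cinner (Op D b u) v = opform b u v"
proof -
 have "EX w. ALL v. cinner w v = opform b u v"
 proof (rule riesz_antilinear[where M = "(LINT X|leb D. cmod (fourier D b X)) * norm u"])
  show "opform b u (v + v') = opform b u v + opform b u v'" for v v'
   unfolding opform_def using opform_integrable[OF b] by (simp add: cinner_simps distrib_left)
  show "opform b u (c *C v) = cnj c * opform b u v" for c v
  proof -
   have "opform b u (c *C v) = (LINT X|leb D. cnj c * (fourier D b X * cinner (rep D (lexp D X) u) v))"
    unfolding opform_def by (rule Bochner_Integration.integral_cong) (simp_all add: cinner_simps)
   then show ?thesis by (simp add: opform_def)
  qed
  show "cmod (opform b u v) <= (LINT X|leb D. cmod (fourier D b X)) * norm u * norm v" for v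
  proof -
   have "cmod (opform b u v) <= (LINT X|leb D. cmod (fourier D b X) * (norm u * norm v))" unfolding opform_def
   proof (rule order_trans[OF integral_norm_bound Bochner_Integration.integral_mono])
    show "integrable (leb D) (%X. cmod (fourier D b X) * (norm u * norm v))"
     using integrable_norm[OF fourier_integrable[OF b]] by simp
    show "norm (fourier D b X * cinner (rep D (lexp D X) u) v) <= cmod (fourier D b X) * (norm u * norm v)" for X
     unfolding norm_mult by (intro mult_left_mono norm_coefficient) simp
   qed (rule integrable_norm[OF opform_integrable[OF b]])
   then show ?thesis by (simp add: mult.assoc)
  qed
 qed
 then obtain w where w: "!!v. cinner w v = opform b u v" by blast
 have "Op D b u = w" unfolding Op_def op_integral_def opform_def[symmetric]
 proof (rule the_equality)
  show "ALL v. cinner w v = opform b u v" using w by blast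
  fix w' assume "ALL v. cinner w' v = opform b u v"
  then show "w' = w" using w by (intro cinner_eqI) simp
 qed
 then show ?thesis using w by simp
qed

text \<open>Since the two central phases cancel, the integrand \<open>H\<close> depends only on
  \<open>pj X\<close>, and the measure-preserving substitution \<open>al g\<close> can replace
  \<open>Ad g\<close>.\<close>

lemma Op_CoAd:
 assumes b: "b \<in> schwartz_orbit D"
 shows "Op D (%xi. b (CoAd D g xi)) u = rep D (ginv g) (Op D b (rep D g u))"
proof (rule cinner_eqI)
 fix v
 define H where "H X = fourier D b X * cinner (rep D (lexp D X) (rep D g u)) (rep D g v)" for X
 have Hm: "H \<in> borel_measurable (leb D)"
  unfolding H_def by (intro borel_measurable_times fourier_measurable b coefficient_measurable)
 have Hpj: "H X = H (pj X)" for X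
 proof -
  have "H X = (cis (- base D (X - pj X)) * cis (base D (X - pj X))) * H (pj X)"
   unfolding H_def fourier_pj[of b X] rep_pj[of X] by (simp add: cinner_simps)
  then show ?thesis by (simp add: cis_mult)
 qed
 have "cinner (Op D (%xi. b (CoAd D g xi)) u) v = (LINT X|leb D. H (al g X))"
  unfolding cinner_Op[OF schwartz_orbit_CoAd[OF b]] opform_def
 proof (rule Bochner_Integration.integral_cong[OF refl])
  fix X
  have "rep D g (rep D (lexp D X) u) = rep D (lexp D (Ad D g X)) (rep D g u)" using rep_lexp_commute[of "Ad D g X" g u] by simp
  then have "cinner (rep D (lexp D X) u) v = cinner (rep D (lexp D (Ad D g X)) (rep D g u)) (rep D g v)"
   using rep_isometry[of g "rep D (lexp D X) u" v] by simp
  then have "fourier D (%xi. b (CoAd D g xi)) X * cinner (rep D (lexp D X) u) v = H (Ad D g X)"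
   by (simp add: H_def fourier_CoAd[OF schwartz_orbit_measurable[OF b]])
  also have "... = H (al g X)" unfolding al_def by (rule Hpj)
  finally show "fourier D (%xi. b (CoAd D g xi)) X * cinner (rep D (lexp D X) u) v = H (al g X)" .
 qed
 also have "... = opform b (rep D g u) (rep D g v)" unfolding integral_leb_al[OF Hm] by (simp add: opform_def H_def[abs_def])
 also have "... = cinner (Op D b (rep D g u)) (rep D g v)" by (rule cinner_Op[OF b, symmetric])
 also have "... = cinner (rep D (ginv g) (Op D b (rep D g u))) v"
  using rep_cinner_inv[of "ginv g" "Op D b (rep D g u)" v] by simp
 finally show "cinner (Op D (%xi. b (CoAd D g xi)) u) v = cinner (rep D (ginv g) (Op D b (rep D g u))) v" .
qed

end

section \<open>Rank-one operators\<close>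

definition orthonormal :: "'h::chilbert_space set => bool" where
 "orthonormal B \<longleftrightarrow> (\<forall>e\<in>B. \<forall>f\<in>B. cinner e f = (if e = f then 1 else 0))"

lemma onb_exists: "EX B :: 'h::chilbert_space set. onb B"
proof -
 have "\<exists>M\<in>{B :: 'h set. orthonormal B}. \<forall>X\<in>{B. orthonormal B}. M <= X --> X = M"
 proof (rule subset_Zorn')
  fix C :: "'h set set" assume C: "subset.chain {B. orthonormal B} C"
  show "\<Union>C \<in> {B. orthonormal B}" unfolding mem_Collect_eq orthonormal_def
  proof (intro ballI)
   fix e f assume "e \<in> \<Union>C" "f \<in> \<Union>C"
   then obtain X Y where XY: "X \<in> C" "Y \<in> C" "e \<in> X" "f \<in> Y" by blast
   have "X <= Y \<or> Y <= X" using C XY by (auto simp: subset_chain_def)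
   then obtain Z where "Z \<in> C" "e \<in> Z" "f \<in> Z" using XY by blast
   moreover have "orthonormal Z" using C \<open>Z \<in> C\<close> by (auto simp: subset_chain_def)
   ultimately show "cinner e f = (if e = f then 1 else 0)" by (auto simp: orthonormal_def)
  qed
 qed
 then obtain M :: "'h set" where M: "orthonormal M" "!!X. orthonormal X ==> M <= X ==> X = M" by blast
 have "v = 0" if v: "!!e. e \<in> M ==> cinner v e = 0" for v :: 'h
 proof (rule ccontr)
  assume nz: "v ~= 0"
  define w where "w = v /\<^sub>R norm v"
  have ww: "cinner w w = 1" using nz by (simp add: w_def cinner_self)
  have we: "cinner w e = 0" "cinner e w = 0" if "e \<in> M" for e
   using v[OF that] cinner_commute[of e w] by (simp_all add: w_def cinner_simps scaleR_scaleC)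
  have wM: "w \<notin> M" using we(1)[of w] ww by auto
  have "cinner e f = (if e = f then 1 else 0)" if ef: "e \<in> insert w M" "f \<in> insert w M" for e f
  proof (cases "e = w \<or> f = w")
   case True
   then show ?thesis using ef ww we wM by auto
  next
   case False
   then have "e \<in> M" "f \<in> M" using ef by auto
   then show ?thesis using M(1) unfolding orthonormal_def by blast
  qed
  then have "orthonormal (insert w M)" unfolding orthonormal_def by blast
  from M(2)[OF this] wM show False by blast
 qed
 then have "onb M" using M(1) unfolding onb_def orthonormal_def by simp
 then show ?thesis by blast
qed

text \<open>The same choice as in \<open>hs_norm\<close>, which makes that norm the square root of
  \<open>hq\<close>.\<close>

definition onb0 :: "'h::chilbert_space set" where "onb0 = (SOME B. onb B)"

lemma onb0: "onb onb0" unfolding onb0_def by (rule someI_ex[OF onb_exists])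

lemma bessel:
 fixes b :: "'h::chilbert_space"
 assumes F: "finite F" "F <= onb0"
 shows "(\<Sum>e\<in>F. (cmod (cinner e b))\<^sup>2) <= (norm b)^2"
proof -
 define c where "c e = cinner b e" for e
 define p where "p = (\<Sum>e\<in>F. c e *C e)"
 have on: "cinner e f = (if e = f then 1 else 0)" if "e \<in> F" "f \<in> F" for e f
 proof -
  have "\<forall>e\<in>onb0 :: 'h set. \<forall>f\<in>onb0. cinner e f = (if e = f then 1 else 0)"
   using onb0 unfolding onb_def by (rule conjunct1)
  then show ?thesis using subsetD[OF F(2) that(1)] subsetD[OF F(2) that(2)] by (blast dest: bspec)
 qed
 have pe: "cinner p e = c e" if e: "e \<in> F" for e
 proof -
  have "cinner p e = (\<Sum>f\<in>F. if f = e then c e else 0)" unfolding p_def cinner.sum_left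
  proof (rule sum.cong[OF refl])
   fix f assume f: "f \<in> F"
   show "cinner (c f *C f) e = (if f = e then c e else 0)" using on[OF f e] by (simp add: cinner_simps)
  qed
  then show ?thesis using F(1) e by simp
 qed
 have "cinner p p = (\<Sum>e\<in>F. cnj (c e) * cinner p e)" by (subst (2) p_def) (simp add: cinner.sum_right cinner_simps)
 also have "... = (\<Sum>e\<in>F. of_real ((cmod (c e))^2))"
 proof (rule sum.cong[OF refl])
  fix e assume "e \<in> F"
  then show "cnj (c e) * cinner p e = of_real ((cmod (c e))^2)" unfolding complex_norm_square by (simp add: pe)
 qed
 finally have pp: "cinner p p = of_real (\<Sum>e\<in>F. (cmod (c e))\<^sup>2)" by simp
 have "cinner b p = (\<Sum>e\<in>F. cnj (c e) * c e)" by (simp add: p_def cinner.sum_right cinner_simps c_def)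
 also have "... = (\<Sum>e\<in>F. of_real ((cmod (c e))^2))" unfolding complex_norm_square by (simp only: mult.commute)
 finally have bp: "cinner b p = of_real (\<Sum>e\<in>F. (cmod (c e))\<^sup>2)" by simp
 have "0 <= inner (b - p) (b - p)" by simp
 also have "... = inner b b - 2 * inner b p + inner p p" by (simp add: inner_diff_left inner_diff_right inner_commute)
 also have "... = (norm b)^2 - (\<Sum>e\<in>F. (cmod (c e))\<^sup>2)"
  by (simp add: inner_eq_Re_cinner[of b p] inner_eq_Re_cinner[of p p] pp bp power2_norm_eq_inner)
 finally have "(\<Sum>e\<in>F. (cmod (c e))\<^sup>2) <= (norm b)^2" by simp
 moreover have "cmod (c e) = cmod (cinner e b)" for e by (subst cinner_commute) (simp add: c_def)
 ultimately show ?thesis by simp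
qed

text \<open>Summability is demanded for the very basis on which \<open>hs_norm\<close> is evaluated,
  so every estimate refers to genuine sums over one basis.\<close>

definition hs0 :: "('h::chilbert_space => 'h) => bool" where
 "hs0 T \<longleftrightarrow> clinear_op T & bounded_linear T & (%e. (norm (T e))\<^sup>2) summable_on onb0"

definition hq :: "('h::chilbert_space => 'h) => real" where
 "hq T = (\<Sum>\<^sub>\<infinity>e\<in>onb0. (norm (T e))\<^sup>2)"

lemma hs_norm_hq: "hs_norm T = sqrt (hq T)" by (simp add: hs_norm_def hq_def onb0_def)

lemma hq_nonneg: "0 <= hq T" unfolding hq_def by (rule infsum_nonneg) simp

lemma hs0_hilbert_schmidt: "hs0 T ==> hilbert_schmidt T" using onb0 unfolding hs0_def hilbert_schmidt_def by blast

lemma hs0_add: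
 assumes S: "hs0 S" and T: "hs0 T"
 shows "hs0 (%u. S u + T u)" and "hq (%u. S u + T u) <= 2 * hq S + 2 * hq T"
proof -
 have sS: "(%e. (norm (S e))\<^sup>2) summable_on onb0" and sT: "(%e. (norm (T e))\<^sup>2) summable_on onb0"
  using S T by (auto simp: hs0_def)
 have le: "(norm (S e + T e))^2 <= 2 * (norm (S e))^2 + 2 * (norm (T e))^2" for e
 proof -
  have "(norm (S e + T e))^2 <= (norm (S e) + norm (T e))^2" by (intro power_mono norm_triangle_ineq) simp
  also have "... <= 2 * (norm (S e))^2 + 2 * (norm (T e))^2"
   using sum_squares_bound[of "norm (S e)" "norm (T e)"] by (simp add: power2_sum)
  finally show ?thesis .
 qed
 have sum: "(%e. 2 * (norm (S e))^2 + 2 * (norm (T e))^2) summable_on onb0"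
  by (intro summable_on_add summable_on_cmult_right sS sT)
 have s: "(%e. (norm (S e + T e))\<^sup>2) summable_on onb0" by (rule summable_on_comparison_test[OF sum]) (use le in auto)
 then show "hs0 (%u. S u + T u)"
  using S T by (auto simp: hs0_def clinear_op_def scaleC_add_right algebra_simps intro: bounded_linear_add)
 have "hq (%u. S u + T u) <= (\<Sum>\<^sub>\<infinity>e\<in>onb0. 2 * (norm (S e))^2 + 2 * (norm (T e))^2)"
  unfolding hq_def by (rule infsum_mono[OF s sum le])
 also have "... = 2 * hq S + 2 * hq T"
  unfolding hq_def by (simp add: infsum_add summable_on_cmult_right sS sT infsum_cmult_right)
 finally show "hq (%u. S u + T u) <= 2 * hq S + 2 * hq T" .
qed

definition rank1 :: "'h::chilbert_space => 'h => 'h => 'h" where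
 "rank1 a b u = cinner u b *C a"

lemma rank1: "hs0 (rank1 a b)" and hq_rank1: "hq (rank1 a b) <= (norm a)^2 * (norm b)^2"
proof -
 have n: "(norm (rank1 a b e))^2 = (norm a)^2 * (cmod (cinner e b))^2" for e
  by (simp add: rank1_def norm_scaleC power_mult_distrib mult.commute)
 have fin: "(\<Sum>e\<in>F. (norm (rank1 a b e))\<^sup>2) <= (norm a)^2 * (norm b)^2" if "finite F" "F <= onb0" for F
  unfolding n sum_distrib_left[symmetric] using bessel[OF that] by (intro mult_left_mono) simp_all
 have s: "(%e. (norm (rank1 a b e))\<^sup>2) summable_on onb0"
  by (rule nonneg_bdd_above_summable_on) (auto intro!: bdd_aboveI2 fin)
 have "bounded_linear (rank1 a b)" unfolding rank1_def
  by (rule bounded_linear_compose[OF bounded_bilinear.bounded_linear_left[OF bounded_bilinear_scaleC] cinner.bounded_linear_left])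
 then show "hs0 (rank1 a b)" using s by (simp add: hs0_def clinear_op_def rank1_def cinner_simps scaleC_add_left scaleC_scaleC)
 show "hq (rank1 a b) <= (norm a)^2 * (norm b)^2" unfolding hq_def by (rule infsum_le_finite_sums[OF s fin])
qed

text \<open>Convergence to 0 in the Hilbert-Schmidt norm, phrased with squares: the inequality in
  \<open>hs0_add\<close> with its factors 2 replaces the triangle inequality.\<close>

definition hs_null :: "('x => 'h::chilbert_space => 'h) => 'x filter => bool" where
 "hs_null T F \<longleftrightarrow> (ALL s. hs0 (T s)) & ((%s. hq (T s)) ---> 0) F"

lemma hs_null_add:
 assumes "hs_null S F" "hs_null T F"
 shows "hs_null (%s u. S s u + T s u) F" unfolding hs_null_def
proof (intro conjI allI)
 have S: "hs0 (S s)" "((%s. hq (S s)) ---> 0) F" and T: "hs0 (T s)" "((%s. hq (T s)) ---> 0) F" for s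
  using assms by (simp_all add: hs_null_def)
 show "hs0 (%u. S s u + T s u)" for s by (rule hs0_add(1)[OF S(1) T(1)])
 have "((%s. 2 * hq (S s) + 2 * hq (T s)) ---> 2 * 0 + 2 * 0) F" by (intro tendsto_intros S(2) T(2))
 then have lim: "((%s. 2 * hq (S s) + 2 * hq (T s)) ---> 0) F" by simp
 show "((%s. hq (%u. S s u + T s u)) ---> 0) F" by (rule tendsto_sandwich[OF _ _ tendsto_const lim])
   (simp_all add: hq_nonneg hs0_add(2)[OF S(1) T(1)])
qed

lemma hs_null_rank1:
 assumes "((%s. norm (a s) * norm (b s)) ---> 0) F"
 shows "hs_null (%s. rank1 (a s) (b s)) F" unfolding hs_null_def
proof (intro conjI allI)
 have "((%s. (norm (a s) * norm (b s))\<^sup>2) ---> 0\<^sup>2) F" by (intro tendsto_power assms)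
 then have lim: "((%s. (norm (a s))\<^sup>2 * (norm (b s))^2) ---> 0) F" by (simp add: power_mult_distrib)
 show "((%s. hq (rank1 (a s) (b s))) ---> 0) F"
  by (rule tendsto_sandwich[OF _ _ tendsto_const lim]) (simp_all add: hq_nonneg hq_rank1)
qed (rule rank1)

lemma hs_null_hs_norm: "hs_null T F ==> ((%s. hs_norm (T s)) ---> 0) F"
 unfolding hs_norm_hq hs_null_def using tendsto_real_sqrt[of "%s. hq (T s)" 0 F] by simp

section \<open>Differentiable families of finite rank operators\<close>

type_synonym ('e, 'h) rank1_family = "(('e => 'h) \<times> ('e => 'h)) list"

definition fam :: "('e, 'h::chilbert_space) rank1_family => 'e => 'h => 'h" where
 "fam L x u = (\<Sum>(alpha, beta)\<leftarrow>L. rank1 (alpha x) (beta x) u)"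

lemma fam_simps: "fam [] x = (%u. 0)" "fam ((alpha, beta) # L) x = (%u. rank1 (alpha x) (beta x) u + fam L x u)"
 by (simp_all add: fam_def fun_eq_iff)

lemma hs0_zero: "hs0 (%u. 0)" using rank1[of 0 0] by (simp add: rank1_def[abs_def] cinner_simps)

lemma hs_null_zero: "hs_null (%s u. 0) F" using hs_null_rank1[of "%_. 0" "%_. 0" F] by (simp add: rank1_def[abs_def])

lemma hs0_fam: "hs0 (fam L x)"
proof (induction L)
 case (Cons p L)
 obtain alpha beta where "p = (alpha, beta)" by (cases p)
 then show ?case using hs0_add(1)[OF rank1 Cons.IH] by (simp add: fam_simps)
qed (simp add: fam_simps hs0_zero)

lemma rank1_diff: "rank1 a b u - rank1 c d u = rank1 (a - c) b u + rank1 c (b - d) u"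
 by (simp add: rank1_def cinner_simps scaleC_diff_left scaleC_diff_right)

lemma hs_continuous_fam:
 assumes "!!alpha beta. (alpha, beta) \<in> set L ==> continuous_on U alpha & continuous_on U beta"
 shows "hs_continuous_on U (fam L)" unfolding hs_continuous_on_def
proof (intro ballI conjI)
 fix x assume x: "x \<in> U"
 show "hilbert_schmidt (fam L x)" by (intro hs0_hilbert_schmidt hs0_fam)
 have "hs_null (%y u. fam L y u - fam L x u) (at x within U)" using assms
 proof (induction L)
  case Nil
  show ?case by (simp add: fam_simps hs_null_zero)
 next
  case (Cons p L)
  obtain alpha beta where p: "p = (alpha, beta)" by (cases p)
  have lim: "(alpha ---> alpha x) (at x within U)" "(beta ---> beta x) (at x within U)"
   using Cons.prems[of alpha beta] x by (auto simp: p continuous_on_def)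
  have "((%y. norm (alpha y - alpha x) * norm (beta y)) ---> norm (alpha x - alpha x) * norm (beta x)) (at x within U)"
   "((%y. norm (alpha x) * norm (beta y - beta x)) ---> norm (alpha x) * norm (beta x - beta x)) (at x within U)"
   by (intro tendsto_intros lim)+
  then have "hs_null (%y u. (rank1 (alpha y - alpha x) (beta y) u + rank1 (alpha x) (beta y - beta x) u) + (fam L y u - fam L x u)) (at x within U)"
   using Cons by (intro hs_null_add hs_null_rank1) auto
  moreover have "(rank1 (alpha y - alpha x) (beta y) u + rank1 (alpha x) (beta y - beta x) u) + (fam L y u - fam L x u)
    = fam (p # L) y u - fam (p # L) x u" for y u by (simp add: p fam_simps rank1_diff[symmetric])
  ultimately show ?case by simp
 qed
 then show "((%y. hs_norm (%u. fam L y u - fam L x u)) ---> 0) (at x within U)" by (rule hs_null_hs_norm)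
qed

text \<open>A rank-one operator has by the product rule a derivative that is a sum of two such
  operators. Finite sums are therefore closed under differentiation, and the induction over
  \<open>k\<close> is on lists.\<close>

lemma hs_Ck_fam:
 fixes L :: "('e::real_normed_vector, 'h::chilbert_space) rank1_family"
 assumes "!!alpha beta. (alpha, beta) \<in> set L ==> Ck_on k U alpha & Ck_on k U beta"
 shows "hs_Ck_on k U (fam L)" using assms
proof (induction k arbitrary: L)
 case 0
 then show ?case by (auto intro!: hs_continuous_fam)
next
 case (Suc k)
 have cont: "hs_continuous_on U (fam L)" using Suc.prems Ck_on_imp_continuous_on by (intro hs_continuous_fam) blast
 define der where "der f = (SOME f'. (\<forall>x\<in>U. (f has_derivative f' x) (at x)) & (ALL v. Ck_on k U (%x. f' x v)))"
  for f :: "'e => 'h"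
 have der: "(\<forall>x\<in>U. (f has_derivative der f x) (at x)) & (ALL v. Ck_on k U (%x. der f x v))" if "Ck_on (Suc k) U f" for f
  unfolding der_def by (rule someI_ex[OF Ck_on_Suc_ex[OF that]])
 \<comment> \<open>The product rule: every pair contributes one entry with its first and one with
   its second vector differentiated.\<close>
 define dl where "dl v L = concat (map (%(alpha, beta). [(%x. der alpha x v, beta), (alpha, %x. der beta x v)]) L)"
  for v and L :: "('e, 'h) rank1_family"
 have "hs_Ck_on k U (fam (dl v L))" for v
 proof (rule Suc.IH)
  fix alpha beta assume "(alpha, beta) \<in> set (dl v L)"
  then obtain \<gamma> \<delta> where gd: "(\<gamma>, \<delta>) \<in> set L" "alpha = (%x. der \<gamma> x v) & beta = \<delta> \<or> alpha = \<gamma> & beta = (%x. der \<delta> x v)"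
   by (auto simp: dl_def)
  have g: "Ck_on (Suc k) U \<gamma>" "Ck_on (Suc k) U \<delta>" using Suc.prems[OF gd(1)] by auto
  then have "Ck_on k U \<gamma>" "Ck_on k U \<delta>" by (auto intro: Ck_on_mono)
  then show "Ck_on k U alpha & Ck_on k U beta" using gd(2) der[OF g(1)] der[OF g(2)] by auto
 qed
 moreover have "((%s. hs_norm (%u. (fam L (x + s *R v) u - fam L x u) /\<^sub>R s - fam (dl v L) x u)) ---> 0) (at 0)"
  if x: "x \<in> U" for x v
 proof -
  have "hs_null (%s u. (fam L (x + s *R v) u - fam L x u) /\<^sub>R s - fam (dl v L) x u) (at 0)" using Suc.prems
  proof (induction L)
   case Nil
   show ?case by (simp add: fam_simps dl_def hs_null_zero)
  next
   case (Cons p L)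
   obtain alpha beta where p: "p = (alpha, beta)" by (cases p)
   define q where "q f s = (f (x + s *R v) - f x) /\<^sub>R s" for f :: "'e => 'h" and s
   have q: "(q f ---> der f x v) (at 0)" "((%s. f (x + s *R v)) ---> f x) (at 0)" if f: "Ck_on (Suc k) U f" for f
   proof -
    have d0: "(f has_derivative der f x) (at (x + 0 *R v))" using der[OF f] x by simp
    have "((%s. x + s *R v) has_derivative (%s. s *R v)) (at 0)" by (auto intro!: derivative_eq_intros)
    from has_derivative_compose[OF this d0]
    have "((%s. f (x + s *R v)) has_derivative (%s. der f x (s *R v))) (at 0)" .
    moreover have "der f x (s *R v) = s *R der f x v" for s using has_derivative_linear[OF d0] by (rule linear_scale)
    ultimately have hv: "((%s. f (x + s *R v)) has_vector_derivative der f x v) (at 0)"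
     by (simp add: has_vector_derivative_def)
    show "(q f ---> der f x v) (at 0)" using has_vector_derivative_quotient[OF hv] by (simp add: q_def[abs_def])
    show "((%s. f (x + s *R v)) ---> f x) (at 0)" using has_vector_derivative_continuous[OF hv] by (simp add: continuous_at)
   qed
   have ab: "Ck_on (Suc k) U alpha" "Ck_on (Suc k) U beta" using Cons.prems[of alpha beta] by (auto simp: p)
   note lim = q(1)[OF ab(1)] q(1)[OF ab(2)] q(2)[OF ab(2)]
   have "((%s. norm (q alpha s - der alpha x v) * norm (beta (x + s *R v))) ---> norm (der alpha x v - der alpha x v) * norm (beta x)) (at 0)"
    "((%s. norm (der alpha x v) * norm (beta (x + s *R v) - beta x)) ---> norm (der alpha x v) * norm (beta x - beta x)) (at 0)"
    "((%s. norm (alpha x) * norm (q beta s - der beta x v)) ---> norm (alpha x) * norm (der beta x v - der beta x v)) (at 0)"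
    by (intro tendsto_intros lim)+
   then have n: "hs_null (%s u. (rank1 (q alpha s - der alpha x v) (beta (x + s *R v)) u
     + (rank1 (der alpha x v) (beta (x + s *R v) - beta x) u + rank1 (alpha x) (q beta s - der beta x v) u))
     + ((fam L (x + s *R v) u - fam L x u) /\<^sub>R s - fam (dl v L) x u)) (at 0)"
    using Cons by (intro hs_null_add hs_null_rank1) auto
   \<comment> \<open>The quotient minus the derivative splits into three rank-one terms, each with
     one factor tending to 0 and the other bounded.\<close>
   have "(rank1 (alpha (x + s *R v)) (beta (x + s *R v)) u - rank1 (alpha x) (beta x) u) /\<^sub>R s
     - (rank1 (der alpha x v) (beta x) u + rank1 (alpha x) (der beta x v) u)
    = rank1 (q alpha s - der alpha x v) (beta (x + s *R v)) u
     + (rank1 (der alpha x v) (beta (x + s *R v) - beta x) u + rank1 (alpha x) (q beta s - der beta x v) u)" for s u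
    by (simp add: rank1_diff rank1_def q_def cinner_simps scaleR_scaleC scaleC_diff_left scaleC_diff_right
      scaleC_add_right scaleC_scaleC mult.commute)
   from this[symmetric] have "(fam (p # L) (x + s *R v) u - fam (p # L) x u) /\<^sub>R s - fam (dl v (p # L)) x u
    = (rank1 (q alpha s - der alpha x v) (beta (x + s *R v)) u
     + (rank1 (der alpha x v) (beta (x + s *R v) - beta x) u + rank1 (alpha x) (q beta s - der beta x v) u))
     + ((fam L (x + s *R v) u - fam L x u) /\<^sub>R s - fam (dl v L) x u)" for s u
    by (simp add: p fam_simps dl_def algebra_simps)
   then show ?case using n by simp
  qed
  then show ?thesis by (rule hs_null_hs_norm)
 qed
 ultimately show ?case unfolding hs_Ck_on.simps(2) using cont by (intro conjI exI[of _ "%v. fam (dl v L)"] allI ballI)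
qed

section \<open>Smooth rank-one operators and covariance for distributions\<close>

context flat_rep
begin

lemma rank1_smooth_operator:
 assumes phi: "phi \<in> smooth_vectors D" and f: "f \<in> smooth_vectors D"
 shows "(%u. cinner u f *C phi) \<in> smooth_operators D" unfolding smooth_operators_def
proof (rule CollectI, clarify)
 fix U theta V psi k
 assume U: "(U, theta) \<in> atlas D" and V: "(V, psi) \<in> atlas D"
 have ck: "Ck_on k (theta ` U) (%x. rep D (inv_into U theta x) v)" if "v \<in> smooth_vectors D" "(U, theta) \<in> atlas D" for v U theta
  using smooth_mapD[of "atlas D" vec_atlas "%g. rep D g v" U theta UNIV "%x. x" k] that
  by (simp add: smooth_vectors_def vec_atlas_def)
 define alpha where "alpha z = rep D (inv_into U theta (fst z)) phi" for z :: "'a \<times> 'a"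
 define beta where "beta z = rep D (inv_into V psi (snd z)) f" for z :: "'a \<times> 'a"
 have "Ck_on k (theta ` U \<times> psi ` V) alpha"
  unfolding alpha_def by (rule Ck_on_compose[OF ck[OF phi U] Ck_on_linear[OF bounded_linear_fst]]) auto
 moreover have "Ck_on k (theta ` U \<times> psi ` V) beta"
  unfolding beta_def by (rule Ck_on_compose[OF ck[OF f V] Ck_on_linear[OF bounded_linear_snd]]) auto
 ultimately have "hs_Ck_on k (theta ` U \<times> psi ` V) (fam [(alpha, beta)])" by (intro hs_Ck_fam) auto
 moreover have "fam [(alpha, beta)] = (%(x, y) u. rep D (inv_into U theta x)
   (cinner (rep D (ginv (inv_into V psi y)) u) f *C phi))"
  by (auto simp: fun_eq_iff fam_simps rank1_def alpha_def beta_def U_scaleC rep_cinner_inv)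
 ultimately show "hs_Ck_on k (theta ` U \<times> psi ` V) (%(x, y) u. rep D (inv_into U theta x)
   (cinner (rep D (ginv (inv_into V psi y)) u) f *C phi))" by simp qed

lemma smooth_vectors_rep:
 assumes "v \<in> smooth_vectors D"
 shows "rep D g v \<in> smooth_vectors D"
proof -
 have atl: "smooth_atlas (atlas D)" and mult: "smooth_map (prod_atlas (atlas D) (atlas D)) (atlas D) (%(x, y). x \<cdot> y)"
  using lie by (auto simp: lie_group_def)
 note ok = smooth_atlas_charts_ok[OF atl]
 have "smooth_map (atlas D) (prod_atlas (atlas D) (atlas D)) (%x. (x, g))"
  by (intro smooth_map_Pair ok smooth_map_id atl smooth_map_const)
 from smooth_map_compose[OF ok charts_ok_prod[OF ok ok] ok this mult]
 have "smooth_map (atlas D) (atlas D) (%x. x \<cdot> g)" by simp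
 from smooth_map_compose[OF ok ok charts_ok_vec this, of "%x. rep D x v"] assms
 show ?thesis by (simp add: smooth_vectors_def rep_mult)
qed

text \<open>\<open>S'\<close> is the conjugate of \<open>S\<close> by \<open>pi(g)\<close>, so
  \<open>tr g\<close> maps the symbols of \<open>S\<close> bijectively onto those of
  \<open>S'\<close>. A unique symbol exists for both or for neither, and in the second case both
  sides are the default 0.\<close>

lemma Op_dist_rep:
 assumes phi: "phi \<in> smooth_vectors D" and f: "f \<in> smooth_vectors D"
 shows "as_operator (Op_dist D (dist_comp_CoAd D a (ginv g))) phi f
  = rep_ext D g (as_operator (Op_dist D a) (rep D (ginv g) phi)) f" proof -
 define S where "S = (%u. cinner u f *C phi)"
 define S' where "S' = (%u. cinner u (rep D (ginv g) f) *C rep D (ginv g) phi)"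
 have S: "S \<in> smooth_operators D" "S' \<in> smooth_operators D"
  unfolding S_def S'_def by (intro rank1_smooth_operator smooth_vectors_rep phi f)+
 have S': "S' u = rep D (ginv g) (S (rep D g u))" for u by (simp add: S_def S'_def U_scaleC rep_cinner_inv)
 define tr where "tr k b = (%xi. b (CoAd D k xi))" for k and b :: "('a =>L real) => complex"
 have tr_inv: "tr (ginv g) (tr g b) = b" "tr g (tr (ginv g) b) = b" for b by (simp_all add: tr_def)
 have so: "tr k b \<in> schwartz_orbit D" if "b \<in> schwartz_orbit D" for k b
  unfolding tr_def using that by (rule schwartz_orbit_CoAd)
 have Op: "Op D (tr k b) u = rep D (ginv k) (Op D b (rep D k u))" if "b \<in> schwartz_orbit D" for k b u
  unfolding tr_def using that by (rule Op_CoAd)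
 have fwd: "Op D (tr g b) = S'" if "b \<in> schwartz_orbit D" "Op D b = S" for b
  using Op[OF that(1), of g] S' that(2) by (simp add: fun_eq_iff)
 have bwd: "Op D (tr (ginv g) b) = S" if "b \<in> schwartz_orbit D" "Op D b = S'" for b
  using Op[OF that(1), of "ginv g"] S' that(2) by (simp add: fun_eq_iff)
 let ?P = "%b. b \<in> schwartz_orbit D & Op D b = S"
 let ?P' = "%b. b \<in> schwartz_orbit D & Op D b = S'"
 have PP': "?P' (tr g b)" if "?P b" for b using that so fwd by blast
 have P'P: "?P (tr (ginv g) b)" if "?P' b" for b using that so bwd by blast
 have "Op_dist D (dist_comp_CoAd D a (ginv g)) S = Op_dist D a S'"
 proof (cases "\<exists>!b. ?P b")
  case True
  then obtain b where b: "?P b" "!!c. ?P c ==> c = b" by blast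
  have b': "c = tr g b" if "?P' c" for c
  proof -
   have "tr (ginv g) c = b" using P'P[OF that] by (rule b(2))
   then have "tr g (tr (ginv g) c) = tr g b" by simp
   then show ?thesis by (simp add: tr_inv)
  qed
  have ex': "\<exists>!b. ?P' b" using PP'[OF b(1)] b' by blast
  have "(THE b. ?P b) = b" using b by (rule the_equality)
  moreover have "(THE b. ?P' b) = tr g b" using PP'[OF b(1)] b' by (rule the_equality)
  \<comment> \<open>The definition inverts its group argument, so passing the inverse composes the
    test function with \<open>CoAd D g\<close>.\<close>
  moreover have "dist_comp_CoAd D a (ginv g) b = a (tr g b)" by (simp add: dist_comp_CoAd_def tr_def)
  ultimately show ?thesis using S True ex' by (simp add: Op_dist_def)
 next
  case False
  have "\<not> (\<exists>!b. ?P' b)"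
  proof
   assume "\<exists>!b. ?P' b"
   then obtain b where b: "?P' b" "!!c. ?P' c ==> c = b" by blast
   have "c = tr (ginv g) b" if "?P c" for c
   proof -
    have "tr g c = b" using PP'[OF that] by (rule b(2))
    then have "tr (ginv g) (tr g c) = tr (ginv g) b" by simp
    then show ?thesis by (simp add: tr_inv)
   qed
   then show False using False P'P[OF b(1)] by blast
  qed
  then show ?thesis using S False by (simp add: Op_dist_def)
 qed
 then show ?thesis by (simp add: as_operator_def rep_ext_def S_def S'_def)
qed

end

theorem theorem3p5:
  fixes D :: "('g::{t2_space, second_countable_topology}, 'a::euclidean_space, 'h::chilbert_space) kdata"
  assumes "lie_group D"
    and "connected (UNIV :: 'g set)"
    and "simply_connected (UNIV :: 'g set)"
    and "lie_algebra_of D"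
    and "nilpotent D"
    and "exp_diffeomorphism D"
    and "unitary_rep D"
    and "irreducible_rep D"
    and "associated_with_orbit D"
    and "jordan_hoelder D"
    and "liouville_normalized D"
    and "lebesgue_normalized D"
    and "square_integrable_mod_center D"
  shows "(\<forall>f h X. AE \<xi> in liou D.
            cross_wigner D (rep D (lexp D X) f) (rep D (lexp D X) h) \<xi>
              = cross_wigner D f h (Blinfun (\<lambda>Y. \<xi> (exp_ad D X Y)))) \<and>
         (\<forall>a\<in>tempered D. \<forall>g. \<forall>\<phi>\<in>smooth_vectors D. \<forall>f\<in>smooth_vectors D.
            as_operator (Op_dist D (dist_comp_CoAd D a (inv\<^bsub>grp D\<^esub> g))) \<phi> f
              = rep_ext D g (as_operator (Op_dist D a) (rep D (inv\<^bsub>grp D\<^esub> g) \<phi>)) f)"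
proof -
 interpret flat_rep D by unfold_locales (fact assms)+
 show ?thesis
 proof (intro conjI allI ballI)
  fix f h :: 'h and X :: 'a
  show "AE xi in liou D. cross_wigner D (rep D (lexp D X) f) (rep D (lexp D X) h) xi
    = cross_wigner D f h (Blinfun (%Y. xi (exp_ad D X Y)))" unfolding CoAd_exp_ad by (rule cross_wigner_rep)
 qed (rule Op_dist_rep)
qed

end
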